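(* Let $q\in[-1,1]$ and let $\varrho(N)$, $N\in\mathbb{N}$, be probability measures on $\hat U(N)$. Assume there is a function $\Psi$ analytic in a neighborhood of $1$ such that for every fixed $r\in\mathbb{N}$ \[ \lim_{N\to\infty}\frac1N\log S_{\varrho(N)}(u_1,\dots,u_r,1^{N-r})=\sum_{i=1}^r\Psi(u_i) \] uniformly in a neighborhood of $1^r$. Then $m_{N,PP(q)}[\varrho(N)]$ converges as $N\to\infty$ in probability, in the sense of moments, to a deterministic measure $\mu^{(q)}$ with moments \[ \mu^{(q)}_k=\sum_{m=0}^k\binom km\frac1{(m+1)!}\frac{d^m}{du^m}\big(u^{k-q}(\Psi'(u))^{k-m}\big)\Big|_{u=1}. \]
   Context: A signature of length $N$ is a tuple $\lambda=(\lambda_1\ge\dots\ge\lambda_N)\in\mathbb{Z}^N$; $\hat U(N)$ denotes the set of signatures of length $N$. For $\lambda\in\hat U(N)$, $\chi^{\lambda}(u_1,\dots,u_N)=\det(u_i^{\lambda_j+N-j})_{i,j}/\prod_{i<j}(u_i-u_j)$ is the rational Schur function. For a probability measure $\varrho(N)$ on $\hat U(N)$, the Schur generating function is $S_{\varrho(N)}(u_1,\dots,u_N)=\sum_{\lambda\in\hat U(N)}\varrho(N)[\lambda]\,\chi^\lambda(u_1,\dots,u_N)/\chi^\lambda(1^N)$, where $1^N=(1,\dots,1)$; it is assumed that this series converges uniformly in a neighborhood of $1^N$. For $q\in[-1,1]$ and $\lambda\in\hat U(N)$ the $q$-deformed Perelomov–Popov measure is \[ m_{N,PP(q)}[\lambda]=\frac1N\sum_{i=1}^N\Big(\prod_{j\ne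 i}\frac{(\lambda_i-i)-(\lambda_j-j)-q}{(\lambda_i-i)-(\lambda_j-j)}\Big)\delta\Big(\frac{\lambda_i+N-i}{N}\Big), \] and $m_{N,PP(q)}[\varrho(N)]$ denotes the random measure $m_{N,PP(q)}[\lambda]$ with $\lambda$ distributed according to $\varrho(N)$. Random measures $m_N$ converge in probability in the sense of moments to a deterministic measure $\mu$ if for every $k\in\mathbb{N}$, $\int t^k m_N(dt)\to\int t^k\mu(dt)$ in probability. *)

theory Defs
  imports "HOL-Probability.Probability" "HOL-Complex_Analysis.Complex_Analysis"
begin

definition sig :: "nat \<Rightarrow> (nat \<Rightarrow> int) set" where
  "sig N = {l. (\<forall>i j. 1 \<le> i \<and> i \<le> j \<and> j \<le> N \<longrightarrow> l j \<le> l i) \<and> (\<forall>i. i \<notin> {1..N} \<longrightarrow> l i = 0)}"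

definition detN :: "nat \<Rightarrow> (nat \<Rightarrow> nat \<Rightarrow> complex) \<Rightarrow> complex" where
  "detN N A = (\<Sum>p\<in>{p. p permutes {1..N}}. of_int (sign p) * (\<Prod>i\<in>{1..N}. A i (p i)))"

definition vandermonde :: "nat \<Rightarrow> (nat \<Rightarrow> complex) \<Rightarrow> complex" where
  "vandermonde N u = (\<Prod>i\<in>{1..N}. \<Prod>j\<in>{i<..N}. u i - u j)"

definition schur_ratio :: "nat \<Rightarrow> (nat \<Rightarrow> int) \<Rightarrow> (nat \<Rightarrow> complex) \<Rightarrow> complex" where
  "schur_ratio N l u = detN N (\<lambda>i j. u i powi (l j + int N - int j)) / vandermonde N u"

text \<open>Rational Schur function: the Laurent polynomial given by the ratio, i.e. its continuous
  extension (limit over points with pairwise distinct nonzero coordinates) to all points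
  (in particular to points with repeated coordinates such as 1^N).  Only coordinates 1..N matter.\<close>
definition schur :: "nat \<Rightarrow> (nat \<Rightarrow> int) \<Rightarrow> (nat \<Rightarrow> complex) \<Rightarrow> complex" where
  "schur N l u = Lim (at u within {v. inj_on v {1..N} \<and> (\<forall>i\<in>{1..N}. v i \<noteq> 0)}) (schur_ratio N l)"

definition ones :: "nat \<Rightarrow> complex" where
  "ones = (\<lambda>_. 1)"

definition sgf_term :: "nat \<Rightarrow> (nat \<Rightarrow> int) pmf \<Rightarrow> (nat \<Rightarrow> int) \<Rightarrow> (nat \<Rightarrow> complex) \<Rightarrow> complex" where
  "sgf_term N \<rho> l u = complex_of_real (pmf \<rho> l) * schur N l u / schur N l ones"

definition sgf :: "nat \<Rightarrow> (nat \<Rightarrow> int) pmf \<Rightarrow> (nat \<Rightarrow> complex) \<Rightarrow> complex" where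
  "sgf N \<rho> u = infsum (\<lambda>l. sgf_term N \<rho> l u) (sig N)"

definition nbhd1 :: "nat \<Rightarrow> real \<Rightarrow> (nat \<Rightarrow> complex) set" where
  "nbhd1 N d = {u. \<forall>i\<in>{1..N}. cmod (u i - 1) < d}"

text \<open>Points (u_1,...,u_r) near 1^r, with all remaining coordinates equal to 1,
  i.e. (u_1,...,u_r,1^(N-r)) for every N >= r.\<close>
definition nbhd_r :: "nat \<Rightarrow> real \<Rightarrow> (nat \<Rightarrow> complex) set" where
  "nbhd_r r d = {u. (\<forall>i\<in>{1..r}. cmod (u i - 1) < d) \<and> (\<forall>i. i \<notin> {1..r} \<longrightarrow> u i = 1)}"

text \<open>Weight of the atom at (l_i+N-i)/N in the q-deformed Perelomov--Popov measure.\<close>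
definition pp_weight :: "nat \<Rightarrow> real \<Rightarrow> (nat \<Rightarrow> int) \<Rightarrow> nat \<Rightarrow> real" where
  "pp_weight N q l i = (\<Prod>j\<in>{1..N}-{i}.
      (real_of_int ((l i - int i) - (l j - int j)) - q) / real_of_int ((l i - int i) - (l j - int j)))"

definition pp_moment :: "nat \<Rightarrow> real \<Rightarrow> (nat \<Rightarrow> int) \<Rightarrow> nat \<Rightarrow> real" where
  "pp_moment N q l k = (1 / real N) * (\<Sum>i\<in>{1..N}.
      pp_weight N q l i * (real_of_int (l i + int N - int i) / real N) ^ k)"

definition mu_q :: "real \<Rightarrow> (complex \<Rightarrow> complex) \<Rightarrow> nat \<Rightarrow> complex" where
  "mu_q q \<Psi> k = (\<Sum>m\<in>{0..k}. of_nat (k choose m) / of_nat (fact (m + 1)) *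
      (deriv ^^ m) (\<lambda>u. u powr (of_nat k - of_real q) * (deriv \<Psi> u) ^ (k - m)) 1)"

end

theory Submission
  imports Defs
begin

text \<open>
  Write \<open>x\<^sub>j = \<lambda>\<^sub>j + N - j\<close>, let \<open>V\<close> be the Vandermonde determinant and let \<open>P\<^sub>k\<close> be the
  normalised power sum \<open>N\<^sup>-\<^sup>1 \<Sum>\<^sub>j (x\<^sub>j/N)\<^sup>k\<close>.  For \<open>\<phi> = 1\<close> the operator
  \<open>V\<^sup>-\<^sup>1 \<Sum>\<^sub>i \<phi>(u\<^sub>i) u\<^sub>i\<^sup>k \<partial>\<^sub>i\<^sup>k V\<close> has the Schur functions as eigenfunctions, with eigenvalue
  \<open>\<Sum>\<^sub>j x\<^sub>j(x\<^sub>j - 1)\<cdots>(x\<^sub>j - k + 1)\<close>.  For \<open>\<phi> = Ln\<close> its value at \<open>1\<^sup>N\<close> on the normalised Schur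
  function is the same sum with the \<open>j\<close>-th summand weighted by \<open>\<Sum>\<^sub>b 1/(x\<^sub>j - x\<^sub>b)\<close>, which
  turns into the quadratic expression \<open>\<Sum>\<^sub>a P\<^sub>a P\<^sub>k\<^sub>-\<^sub>1\<^sub>-\<^sub>a\<close> up to lower order terms.  Applying
  the operators to the Schur generating function, expanding by the Leibniz rule into
  symmetrised quotients in few variables and using the hypothesis on its logarithm gives the limits
  of the expectations.  The limit for \<open>\<phi> = Ln\<close> is, by Lagrange inversion, exactly the quadratic
  expression in the limits for \<open>\<phi> = 1\<close>.  As \<open>E P\<^sub>c\<^sup>2\<close> is the only summand of
  \<open>\<Sum>\<^sub>a E (P\<^sub>a P\<^sub>2\<^sub>c\<^sub>-\<^sub>a)\<close> that does not contain some \<open>P\<^sub>a\<close> with \<open>a < c\<close>, induction on \<open>c\<close> shows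
  that the variances tend to 0.  The moments of the deformed
  measure obey a recursion in the \<open>P\<^sub>a\<close> (logarithmic derivative of \<open>\<Prod>\<^sub>j (z - x\<^sub>j - q)/(z - x\<^sub>j)\<close>)
  that matches the recursion of the limiting moments.  Finally, the measures at hand are probability
  measures for \<open>|q| \<le> 1\<close>, so Helly's theorem provides a measure with the limiting moments.
\<close>

section \<open>Determinants and the branching rule\<close>

text \<open>The hypothesis speaks about finitely many variables, whereas the operators act in N
  variables and divide by a product that vanishes at 1^N. In the Leibniz expansion, m derivatives on
  V and k - m on the generating function leave sums over (m+1)-subsets of the variables. By symmetry
  all subsets have the same limit, so m + 1 variables suffice. There are about N^(m+1)/(m+1)!
  subsets and the derivatives contribute N^(k-m), so every m enters at the common order N^(k+1). The
  limit at 1^N has to be exchanged with the infinite sum over signatures. For one signature the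
  quotients extend across the diagonal because Schur functions are Laurent polynomials. Along a line
  through 1^N the extended value is a Cauchy integral over a small circle that avoids the diagonal,
  and there both the sum and the limit in N pass through by uniform convergence. The logarithmic
  weight takes the place of a second application of the operators: it reaches products of two power
  sums with a first-order expansion only.\<close>

lemma detN_cong:
  assumes "\<And>i j. i \<in> {1..N} \<Longrightarrow> j \<in> {1..N} \<Longrightarrow> A i j = B i j"
  shows "detN N A = detN N B"
  unfolding detN_def
proof (rule sum.cong[OF refl])
  fix p assume "p \<in> {p. p permutes {1..N}}"
  then have "p i \<in> {1..N}" if "i \<in> {1..N}" for i using that permutes_in_image[of p "{1..N}" i] by simp
  then have "(\<Prod>i\<in>{1..N}. A i (p i)) = (\<Prod>i\<in>{1..N}. B i (p i))"
    using assms by (intro prod.cong refl) blast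
  then show "of_int (sign p) * (\<Prod>i\<in>{1..N}. A i (p i)) = of_int (sign p) * (\<Prod>i\<in>{1..N}. B i (p i))"
    by simp
qed

lemma detN_permute_rows:
  assumes \<pi>: "\<pi> permutes {1..N}"
  shows "detN N (\<lambda>i j. A (\<pi> i) j) = of_int (sign \<pi>) * detN N A"
proof -
  have inv: "inv \<pi> permutes {1..N}" by (rule permutes_inv[OF \<pi>])
  have "detN N (\<lambda>i j. A (\<pi> i) j) =
      (\<Sum>p\<in>{p. p permutes {1..N}}. of_int (sign (p \<circ> \<pi>)) * (\<Prod>i\<in>{1..N}. A (\<pi> i) ((p \<circ> \<pi>) i)))"
    unfolding detN_def
    by (rule sum_permutations_compose_right[OF \<pi>])
  also have "\<dots> = (\<Sum>p\<in>{p. p permutes {1..N}}. of_int (sign \<pi>) * (of_int (sign p) * (\<Prod>i\<in>{1..N}. A i (p i))))"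
  proof (rule sum.cong[OF refl])
    fix p assume "p \<in> {p. p permutes {1..N}}"
    then have p: "p permutes {1..N}" by simp
    have "sign (p \<circ> \<pi>) = sign p * sign \<pi>"
      by (rule sign_compose) (use p \<pi> in \<open>auto simp: permutation_permutes\<close>)
    moreover have "(\<Prod>i\<in>{1..N}. A (\<pi> i) ((p \<circ> \<pi>) i)) = (\<Prod>i\<in>{1..N}. A i (p i))"
      using prod.permute[OF \<pi>, of "\<lambda>i. A i (p i)"] by (simp add: o_def)
    ultimately show "of_int (sign (p \<circ> \<pi>)) * (\<Prod>i\<in>{1..N}. A (\<pi> i) ((p \<circ> \<pi>) i)) =
       of_int (sign \<pi>) * (of_int (sign p) * (\<Prod>i\<in>{1..N}. A i (p i)))" by simp
  qed
  also have "\<dots> = of_int (sign \<pi>) * detN N A"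
    by (simp add: detN_def sum_distrib_left)
  finally show ?thesis .
qed

lemma detN_transpose: "detN N (\<lambda>i j. A j i) = detN N A"
proof -
  have "detN N (\<lambda>i j. A j i) =
      (\<Sum>p\<in>{p. p permutes {1..N}}. of_int (sign (inv p)) * (\<Prod>i\<in>{1..N}. A (inv p i) i))"
    unfolding detN_def by (rule sum_permutations_inverse)
  also have "\<dots> = detN N A" unfolding detN_def
  proof (rule sum.cong[OF refl])
    fix p assume "p \<in> {p. p permutes {1..N}}"
    then have p: "p permutes {1..N}" by simp
    have "(\<Prod>i\<in>{1..N}. A (inv p i) i) = (\<Prod>i\<in>{1..N}. A i (p i))"
      using prod.permute[OF p, of "\<lambda>i. A (inv p i) i"] permutes_inverses[OF p] by (simp add: o_def)
    moreover have "sign (inv p) = sign p" using p by (intro sign_inverse) (auto simp: permutation_permutes)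
    ultimately show "of_int (sign (inv p)) * (\<Prod>i\<in>{1..N}. A (inv p i) i) =
       of_int (sign p) * (\<Prod>i\<in>{1..N}. A i (p i))" by simp
  qed
  finally show ?thesis .
qed

lemma detN_permute_cols:
  assumes \<pi>: "\<pi> permutes {1..N}"
  shows "detN N (\<lambda>i j. A i (\<pi> j)) = of_int (sign \<pi>) * detN N A"
  using detN_permute_rows[OF \<pi>, of "\<lambda>i j. A j i"] detN_transpose[of N "\<lambda>i j. A i (\<pi> j)"]
    detN_transpose[of N A] by simp

lemma detN_equal_cols:
  assumes "a \<in> {1..N}" "b \<in> {1..N}" "a \<noteq> b" and eq: "\<And>i. i \<in> {1..N} \<Longrightarrow> A i a = A i b"
  shows "detN N A = 0"
proof -
  let ?t = "Transposition.transpose a b"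
  have t: "?t permutes {1..N}" using assms by (intro permutes_swap_id)
  have "detN N A = detN N (\<lambda>i j. A i (?t j))"
    by (rule detN_cong) (auto simp: Transposition.transpose_def eq)
  also have "\<dots> = of_int (sign ?t) * detN N A" by (rule detN_permute_cols[OF t])
  also have "\<dots> = - detN N A" using assms by (simp add: sign_swap_id)
  finally show ?thesis by simp
qed

text \<open>The row meeting column \<open>c\<close> under \<open>p\<close> is
  \<open>inv p c\<close>; splitting it off makes the dependence on that column linear term by term.
  No cofactors are formed: the same form yields multilinearity here and, later, the derivative in
  the variable of a single column.\<close>

lemma detN_col_expand:
  assumes c: "c \<in> {1..N}"
  shows "detN N A = (\<Sum>p\<in>{p. p permutes {1..N}}. of_int (sign p) *
     (A (inv p c) c * (\<Prod>i\<in>{1..N}-{inv p c}. A i (p i))))"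
  unfolding detN_def
proof (rule sum.cong[OF refl])
  fix p assume "p \<in> {p. p permutes {1..N}}"
  then have p: "p permutes {1..N}" by simp
  have "inv p c \<in> {1..N}" using c p by (meson permutes_in_image permutes_inv)
  then have "(\<Prod>i\<in>{1..N}. A i (p i)) = A (inv p c) (p (inv p c)) * (\<Prod>i\<in>{1..N}-{inv p c}. A i (p i))"
    by (intro prod.remove) auto
  then show "of_int (sign p) * (\<Prod>i\<in>{1..N}. A i (p i)) = of_int (sign p) *
     (A (inv p c) c * (\<Prod>i\<in>{1..N}-{inv p c}. A i (p i)))"
    using permutes_inverses(1)[OF p] by simp
qed

lemma detN_col_diff:
  assumes c: "c \<in> {1..N}"
    and B: "\<And>i j. i \<in> {1..N} \<Longrightarrow> j \<in> {1..N} \<Longrightarrow> j \<noteq> c \<Longrightarrow> B i j = A i j"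
    and C: "\<And>i j. i \<in> {1..N} \<Longrightarrow> j \<in> {1..N} \<Longrightarrow> j \<noteq> c \<Longrightarrow> C i j = A i j"
    and A: "\<And>i. i \<in> {1..N} \<Longrightarrow> A i c = B i c - C i c"
  shows "detN N A = detN N B - detN N C"
  unfolding detN_col_expand[OF c, of A] detN_col_expand[OF c, of B] detN_col_expand[OF c, of C]
    sum_subtractf[symmetric]
proof (rule sum.cong[OF refl])
  fix p assume "p \<in> {p. p permutes {1..N}}"
  then have p: "p permutes {1..N}" by simp
  have i: "inv p c \<in> {1..N}" using c p by (meson permutes_in_image permutes_inv)
  have *: "p i \<noteq> c \<and> p i \<in> {1..N}" if "i \<in> {1..N}-{inv p c}" for i
    using that permutes_inverses(2)[OF p, of i] permutes_in_image[OF p, of i] by (metis DiffE singletonI)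
  have "(\<Prod>i\<in>{1..N}-{inv p c}. B i (p i)) = (\<Prod>i\<in>{1..N}-{inv p c}. A i (p i))"
    "(\<Prod>i\<in>{1..N}-{inv p c}. C i (p i)) = (\<Prod>i\<in>{1..N}-{inv p c}. A i (p i))"
    using * B C by (intro prod.cong refl; blast)+
  then show "of_int (sign p) * (A (inv p c) c * (\<Prod>i\<in>{1..N}-{inv p c}. A i (p i))) =
     of_int (sign p) * (B (inv p c) c * (\<Prod>i\<in>{1..N}-{inv p c}. B i (p i))) -
     of_int (sign p) * (C (inv p c) c * (\<Prod>i\<in>{1..N}-{inv p c}. C i (p i)))"
    by (simp add: A[OF i] algebra_simps)
qed

text \<open>Going from left to right, column \<open>Suc j\<close> is still the original one when it
  is subtracted from column \<open>j\<close>. If the last row is constant, the result has zeros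
  there except in the last column, which is how the branching rule starts.\<close>

lemma detN_subtract_next_cols:
  assumes "t \<le> n"
  shows "detN (Suc n) (\<lambda>i j. if j \<le> t then A i j - A i (Suc j) else A i j) = detN (Suc n) A"
  using assms
proof (induction t)
  case 0
  show ?case by (rule detN_cong) auto
next
  case (Suc t)
  let ?B = "\<lambda>i j. if j \<le> t then A i j - A i (Suc j) else A i j"
  let ?C = "\<lambda>i j. if j = Suc t then A i (Suc (Suc t)) else ?B i j"
  have "detN (Suc n) (\<lambda>i j. if j \<le> Suc t then A i j - A i (Suc j) else A i j) =
     detN (Suc n) ?B - detN (Suc n) ?C"
    by (rule detN_col_diff[of "Suc t"]) (use Suc.prems in auto)
  moreover have "detN (Suc n) ?C = 0"
    by (rule detN_equal_cols[of "Suc t" _ "Suc (Suc t)"]) (use Suc.prems in auto)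
  ultimately show ?case using Suc by simp
qed

lemma detN_last_row:
  assumes "\<And>j. j \<in> {1..n} \<Longrightarrow> A (Suc n) j = 0"
  shows "detN (Suc n) A = A (Suc n) (Suc n) * detN n A"
proof -
  let ?f = "\<lambda>p. of_int (sign p) * (\<Prod>i\<in>{1..Suc n}. A i (p i))"
  have sub: "{p. p permutes {1..n}} \<subseteq> {p. p permutes {1..Suc n}}"
  proof
    fix p assume "p \<in> {p. p permutes {1..n}}"
    then show "p \<in> {p. p permutes {1..Suc n}}" using permutes_subset[of p "{1..n}" "{1..Suc n}"] by simp
  qed
  have "detN (Suc n) A = (\<Sum>p\<in>{p. p permutes {1..n}}. ?f p)"
    unfolding detN_def
  proof (rule sum.mono_neutral_right[OF _ sub])
    show "finite {p. p permutes {1..Suc n}}" by (rule finite_permutations) auto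
    show "\<forall>p\<in>{p. p permutes {1..Suc n}} - {p. p permutes {1..n}}. ?f p = 0"
    proof
      fix p assume p: "p \<in> {p. p permutes {1..Suc n}} - {p. p permutes {1..n}}"
      have "p (Suc n) \<noteq> Suc n"
      proof
        assume "p (Suc n) = Suc n"
        then have "p permutes {1..Suc n} - {Suc n}"
          using permutes_superset[of p "{1..Suc n}" "{1..Suc n} - {Suc n}"] p by auto
        moreover have "{1..Suc n} - {Suc n} = {1..n}" by auto
        ultimately show False using p by simp
      qed
      moreover have "p (Suc n) \<in> {1..Suc n}" using p permutes_in_image[of p "{1..Suc n}" "Suc n"] by simp
      ultimately have "A (Suc n) (p (Suc n)) = 0" using assms[of "p (Suc n)"] by auto
      then have "(\<Prod>i\<in>{1..Suc n}. A i (p i)) = 0" by (intro prod_zero) auto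
      then show "?f p = 0" by simp
    qed
  qed
  also have "\<dots> = (\<Sum>p\<in>{p. p permutes {1..n}}. A (Suc n) (Suc n) * (of_int (sign p) * (\<Prod>i\<in>{1..n}. A i (p i))))"
  proof (rule sum.cong[OF refl])
    fix p assume "p \<in> {p. p permutes {1..n}}"
    then have "p (Suc n) = Suc n" using permutes_not_in[of p "{1..n}" "Suc n"] by simp
    then show "?f p = A (Suc n) (Suc n) * (of_int (sign p) * (\<Prod>i\<in>{1..n}. A i (p i)))"
      by (simp add: prod.nat_ivl_Suc')
  qed
  finally show ?thesis by (simp add: detN_def sum_distrib_left)
qed

lemma detN_scale_rows: "detN N (\<lambda>i j. c i * A i j) = (\<Prod>i\<in>{1..N}. c i) * detN N A"
  unfolding detN_def by (simp add: prod.distrib sum_distrib_left mult.left_commute)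

lemma detN_scale_cols: "detN N (\<lambda>i j. c j * A i j) = (\<Prod>i\<in>{1..N}. c i) * detN N A"
  using detN_scale_rows[of N c "\<lambda>i j. A j i"] detN_transpose[of N "\<lambda>i j. c j * A i j"]
    detN_transpose[of N A] by simp

lemma detN_sum_cols:
  assumes "\<And>j. j \<in> {1..N} \<Longrightarrow> finite (Y j)"
  shows "detN N (\<lambda>i j. \<Sum>y\<in>Y j. f i y) = (\<Sum>g\<in>Pi\<^sub>E {1..N} Y. detN N (\<lambda>i j. f i (g j)))"
proof -
  have "detN N (\<lambda>i j. \<Sum>y\<in>Y j. f i y) = detN N (\<lambda>i j. \<Sum>y\<in>Y i. f j y)"
    using detN_transpose[of N "\<lambda>i j. \<Sum>y\<in>Y j. f i y"] by simp
  also have "\<dots> = (\<Sum>p\<in>{p. p permutes {1..N}}. of_int (sign p) * (\<Sum>g\<in>Pi\<^sub>E {1..N} Y. \<Prod>i\<in>{1..N}. f (p i) (g i)))"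
    unfolding detN_def using assms by (subst prod_sum_PiE) auto
  also have "\<dots> = (\<Sum>g\<in>Pi\<^sub>E {1..N} Y. detN N (\<lambda>i j. f j (g i)))"
    unfolding detN_def sum_distrib_left by (rule sum.swap)
  also have "\<dots> = (\<Sum>g\<in>Pi\<^sub>E {1..N} Y. detN N (\<lambda>i j. f i (g j)))"
    by (rule sum.cong[OF refl], rule detN_transpose)
  finally show ?thesis .
qed

section \<open>Branching rule: removing one variable from an alternant\<close>

lemma powi_diff_eq_sum:
  fixes w :: complex
  assumes "w \<noteq> 0" "a \<le> b"
  shows "w powi b - w powi a = (w - 1) * (\<Sum>y\<in>{a..<b}. w powi y)"
  using assms(2)
proof (induction b rule: int_ge_induct)
  case (step b)
  have "{a..<b+1} = insert b {a..<b}" using step by auto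
  then have "(w - 1) * (\<Sum>y\<in>{a..<b+1}. w powi y) = (w - 1) * w powi b + (w powi b - w powi a)"
    by (simp add: step algebra_simps)
  also have "\<dots> = w powi (b+1) - w powi a"
    using assms(1) by (simp add: power_int_add algebra_simps)
  finally show ?case by simp
qed simp

text \<open>With \<open>x j\<close> = lambda_j + (n+1) - j and \<open>y j\<close> = mu_j + n - j the
  half-open intervals say lambda_(j+1) <= mu_j <= lambda_j: Gelfand-Tsetlin interlacing in strictly
  decreasing coordinates. Extensionality makes the set finite.\<close>

definition interlace :: "nat \<Rightarrow> (nat \<Rightarrow> int) \<Rightarrow> (nat \<Rightarrow> int) set" where
  "interlace n x = Pi\<^sub>E {1..n} (\<lambda>j. {x (Suc j)..<x j})"

lemma finite_interlace: "finite (interlace n x)"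
  unfolding interlace_def by (rule finite_PiE) auto

lemma powi_prod: "(w::complex) \<noteq> 0 \<Longrightarrow> finite A \<Longrightarrow> (\<Prod>i\<in>A. w powi x i) = w powi (\<Sum>i\<in>A. x i)"
  by (rotate_tac, induction A rule: finite_induct) (auto simp: power_int_add)

text \<open>The last row consists of ones. After neighbouring columns are subtracted it is (0, ...,
  0, 1), and every remaining entry is \<open>w i - 1\<close> times a geometric sum over one
  interval; multilinearity then distributes the determinant over the interlacing sequences.\<close>

lemma detN_branching_one:
  fixes w :: "nat \<Rightarrow> complex"
  assumes dec: "\<And>j. j \<in> {1..n} \<Longrightarrow> x (Suc j) < x j" and w: "\<And>i. i \<in> {1..n} \<Longrightarrow> w i \<noteq> 0"
    and w1: "w (Suc n) = 1"
  shows "detN (Suc n) (\<lambda>i j. w i powi x j) =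
     (\<Prod>i\<in>{1..n}. w i - 1) * (\<Sum>y\<in>interlace n x. detN n (\<lambda>i j. w i powi y j))"
proof -
  let ?A = "\<lambda>i j. w i powi x j"
  have "detN (Suc n) ?A = detN (Suc n) (\<lambda>i j. if j \<le> n then ?A i j - ?A i (Suc j) else ?A i j)"
    by (rule detN_subtract_next_cols[symmetric]) simp
  also have "\<dots> = detN n (\<lambda>i j. if j \<le> n then ?A i j - ?A i (Suc j) else ?A i j)"
    by (subst detN_last_row) (auto simp: w1)
  also have "\<dots> = detN n (\<lambda>i j. (w i - 1) * (\<Sum>y\<in>{x (Suc j)..<x j}. w i powi y))"
    by (rule detN_cong) (use dec w in \<open>auto intro!: powi_diff_eq_sum less_imp_le\<close>)
  also have "\<dots> = (\<Prod>i\<in>{1..n}. w i - 1) * detN n (\<lambda>i j. \<Sum>y\<in>{x (Suc j)..<x j}. w i powi y)"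
    by (rule detN_scale_rows)
  also have "detN n (\<lambda>i j. \<Sum>y\<in>{x (Suc j)..<x j}. w i powi y) = (\<Sum>y\<in>interlace n x. detN n (\<lambda>i j. w i powi y j))"
    unfolding interlace_def by (rule detN_sum_cols) auto
  finally show ?thesis .
qed

text \<open>Homogeneity reduces this to last variable one: all variables are divided by
  \<open>c = u (Suc n)\<close>. The exponent of \<open>c\<close> collects the total degree of
  \<open>x\<close>, minus the degree given back to \<open>y\<close>, minus \<open>n\<close> for the
  linear factors.\<close>

lemma detN_branching:
  fixes u :: "nat \<Rightarrow> complex"
  assumes dec: "\<And>j. j \<in> {1..n} \<Longrightarrow> x (Suc j) < x j" and u: "\<And>i. i \<in> {1..Suc n} \<Longrightarrow> u i \<noteq> 0"
  shows "detN (Suc n) (\<lambda>i j. u i powi x j) =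
     (\<Prod>i\<in>{1..n}. u i - u (Suc n)) *
     (\<Sum>y\<in>interlace n x. u (Suc n) powi (sum x {1..Suc n} - sum y {1..n} - int n) * detN n (\<lambda>i j. u i powi y j))"
proof -
  define c where "c = u (Suc n)"
  have c: "c \<noteq> 0" using u[of "Suc n"] by (simp add: c_def)
  define w where "w i = u i / c" for i
  have uw: "u i = c * w i" for i using c by (simp add: w_def)
  have scale: "detN m (\<lambda>i j. u i powi x j) = c powi sum x {1..m} * detN m (\<lambda>i j. w i powi x j)" for m x
  proof -
    have "detN m (\<lambda>i j. u i powi x j) = detN m (\<lambda>i j. c powi x j * w i powi x j)"
      by (simp add: uw power_int_mult_distrib)
    then show ?thesis by (simp add: detN_scale_cols powi_prod[OF c])
  qed
  have "detN (Suc n) (\<lambda>i j. u i powi x j) = c powi sum x {1..Suc n} * ((\<Prod>i\<in>{1..n}. w i - 1) *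
     (\<Sum>y\<in>interlace n x. detN n (\<lambda>i j. w i powi y j)))"
    unfolding scale
    by (subst detN_branching_one) (use dec u c in \<open>auto simp: w_def c_def\<close>)
  also have "(\<Prod>i\<in>{1..n}. w i - 1) = c powi (- int n) * (\<Prod>i\<in>{1..n}. u i - c)"
  proof -
    have "(\<Prod>i\<in>{1..n}. u i - c) = (\<Prod>i\<in>{1..n}. c * (w i - 1))" using c by (simp add: w_def algebra_simps)
    also have "\<dots> = c ^ n * (\<Prod>i\<in>{1..n}. w i - 1)" by (simp add: prod.distrib)
    finally show ?thesis using c by (simp add: power_int_minus)
  qed
  also have "(\<Sum>y\<in>interlace n x. detN n (\<lambda>i j. w i powi y j)) =
      (\<Sum>y\<in>interlace n x. c powi (- sum y {1..n}) * detN n (\<lambda>i j. u i powi y j))"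
    using c by (intro sum.cong refl) (simp add: scale power_int_minus)
  also have "c powi sum x {1..Suc n} * (c powi (- int n) * (\<Prod>i\<in>{1..n}. u i - c) *
      (\<Sum>y\<in>interlace n x. c powi (- sum y {1..n}) * detN n (\<lambda>i j. u i powi y j))) =
     (\<Prod>i\<in>{1..n}. u i - c) * (\<Sum>y\<in>interlace n x. (c powi sum x {1..Suc n} * c powi (- sum y {1..n}) * c powi (- int n))
        * detN n (\<lambda>i j. u i powi y j))"
    unfolding sum_distrib_left by (intro sum.cong refl) (simp only: ac_simps)
  also have "\<dots> = (\<Prod>i\<in>{1..n}. u i - c) * (\<Sum>y\<in>interlace n x. c powi (sum x {1..Suc n} - sum y {1..n} - int n)
        * detN n (\<lambda>i j. u i powi y j))"
    using c by (simp add: power_int_add[symmetric])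
  finally show ?thesis by (simp only: c_def)
qed

text \<open>The Schur function in the coordinates x_j = lambda_j + n - j, as a sum over
  Gelfand-Tsetlin patterns. Free of Vandermonde denominators, it makes sense at points with equal
  coordinates, where \<open>schur\<close> is only a limit, and it shows that the coefficients are
  nonnegative.\<close>

fun schurP :: "nat \<Rightarrow> (nat \<Rightarrow> int) \<Rightarrow> (nat \<Rightarrow> complex) \<Rightarrow> complex" where
  "schurP 0 x u = 1"
| "schurP (Suc n) x u = (\<Sum>y\<in>interlace n x.
     u (Suc n) powi (sum x {1..Suc n} - sum y {1..n} - int n) * schurP n y u)"

lemma vandermonde_Suc:
  "vandermonde (Suc n) u = vandermonde n u * (\<Prod>i\<in>{1..n}. u i - u (Suc n))"
proof -
  have "(\<Prod>j\<in>{i<..Suc n}. u i - u j) = (\<Prod>j\<in>{i<..n}. u i - u j) * (u i - u (Suc n))" if "i \<in> {1..n}" for i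
  proof -
    have "{i<..Suc n} = insert (Suc n) {i<..n}" using that by auto
    then show ?thesis by (simp add: mult.commute)
  qed
  then show ?thesis by (simp add: vandermonde_def prod.nat_ivl_Suc' prod.distrib)
qed

lemma detN_eq_vandermonde_schurP:
  fixes u :: "nat \<Rightarrow> complex"
  assumes "\<And>j. j \<in> {1..<n} \<Longrightarrow> x (Suc j) < x j" and "\<And>i. i \<in> {1..n} \<Longrightarrow> u i \<noteq> 0"
  shows "detN n (\<lambda>i j. u i powi x j) = vandermonde n u * schurP n x u"
  using assms
proof (induction n arbitrary: x)
  case 0
  then show ?case by (simp add: detN_def vandermonde_def)
next
  case (Suc n)
  have "detN n (\<lambda>i j. u i powi y j) = vandermonde n u * schurP n y u" if "y \<in> interlace n x" for y
  proof (rule Suc.IH)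
    fix j assume j: "j \<in> {1..<n}"
    \<comment> \<open>Neighbouring intervals share the endpoint \<open>x (Suc j)\<close>, hence
      interlacing sequences are again strictly decreasing.\<close>
    have "y (Suc j) < x (Suc j)" "x (Suc j) \<le> y j"
      using that j unfolding interlace_def PiE_iff by fastforce+
    then show "y (Suc j) < y j" by simp
  qed (use Suc.prems in auto)
  then show ?case
    using Suc.prems by (subst detN_branching) (auto simp: vandermonde_Suc sum_distrib_left mult_ac intro!: sum.cong)
qed

text \<open>The staircase is the empty partition: every interval is a single point, so there is
  exactly one pattern, and all its exponents are 0. Together with the determinant formula this
  evaluates the Vandermonde determinant.\<close>

lemma schurP_staircase: "schurP n (\<lambda>j. int n - int j) u = 1"
proof (cases "n = 0")
  case False
  have "schurP n x u = 1" if "\<And>j. j \<in> {1..n} \<Longrightarrow> x j = int n - int j" for x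
    using that
  proof (induction n arbitrary: x)
    case (Suc n)
    have "{x (Suc j)..<x j} = {int n - int j}" if "j \<in> {1..n}" for j
      using Suc.prems[of j] Suc.prems[of "Suc j"] that by auto
    then have "interlace n x = Pi\<^sub>E {1..n} (\<lambda>j. {(\<lambda>j\<in>{1..n}. int n - int j) j})"
      unfolding interlace_def by (intro PiE_cong) simp
    then have I: "interlace n x = {\<lambda>j\<in>{1..n}. int n - int j}"
      using PiE_singleton[of "\<lambda>j\<in>{1..n}. int n - int j" "{1..n}"] by simp
    have "sum x {1..Suc n} = (\<Sum>j\<in>{1..n}. int (Suc n) - int j)"
      using Suc.prems by (simp add: sum.nat_ivl_Suc')
    also have "\<dots> = (\<Sum>j\<in>{1..n}. int n - int j) + int n" by (simp add: sum.distrib sum_subtractf algebra_simps)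
    finally have "sum x {1..Suc n} - (\<Sum>j\<in>{1..n}. int n - int j) - int n = 0" by simp
    moreover have "schurP n (\<lambda>j\<in>{1..n}. int n - int j) u = 1" by (rule Suc.IH) auto
    ultimately show ?case by (simp add: I)
  qed simp
  then show ?thesis by simp
qed simp

lemma vandermonde_eq_detN:
  assumes "\<And>i. i \<in> {1..n} \<Longrightarrow> u i \<noteq> 0"
  shows "vandermonde n u = detN n (\<lambda>i j. u i powi (int n - int j))"
  using detN_eq_vandermonde_schurP[of n "\<lambda>j. int n - int j" u] assms schurP_staircase by simp

text \<open>The value counts Gelfand-Tsetlin patterns, of which there is at least one since no
  interval is empty. It serves as the normalising denominator.\<close>

lemma schurP_nz_ones:
  assumes "\<And>j. j \<in> {1..<n} \<Longrightarrow> x (Suc j) < x j"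
  shows "schurP n x ones \<in> \<real> \<and> Re (schurP n x ones) \<ge> 1"
  using assms
proof (induction n arbitrary: x)
  case (Suc n)
  have IH: "schurP n y ones \<in> \<real> \<and> Re (schurP n y ones) \<ge> 1" if "y \<in> interlace n x" for y
  proof (rule Suc.IH)
    fix j assume j: "j \<in> {1..<n}"
    have "y (Suc j) < x (Suc j)" "x (Suc j) \<le> y j"
      using that j unfolding interlace_def PiE_iff by fastforce+
    then show "y (Suc j) < y j" by simp
  qed
  have "interlace n x \<noteq> {}" using Suc.prems unfolding interlace_def by (auto simp: PiE_eq_empty_iff)
  then have "card (interlace n x) \<ge> 1" using finite_interlace[of n x] by (simp add: Suc_le_eq card_gt_0_iff)
  moreover have "(\<Sum>y\<in>interlace n x. 1) \<le> (\<Sum>y\<in>interlace n x. Re (schurP n y ones))"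
    using IH by (intro sum_mono) auto
  ultimately show ?case using IH by (auto simp: ones_def intro!: sum_in_Reals)
qed simp

section \<open>Laurent polynomials in infinitely many letters\<close>

definition nzpt :: "(nat \<Rightarrow> complex) set" where
  "nzpt = {u. \<forall>i. u i \<noteq> 0}"

lemma nzpt_upd [simp]: "u \<in> nzpt \<Longrightarrow> z \<noteq> 0 \<Longrightarrow> u(i := z) \<in> nzpt"
  by (auto simp: nzpt_def)

lemma nzpt_nz: "u \<in> nzpt \<Longrightarrow> u i \<noteq> 0"
  by (auto simp: nzpt_def)

lemma nzpt_relabel: "u \<in> nzpt \<Longrightarrow> (\<lambda>i. u (\<pi> i)) \<in> nzpt"
  by (auto simp: nzpt_def)

text \<open>Letters are indexed by all of \<open>nat\<close>, so the same function serves for every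
  number of variables and every relabelling. Since \<open>inverse 0 = 0\<close>, algebraic
  identities are claimed on \<open>nzpt\<close> only. The inductive form allows divisibility and
  differentiation to be proved by structural induction.\<close>

inductive laurent :: "((nat \<Rightarrow> complex) \<Rightarrow> complex) \<Rightarrow> bool" where
  laurent_const: "laurent (\<lambda>u. c)"
| laurent_coord: "laurent (\<lambda>u. u i)"
| laurent_inv: "laurent (\<lambda>u. inverse (u i))"
| laurent_add: "laurent f \<Longrightarrow> laurent g \<Longrightarrow> laurent (\<lambda>u. f u + g u)"
| laurent_mult: "laurent f \<Longrightarrow> laurent g \<Longrightarrow> laurent (\<lambda>u. f u * g u)"

lemma laurent_minus: "laurent f \<Longrightarrow> laurent (\<lambda>u. - f u)"
  using laurent_mult[OF laurent_const[of "-1"], of f] by simp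

lemma laurent_diff: "laurent f \<Longrightarrow> laurent g \<Longrightarrow> laurent (\<lambda>u. f u - g u)"
  using laurent_add[OF _ laurent_minus, of f g] by simp

lemma laurent_sum: "(\<And>i. i \<in> A \<Longrightarrow> laurent (f i)) \<Longrightarrow> laurent (\<lambda>u. \<Sum>i\<in>A. f i u)"
  by (induction A rule: infinite_finite_induct) (auto intro: laurent_const laurent_add)

lemma laurent_prod: "(\<And>i. i \<in> A \<Longrightarrow> laurent (f i)) \<Longrightarrow> laurent (\<lambda>u. \<Prod>i\<in>A. f i u)"
  by (induction A rule: infinite_finite_induct) (auto intro: laurent_const laurent_mult)

lemma laurent_power: "laurent f \<Longrightarrow> laurent (\<lambda>u. f u ^ n)"
  by (induction n) (auto intro: laurent_const laurent_mult)

lemma laurent_powi: "laurent (\<lambda>u. u i powi n)"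
  by (cases "n \<ge> 0") (auto simp: power_int_def intro: laurent_power laurent_coord laurent_inv)

lemma laurent_relabel: "laurent f \<Longrightarrow> laurent (\<lambda>u. f (\<lambda>i. u (\<pi> i)))"
  by (induction rule: laurent.induct) (auto intro: laurent.intros)

lemma laurent_tendsto:
  assumes "laurent f" "u \<in> nzpt" "\<And>i. ((\<lambda>t. c t i) \<longlongrightarrow> u i) F"
  shows "((\<lambda>t. f (c t)) \<longlongrightarrow> f u) F"
  using assms
  by (induction rule: laurent.induct) (auto intro!: tendsto_intros simp: nzpt_def)

lemma laurent_holomorphic:
  assumes "laurent f" "\<And>i. (\<lambda>t. c t i) holomorphic_on A" "\<And>t. t \<in> A \<Longrightarrow> c t \<in> nzpt"
  shows "(\<lambda>t. f (c t)) holomorphic_on A"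
  using assms
  by (induction rule: laurent.induct) (auto intro!: holomorphic_intros simp: nzpt_def)

text \<open>Factor theorem within the Laurent polynomials. Sums are immediate, products go as in the
  Leibniz rule, and 1/u_a - 1/u_b = -(u_a - u_b)/(u_a u_b).\<close>

lemma laurent_diff_subst:
  assumes "laurent f"
  shows "\<exists>g. laurent g \<and> (\<forall>u\<in>nzpt. f u - f (u(a := u b)) = (u a - u b) * g u)"
  using assms
proof (induction rule: laurent.induct)
  case (laurent_const c)
  then show ?case by (intro exI[of _ "\<lambda>u. 0"]) (auto intro: laurent.laurent_const)
next
  case (laurent_coord i)
  then show ?case
    by (intro exI[of _ "\<lambda>u. if i = a then 1 else 0"]) (auto intro: laurent.laurent_const)
next
  case (laurent_inv i)
  have "laurent (\<lambda>u. if i = a then - (inverse (u a) * inverse (u b)) else 0)"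
    by (cases "i = a") (auto intro!: laurent.intros laurent_minus)
  then show ?case
    by (intro exI[of _ "\<lambda>u. if i = a then - (inverse (u a) * inverse (u b)) else 0"])
       (auto simp: nzpt_def field_simps)
next
  case (laurent_add f g)
  then obtain f' g' where fg: "laurent f'" "laurent g'" "\<forall>u\<in>nzpt. f u - f (u(a := u b)) = (u a - u b) * f' u"
    "\<forall>u\<in>nzpt. g u - g (u(a := u b)) = (u a - u b) * g' u" by blast
  have "f u + g u - (f (u(a := u b)) + g (u(a := u b))) = (u a - u b) * (f' u + g' u)" if "u \<in> nzpt" for u
    unfolding add_diff_add fg(3)[rule_format, OF that] fg(4)[rule_format, OF that] by (rule distrib_left[symmetric])
  then show ?case using laurent.laurent_add[OF fg(1,2)] by blast
next
  case (laurent_mult f g)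
  then obtain f' g' where fg: "laurent f'" "laurent g'" "\<forall>u\<in>nzpt. f u - f (u(a := u b)) = (u a - u b) * f' u"
    "\<forall>u\<in>nzpt. g u - g (u(a := u b)) = (u a - u b) * g' u" by blast
  have "f u * g u - f (u(a := u b)) * g (u(a := u b)) = (u a - u b) * (f' u * g u + (f u - (u a - u b) * f' u) * g' u)"
    if "u \<in> nzpt" for u
  proof -
    have e: "f (u(a := u b)) = f u - (u a - u b) * f' u" "g (u(a := u b)) = g u - (u a - u b) * g' u"
      using fg that by (auto simp: algebra_simps)
    show ?thesis unfolding e by (simp add: algebra_simps)
  qed
  moreover have "laurent (\<lambda>u. f' u * g u + (f u - (u a - u b) * f' u) * g' u)"
    using fg laurent_mult.hyps by (intro laurent.laurent_add laurent.laurent_mult laurent_diff laurent_coord)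
  ultimately show ?case by blast
qed

lemma laurent_deriv:
  assumes "laurent f"
  shows "\<exists>g. laurent g \<and> (\<forall>u\<in>nzpt. ((\<lambda>z. f (u(i := z))) has_field_derivative g u) (at (u i)))"
  using assms
proof (induction rule: laurent.induct)
  case (laurent_const c)
  then show ?case by (intro exI[of _ "\<lambda>u. 0"]) (auto intro: laurent.laurent_const)
next
  case (laurent_coord j)
  then show ?case
    by (intro exI[of _ "\<lambda>u. if i = j then 1 else 0"]) (auto intro: laurent.laurent_const)
next
  case (laurent_inv j)
  have "laurent (\<lambda>u. if i = j then - (inverse (u j) * inverse (u j)) else 0)"
    by (cases "i = j") (auto intro!: laurent.intros laurent_minus)
  moreover have "((\<lambda>z. inverse ((u(i := z)) j)) has_field_derivative
      (if i = j then - (inverse (u j) * inverse (u j)) else 0)) (at (u i))" if "u \<in> nzpt" for u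
    using that by (auto simp: nzpt_def intro!: derivative_eq_intros)
  ultimately show ?case by blast
next
  case (laurent_add f g)
  then obtain f' g' where fg: "laurent f'" "laurent g'"
    "\<forall>u\<in>nzpt. ((\<lambda>z. f (u(i := z))) has_field_derivative f' u) (at (u i))"
    "\<forall>u\<in>nzpt. ((\<lambda>z. g (u(i := z))) has_field_derivative g' u) (at (u i))" by blast
  have "((\<lambda>z. f (u(i := z)) + g (u(i := z))) has_field_derivative f' u + g' u) (at (u i))"
    if "u \<in> nzpt" for u
    using DERIV_add[OF fg(3)[rule_format, OF that] fg(4)[rule_format, OF that]] .
  then show ?case using laurent.laurent_add[OF fg(1,2)] by blast
next
  case (laurent_mult f g)
  then obtain f' g' where fg: "laurent f'" "laurent g'"
    "\<forall>u\<in>nzpt. ((\<lambda>z. f (u(i := z))) has_field_derivative f' u) (at (u i))"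
    "\<forall>u\<in>nzpt. ((\<lambda>z. g (u(i := z))) has_field_derivative g' u) (at (u i))" by blast
  have "((\<lambda>z. f (u(i := z)) * g (u(i := z))) has_field_derivative f' u * g u + f u * g' u) (at (u i))"
    if "u \<in> nzpt" for u
    using DERIV_mult[OF fg(3)[rule_format, OF that] fg(4)[rule_format, OF that]] by (simp add: algebra_simps)
  moreover have "laurent (\<lambda>u. f' u * g u + f u * g' u)"
    using fg laurent_mult.hyps by (intro laurent.laurent_add laurent.laurent_mult)
  ultimately show ?case by blast
qed

definition pd :: "nat \<Rightarrow> nat \<Rightarrow> ((nat \<Rightarrow> complex) \<Rightarrow> complex) \<Rightarrow> (nat \<Rightarrow> complex) \<Rightarrow> complex" where
  "pd p i f u = (deriv ^^ p) (\<lambda>z. f (u(i := z))) (u i)"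

lemma laurent_pd:
  assumes "laurent f"
  shows "\<exists>g. laurent g \<and> (\<forall>u\<in>nzpt. pd p i f u = g u)"
proof (induction p)
  case 0
  then show ?case using assms by (intro exI[of _ f]) (auto simp: pd_def)
next
  case (Suc p)
  then obtain g where g: "laurent g" "\<forall>u\<in>nzpt. pd p i f u = g u" by blast
  obtain g' where g': "laurent g'" "\<forall>u\<in>nzpt. ((\<lambda>z. g (u(i := z))) has_field_derivative g' u) (at (u i))"
    using laurent_deriv[OF g(1)] by blast
  have "pd (Suc p) i f u = g' u" if u: "u \<in> nzpt" for u
  proof -
    have "((deriv ^^ p) (\<lambda>z. f (u(i := z))) has_field_derivative g' u) (at (u i))"
    proof (rule has_field_derivative_transform_within_open)
      show "((\<lambda>z. g (u(i := z))) has_field_derivative g' u) (at (u i))" using g' u by blast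
      show "open (- {0::complex})" by (simp add: open_Compl)
      show "u i \<in> - {0}" using u by (simp add: nzpt_def)
      show "g (u(i := z)) = (deriv ^^ p) (\<lambda>z. f (u(i := z))) z" if "z \<in> - {0}" for z
        using g(2)[rule_format, of "u(i := z)"] that u by (simp add: pd_def)
    qed
    then show ?thesis by (simp add: pd_def DERIV_imp_deriv)
  qed
  then show ?case using g' by blast
qed

section \<open>Generic perturbations and division by differences of variables\<close>

lemma perturb_tendsto: "((\<lambda>t. u i + c i * t) \<longlongrightarrow> u i) (at (0::complex))" for u :: "nat \<Rightarrow> complex"
  by (rule tendsto_eq_intros refl | simp)+

lemma perturb_noteq:
  fixes u c :: "nat \<Rightarrow> complex"
  assumes "c i \<noteq> c j"
  shows "eventually (\<lambda>t. u i + c i * t \<noteq> u j + c j * t) (at (0::complex))"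
proof (cases "u i = u j")
  case True
  then show ?thesis using assms by (auto simp: eventually_at intro!: exI[of _ 1])
next
  case False
  have "((\<lambda>t. (u i + c i * t) - (u j + c j * t)) \<longlongrightarrow> u i - u j) (at (0::complex))"
    by (intro tendsto_diff perturb_tendsto)
  then have "eventually (\<lambda>t. (u i + c i * t) - (u j + c j * t) \<noteq> 0) (at (0::complex))"
    using False by (intro tendsto_imp_eventually_ne) auto
  then show ?thesis by simp
qed

lemma perturb_nz:
  fixes u c :: "nat \<Rightarrow> complex"
  assumes "u \<in> nzpt"
  shows "eventually (\<lambda>t. u i + c i * t \<noteq> 0) (at (0::complex))"
  using assms perturb_tendsto[of u i c] by (intro tendsto_imp_eventually_ne) (auto simp: nzpt_def)

text \<open>Only the letters up to \<open>M\<close> move, so that remaining in \<open>nzpt\<close>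
  is a condition on finitely many coordinates and holds for all small \<open>t\<close>.\<close>

definition perturb :: "nat \<Rightarrow> (nat \<Rightarrow> complex) \<Rightarrow> (nat \<Rightarrow> complex) \<Rightarrow> complex \<Rightarrow> nat \<Rightarrow> complex" where
  "perturb M c u t = (\<lambda>i. if i \<le> M then u i + c i * t else u i)"

lemma perturb_in_nzpt:
  assumes "u \<in> nzpt"
  shows "eventually (\<lambda>t. perturb M c u t \<in> nzpt) (at 0)"
proof -
  have "eventually (\<lambda>t. \<forall>i\<in>{..M}. u i + c i * t \<noteq> 0) (at (0::complex))"
    using perturb_nz[OF assms] by (intro eventually_ball_finite) auto
  then show ?thesis
    by eventually_elim (use assms in \<open>auto simp: perturb_def nzpt_def\<close>)
qed

lemma perturb_laurent_tendsto:
  assumes "laurent f" "u \<in> nzpt"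
  shows "((\<lambda>t. f (perturb M c u t)) \<longlongrightarrow> f u) (at 0)"
proof (rule laurent_tendsto[OF assms])
  fix i show "((\<lambda>t. perturb M c u t i) \<longlongrightarrow> u i) (at 0)"
    using perturb_tendsto[of u i c] by (cases "i \<le> M") (auto simp: perturb_def)
qed

text \<open>Induction over the pairs. To divide the quotient \<open>g\<close> obtained so far by one
  more u_a - u_b, it must vanish where u_a = u_b. At points where the other differences are nonzero
  this follows from the vanishing of \<open>f\<close>; every other point of this set is a limit of
  such points.\<close>

lemma laurent_divide_pairs:
  assumes "finite Q" "laurent f" "\<And>a b. (a, b) \<in> Q \<Longrightarrow> a < b"
    and "\<And>a b u. (a, b) \<in> Q \<Longrightarrow> u \<in> nzpt \<Longrightarrow> u a = u b \<Longrightarrow> f u = 0"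
  shows "\<exists>g. laurent g \<and> (\<forall>u\<in>nzpt. f u = (\<Prod>(a,b)\<in>Q. u a - u b) * g u)"
  using assms
proof (induction Q rule: finite_induct)
  case empty
  then show ?case by auto
next
  case (insert ab Q)
  obtain a b where ab: "ab = (a, b)" by force
  obtain g where g: "laurent g" "\<forall>u\<in>nzpt. f u = (\<Prod>(a,b)\<in>Q. u a - u b) * g u"
    using insert.IH insert.prems by blast
  have ltab: "a < b" using insert.prems ab by auto
  define M where "M = Max (insert b (snd ` Q))"
  have M: "snd p \<le> M" if "p \<in> Q" for p using that insert.hyps by (auto simp: M_def)
  have Mb: "b \<le> M" using insert.hyps by (auto simp: M_def)
  have van: "g u = 0" if u: "u \<in> nzpt" "u a = u b" for u
  proof -
    \<comment> \<open>Letter \<open>b\<close> moves with the speed of \<open>a\<close>, which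
      preserves u_a = u_b, while all other speeds differ. As pairs are ordered, (a, b) is the only
      one whose two speeds agree, and it is not in \<open>Q\<close>.\<close>
    define c :: "nat \<Rightarrow> complex" where "c i = (if i = b then of_nat a else of_nat i)" for i
    let ?v = "perturb M c u"
    have "eventually (\<lambda>t. \<forall>p\<in>Q. ?v t (fst p) \<noteq> ?v t (snd p)) (at 0)"
    proof (intro eventually_ball_finite ballI)
      fix p assume p: "p \<in> Q"
      obtain a' b' where p': "p = (a', b')" by force
      have "a' < b'" using insert.prems p p' by auto
      moreover have "(a', b') \<noteq> (a, b)" using insert.hyps p p' ab by auto
      ultimately have "c a' \<noteq> c b'" using ltab by (auto simp: c_def)
      moreover have "b' \<le> M" using M[OF p] p' by simp
      ultimately show "eventually (\<lambda>t. ?v t (fst p) \<noteq> ?v t (snd p)) (at 0)"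
        using perturb_noteq[of c a' b' u] \<open>a' < b'\<close> by (auto simp: p' perturb_def)
    qed (use insert.hyps in auto)
    moreover have "eventually (\<lambda>t. ?v t \<in> nzpt) (at 0)" by (rule perturb_in_nzpt[OF u(1)])
    ultimately have "eventually (\<lambda>t. g (?v t) = 0) (at 0)"
    proof eventually_elim
      case (elim t)
      have "?v t a = ?v t b" using u(2) Mb ltab by (simp add: perturb_def c_def)
      then have "f (?v t) = 0" using insert.prems(3)[of a b "?v t"] elim ab by auto
      moreover have "(\<Prod>(a,b)\<in>Q. ?v t a - ?v t b) \<noteq> 0"
        using elim insert.hyps by (auto simp: case_prod_unfold)
      ultimately show ?case using g(2) elim by auto
    qed
    then have "((\<lambda>t. g (?v t)) \<longlongrightarrow> 0) (at 0)" by (rule tendsto_eventually)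
    moreover have "((\<lambda>t. g (?v t)) \<longlongrightarrow> g u) (at 0)" by (rule perturb_laurent_tendsto[OF g(1) u(1)])
    ultimately show ?thesis by (rule tendsto_unique[OF at_neq_bot, symmetric])
  qed
  obtain g' where g': "laurent g'" "\<forall>u\<in>nzpt. g u - g (u(a := u b)) = (u a - u b) * g' u"
    using laurent_diff_subst[OF g(1)] by blast
  have "f u = (\<Prod>(a,b)\<in>insert ab Q. u a - u b) * g' u" if u: "u \<in> nzpt" for u
  proof -
    have "g (u(a := u b)) = 0" using u ltab by (intro van) (auto simp: nzpt_def)
    then have "g u = (u a - u b) * g' u" using g' u by auto
    then show ?thesis using g(2) u insert.hyps by (simp add: ab)
  qed
  then show ?case using g' by blast
qed

lemma vandermonde_pairs:
  "vandermonde M u = (\<Prod>(a,b)\<in>(SIGMA i:{1..M}. {i<..M}). u a - u b)"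
  unfolding vandermonde_def by (subst prod.Sigma) auto

lemma vandermonde_nz_iff: "vandermonde M u \<noteq> 0 \<longleftrightarrow> inj_on u {1..M}"
proof -
  have "vandermonde M u \<noteq> 0 \<longleftrightarrow> (\<forall>a\<in>{1..M}. \<forall>b\<in>{a<..M}. u a \<noteq> u b)"
    unfolding vandermonde_def by auto
  also have "\<dots> \<longleftrightarrow> inj_on u {1..M}"
  proof
    assume *: "\<forall>a\<in>{1..M}. \<forall>b\<in>{a<..M}. u a \<noteq> u b"
    show "inj_on u {1..M}"
    proof (rule inj_onI)
      fix x y assume "x \<in> {1..M}" "y \<in> {1..M}" "u x = u y"
      then show "x = y" using *[rule_format, of x y] *[rule_format, of y x] by (cases x y rule: linorder_cases) auto
    qed
  next
    assume "inj_on u {1..M}"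
    then show "\<forall>a\<in>{1..M}. \<forall>b\<in>{a<..M}. u a \<noteq> u b" by (auto dest!: inj_onD)
  qed
  finally show ?thesis .
qed

text \<open>As a polynomial in u_i alone the Vandermonde product is a constant times the product of
  all u_i - u_j. The constant \<open>A\<close> carries the sign of the \<open>i - 1\<close> factors
  in which u_i stands second.\<close>

lemma vandermonde_split:
  assumes i: "i \<in> {1..M}"
  shows "\<exists>A. laurent A \<and> (\<forall>u z. A (u(i := z)) = A u) \<and>
    (\<forall>u. vandermonde M u = A u * (\<Prod>j\<in>{1..M}-{i}. u i - u j))"
proof -
  define P where "P = (SIGMA i:{1..M}. {i<..M})"
  define R where "R = {p\<in>P. fst p \<noteq> i \<and> snd p \<noteq> i}"
  define A where "A u = (\<Prod>j\<in>{1..<i}. (-1)) * (\<Prod>(a,b)\<in>R. u a - u b)" for u :: "nat \<Rightarrow> complex"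
  have fin: "finite P" "finite R" by (auto simp: P_def R_def)
  have "laurent A" unfolding A_def case_prod_unfold by (auto intro!: laurent_mult laurent_const laurent_prod laurent_diff laurent_coord)
  moreover have "A (u(i := z)) = A u" for u z
    unfolding A_def by (intro arg_cong2[of _ _ _ _ "(*)"] prod.cong) (auto simp: R_def)
  moreover have "vandermonde M u = A u * (\<Prod>j\<in>{1..M}-{i}. u i - u j)" for u
  proof -
    have P: "P = R \<union> ((\<lambda>b. (i, b)) ` {i<..M} \<union> (\<lambda>a. (a, i)) ` {1..<i})"
      using i by (auto simp: P_def R_def)
    have "vandermonde M u = (\<Prod>(a,b)\<in>R. u a - u b) * ((\<Prod>(a,b)\<in>(\<lambda>b. (i, b)) ` {i<..M}. u a - u b) *
        (\<Prod>(a,b)\<in>(\<lambda>a. (a, i)) ` {1..<i}. u a - u b))"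
      unfolding vandermonde_pairs P_def[symmetric]
      by (subst P, subst prod.union_disjoint, (use fin in \<open>auto simp: R_def\<close>)[3],
          subst prod.union_disjoint, auto)
    also have "(\<Prod>(a,b)\<in>(\<lambda>b. (i, b)) ` {i<..M}. u a - u b) = (\<Prod>j\<in>{i<..M}. u i - u j)"
      by (subst prod.reindex) (auto simp: inj_on_def)
    also have "(\<Prod>(a,b)\<in>(\<lambda>a. (a, i)) ` {1..<i}. u a - u b) = (\<Prod>j\<in>{1..<i}. (-1) * (u i - u j))"
      by (subst prod.reindex) (auto simp: inj_on_def)
    also have "\<dots> = (\<Prod>j\<in>{1..<i}. (-1)) * (\<Prod>j\<in>{1..<i}. u i - u j)" by (simp only: prod.distrib)
    also have "(\<Prod>(a,b)\<in>R. u a - u b) * ((\<Prod>j\<in>{i<..M}. u i - u j) * ((\<Prod>j\<in>{1..<i}. (-1)) * (\<Prod>j\<in>{1..<i}. u i - u j)))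
      = A u * ((\<Prod>j\<in>{i<..M}. u i - u j) * (\<Prod>j\<in>{1..<i}. u i - u j))"
      by (simp add: A_def mult_ac)
    also have "(\<Prod>j\<in>{i<..M}. u i - u j) * (\<Prod>j\<in>{1..<i}. u i - u j) = (\<Prod>j\<in>{1..M}-{i}. u i - u j)"
      using i by (subst prod.union_disjoint[symmetric]) (auto intro!: prod.cong)
    finally show ?thesis .
  qed
  ultimately show ?thesis by blast
qed

text \<open>The determinant form already has the sign rule, so no inversions have to be
  counted.\<close>

lemma vandermonde_permute:
  assumes "\<pi> permutes {1..M}" "\<And>i. i \<in> {1..M} \<Longrightarrow> u i \<noteq> 0"
  shows "vandermonde M (\<lambda>i. u (\<pi> i)) = of_int (sign \<pi>) * vandermonde M u"
proof -
  have "u (\<pi> i) \<noteq> 0" if "i \<in> {1..M}" for i using that assms(2) permutes_in_image[OF assms(1), of i] by blast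
  then have "vandermonde M (\<lambda>i. u (\<pi> i)) = detN M (\<lambda>i j. u (\<pi> i) powi (int M - int j))"
    by (rule vandermonde_eq_detN)
  also have "\<dots> = of_int (sign \<pi>) * detN M (\<lambda>i j. u i powi (int M - int j))"
    by (rule detN_permute_rows[OF assms(1), of "\<lambda>i j. u i powi (int M - int j)"])
  also have "detN M (\<lambda>i j. u i powi (int M - int j)) = vandermonde M u"
    by (rule vandermonde_eq_detN[symmetric]) (rule assms(2))
  finally show ?thesis .
qed

lemma eventually_perturb_inj:
  "eventually (\<lambda>t. inj_on (perturb M of_nat u t) {1..M}) (at 0)"
proof -
  have "eventually (\<lambda>t. \<forall>p\<in>(SIGMA i:{1..M}. {1..M}-{i}). perturb M of_nat u t (fst p) \<noteq> perturb M of_nat u t (snd p)) (at 0)"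
  proof (intro eventually_ball_finite ballI)
    fix p assume p: "p \<in> (SIGMA i:{1..M}. {1..M}-{i})"
    then have "of_nat (fst p) \<noteq> (of_nat (snd p) :: complex)" by auto
    from perturb_noteq[OF this, of u] show "eventually (\<lambda>t. perturb M of_nat u t (fst p) \<noteq> perturb M of_nat u t (snd p)) (at 0)"
      using p by (auto simp: perturb_def)
  qed auto
  then show ?thesis by eventually_elim (force simp: inj_on_def)
qed

text \<open>Multiplied by the Vandermonde product the sum becomes a Laurent polynomial. The sum is
  symmetric and the Vandermonde product alternating, so this numerator is alternating, vanishes
  whenever two of the variables agree, and is divisible by all differences. This removes the
  singularity on the diagonal.\<close>

lemma laurent_symmetrized_quotient:
  assumes laurent: "\<And>i. i \<in> {1..M} \<Longrightarrow> laurent (h i)"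
    and sym: "\<And>a b i u. a \<in> {1..M} \<Longrightarrow> b \<in> {1..M} \<Longrightarrow> i \<in> {1..M} \<Longrightarrow> u \<in> nzpt \<Longrightarrow>
      h i (\<lambda>j. u (Transposition.transpose a b j)) = h (Transposition.transpose a b i) u"
  shows "\<exists>\<Phi>. laurent \<Phi> \<and> (\<forall>u\<in>nzpt. inj_on u {1..M} \<longrightarrow>
     \<Phi> u = (\<Sum>i\<in>{1..M}. h i u / (\<Prod>j\<in>{1..M}-{i}. u i - u j)))"
proof -
  have "\<forall>i\<in>{1..M}. \<exists>A. laurent A \<and> (\<forall>u. vandermonde M u = A u * (\<Prod>j\<in>{1..M}-{i}. u i - u j))"
    using vandermonde_split[of _ M] by blast
  then obtain A where "\<forall>i\<in>{1..M}. laurent (A i) \<and> (\<forall>u. vandermonde M u = A i u * (\<Prod>j\<in>{1..M}-{i}. u i - u j))"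
    by (rule bchoice[THEN exE])
  then have A: "\<And>i. i \<in> {1..M} \<Longrightarrow> laurent (A i)"
    "\<And>i u. i \<in> {1..M} \<Longrightarrow> vandermonde M u = A i u * (\<Prod>j\<in>{1..M}-{i}. u i - u j)" by blast+
  define R where "R u = (\<Sum>i\<in>{1..M}. h i u / (\<Prod>j\<in>{1..M}-{i}. u i - u j))" for u
  define num where "num u = (\<Sum>i\<in>{1..M}. h i u * A i u)" for u
  have laurent_num: "laurent num" unfolding num_def by (intro laurent_sum laurent_mult laurent A(1))
  have num: "num u = vandermonde M u * R u" if "inj_on u {1..M}" for u
    unfolding num_def R_def sum_distrib_left
  proof (rule sum.cong[OF refl])
    fix i assume i: "i \<in> {1..M}"
    have "u i - u j \<noteq> 0" if "j \<in> {1..M}-{i}" for j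
      using inj_onD[OF \<open>inj_on u {1..M}\<close>, of i j] i that by auto
    then have "(\<Prod>j\<in>{1..M}-{i}. u i - u j) \<noteq> 0" by simp
    then show "h i u * A i u = vandermonde M u * (h i u / (\<Prod>j\<in>{1..M}-{i}. u i - u j))"
      by (simp add: A(2)[OF i, of u])
  qed
  have van: "num u = 0" if ab: "a \<in> {1..M}" "b \<in> {1..M}" "a \<noteq> b" and u: "u \<in> nzpt" "u a = u b" for a b u
  proof -
    let ?\<tau> = "Transposition.transpose a b"
    let ?v = "perturb M of_nat u"
    have \<tau>: "?\<tau> permutes {1..M}" using ab by (intro permutes_swap_id)
    have anti: "num (\<lambda>j. v (?\<tau> j)) = - num v" if v: "v \<in> nzpt" "inj_on v {1..M}" for v
    proof -
      have R: "R (\<lambda>j. v (?\<tau> j)) = R v"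
      proof -
        have "R (\<lambda>j. v (?\<tau> j)) = (\<Sum>i\<in>{1..M}. h (?\<tau> i) v / (\<Prod>j\<in>{1..M}-{?\<tau> i}. v (?\<tau> i) - v j))"
          unfolding R_def
        proof (intro sum.cong refl arg_cong2[of _ _ _ _ "(/)"] sym ab v(1))
          fix i assume i: "i \<in> {1..M}"
          show "(\<Prod>j\<in>{1..M}-{i}. v (?\<tau> i) - v (?\<tau> j)) = (\<Prod>j\<in>{1..M}-{?\<tau> i}. v (?\<tau> i) - v j)"
          proof (rule prod.reindex_bij_betw[where h = ?\<tau>])
            show "bij_betw ?\<tau> ({1..M} - {i}) ({1..M} - {?\<tau> i})"
              using bij_betw_DiffI[of ?\<tau> "{1..M}" "{1..M}" "{i}" "{?\<tau> i}"] permutes_imp_bij[OF \<tau>] i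
                permutes_in_image[OF \<tau>, of i] by (auto simp: bij_betw_def)
          qed
        qed
        also have "\<dots> = R v"
          unfolding R_def
          by (rule sum.reindex_bij_betw[OF permutes_imp_bij[OF \<tau>],
               of "\<lambda>i. h i v / (\<Prod>j\<in>{1..M}-{i}. v i - v j)"])
        finally show ?thesis .
      qed
      have inj: "inj_on (\<lambda>j. v (?\<tau> j)) {1..M}"
        using comp_inj_on[of ?\<tau> "{1..M}" v] permutes_inj_on[OF \<tau>] permutes_image[OF \<tau>] v(2)
        by (simp add: o_def)
      have "vandermonde M (\<lambda>j. v (?\<tau> j)) = - vandermonde M v"
        using vandermonde_permute[OF \<tau>, of v] v(1) ab by (simp add: nzpt_def sign_swap_id)
      then show ?thesis using num[OF inj] num[OF v(2)] R by simp
    qed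
    \<comment> \<open>Antisymmetry is available at points with distinct coordinates and is carried
      to \<open>u\<close> by continuity. There the transposition acts trivially, so the numerator
      equals its own negative.\<close>
    have "eventually (\<lambda>t. num (\<lambda>j. ?v t (?\<tau> j)) = - num (?v t)) (at 0)"
      using eventually_perturb_inj perturb_in_nzpt[OF u(1)] by eventually_elim (rule anti)
    moreover have "((\<lambda>t. num (\<lambda>j. ?v t (?\<tau> j))) \<longlongrightarrow> num (\<lambda>j. u (?\<tau> j))) (at 0)"
      by (rule perturb_laurent_tendsto[OF laurent_relabel[OF laurent_num] u(1)])
    ultimately have "((\<lambda>t. - num (?v t)) \<longlongrightarrow> num (\<lambda>j. u (?\<tau> j))) (at 0)"
      by (rule Lim_transform_eventually[rotated])
    moreover have "((\<lambda>t. - num (?v t)) \<longlongrightarrow> - num u) (at 0)"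
      by (intro tendsto_minus perturb_laurent_tendsto laurent_num u)
    ultimately have "num (\<lambda>j. u (?\<tau> j)) = - num u" by (rule tendsto_unique[OF at_neq_bot])
    moreover have "(\<lambda>j. u (?\<tau> j)) = u" using u(2) by (auto simp: Transposition.transpose_def)
    ultimately show ?thesis by simp
  qed
  have "\<exists>g. laurent g \<and> (\<forall>u\<in>nzpt. num u = (\<Prod>(a,b)\<in>(SIGMA i:{1..M}. {i<..M}). u a - u b) * g u)"
  proof (rule laurent_divide_pairs)
    fix a b u assume "(a, b) \<in> (SIGMA i:{1..M}. {i<..M})" "u \<in> nzpt" "u a = u b"
    then show "num u = 0" by (intro van[of a b]) auto
  qed (use laurent_num in auto)
  then obtain g where g: "laurent g" "\<forall>u\<in>nzpt. num u = vandermonde M u * g u"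
    unfolding vandermonde_pairs by blast
  have "g u = R u" if "u \<in> nzpt" "inj_on u {1..M}" for u
    using g(2) num[of u] that vandermonde_nz_iff[of M u] by auto
  then show ?thesis using g(1) unfolding R_def by blast
qed

section \<open>Schur functions and uniform convergence of the generating function\<close>

definition particle :: "nat \<Rightarrow> (nat \<Rightarrow> int) \<Rightarrow> nat \<Rightarrow> int" where
  "particle N l j = l j + int N - int j"

lemma particle_strict_dec:
  assumes "l \<in> sig N" "1 \<le> i" "i < j" "j \<le> N"
  shows "particle N l j < particle N l i"
proof -
  have "l j \<le> l i" using assms by (auto simp: sig_def)
  then show ?thesis using assms by (simp add: particle_def)
qed

lemma laurent_schurP: "laurent (schurP n x)"
proof (induction n arbitrary: x)
  case 0
  have "schurP 0 x = (\<lambda>u. 1)" by auto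
  then show ?case by (simp add: laurent_const)
next
  case (Suc n)
  have "schurP (Suc n) x = (\<lambda>u. \<Sum>y\<in>interlace n x.
     u (Suc n) powi (sum x {1..Suc n} - sum y {1..n} - int n) * schurP n y u)" by (rule ext) simp
  then show ?case using Suc by (auto intro!: laurent_sum laurent_mult laurent_powi)
qed

text \<open>The sum over patterns singles out an order of the variables, so symmetry is not visible.
  At distinct coordinates it is a ratio of two alternating determinants; continuity does the
  rest.\<close>

lemma schurP_permute:
  assumes x: "\<And>j. j \<in> {1..<n} \<Longrightarrow> x (Suc j) < x j" and \<pi>: "\<pi> permutes {1..n}" and u: "u \<in> nzpt"
  shows "schurP n x (\<lambda>i. u (\<pi> i)) = schurP n x u"
proof -
  let ?v = "perturb n of_nat u"
  have inj_eq: "schurP n x (\<lambda>i. v (\<pi> i)) = schurP n x v" if v: "v \<in> nzpt" "inj_on v {1..n}" for v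
  proof -
    have "of_int (sign \<pi>) * (vandermonde n v * schurP n x (\<lambda>i. v (\<pi> i))) =
        vandermonde n (\<lambda>i. v (\<pi> i)) * schurP n x (\<lambda>i. v (\<pi> i))"
      using vandermonde_permute[OF \<pi>, of v] v by (simp add: nzpt_def)
    also have "\<dots> = detN n (\<lambda>i j. v (\<pi> i) powi x j)"
      by (rule detN_eq_vandermonde_schurP[symmetric]) (use x v in \<open>auto simp: nzpt_def\<close>)
    also have "\<dots> = of_int (sign \<pi>) * detN n (\<lambda>i j. v i powi x j)"
      by (rule detN_permute_rows[OF \<pi>, of "\<lambda>i j. v i powi x j"])
    also have "\<dots> = of_int (sign \<pi>) * (vandermonde n v * schurP n x v)"
      by (subst detN_eq_vandermonde_schurP) (use x v in \<open>auto simp: nzpt_def\<close>)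
    finally show ?thesis using vandermonde_nz_iff[of n v] v by (auto simp: sign_def split: if_splits)
  qed
  have "eventually (\<lambda>t. schurP n x (\<lambda>i. ?v t (\<pi> i)) = schurP n x (?v t)) (at 0)"
    using eventually_perturb_inj perturb_in_nzpt[OF u] by eventually_elim (rule inj_eq)
  moreover have "((\<lambda>t. schurP n x (\<lambda>i. ?v t (\<pi> i))) \<longlongrightarrow> schurP n x (\<lambda>i. u (\<pi> i))) (at 0)"
    by (rule perturb_laurent_tendsto[OF laurent_relabel[OF laurent_schurP] u])
  ultimately have "((\<lambda>t. schurP n x (?v t)) \<longlongrightarrow> schurP n x (\<lambda>i. u (\<pi> i))) (at 0)"
    by (rule Lim_transform_eventually[rotated])
  then show ?thesis
    using perturb_laurent_tendsto[OF laurent_schurP u, of n x n of_nat] by (rule tendsto_unique[OF at_neq_bot])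
qed

lemma coord_tendsto: "((\<lambda>v. v i) \<longlongrightarrow> u i) (at (u :: nat \<Rightarrow> complex) within S)"
proof -
  have "continuous_on UNIV (\<lambda>v :: nat \<Rightarrow> complex. v i)" by simp
  then have "((\<lambda>v. v i) \<longlongrightarrow> u i) (at u within UNIV)" by (auto simp: continuous_on_def)
  then show ?thesis by (rule tendsto_within_subset) auto
qed

text \<open>\<open>schur\<close> is a limit over points with distinct nonzero coordinates, where the
  ratio equals the continuous \<open>schurP\<close>. The limit is determined only because the filter
  is nontrivial, which takes up the second half of the proof.\<close>

lemma schur_eq_schurP:
  assumes l: "l \<in> sig N" and u: "u \<in> nzpt"
  shows "schur N l u = schurP N (particle N l) u"
proof -
  define S where "S = {v :: nat \<Rightarrow> complex. inj_on v {1..N} \<and> (\<forall>i\<in>{1..N}. v i \<noteq> 0)}"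
  have dec: "particle N l (Suc j) < particle N l j" if "j \<in> {1..<N}" for j
    using that by (intro particle_strict_dec[OF l]) auto
  have ratio: "schur_ratio N l v = schurP N (particle N l) v" if "v \<in> S" for v
  proof -
    have "detN N (\<lambda>i j. v i powi (l j + int N - int j)) = vandermonde N v * schurP N (particle N l) v"
      unfolding particle_def[symmetric] by (rule detN_eq_vandermonde_schurP) (use that dec in \<open>auto simp: S_def\<close>)
    then show ?thesis using that vandermonde_nz_iff[of N v] by (simp add: schur_ratio_def S_def)
  qed
  have "(schurP N (particle N l) \<longlongrightarrow> schurP N (particle N l) u) (at u within S)"
    using laurent_tendsto[OF laurent_schurP u, of "\<lambda>v. v" "at u within S"] coord_tendsto by blast
  then have lim: "(schur_ratio N l \<longlongrightarrow> schurP N (particle N l) u) (at u within S)"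
    by (rule Lim_transform_eventually) (auto simp: eventually_at_filter ratio)
  have "at u within S \<noteq> bot"
  proof
    assume bot: "at u within S = bot"
    \<comment> \<open>Letter \<open>Suc N\<close> moves as well: this keeps the perturbed point
      different from \<open>u\<close> also for \<open>N = 0\<close>, where \<open>S\<close> imposes
      no condition.\<close>
    let ?v = "perturb (Suc N) of_nat u"
    have "continuous_on UNIV ?v"
    proof (rule continuous_on_coordinatewise_then_product)
      fix i show "continuous_on UNIV (\<lambda>t. ?v t i)"
        by (cases "i \<le> Suc N") (auto simp: perturb_def intro!: continuous_intros)
    qed
    then have "(?v \<longlongrightarrow> ?v 0) (at 0)" by (auto simp: continuous_on_def)
    moreover have "?v 0 = u" by (auto simp: perturb_def)
    ultimately have t: "(?v \<longlongrightarrow> u) (at 0)" by simp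
    have "eventually (\<lambda>t. ?v t \<in> S \<and> ?v t \<noteq> u) (at 0)"
      using eventually_perturb_inj[of "Suc N" u] perturb_in_nzpt[OF u, of "Suc N" of_nat] eventually_neq_at_within[of 0 0 UNIV]
    proof eventually_elim
      case (elim t)
      have "?v t (Suc N) \<noteq> u (Suc N)" using elim(3) of_nat_neq_0[of N, where 'a = complex] by (simp add: perturb_def del: of_nat_Suc)
      moreover have "inj_on (?v t) {1..N}" using elim(1) by (rule inj_on_subset) auto
      ultimately show ?case using elim(2) by (auto simp: S_def nzpt_def)
    qed
    then have "filterlim ?v (at u within S) (at 0)" using t by (auto simp: filterlim_at)
    then have "filterlim ?v bot (at (0::complex))" by (simp only: bot)
    then show False by (simp add: filterlim_def filtermap_bot_iff bot_unique)
  qed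
  then show ?thesis unfolding schur_def S_def[symmetric] using lim by (rule tendsto_Lim)
qed

text \<open>Laurent polynomials with nonnegative coefficients: on a polyannulus their modulus is
  dominated by their values at the corners of a real box.\<close>

inductive pos_laurent :: "nat \<Rightarrow> ((nat \<Rightarrow> complex) \<Rightarrow> complex) \<Rightarrow> bool" for n where
  pos_laurent_0: "pos_laurent n (\<lambda>u. 0)"
| pos_laurent_add_monom: "pos_laurent n f \<Longrightarrow> pos_laurent n (\<lambda>u. (\<Prod>i\<in>{1..n}. u i powi e i) + f u)"

lemma pos_laurent_add: "pos_laurent n f \<Longrightarrow> pos_laurent n g \<Longrightarrow> pos_laurent n (\<lambda>u. f u + g u)"
proof (induction rule: pos_laurent.induct)
  case (pos_laurent_add_monom f e)
  show ?case unfolding add.assoc using pos_laurent.pos_laurent_add_monom[OF pos_laurent_add_monom.IH[OF pos_laurent_add_monom.prems]] .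
qed simp

lemma pos_laurent_sum: "(\<And>i. i \<in> A \<Longrightarrow> pos_laurent n (f i)) \<Longrightarrow> pos_laurent n (\<lambda>u. \<Sum>i\<in>A. f i u)"
  by (induction A rule: infinite_finite_induct) (auto intro: pos_laurent_0 pos_laurent_add)

lemma pos_laurent_mult_last: "pos_laurent n f \<Longrightarrow> pos_laurent (Suc n) (\<lambda>u. u (Suc n) powi m * f u)"
proof (induction rule: pos_laurent.induct)
  case pos_laurent_0
  then show ?case by (auto intro: pos_laurent.pos_laurent_0)
next
  case (pos_laurent_add_monom f e)
  have eq: "(\<lambda>u :: nat \<Rightarrow> complex. u (Suc n) powi m * ((\<Prod>i\<in>{1..n}. u i powi e i) + f u)) =
    (\<lambda>u. (\<Prod>i\<in>{1..Suc n}. u i powi (e(Suc n := m)) i) + u (Suc n) powi m * f u)"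
    by (rule ext) (simp add: prod.nat_ivl_Suc' algebra_simps)
  show ?case unfolding eq by (rule pos_laurent.pos_laurent_add_monom[OF pos_laurent_add_monom.IH])
qed

lemma pos_laurent_schurP: "pos_laurent n (schurP n x)"
proof (induction n arbitrary: x)
  case 0
  have "schurP 0 x = (\<lambda>u. (\<Prod>i\<in>{1..0}. u i powi 0) + 0)" by auto
  then show ?case using pos_laurent_add_monom[OF pos_laurent_0, of 0 "\<lambda>_. 0"] by simp
next
  case (Suc n)
  have "schurP (Suc n) x = (\<lambda>u. \<Sum>y\<in>interlace n x.
     u (Suc n) powi (sum x {1..Suc n} - sum y {1..n} - int n) * schurP n y u)" by (rule ext) simp
  then show ?case using Suc by (auto intro!: pos_laurent_sum pos_laurent_mult_last)
qed

definition corner :: "nat \<Rightarrow> (nat \<Rightarrow> real) \<Rightarrow> nat \<Rightarrow> complex" where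
  "corner r c = (\<lambda>i. if i \<in> {1..r} then of_real (c i) else 1)"

lemma powi_between:
  fixes a b t :: real
  assumes "0 < a" "a \<le> t" "t \<le> b"
  shows "t powi e \<le> a powi e + b powi e"
proof (cases "e \<ge> 0")
  case True
  then have "t powi e \<le> b powi e" using assms by (simp add: power_int_def power_mono)
  moreover have "0 \<le> a powi e" using assms by simp
  ultimately show ?thesis by linarith
next
  case False
  then have "t powi e \<le> a powi e" using assms
    by (simp add: power_int_def power_mono le_imp_inverse_le)
  moreover have "0 \<le> b powi e" using assms by simp
  ultimately show ?thesis by linarith
qed

text \<open>On [a, b] a power t^e is at most a^e + b^e, whatever the sign of e. Each monomial is
  thus bounded by a product of such sums, and multiplying out gives one summand per corner.
  Coordinates beyond \<open>r\<close> equal 1, so the number of corners depends on \<open>r\<close>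
  only and not on \<open>n\<close>.\<close>

lemma pos_laurent_bound:
  assumes "pos_laurent n f" "r \<le> n" "0 < a" "a \<le> b"
    and u: "\<And>i. i \<in> {1..r} \<Longrightarrow> a \<le> cmod (u i) \<and> cmod (u i) \<le> b" "\<And>i. i \<notin> {1..r} \<Longrightarrow> u i = 1"
  shows "cmod (f u) \<le> (\<Sum>c\<in>Pi\<^sub>E {1..r} (\<lambda>_. {a, b}). cmod (f (corner r c)))"
proof -
  let ?C = "Pi\<^sub>E {1..r} (\<lambda>_. {a, b})"
  have fin: "finite ?C" by (rule finite_PiE) auto
  have "cmod (f u) \<le> (\<Sum>c\<in>?C. Re (f (corner r c))) \<and> (\<forall>c\<in>?C. f (corner r c) \<in> \<real> \<and> 0 \<le> Re (f (corner r c)))"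
    using assms(1)
  proof (induction rule: pos_laurent.induct)
    case (pos_laurent_add_monom f e)
    have sub: "{1..r} \<subseteq> {1..n}" using assms(2) by auto
    have restr: "(\<Prod>i\<in>{1..n}. v i powi e i) = (\<Prod>i\<in>{1..r}. v i powi e i)"
      if "\<And>i. i \<notin> {1..r} \<Longrightarrow> v i = 1" for v :: "nat \<Rightarrow> complex"
      using that by (intro prod.mono_neutral_right[OF _ sub]) auto
    have mon: "(\<Prod>i\<in>{1..n}. corner r c i powi e i) = of_real (\<Prod>i\<in>{1..r}. c i powi e i)" for c
      by (subst restr) (auto simp: corner_def)
    have pos: "0 \<le> (\<Prod>i\<in>{1..r}. c i powi e i)" if "c \<in> ?C" for c
    proof (rule prod_nonneg)
      fix i assume "i \<in> {1..r}"
      then have "c i = a \<or> c i = b" using that by (auto simp: PiE_iff)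
      then show "0 \<le> c i powi e i" using assms(3,4) by auto
    qed
    have "cmod (\<Prod>i\<in>{1..n}. u i powi e i) = (\<Prod>i\<in>{1..r}. cmod (u i) powi e i)"
      by (subst restr) (use u(2) in \<open>auto simp: prod_norm[symmetric] norm_power_int\<close>)
    also have "\<dots> \<le> (\<Prod>i\<in>{1..r}. \<Sum>y\<in>{a,b}. y powi e i) + (\<Prod>i\<in>{1..r}. \<Sum>y\<in>{a,b}. y powi e i) * 0"
    proof -
      have "cmod (u i) powi e i \<le> (\<Sum>y\<in>{a,b}. y powi e i)" if "i \<in> {1..r}" for i
      proof (cases "a = b")
        case True
        then have "cmod (u i) = b" using u(1)[OF that] by simp
        then show ?thesis using True by simp
      next
        case False
        then show ?thesis using powi_between[of a "cmod (u i)" b "e i"] u(1)[OF that] assms(3) by simp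
      qed
      then have "(\<Prod>i\<in>{1..r}. cmod (u i) powi e i) \<le> (\<Prod>i\<in>{1..r}. \<Sum>y\<in>{a,b}. y powi e i)"
        by (intro prod_mono) auto
      then show ?thesis by simp
    qed
    also have "\<dots> = (\<Sum>c\<in>?C. \<Prod>i\<in>{1..r}. c i powi e i)"
      by (subst prod_sum_PiE) auto
    finally have m: "cmod (\<Prod>i\<in>{1..n}. u i powi e i) \<le> (\<Sum>c\<in>?C. \<Prod>i\<in>{1..r}. c i powi e i)" .
    have "cmod ((\<Prod>i\<in>{1..n}. u i powi e i) + f u) \<le>
        (\<Sum>c\<in>?C. \<Prod>i\<in>{1..r}. c i powi e i) + (\<Sum>c\<in>?C. Re (f (corner r c)))"
      using m pos_laurent_add_monom.IH norm_triangle_ineq[of "\<Prod>i\<in>{1..n}. u i powi e i" "f u"] by linarith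
    also have "\<dots> = (\<Sum>c\<in>?C. Re ((\<Prod>i\<in>{1..n}. corner r c i powi e i) + f (corner r c)))"
      by (simp only: mon plus_complex.sel Re_complex_of_real sum.distrib)
    finally have "cmod ((\<Prod>i\<in>{1..n}. u i powi e i) + f u) \<le>
      (\<Sum>c\<in>?C. Re ((\<Prod>i\<in>{1..n}. corner r c i powi e i) + f (corner r c)))" .
    moreover have "(\<Prod>i\<in>{1..n}. corner r c i powi e i) + f (corner r c) \<in> \<real> \<and>
        0 \<le> Re ((\<Prod>i\<in>{1..n}. corner r c i powi e i) + f (corner r c))" if c: "c \<in> ?C" for c
      using pos_laurent_add_monom.IH c pos[OF c] unfolding mon
      by (intro conjI Reals_add Reals_of_real) (auto simp del: of_real_prod)
    ultimately show ?case by blast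
  qed auto
  moreover have "Re (f (corner r c)) \<le> cmod (f (corner r c))" for c by (rule complex_Re_le_cmod)
  ultimately show ?thesis by (meson sum_mono order_trans)
qed

definition norm_schur :: "nat \<Rightarrow> (nat \<Rightarrow> int) \<Rightarrow> (nat \<Rightarrow> complex) \<Rightarrow> complex" where
  "norm_schur N l u = schurP N (particle N l) u / schurP N (particle N l) ones"

lemma ones_nzpt: "ones \<in> nzpt" by (simp add: ones_def nzpt_def)

lemma schurP_ones_nz: "l \<in> sig N \<Longrightarrow> schurP N (particle N l) ones \<noteq> 0"
  using schurP_nz_ones[of N "particle N l"] particle_strict_dec[of l N] by (fastforce simp: complex_eq_iff)

lemma sgf_term_eq: "l \<in> sig N \<Longrightarrow> u \<in> nzpt \<Longrightarrow> sgf_term N \<rho> l u = of_real (pmf \<rho> l) * norm_schur N l u"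
  by (simp add: sgf_term_def norm_schur_def schur_eq_schurP ones_nzpt)

lemma laurent_norm_schur: "laurent (norm_schur N l)"
proof -
  have "norm_schur N l = (\<lambda>u. inverse (schurP N (particle N l) ones) * schurP N (particle N l) u)"
    by (rule ext) (simp add: norm_schur_def field_simps)
  then show ?thesis by (simp only: laurent_mult laurent_const laurent_schurP)
qed

lemma nbhd_r_nzpt: "u \<in> nbhd_r r d \<Longrightarrow> d \<le> 1 \<Longrightarrow> u \<in> nzpt"
proof (clarsimp simp: nzpt_def)
  fix i assume u: "u \<in> nbhd_r r d" "d \<le> 1" "u i = 0"
  then have "u i = 1" if "i \<notin> {1..r}" using that by (simp add: nbhd_r_def)
  moreover have "cmod (u i - 1) < d" if "i \<in> {1..r}" using that u(1) unfolding nbhd_r_def by blast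
  ultimately show False using u(2,3) by (cases "i \<in> {1..r}") auto
qed

lemma summable_on_finite_sum:
  fixes f :: "'a \<Rightarrow> 'b \<Rightarrow> real"
  assumes "\<And>c. c \<in> C \<Longrightarrow> f c summable_on A"
  shows "(\<lambda>l. \<Sum>c\<in>C. f c l) summable_on A"
  using assms by (induction C rule: infinite_finite_induct) (auto intro!: summable_on_add)

text \<open>Nonvanishing is the source of convergence: \<open>infsum\<close> is 0 for a divergent
  family, so \<open>sgf \<noteq> 0\<close> at a point means summability there. The corners with
  coordinates 1 - d' and 1 + d' lie in the larger neighbourhood, and by positivity of the
  coefficients their terms dominate those on the whole smaller one; the Weierstrass test
  applies.\<close>

lemma sgf_uniform_limit:
  assumes r: "r \<le> N" and d: "d > 0" and nz: "\<And>u. u \<in> nbhd_r r d \<Longrightarrow> sgf N \<rho> u \<noteq> 0"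
    and d': "0 < d'" "d' < d" "d' < 1"
  shows "uniform_limit (nbhd_r r d') (\<lambda>F u. \<Sum>l\<in>F. sgf_term N \<rho> l u) (sgf N \<rho>) (finite_subsets_at_top (sig N))"
proof -
  define a b where "a = 1 - d'" and "b = 1 + d'"
  have ab: "0 < a" "a \<le> b" using d' by (auto simp: a_def b_def)
  let ?C = "Pi\<^sub>E {1..r} (\<lambda>_. {a, b})"
  have corner: "corner r c \<in> nbhd_r r d \<and> corner r c \<in> nzpt" if c: "c \<in> ?C" for c
  proof -
    have "c i = a \<or> c i = b" if "i \<in> {1..r}" for i using c that by (auto simp: PiE_iff)
    then have *: "cmod (of_real (c i) - 1) = d' \<and> c i \<noteq> 0" if "i \<in> {1..r}" for i
    proof -
      have "cmod (of_real (c i) - 1) = \<bar>c i - 1\<bar>" by (metis norm_of_real of_real_1 of_real_diff)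
      then show ?thesis using \<open>\<And>i. i \<in> {1..r} \<Longrightarrow> c i = a \<or> c i = b\<close>[OF that] d' by (auto simp: a_def b_def)
    qed
    then show ?thesis using d' by (auto simp: corner_def nbhd_r_def nzpt_def)
  qed
  define M where "M l = (\<Sum>c\<in>?C. cmod (sgf_term N \<rho> l (corner r c)))" for l
  have "M summable_on sig N" unfolding M_def
  proof (rule summable_on_finite_sum)
    fix c assume c: "c \<in> ?C"
    have "sgf N \<rho> (corner r c) \<noteq> 0" using nz corner[OF c] by blast
    then have "(\<lambda>l. sgf_term N \<rho> l (corner r c)) summable_on sig N"
      unfolding sgf_def using infsum_not_exists by blast
    then show "(\<lambda>l. cmod (sgf_term N \<rho> l (corner r c))) summable_on sig N"
      by (simp add: summable_on_iff_abs_summable_on_complex)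
  qed
  moreover have "cmod (sgf_term N \<rho> l u) \<le> M l" if l: "l \<in> sig N" and u: "u \<in> nbhd_r r d'" for l u
  proof -
    have "a \<le> cmod (u i) \<and> cmod (u i) \<le> b" if "i \<in> {1..r}" for i
    proof -
      have "cmod (u i - 1) < d'" using u that by (auto simp: nbhd_r_def)
      then show ?thesis using norm_triangle_ineq3[of "u i" 1] by (auto simp: a_def b_def)
    qed
    then have "cmod (schurP N (particle N l) u) \<le> (\<Sum>c\<in>?C. cmod (schurP N (particle N l) (corner r c)))"
      by (intro pos_laurent_bound[OF pos_laurent_schurP r ab]) (use u in \<open>auto simp: nbhd_r_def\<close>)
    then have "pmf \<rho> l * (cmod (schurP N (particle N l) u) / cmod (schurP N (particle N l) ones)) \<le>
       pmf \<rho> l * ((\<Sum>c\<in>?C. cmod (schurP N (particle N l) (corner r c))) / cmod (schurP N (particle N l) ones))"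
      by (intro mult_left_mono divide_right_mono) auto
    also have "\<dots> = M l"
      unfolding M_def sum_divide_distrib sum_distrib_left
      by (intro sum.cong refl) (use corner l in \<open>auto simp: sgf_term_eq norm_schur_def norm_mult norm_divide\<close>)
    finally show ?thesis
      using nbhd_r_nzpt[OF u] d' l by (simp add: sgf_term_eq norm_schur_def norm_mult norm_divide)
  qed
  ultimately show ?thesis unfolding sgf_def
    by (intro Weierstrass_m_test_general[where M = M]) auto
qed

section \<open>Symmetrised quotients at the diagonal\<close>

text \<open>The remainder is of order (c - 1)^(k+1) and c - 1 is of order t, so at least one power
  of c - 1 is left after division by t^m.\<close>

lemma taylor_remainder_tendsto:
  fixes \<phi> :: "complex \<Rightarrow> complex"
  assumes \<phi>: "\<phi> holomorphic_on ball 1 s" and s: "s > 0" and m: "m \<le> k"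
    and c1: "(c \<longlongrightarrow> 1) (at 0)" and ca: "((\<lambda>t. (c t - 1) / t) \<longlongrightarrow> a) (at (0::complex))"
  shows "((\<lambda>t. (\<phi> (c t) - (\<Sum>n\<le>k. (deriv ^^ n) \<phi> 1 * (c t - 1) ^ n / fact n)) / t ^ m) \<longlongrightarrow> 0) (at 0)"
proof -
  have "continuous_on (cball 1 (s/2)) ((deriv ^^ Suc k) \<phi>)"
    by (rule holomorphic_on_imp_continuous_on, rule holomorphic_on_subset[OF holomorphic_higher_deriv[OF \<phi>]])
       (use s in auto)
  then have "bounded ((deriv ^^ Suc k) \<phi> ` cball 1 (s/2))"
    by (intro compact_imp_bounded compact_continuous_image) auto
  then obtain B where B: "\<And>x. x \<in> cball 1 (s/2) \<Longrightarrow> cmod ((deriv ^^ Suc k) \<phi> x) \<le> B"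
    unfolding bounded_iff by blast
  have bound: "cmod (\<phi> z - (\<Sum>n\<le>k. (deriv ^^ n) \<phi> 1 * (z - 1) ^ n / fact n)) \<le> B * cmod (z - 1) ^ Suc k / fact k"
    if z: "z \<in> cball 1 (s/2)" for z
  proof -
    have "((deriv ^^ i) \<phi> has_field_derivative (deriv ^^ Suc i) \<phi> x) (at x within cball 1 (s/2))"
      if "x \<in> cball 1 (s/2)" for i x
      using has_field_derivative_higher_deriv[OF \<phi>, of x i] that s
      by (auto intro: has_field_derivative_at_within)
    then show ?thesis
      using complex_Taylor[of "cball 1 (s/2)" k "\<lambda>i. (deriv ^^ i) \<phi>" B 1 z] B s z by simp
  qed
  have ev: "eventually (\<lambda>t. c t \<in> cball 1 (s/2)) (at 0)"
    using tendstoD[OF c1, of "s/2"] s by (auto elim!: eventually_mono simp: dist_commute)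
  have "((\<lambda>t. B / fact k * (cmod ((c t - 1) / t) ^ m * cmod (c t - 1) ^ (Suc k - m))) \<longlongrightarrow>
     B / fact k * (cmod a ^ m * cmod (1 - 1) ^ (Suc k - m))) (at 0)"
    by (intro tendsto_intros ca c1)
  then have lim: "((\<lambda>t. B / fact k * (cmod ((c t - 1) / t) ^ m * cmod (c t - 1) ^ (Suc k - m))) \<longlongrightarrow> 0) (at 0)"
    using m by (simp add: power_0_left)
  show ?thesis
  proof (rule Lim_null_comparison[OF _ lim])
    show "eventually (\<lambda>t. norm ((\<phi> (c t) - (\<Sum>n\<le>k. (deriv ^^ n) \<phi> 1 * (c t - 1) ^ n / fact n)) / t ^ m)
      \<le> B / fact k * (cmod ((c t - 1) / t) ^ m * cmod (c t - 1) ^ (Suc k - m))) (at 0)"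
      using ev eventually_neq_at_within[of 0 0 UNIV]
    proof eventually_elim
      case (elim t)
      have "Suc k = m + (Suc k - m)" using m by simp
      then have "cmod (c t - 1) ^ Suc k = cmod (c t - 1) ^ m * cmod (c t - 1) ^ (Suc k - m)"
        by (metis power_add)
      then show ?case
        using divide_right_mono[OF bound[OF elim(1)], of "cmod t ^ m"]
        by (simp add: norm_divide norm_power power_divide field_simps del: power_Suc)
    qed
  qed
qed

text \<open>What the Leibniz rule leaves on a set \<open>I\<close> of variables: if \<open>I\<close>
  has m + 1 elements, then m derivatives have hit the Vandermonde product, producing the
  denominator, and \<open>p = k - m\<close> have hit \<open>f\<close>.\<close>

definition symq :: "(complex \<Rightarrow> complex) \<Rightarrow> nat \<Rightarrow> nat \<Rightarrow> ((nat \<Rightarrow> complex) \<Rightarrow> complex) \<Rightarrow> nat set \<Rightarrow> (nat \<Rightarrow> complex) \<Rightarrow> complex" where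
  "symq \<phi> k p f I u = (\<Sum>i\<in>I. \<phi> (u i) * u i ^ k * pd p i f u / (\<Prod>j\<in>I-{i}. u i - u j))"

definition symN :: "nat \<Rightarrow> ((nat \<Rightarrow> complex) \<Rightarrow> complex) \<Rightarrow> bool" where
  "symN N f \<longleftrightarrow> (\<forall>\<pi> u. \<pi> permutes {1..N} \<longrightarrow> u \<in> nzpt \<longrightarrow> f (\<lambda>i. u (\<pi> i)) = f u)"

lemma symN_norm_schur: "l \<in> sig N \<Longrightarrow> symN N (norm_schur N l)"
  unfolding symN_def norm_schur_def
  by (auto intro!: arg_cong2[of _ _ _ _ "(/)"] schurP_permute particle_strict_dec)

lemma pd_permute:
  assumes f: "symN N f" and \<pi>: "\<pi> permutes {1..N}" and u: "u \<in> nzpt"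
  shows "pd p i f (\<lambda>j. u (\<pi> j)) = pd p (\<pi> i) f u"
proof -
  have eq: "f ((\<lambda>j. u (\<pi> j))(i := z)) = f (u(\<pi> i := z))" if "z \<noteq> 0" for z
  proof -
    have "(\<lambda>j. u (\<pi> j))(i := z) = (\<lambda>j. (u(\<pi> i := z)) (\<pi> j))"
      using permutes_inj[OF \<pi>] by (auto simp: fun_eq_iff inj_eq)
    then show ?thesis using f \<pi> u that unfolding symN_def by (simp del: fun_upd_apply)
  qed
  have "eventually (\<lambda>z. f ((\<lambda>j. u (\<pi> j))(i := z)) = f (u(\<pi> i := z))) (nhds (u (\<pi> i)))"
  proof (rule eventually_mono)
    show "eventually (\<lambda>z. z \<in> - {0}) (nhds (u (\<pi> i)))"
      using u by (intro eventually_nhds_in_open) (auto simp: nzpt_def open_Compl)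
  qed (use eq in auto)
  then show ?thesis unfolding pd_def by (intro higher_deriv_cong_ev) auto
qed

lemma symq_permute:
  assumes f: "symN N f" and \<pi>: "\<pi> permutes {1..N}" and u: "u \<in> nzpt"
  shows "symq \<phi> k p f I (\<lambda>j. u (\<pi> j)) = symq \<phi> k p f (\<pi> ` I) u"
proof -
  have inj: "inj_on \<pi> A" for A using permutes_inj[OF \<pi>] by (rule inj_on_subset) auto
  have "(\<Prod>j\<in>\<pi> ` I - {\<pi> i}. u (\<pi> i) - u j) = (\<Prod>j\<in>I-{i}. u (\<pi> i) - u (\<pi> j))" for i
  proof -
    have "\<pi> ` I - {\<pi> i} = \<pi> ` (I - {i})" using permutes_inj[OF \<pi>] by (auto simp: inj_eq)
    then show ?thesis by (simp add: prod.reindex[OF inj])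
  qed
  then show ?thesis
    unfolding symq_def by (simp add: sum.reindex[OF inj] pd_permute[OF f \<pi> u])
qed

text \<open>Curves through \<open>1\<^sup>N\<close> at \<open>t = 0\<close> with pairwise distinct velocities: along all of them the
  symmetrised quotients have the same limit.\<close>

definition gcurve :: "nat \<Rightarrow> (complex \<Rightarrow> nat \<Rightarrow> complex) \<Rightarrow> bool" where
  "gcurve M c \<longleftrightarrow> (\<forall>i. ((\<lambda>t. c t i) \<longlongrightarrow> 1) (at 0)) \<and> eventually (\<lambda>t. c t \<in> nzpt) (at 0) \<and>
     (\<exists>a. inj_on a {1..M} \<and> (\<forall>i\<in>{1..M}. ((\<lambda>t. (c t i - 1) / t) \<longlongrightarrow> a i) (at 0)))"

lemma gcurve_diff:
  assumes "((\<lambda>t. (c t i - 1) / t) \<longlongrightarrow> a i) (at (0::complex))" "((\<lambda>t. (c t j - 1) / t) \<longlongrightarrow> a j) (at 0)"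
  shows "((\<lambda>t. (c t i - c t j) / t) \<longlongrightarrow> a i - a (j::nat)) (at 0)"
  using tendsto_diff[OF assms] by (simp add: diff_divide_distrib[symmetric])

lemma gcurve_inj:
  assumes "gcurve M c"
  shows "eventually (\<lambda>t. inj_on (c t) {1..M}) (at 0)"
proof -
  obtain a where a: "inj_on a {1..M}" "\<And>i. i \<in> {1..M} \<Longrightarrow> ((\<lambda>t. (c t i - 1) / t) \<longlongrightarrow> a i) (at 0)"
    using assms by (auto simp: gcurve_def)
  have "eventually (\<lambda>t. \<forall>p\<in>(SIGMA i:{1..M}. {1..M}-{i}). c t (fst p) \<noteq> c t (snd p)) (at 0)"
  proof (intro eventually_ball_finite ballI)
    fix p assume p: "p \<in> (SIGMA i:{1..M}. {1..M}-{i})"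
    have "a (fst p) - a (snd p) \<noteq> 0" using p a(1) by (auto simp: inj_on_eq_iff)
    moreover have "((\<lambda>t. (c t (fst p) - c t (snd p)) / t) \<longlongrightarrow> a (fst p) - a (snd p)) (at 0)"
      using p by (intro gcurve_diff a) auto
    ultimately have "eventually (\<lambda>t. (c t (fst p) - c t (snd p)) / t \<noteq> 0) (at 0)"
      by (intro tendsto_imp_eventually_ne)
    then show "eventually (\<lambda>t. c t (fst p) \<noteq> c t (snd p)) (at 0)" by eventually_elim auto
  qed auto
  then show ?thesis by eventually_elim (force simp: inj_on_def)
qed

text \<open>A holomorphic \<open>\<phi>\<close> is outside the Laurent polynomials, so it is
  replaced by its Taylor polynomial \<open>T\<close> of degree k. The part with \<open>T\<close> has
  a removable singularity and is continuous at 1^N. The error is o(t^(M-1)) because M - 1 <= k,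
  which beats the M - 1 denominators, each of exact order t since the velocities differ. Neither
  limit depends on the curve.\<close>

lemma symq_limit_exists:
  assumes f: "laurent f" "symN N f" and \<phi>: "\<phi> holomorphic_on ball 1 s" and s: "s > 0"
    and M: "M \<le> N" "M \<le> Suc k"
  shows "\<exists>L. \<forall>c. gcurve M c \<longrightarrow> ((\<lambda>t. symq \<phi> k p f {1..M} (c t)) \<longlongrightarrow> L) (at 0)"
proof -
  define T where "T z = (\<Sum>n\<le>k. (deriv ^^ n) \<phi> 1 * (z - 1) ^ n / fact n)" for z
  have "\<forall>i. \<exists>g. laurent g \<and> (\<forall>u\<in>nzpt. pd p i f u = g u)" using laurent_pd[OF f(1)] by blast
  then obtain g where g: "\<And>i. laurent (g i)" "\<And>i u. u \<in> nzpt \<Longrightarrow> pd p i f u = g i u" by metis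
  define h where "h i u = T (u i) * u i ^ k * g i u" for i u
  have lpT: "laurent (\<lambda>u. T (u i))" for i
    unfolding T_def by (auto intro!: laurent_sum laurent_mult laurent_const laurent_power laurent_diff laurent_coord simp: divide_inverse)
  have lph: "laurent (h i)" for i unfolding h_def by (intro laurent_mult lpT laurent_power laurent_coord g)
  obtain \<Phi> where \<Phi>: "laurent \<Phi>" "\<And>u. u \<in> nzpt \<Longrightarrow> inj_on u {1..M} \<Longrightarrow>
     \<Phi> u = (\<Sum>i\<in>{1..M}. h i u / (\<Prod>j\<in>{1..M}-{i}. u i - u j))"
  proof -
    have "h i (\<lambda>j. u (Transposition.transpose a b j)) = h (Transposition.transpose a b i) u"
      if ab: "a \<in> {1..M}" "b \<in> {1..M}" and u: "u \<in> nzpt" for a b i u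
    proof -
      have "Transposition.transpose a b permutes {1..N}" using ab M by (intro permutes_swap_id) auto
      from pd_permute[OF f(2) this u] show ?thesis
        using u nzpt_relabel[OF u] by (simp add: h_def g(2)[symmetric])
    qed
    then show ?thesis using laurent_symmetrized_quotient[of M h] lph that by blast
  qed
  have "((\<lambda>t. symq \<phi> k p f {1..M} (c t)) \<longlongrightarrow> \<Phi> ones) (at 0)" if c: "gcurve M c" for c
  proof -
    obtain a where a: "inj_on a {1..M}" "\<And>i. i \<in> {1..M} \<Longrightarrow> ((\<lambda>t. (c t i - 1) / t) \<longlongrightarrow> a i) (at 0)"
      using c by (auto simp: gcurve_def)
    have c1: "((\<lambda>t. c t i) \<longlongrightarrow> 1) (at 0)" for i using c by (auto simp: gcurve_def)
    have cnz: "eventually (\<lambda>t. c t \<in> nzpt) (at 0)" using c by (auto simp: gcurve_def)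
    have "((\<lambda>t. \<Phi> (c t)) \<longlongrightarrow> \<Phi> ones) (at 0)"
      by (rule laurent_tendsto[OF \<Phi>(1) ones_nzpt]) (simp add: ones_def c1)
    moreover have "((\<lambda>t. \<Sum>i\<in>{1..M}. ((\<phi> (c t i) - T (c t i)) / t ^ (M-1)) * (c t i ^ k * g i (c t)) /
        (\<Prod>j\<in>{1..M}-{i}. (c t i - c t j) / t)) \<longlongrightarrow>
        (\<Sum>i\<in>{1..M}. 0 * (1 ^ k * g i ones) / (\<Prod>j\<in>{1..M}-{i}. a i - a j))) (at 0)"
    proof (intro tendsto_sum tendsto_divide tendsto_mult tendsto_power tendsto_prod)
      fix i assume i: "i \<in> {1..M}"
      show "((\<lambda>t. (\<phi> (c t i) - T (c t i)) / t ^ (M-1)) \<longlongrightarrow> 0) (at 0)"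
        unfolding T_def by (rule taylor_remainder_tendsto[OF \<phi> s _ c1 a(2)[OF i]]) (use M in simp)
      show "((\<lambda>t. c t i) \<longlongrightarrow> 1) (at 0)" by (rule c1)
      show "((\<lambda>t. g i (c t)) \<longlongrightarrow> g i ones) (at 0)"
        by (rule laurent_tendsto[OF g(1) ones_nzpt]) (simp add: ones_def c1)
      show "((\<lambda>t. (c t i - c t j) / t) \<longlongrightarrow> a i - a j) (at 0)" if "j \<in> {1..M}-{i}" for j
        using i that by (intro gcurve_diff a) auto
      show "(\<Prod>j\<in>{1..M}-{i}. a i - a j) \<noteq> 0" using a(1) i by (auto simp: inj_on_eq_iff)
    qed
    ultimately have lim: "((\<lambda>t. \<Phi> (c t) + (\<Sum>i\<in>{1..M}. ((\<phi> (c t i) - T (c t i)) / t ^ (M-1)) * (c t i ^ k * g i (c t)) /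
        (\<Prod>j\<in>{1..M}-{i}. (c t i - c t j) / t))) \<longlongrightarrow> \<Phi> ones) (at 0)"
      using tendsto_add by force
    show ?thesis
    proof (rule Lim_transform_eventually[OF lim])
      show "eventually (\<lambda>t. \<Phi> (c t) + (\<Sum>i\<in>{1..M}. ((\<phi> (c t i) - T (c t i)) / t ^ (M-1)) * (c t i ^ k * g i (c t)) /
        (\<Prod>j\<in>{1..M}-{i}. (c t i - c t j) / t)) = symq \<phi> k p f {1..M} (c t)) (at 0)"
        using cnz gcurve_inj[OF c] eventually_neq_at_within[of 0 0 UNIV]
      proof eventually_elim
        case (elim t)
        have "(\<phi> (c t i) - T (c t i)) / t ^ (M-1) * (c t i ^ k * g i (c t)) / (\<Prod>j\<in>{1..M}-{i}. (c t i - c t j) / t)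
          = \<phi> (c t i) * c t i ^ k * pd p i f (c t) / (\<Prod>j\<in>{1..M}-{i}. c t i - c t j)
            - h i (c t) / (\<Prod>j\<in>{1..M}-{i}. c t i - c t j)" if i: "i \<in> {1..M}" for i
        proof -
          have "(\<Prod>j\<in>{1..M}-{i}. (c t i - c t j) / t) = (\<Prod>j\<in>{1..M}-{i}. c t i - c t j) / t ^ (M - 1)"
            using i by (simp add: prod_dividef)
          then show ?thesis using elim(3) by (simp add: h_def g(2)[OF elim(1)] diff_divide_distrib algebra_simps)
        qed
        then show ?case unfolding symq_def \<Phi>(2)[OF elim(1,2)] by (simp add: sum_subtractf)
      qed
    qed
  qed
  then show ?thesis by blast
qed

definition expc :: "complex \<Rightarrow> nat \<Rightarrow> complex" where
  "expc t = (\<lambda>i. exp (of_nat i * t))"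

definition linc :: "nat \<Rightarrow> complex \<Rightarrow> nat \<Rightarrow> complex" where
  "linc r t = (\<lambda>i. if i \<in> {1..r} then 1 + of_nat i * t else 1)"

lemma exp_quotient_tendsto: "((\<lambda>t. (exp (a * t) - 1) / t) \<longlongrightarrow> (a::complex)) (at 0)"
proof -
  have "((\<lambda>t. exp (a * t)) has_field_derivative exp (a * 0) * a) (at 0)"
    by (auto intro!: derivative_eq_intros)
  then show ?thesis by (simp add: has_field_derivative_iff)
qed

lemma gcurve_expc_permute:
  assumes "\<pi> permutes {1..N}"
  shows "gcurve M (\<lambda>t i. expc t (\<pi> i))"
  unfolding gcurve_def
proof (intro conjI allI exI[of _ "\<lambda>i. of_nat (\<pi> i)"] ballI)
  show "((\<lambda>t. expc t (\<pi> i)) \<longlongrightarrow> 1) (at 0)" for i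
    unfolding expc_def by (rule tendsto_eq_intros refl | simp)+
  show "inj_on (\<lambda>i. of_nat (\<pi> i) :: complex) {1..M}"
    using permutes_inj[OF assms] by (auto simp: inj_on_def)
  show "((\<lambda>t. (expc t (\<pi> i) - 1) / t) \<longlongrightarrow> of_nat (\<pi> i)) (at 0)" for i
    unfolding expc_def by (rule exp_quotient_tendsto)
qed (auto simp: expc_def nzpt_def)

lemma gcurve_linc: "gcurve M (linc M)"
  unfolding gcurve_def
proof (intro conjI allI exI[of _ "of_nat"] ballI)
  show "((\<lambda>t. linc M t i) \<longlongrightarrow> 1) (at 0)" for i
  proof (cases "i \<in> {1..M}")
    case True
    then show ?thesis unfolding linc_def by simp (rule tendsto_eq_intros refl | simp)+
  qed (auto simp: linc_def)
  then have "eventually (\<lambda>t. \<forall>i\<in>{1..M}. linc M t i \<noteq> 0) (at 0)"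
    by (intro eventually_ball_finite ballI tendsto_imp_eventually_ne) auto
  then show "eventually (\<lambda>t. linc M t \<in> nzpt) (at 0)"
    by eventually_elim (auto simp: nzpt_def linc_def)
  show "inj_on (of_nat :: nat \<Rightarrow> complex) {1..M}" by (auto simp: inj_on_def)
  show "((\<lambda>t. (linc M t i - 1) / t) \<longlongrightarrow> of_nat i) (at 0)" if "i \<in> {1..M}" for i
  proof (rule Lim_transform_eventually[OF tendsto_const])
    show "eventually (\<lambda>t. of_nat i = (linc M t i - 1) / t) (at 0)"
      using that by (auto simp: eventually_at_filter linc_def)
  qed
qed

lemma ex_permutes_image:
  assumes "I \<subseteq> {1..N}" "card I = M"
  shows "\<exists>\<pi>. \<pi> permutes {1..N} \<and> \<pi> ` {1..M} = I"
proof -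
  have fin: "finite I" using assms finite_subset by blast
  have M: "M \<le> N" using card_mono[OF _ assms(1)] assms(2) by simp
  obtain f where f: "bij_betw f {1..M} I" using finite_same_card_bij[of "{1..M}" I] fin assms(2) by auto
  have "card ({1..N} - {1..M}) = card ({1..N} - I)"
    using assms M fin by (simp add: card_Diff_subset)
  then obtain g where g: "bij_betw g ({1..N} - {1..M}) ({1..N} - I)"
    using finite_same_card_bij[of "{1..N} - {1..M}" "{1..N} - I"] by auto
  define \<pi> where "\<pi> i = (if i \<in> {1..M} then f i else if i \<in> {1..N} then g i else i)" for i
  have "bij_betw \<pi> ({1..M} \<union> ({1..N} - {1..M})) (I \<union> ({1..N} - I))"
  proof (rule bij_betw_combine)
    show "bij_betw \<pi> {1..M} I" using f by (rule bij_betw_cong[THEN iffD1, rotated]) (simp add: \<pi>_def)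
    show "bij_betw \<pi> ({1..N} - {1..M}) ({1..N} - I)"
      using g by (rule bij_betw_cong[THEN iffD1, rotated]) (auto simp: \<pi>_def)
  qed auto
  moreover have "{1..M} \<union> ({1..N} - {1..M}) = {1..N}" "I \<union> ({1..N} - I) = {1..N}" using M assms by auto
  ultimately have "bij_betw \<pi> {1..N} {1..N}" by simp
  then have "\<pi> permutes {1..N}" using M by (intro bij_imp_permutes) (auto simp: \<pi>_def)
  moreover have "\<pi> ` {1..M} = f ` {1..M}" by (intro image_cong) (auto simp: \<pi>_def)
  ultimately show ?thesis using f by (auto simp: bij_betw_def)
qed

text \<open>The linear curve makes the limit computable by Cauchy's formula; the exponential curve turns
  the determinants into Vandermonde determinants.\<close>

definition symq_lim :: "(complex \<Rightarrow> complex) \<Rightarrow> nat \<Rightarrow> nat \<Rightarrow> ((nat \<Rightarrow> complex) \<Rightarrow> complex) \<Rightarrow> complex" where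
  "symq_lim \<phi> k m f = Lim (at 0) (\<lambda>t. symq \<phi> k (k - m) f {1..Suc m} (linc (Suc m) t))"

text \<open>A permutation moves an arbitrary \<open>I\<close> to \<open>{1..Suc m}\<close>. It turns
  the exponential curve into a relabelled one, which again has distinct velocities, so all
  \<open>I\<close> of the same size share one limit.\<close>

lemma symq_tendsto_symq_lim:
  assumes f: "laurent f" "symN N f" and \<phi>: "\<phi> holomorphic_on ball 1 s" and s: "s > 0"
    and M: "m \<le> k"
  shows "Suc m \<le> N \<Longrightarrow> ((\<lambda>t. symq \<phi> k (k - m) f {1..Suc m} (linc (Suc m) t)) \<longlongrightarrow> symq_lim \<phi> k m f) (at 0)"
    and "I \<subseteq> {1..N} \<Longrightarrow> card I = Suc m \<Longrightarrow> ((\<lambda>t. symq \<phi> k (k - m) f I (expc t)) \<longlongrightarrow> symq_lim \<phi> k m f) (at 0)"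
proof -
  have main: "\<exists>L. \<forall>c. gcurve (Suc m) c \<longrightarrow> ((\<lambda>t. symq \<phi> k (k - m) f {1..Suc m} (c t)) \<longlongrightarrow> L) (at 0)"
    if "Suc m \<le> N"
    by (rule symq_limit_exists[OF f \<phi> s that]) (use M in simp)
  have all: "((\<lambda>t. symq \<phi> k (k - m) f {1..Suc m} (c t)) \<longlongrightarrow> symq_lim \<phi> k m f) (at 0)"
    if N: "Suc m \<le> N" and c: "gcurve (Suc m) c" for c
  proof -
    obtain L where L: "\<And>c. gcurve (Suc m) c \<Longrightarrow> ((\<lambda>t. symq \<phi> k (k - m) f {1..Suc m} (c t)) \<longlongrightarrow> L) (at 0)"
      using main[OF N] by blast
    have "symq_lim \<phi> k m f = L" unfolding symq_lim_def using L[OF gcurve_linc] by (intro tendsto_Lim) auto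
    then show ?thesis using L[OF c] by simp
  qed
  show "Suc m \<le> N \<Longrightarrow> ((\<lambda>t. symq \<phi> k (k - m) f {1..Suc m} (linc (Suc m) t)) \<longlongrightarrow> symq_lim \<phi> k m f) (at 0)"
    by (rule all[OF _ gcurve_linc])
  assume I: "I \<subseteq> {1..N}" "card I = Suc m"
  then have N: "Suc m \<le> N" using card_mono[OF _ I(1)] by simp
  obtain \<pi> where \<pi>: "\<pi> permutes {1..N}" "\<pi> ` {1..Suc m} = I" using ex_permutes_image[OF I] by blast
  have "symq \<phi> k (k - m) f I (expc t) = symq \<phi> k (k - m) f {1..Suc m} (\<lambda>i. expc t (\<pi> i))" for t
    using symq_permute[OF f(2) \<pi>(1), of "expc t" \<phi> k "k-m" "{1..Suc m}"] \<pi>(2)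
    by (simp add: nzpt_def expc_def)
  then show "((\<lambda>t. symq \<phi> k (k - m) f I (expc t)) \<longlongrightarrow> symq_lim \<phi> k m f) (at 0)"
    using all[OF N gcurve_expc_permute[OF \<pi>(1)]] by simp
qed

section \<open>The differential operators on Schur functions\<close>

text \<open>An element together with an m-set avoiding it is the same as an (m+1)-set with a
  distinguished element. This converts the Leibniz expansion, organised by the differentiated
  variable, into symmetric sums over sets.\<close>

lemma sum_subsets_remove:
  assumes "finite A"
  shows "(\<Sum>i\<in>A. \<Sum>J\<in>{J. J \<subseteq> A - {i} \<and> card J = m}. F i J) =
    (\<Sum>I\<in>{I. I \<subseteq> A \<and> card I = Suc m}. \<Sum>i\<in>I. F i (I - {i}))"
proof -
  have fin: "finite {J. J \<subseteq> A - {i} \<and> card J = m}" for i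
    using assms by (auto intro: finite_subset[of _ "Pow A"])
  have fin2: "finite {I. I \<subseteq> A \<and> card I = Suc m}"
    using assms by (auto intro: finite_subset[of _ "Pow A"])
  have finI: "finite I" if "I \<subseteq> A" for I using that assms finite_subset by blast
  have "(\<Sum>i\<in>A. \<Sum>J\<in>{J. J \<subseteq> A - {i} \<and> card J = m}. F i J) =
     (\<Sum>(i,J)\<in>(SIGMA i:A. {J. J \<subseteq> A - {i} \<and> card J = m}). F i J)"
    by (rule sum.Sigma) (use assms fin in auto)
  also have "\<dots> = (\<Sum>(I,i)\<in>(SIGMA I:{I. I \<subseteq> A \<and> card I = Suc m}. I). F i (I - {i}))"
  proof (rule sum.reindex_bij_witness[where i = "\<lambda>(I,i). (i, I - {i})" and j = "\<lambda>(i,J). (insert i J, i)"])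
    fix a assume a: "a \<in> (SIGMA i:A. {J. J \<subseteq> A - {i} \<and> card J = m})"
    obtain i J where iJ: "a = (i, J)" by force
    have "i \<notin> J" "finite J" using a iJ finI[of J] by auto
    then show "(case case a of (i, J) \<Rightarrow> (insert i J, i) of (I, i) \<Rightarrow> (i, I - {i})) = a"
      "(case a of (i, J) \<Rightarrow> (insert i J, i)) \<in> (SIGMA I:{I. I \<subseteq> A \<and> card I = Suc m}. I)"
      "(case case a of (i, J) \<Rightarrow> (insert i J, i) of (I, i) \<Rightarrow> F i (I - {i})) = (case a of (i, J) \<Rightarrow> F i J)"
      using a iJ by auto
  next
    fix b assume b: "b \<in> (SIGMA I:{I. I \<subseteq> A \<and> card I = Suc m}. I)"
    then show "(case case b of (I, i) \<Rightarrow> (i, I - {i}) of (i, J) \<Rightarrow> (insert i J, i)) = b"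
      "(case b of (I, i) \<Rightarrow> (i, I - {i})) \<in> (SIGMA i:A. {J. J \<subseteq> A - {i} \<and> card J = m})"
      using finI by (auto simp: card_Diff_singleton)
  qed
  also have "\<dots> = (\<Sum>I\<in>{I. I \<subseteq> A \<and> card I = Suc m}. \<Sum>i\<in>I. F i (I - {i}))"
    by (rule sum.Sigma[symmetric]) (use fin2 finI in auto)
  finally show ?thesis .
qed

lemma DERIV_prod_linear:
  fixes c :: "nat \<Rightarrow> complex"
  assumes "finite B"
  shows "((\<lambda>z. \<Prod>j\<in>B. z - c j) has_field_derivative (\<Sum>b\<in>B. \<Prod>j\<in>B-{b}. z - c j)) (at z)"
  using assms
proof (induction B rule: finite_induct)
  case (insert a B)
  have "(\<Prod>j\<in>insert a B - {b}. z - c j) = (z - c a) * (\<Prod>j\<in>B-{b}. z - c j)" if "b \<in> B" for b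
  proof -
    have "insert a B - {b} = insert a (B - {b})" using that insert.hyps by auto
    then show ?thesis using insert.hyps by simp
  qed
  then have eq: "(\<Sum>b\<in>insert a B. \<Prod>j\<in>insert a B - {b}. z - c j) =
      (z - c a) * (\<Sum>b\<in>B. \<Prod>j\<in>B-{b}. z - c j) + 1 * (\<Prod>j\<in>B. z - c j)"
    using insert.hyps by (simp add: sum_distrib_left)
  have "((\<lambda>z. z - c a) has_field_derivative 1) (at z)" by (auto intro!: derivative_eq_intros)
  from DERIV_mult'[OF this insert.IH] show ?case
    unfolding eq using insert.hyps by simp
qed simp

text \<open>Each derivative deletes one factor, and a set of m deleted factors arises in m! orders.
  In the induction an (m+1)-set is reached through each of its m + 1 elements as the last one
  deleted.\<close>

lemma higher_deriv_prod_linear: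
  fixes c :: "nat \<Rightarrow> complex"
  assumes A: "finite A"
  shows "(deriv ^^ m) (\<lambda>z. \<Prod>j\<in>A. z - c j) =
    (\<lambda>z. fact m * (\<Sum>J\<in>{J. J \<subseteq> A \<and> card J = m}. \<Prod>j\<in>A-J. z - c j))"
proof (induction m)
  case 0
  have "{J. J \<subseteq> A \<and> card J = 0} = {{}}" using A finite_subset[OF _ A] by auto
  then show ?case by simp
next
  case (Suc m)
  have d1: "((\<lambda>z. \<Prod>j\<in>B. z - c j) has_field_derivative (\<Sum>b\<in>B. \<Prod>j\<in>B-{b}. z - c j)) (at z)"
    if "B \<subseteq> A" for B z using that A finite_subset by (intro DERIV_prod_linear) blast
  have "deriv (\<lambda>z. fact m * (\<Sum>J\<in>{J. J \<subseteq> A \<and> card J = m}. \<Prod>j\<in>A-J. z - c j)) z =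
     fact m * (\<Sum>J\<in>{J. J \<subseteq> A \<and> card J = m}. \<Sum>b\<in>A-J. \<Prod>j\<in>A-J-{b}. z - c j)" for z
    by (intro DERIV_imp_deriv DERIV_cmult DERIV_sum d1) auto
  moreover have "(\<Sum>J\<in>{J. J \<subseteq> A \<and> card J = m}. \<Sum>b\<in>A-J. \<Prod>j\<in>A-J-{b}. z - c j) =
     of_nat (Suc m) * (\<Sum>J\<in>{J. J \<subseteq> A \<and> card J = Suc m}. \<Prod>j\<in>A-J. z - c j)" for z
  proof -
    have fin: "finite {J. J \<subseteq> A \<and> card J = m}" using A by (auto intro: finite_subset[of _ "Pow A"])
    have "(\<Sum>J\<in>{J. J \<subseteq> A \<and> card J = m}. \<Sum>b\<in>A-J. \<Prod>j\<in>A-J-{b}. z - c j) =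
       (\<Sum>J\<in>{J. J \<subseteq> A \<and> card J = m}. \<Sum>b\<in>A. if b \<notin> J then \<Prod>j\<in>A-J-{b}. z - c j else 0)"
      using A by (intro sum.cong refl sum.mono_neutral_cong_left) auto
    also have "\<dots> = (\<Sum>b\<in>A. \<Sum>J\<in>{J. J \<subseteq> A \<and> card J = m}. if b \<notin> J then \<Prod>j\<in>A-J-{b}. z - c j else 0)"
      by (rule sum.swap)
    also have "\<dots> = (\<Sum>b\<in>A. \<Sum>J\<in>{J. J \<subseteq> A - {b} \<and> card J = m}. \<Prod>j\<in>A-J-{b}. z - c j)"
      using fin by (intro sum.cong refl sum.mono_neutral_cong_right) auto
    also have "\<dots> = (\<Sum>I\<in>{I. I \<subseteq> A \<and> card I = Suc m}. \<Sum>i\<in>I. \<Prod>j\<in>A-(I-{i})-{i}. z - c j)"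
      by (rule sum_subsets_remove[OF A])
    also have "\<dots> = (\<Sum>I\<in>{I. I \<subseteq> A \<and> card I = Suc m}. \<Sum>i\<in>I. \<Prod>j\<in>A-I. z - c j)"
      by (intro sum.cong refl prod.cong) auto
    also have "\<dots> = of_nat (Suc m) * (\<Sum>J\<in>{J. J \<subseteq> A \<and> card J = Suc m}. \<Prod>j\<in>A-J. z - c j)"
      unfolding sum_distrib_left by (intro sum.cong refl) auto
    finally show ?thesis .
  qed
  ultimately have "deriv (\<lambda>z. fact m * (\<Sum>J\<in>{J. J \<subseteq> A \<and> card J = m}. \<Prod>j\<in>A-J. z - c j)) z =
     fact (Suc m) * (\<Sum>J\<in>{J. J \<subseteq> A \<and> card J = Suc m}. \<Prod>j\<in>A-J. z - c j)" for z
    by (simp add: algebra_simps)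
  then show ?case by (simp only: funpow.simps o_apply Suc.IH)
qed

text \<open>Deleting m factors of the product and dividing by the whole product leaves the
  reciprocals of the deleted factors.\<close>

lemma pd_vandermonde:
  assumes i: "i \<in> {1..N}" and u: "inj_on u {1..N}"
  shows "pd m i (vandermonde N) u = vandermonde N u * (fact m *
    (\<Sum>J\<in>{J. J \<subseteq> {1..N}-{i} \<and> card J = m}. 1 / (\<Prod>j\<in>J. u i - u j)))"
proof -
  obtain A where A: "\<And>u z. A (u(i := z)) = A u"
    "\<And>u. vandermonde N u = A u * (\<Prod>j\<in>{1..N}-{i}. u i - u j)"
    using vandermonde_split[OF i] by blast
  have "(\<Prod>j\<in>{1..N}-{i}. z - (u(i := z)) j) = (\<Prod>j\<in>{1..N}-{i}. z - u j)" for z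
    by (intro prod.cong) auto
  then have "(\<lambda>z. vandermonde N (u(i := z))) = (\<lambda>z. A u * (\<Prod>j\<in>{1..N}-{i}. z - u j))"
    using A(2)[of "u(i := _)"] A(1) by (simp add: fun_eq_iff)
  then have "pd m i (vandermonde N) u = A u * (deriv ^^ m) (\<lambda>z. \<Prod>j\<in>{1..N}-{i}. z - u j) (u i)"
    unfolding pd_def by (simp only:) (rule higher_deriv_cmult[where A = UNIV], auto intro!: holomorphic_intros)
  also have "\<dots> = A u * (fact m * (\<Sum>J\<in>{J. J \<subseteq> {1..N}-{i} \<and> card J = m}. \<Prod>j\<in>{1..N}-{i}-J. u i - u j))"
    by (subst higher_deriv_prod_linear) auto
  also have "(\<Sum>J\<in>{J. J \<subseteq> {1..N}-{i} \<and> card J = m}. \<Prod>j\<in>{1..N}-{i}-J. u i - u j) =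
    (\<Sum>J\<in>{J. J \<subseteq> {1..N}-{i} \<and> card J = m}. (\<Prod>j\<in>{1..N}-{i}. u i - u j) * (1 / (\<Prod>j\<in>J. u i - u j)))"
  proof (rule sum.cong[OF refl])
    fix J assume J: "J \<in> {J. J \<subseteq> {1..N}-{i} \<and> card J = m}"
    then have "(\<Prod>j\<in>{1..N}-{i}. u i - u j) = (\<Prod>j\<in>{1..N}-{i}-J. u i - u j) * (\<Prod>j\<in>J. u i - u j)"
      by (intro prod.subset_diff) auto
    moreover have "u i - u j \<noteq> 0" if "j \<in> J" for j
      using inj_onD[OF u, of i j] J that i by auto
    moreover have "finite J" using J finite_subset[of J "{1..N}-{i}"] by auto
    ultimately show "(\<Prod>j\<in>{1..N}-{i}-J. u i - u j) = (\<Prod>j\<in>{1..N}-{i}. u i - u j) * (1 / (\<Prod>j\<in>J. u i - u j))"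
      by simp
  qed
  finally show ?thesis using A(2)[of u] by (simp add: sum_distrib_left mult_ac)
qed

text \<open>The derivatives on the Vandermonde product select an m-set J of variables; joining the
  differentiated variable i to it gives the index set of \<open>symq\<close>.\<close>

lemma leibniz_symq:
  assumes u: "u \<in> nzpt" "inj_on u {1..N}" and f: "laurent f"
  shows "(\<Sum>i\<in>{1..N}. \<phi> (u i) * u i ^ k * pd k i (\<lambda>v. vandermonde N v * f v) u) = vandermonde N u *
    (\<Sum>m\<le>k. of_nat (k choose m) * fact m * (\<Sum>I\<in>{I. I \<subseteq> {1..N} \<and> card I = Suc m}. symq \<phi> k (k - m) f I u))"
proof -
  have "pd k i (\<lambda>v. vandermonde N v * f v) u =
     (\<Sum>m\<le>k. of_nat (k choose m) * pd m i (vandermonde N) u * pd (k - m) i f u)" for i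
  proof -
    have "(\<lambda>z. f (u(i := z))) holomorphic_on - {0}"
    proof (rule laurent_holomorphic[OF f])
      show "(\<lambda>z. (u(i := z)) j) holomorphic_on - {0}" for j
        by (cases "j = i") (auto intro!: holomorphic_intros)
    qed (use u(1) in auto)
    moreover have "(\<lambda>z. vandermonde N (u(i := z))) holomorphic_on - {0}"
      unfolding vandermonde_def
    proof (intro holomorphic_on_prod holomorphic_on_diff)
      have "(\<lambda>z. (u(i := z)) j) holomorphic_on - {0}" for j
        by (cases "j = i") (auto intro!: holomorphic_intros)
      then show "(\<lambda>z. (u(i := z)) j) holomorphic_on - {0}" "(\<lambda>z. (u(i := z)) j) holomorphic_on - {0}" for j
        by blast+
    qed
    ultimately show ?thesis unfolding pd_def
      by (subst higher_deriv_mult[where S = "- {0}"]) (use u(1) in \<open>auto simp: nzpt_def open_Compl atMost_atLeast0\<close>)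
  qed
  then have "(\<Sum>i\<in>{1..N}. \<phi> (u i) * u i ^ k * pd k i (\<lambda>v. vandermonde N v * f v) u) =
    (\<Sum>i\<in>{1..N}. \<Sum>m\<le>k. vandermonde N u * (of_nat (k choose m) * fact m *
      (\<Sum>J\<in>{J. J \<subseteq> {1..N}-{i} \<and> card J = m}. \<phi> (u i) * u i ^ k * pd (k - m) i f u / (\<Prod>j\<in>J. u i - u j))))"
    by (intro sum.cong refl) (simp add: pd_vandermonde[OF _ u(2)] sum_distrib_left sum_distrib_right mult_ac)
  also have "\<dots> = (\<Sum>m\<le>k. vandermonde N u * (of_nat (k choose m) * fact m * (\<Sum>i\<in>{1..N}.
      (\<Sum>J\<in>{J. J \<subseteq> {1..N}-{i} \<and> card J = m}. \<phi> (u i) * u i ^ k * pd (k - m) i f u / (\<Prod>j\<in>J. u i - u j)))))"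
    by (subst sum.swap) (simp add: sum_distrib_left)
  also have "\<dots> = (\<Sum>m\<le>k. vandermonde N u * (of_nat (k choose m) * fact m *
      (\<Sum>I\<in>{I. I \<subseteq> {1..N} \<and> card I = Suc m}. symq \<phi> k (k - m) f I u)))"
    unfolding symq_def by (subst sum_subsets_remove) auto
  finally show ?thesis by (simp add: sum_distrib_left)
qed

text \<open>The eigenvalue of z^k (d/dz)^k on the power z^n.\<close>

definition ffall :: "int \<Rightarrow> nat \<Rightarrow> complex" where
  "ffall n k = (\<Prod>a<k. of_int n - of_nat a)"

lemma higher_deriv_sum_powi:
  assumes "z \<noteq> (0::complex)"
  shows "(deriv ^^ k) (\<lambda>z. \<Sum>p\<in>P. C p * z powi n p) z = (\<Sum>p\<in>P. C p * ffall (n p) k * z powi (n p - int k))"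
  using assms
proof (induction k arbitrary: z)
  case 0
  then show ?case by (simp add: ffall_def)
next
  case (Suc k)
  have "((deriv ^^ k) (\<lambda>z. \<Sum>p\<in>P. C p * z powi n p) has_field_derivative
     (\<Sum>p\<in>P. C p * ffall (n p) k * (of_int (n p - int k) * z powi (n p - int k - 1)))) (at z)"
  proof (rule has_field_derivative_transform_within_open)
    show "((\<lambda>z. \<Sum>p\<in>P. C p * ffall (n p) k * z powi (n p - int k)) has_field_derivative
     (\<Sum>p\<in>P. C p * ffall (n p) k * (of_int (n p - int k) * z powi (n p - int k - 1)))) (at z)"
      using Suc.prems by (auto intro!: DERIV_sum derivative_eq_intros)
    show "open (- {0::complex})" by (simp add: open_Compl)
  qed (use Suc in auto)
  then have "(deriv ^^ Suc k) (\<lambda>z. \<Sum>p\<in>P. C p * z powi n p) z =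
     (\<Sum>p\<in>P. C p * ffall (n p) k * (of_int (n p - int k) * z powi (n p - int k - 1)))"
    by (simp add: DERIV_imp_deriv)
  also have "\<dots> = (\<Sum>p\<in>P. C p * ffall (n p) (Suc k) * z powi (n p - int (Suc k)))"
    by (intro sum.cong refl) (simp add: ffall_def algebra_simps)
  finally show ?case .
qed

text \<open>In each term of the determinant u_i occurs in one factor only, so the operator acts on a
  monomial and reproduces it up to its eigenvalue.\<close>

lemma pd_detN_powi:
  assumes i: "i \<in> {1..N}" and u: "u \<in> nzpt"
  shows "u i ^ k * pd k i (\<lambda>v. cst * detN N (\<lambda>i j. v i powi x j)) u =
    (\<Sum>p\<in>{p. p permutes {1..N}}. cst * of_int (sign p) * ffall (x (p i)) k * (\<Prod>i\<in>{1..N}. u i powi x (p i)))"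
proof -
  have nz: "u i \<noteq> 0" using u by (rule nzpt_nz)
  have eq: "cst * detN N (\<lambda>i' j. (u(i := z)) i' powi x j) = (\<Sum>p\<in>{p. p permutes {1..N}}.
      (cst * of_int (sign p) * (\<Prod>i'\<in>{1..N}-{i}. u i' powi x (p i'))) * z powi x (p i))" for z
    unfolding detN_def sum_distrib_left
  proof (rule sum.cong[OF refl])
    fix p
    have "(\<Prod>i'\<in>{1..N}. (u(i := z)) i' powi x (p i')) = z powi x (p i) * (\<Prod>i'\<in>{1..N}-{i}. (u(i := z)) i' powi x (p i'))"
      using i by (subst prod.remove[of _ i]) auto
    also have "(\<Prod>i'\<in>{1..N}-{i}. (u(i := z)) i' powi x (p i')) = (\<Prod>i'\<in>{1..N}-{i}. u i' powi x (p i'))"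
      by (intro prod.cong) auto
    finally show "cst * (of_int (sign p) * (\<Prod>i'\<in>{1..N}. (u(i := z)) i' powi x (p i'))) =
      cst * of_int (sign p) * (\<Prod>i'\<in>{1..N}-{i}. u i' powi x (p i')) * z powi x (p i)" by (simp add: mult_ac)
  qed
  have "u i ^ k * pd k i (\<lambda>v. cst * detN N (\<lambda>i j. v i powi x j)) u =
     u i ^ k * (\<Sum>p\<in>{p. p permutes {1..N}}. (cst * of_int (sign p) * (\<Prod>i'\<in>{1..N}-{i}. u i' powi x (p i'))) *
        ffall (x (p i)) k * u i powi (x (p i) - int k))"
    unfolding pd_def eq using nz by (subst higher_deriv_sum_powi) auto
  also have "\<dots> = (\<Sum>p\<in>{p. p permutes {1..N}}. cst * of_int (sign p) * ffall (x (p i)) k * (\<Prod>i\<in>{1..N}. u i powi x (p i)))"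
    unfolding sum_distrib_left
  proof (rule sum.cong[OF refl])
    fix p
    have "u i ^ k * u i powi (x (p i) - int k) = u i powi x (p i)"
      using nz by (simp add: power_int_diff)
    moreover have "(\<Prod>i\<in>{1..N}. u i powi x (p i)) = u i powi x (p i) * (\<Prod>i'\<in>{1..N}-{i}. u i' powi x (p i'))"
      using i by (subst prod.remove[of _ i]) auto
    ultimately have "(\<Prod>i\<in>{1..N}. u i powi x (p i)) = u i ^ k * u i powi (x (p i) - int k) * (\<Prod>i'\<in>{1..N}-{i}. u i' powi x (p i'))"
      by simp
    then show "u i ^ k * (cst * of_int (sign p) * (\<Prod>i'\<in>{1..N}-{i}. u i' powi x (p i')) *
        ffall (x (p i)) k * u i powi (x (p i) - int k)) =
      cst * of_int (sign p) * ffall (x (p i)) k * (\<Prod>i\<in>{1..N}. u i powi x (p i))" by (simp only: mult_ac)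
  qed
  finally show ?thesis .
qed

text \<open>On the term of a permutation p the i-th summand multiplies by
  \<open>\<phi> (u i)\<close> and by the eigenvalue belonging to the exponent x(p i). Sorted by the
  column j = p i instead of the row i, the weight sits in exactly one column of a
  determinant.\<close>

lemma sum_pd_detN:
  assumes u: "u \<in> nzpt"
  shows "(\<Sum>i\<in>{1..N}. \<phi> (u i) * u i ^ k * pd k i (\<lambda>v. cst * detN N (\<lambda>i j. v i powi x j)) u) =
    (\<Sum>j\<in>{1..N}. ffall (x j) k * (cst * detN N (\<lambda>i j'. (if j' = j then \<phi> (u i) else 1) * u i powi x j')))"
proof -
  let ?P = "{p. p permutes {1..N}}"
  let ?m = "\<lambda>p. \<Prod>i\<in>{1..N}. u i powi x (p i)"
  have "(\<Sum>i\<in>{1..N}. \<phi> (u i) * u i ^ k * pd k i (\<lambda>v. cst * detN N (\<lambda>i j. v i powi x j)) u) =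
     (\<Sum>i\<in>{1..N}. \<Sum>p\<in>?P. \<phi> (u i) * (cst * of_int (sign p) * ffall (x (p i)) k * ?m p))"
    unfolding sum_distrib_left[symmetric] by (intro sum.cong refl) (simp only: mult.assoc pd_detN_powi[OF _ u])
  also have "\<dots> = (\<Sum>p\<in>?P. \<Sum>i\<in>{1..N}. \<phi> (u i) * (cst * of_int (sign p) * ffall (x (p i)) k * ?m p))"
    by (rule sum.swap)
  also have "\<dots> = (\<Sum>p\<in>?P. \<Sum>j\<in>{1..N}. ffall (x j) k * (cst * (of_int (sign p) *
       (\<Prod>i\<in>{1..N}. (if p i = j then \<phi> (u i) else 1) * u i powi x (p i)))))"
  proof (rule sum.cong[OF refl])
    fix p assume "p \<in> ?P"
    then have p: "p permutes {1..N}" by simp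
    have "(\<Sum>i\<in>{1..N}. \<phi> (u i) * (cst * of_int (sign p) * ffall (x (p i)) k * ?m p)) =
      (\<Sum>i\<in>{1..N}. (\<lambda>j. ffall (x j) k * (cst * (of_int (sign p) *
       (\<Prod>i\<in>{1..N}. (if p i = j then \<phi> (u i) else 1) * u i powi x (p i))))) (p i))"
    proof (rule sum.cong[OF refl])
      fix i assume i: "i \<in> {1..N}"
      have "(\<Prod>i'\<in>{1..N}. (if p i' = p i then \<phi> (u i') else 1) * u i' powi x (p i')) = \<phi> (u i) * ?m p"
        using i permutes_inj[OF p] by (simp add: prod.distrib inj_eq)
      then show "\<phi> (u i) * (cst * of_int (sign p) * ffall (x (p i)) k * ?m p) =
        (\<lambda>j. ffall (x j) k * (cst * (of_int (sign p) *
       (\<Prod>i\<in>{1..N}. (if p i = j then \<phi> (u i) else 1) * u i powi x (p i))))) (p i)" by simp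
    qed
    also have "\<dots> = (\<Sum>j\<in>{1..N}. ffall (x j) k * (cst * (of_int (sign p) *
       (\<Prod>i\<in>{1..N}. (if p i = j then \<phi> (u i) else 1) * u i powi x (p i)))))"
      by (rule sum.reindex_bij_betw[OF permutes_imp_bij[OF p]])
    finally show "(\<Sum>i\<in>{1..N}. \<phi> (u i) * (cst * of_int (sign p) * ffall (x (p i)) k * ?m p)) =
      (\<Sum>j\<in>{1..N}. ffall (x j) k * (cst * (of_int (sign p) *
       (\<Prod>i\<in>{1..N}. (if p i = j then \<phi> (u i) else 1) * u i powi x (p i)))))" .
  qed
  also have "\<dots> = (\<Sum>j\<in>{1..N}. \<Sum>p\<in>?P. ffall (x j) k * (cst * (of_int (sign p) *
       (\<Prod>i\<in>{1..N}. (if p i = j then \<phi> (u i) else 1) * u i powi x (p i)))))"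
    by (rule sum.swap)
  also have "\<dots> = (\<Sum>j\<in>{1..N}. ffall (x j) k * (cst * detN N (\<lambda>i j'. (if j' = j then \<phi> (u i) else 1) * u i powi x j')))"
    by (simp add: detN_def sum_distrib_left)
  finally show ?thesis .
qed

text \<open>A Vandermonde determinant with ascending exponents starting at 1, which accounts for a
  sign and for the product of the w_i. The sign \<open>s\<close> depends on \<open>N\<close> only
  and cancels later, so its existence is enough.\<close>

lemma detN_power_cols:
  "\<exists>s. \<forall>w. (\<forall>i\<in>{1..N}. w i \<noteq> 0) \<longrightarrow> detN N (\<lambda>i j. w j ^ i) = s * (\<Prod>i\<in>{1..N}. w i) * vandermonde N w"
proof -
  define \<rho> where "\<rho> j = (if j \<in> {1..N} then Suc N - j else j)" for j
  have "bij_betw \<rho> {1..N} {1..N}"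
    by (rule bij_betwI[of _ _ _ \<rho>]) (auto simp: \<rho>_def)
  then have \<rho>: "\<rho> permutes {1..N}" by (intro bij_imp_permutes) (auto simp: \<rho>_def)
  have "detN N (\<lambda>i j. w j ^ i) = of_int (sign \<rho>) * (\<Prod>i\<in>{1..N}. w i) * vandermonde N w"
    if w: "\<forall>i\<in>{1..N}. w i \<noteq> 0" for w
  proof -
    have "detN N (\<lambda>i j. w j ^ i) = detN N (\<lambda>i j. w i ^ j)" by (rule detN_transpose)
    also have "\<dots> = detN N (\<lambda>i j. w i * w i powi (int N - int (\<rho> j)))"
    proof (rule detN_cong)
      fix i j assume ij: "i \<in> {1..N}" "j \<in> {1..N}"
      then have "int N - int (\<rho> j) = int (j - 1)" by (auto simp: \<rho>_def)
      then have "w i * w i powi (int N - int (\<rho> j)) = w i ^ Suc (j - 1)" by simp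
      then show "w i ^ j = w i * w i powi (int N - int (\<rho> j))" using ij by (simp del: power_Suc)
    qed
    also have "\<dots> = (\<Prod>i\<in>{1..N}. w i) * detN N (\<lambda>i j. w i powi (int N - int (\<rho> j)))"
      by (rule detN_scale_rows)
    also have "detN N (\<lambda>i j. w i powi (int N - int (\<rho> j))) = of_int (sign \<rho>) * vandermonde N w"
      using detN_permute_cols[OF \<rho>, of "\<lambda>i j. w i powi (int N - int j)"] vandermonde_eq_detN[of N w] w by simp
    finally show ?thesis by (simp add: mult_ac)
  qed
  then show ?thesis by blast
qed

text \<open>A factor i in row i of column j is the effect of y_j d/dy_j on y_j^i. The left side is
  therefore an Euler derivative of the ascending Vandermonde determinant, which depends on y_j
  through y_j times the product of all y_j - y_b; the bracket is the logarithmic derivative of that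
  expression, multiplied by y_j.\<close>

lemma detN_log_column:
  assumes j: "j \<in> {1..N}" and y: "\<And>i. y i \<noteq> 0" "inj_on y {1..N}"
  shows "detN N (\<lambda>i j'. (if j' = j then of_nat i else 1) * y j' ^ i) =
    (1 + (\<Sum>b\<in>{1..N}-{j}. y j / (y j - y b))) * detN N (\<lambda>i j. y j ^ i)"
proof -
  let ?P = "{p. p permutes {1..N}}"
  define G where "G z = detN N (\<lambda>i j'. (y(j := z)) j' ^ i)" for z
  let ?r = "\<lambda>p. \<Prod>i\<in>{1..N}-{inv p j}. y (p i) ^ i"
  have pj: "p i \<noteq> j" if "p \<in> ?P" "i \<in> {1..N}-{inv p j}" for p i
    using that permutes_inverses(2)[of p "{1..N}" i] by force
  have G_eq: "G z = (\<Sum>p\<in>?P. of_int (sign p) * (z ^ (inv p j) * ?r p))" for z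
    unfolding G_def detN_col_expand[OF j]
  proof (rule sum.cong[OF refl])
    fix p assume p: "p \<in> ?P"
    have "(\<Prod>i\<in>{1..N}-{inv p j}. (y(j := z)) (p i) ^ i) = ?r p"
      by (intro prod.cong refl) (use pj[OF p] in auto)
    then show "of_int (sign p) * ((y(j := z)) j ^ inv p j * (\<Prod>i\<in>{1..N}-{inv p j}. (y(j := z)) (p i) ^ i)) =
      of_int (sign p) * (z ^ inv p j * ?r p)" by simp
  qed
  have d1: "(G has_field_derivative (\<Sum>p\<in>?P. of_int (sign p) * (of_nat (inv p j) * y j ^ (inv p j - 1) * ?r p))) (at (y j))"
    unfolding G_eq[abs_def] by (auto intro!: DERIV_sum derivative_eq_intros)
  obtain s where s: "\<And>w. (\<forall>i\<in>{1..N}. w i \<noteq> 0) \<Longrightarrow> detN N (\<lambda>i j. w j ^ i) = s * (\<Prod>i\<in>{1..N}. w i) * vandermonde N w"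
    using detN_power_cols by blast
  obtain A where A: "\<And>u z. A (u(j := z)) = A u"
    "\<And>u. vandermonde N u = A u * (\<Prod>b\<in>{1..N}-{j}. u j - u b)"
    using vandermonde_split[OF j] by blast
  define C where "C = s * (\<Prod>i\<in>{1..N}-{j}. y i) * A y"
  have G2: "G z = C * (z * (\<Prod>b\<in>{1..N}-{j}. z - y b))" if "z \<noteq> 0" for z
  proof -
    have "G z = s * (\<Prod>i\<in>{1..N}. (y(j := z)) i) * vandermonde N (y(j := z))"
      unfolding G_def by (rule s) (use y that in auto)
    also have "(\<Prod>i\<in>{1..N}. (y(j := z)) i) = z * (\<Prod>i\<in>{1..N}-{j}. (y(j := z)) i)"
      using j by (subst prod.remove[of _ j]) auto
    also have "(\<Prod>i\<in>{1..N}-{j}. (y(j := z)) i) = (\<Prod>i\<in>{1..N}-{j}. y i)" by (intro prod.cong) auto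
    also have "vandermonde N (y(j := z)) = A y * (\<Prod>b\<in>{1..N}-{j}. z - (y(j := z)) b)"
      using A by simp
    also have "(\<Prod>b\<in>{1..N}-{j}. z - (y(j := z)) b) = (\<Prod>b\<in>{1..N}-{j}. z - y b)" by (intro prod.cong) auto
    finally show ?thesis by (simp add: C_def mult_ac)
  qed
  have nz: "y j - y b \<noteq> 0" if "b \<in> {1..N}-{j}" for b
    using inj_onD[OF y(2), of j b] that j by auto
  have d2: "(G has_field_derivative C * ((\<Prod>b\<in>{1..N}-{j}. y j - y b) * (1 + (\<Sum>b\<in>{1..N}-{j}. y j / (y j - y b))))) (at (y j))"
  proof (rule has_field_derivative_transform_within_open)
    have "((\<lambda>z. \<Prod>b\<in>{1..N}-{j}. z - y b) has_field_derivative (\<Sum>b\<in>{1..N}-{j}. \<Prod>c\<in>{1..N}-{j}-{b}. y j - y c)) (at (y j))"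
      by (rule DERIV_prod_linear) simp
    moreover have "(\<Sum>b\<in>{1..N}-{j}. \<Prod>c\<in>{1..N}-{j}-{b}. y j - y c) =
       (\<Prod>b\<in>{1..N}-{j}. y j - y b) * (\<Sum>b\<in>{1..N}-{j}. 1 / (y j - y b))"
      unfolding sum_distrib_left
    proof (rule sum.cong[OF refl])
      fix b assume b: "b \<in> {1..N}-{j}"
      show "(\<Prod>c\<in>{1..N}-{j}-{b}. y j - y c) = (\<Prod>b\<in>{1..N}-{j}. y j - y b) * (1 / (y j - y b))"
        using nz[OF b] by (subst prod.remove[OF _ b]) auto
    qed
    ultimately have "((\<lambda>z. \<Prod>b\<in>{1..N}-{j}. z - y b) has_field_derivative
       (\<Prod>b\<in>{1..N}-{j}. y j - y b) * (\<Sum>b\<in>{1..N}-{j}. 1 / (y j - y b))) (at (y j))" by simp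
    from DERIV_cmult[OF DERIV_mult[OF DERIV_ident this], of C]
    show "((\<lambda>z. C * (z * (\<Prod>b\<in>{1..N}-{j}. z - y b))) has_field_derivative
       C * ((\<Prod>b\<in>{1..N}-{j}. y j - y b) * (1 + (\<Sum>b\<in>{1..N}-{j}. y j / (y j - y b))))) (at (y j))"
      by (simp add: sum_distrib_left algebra_simps)
    show "open (- {0::complex})" by (simp add: open_Compl)
  qed (use y G2 in auto)
  have "detN N (\<lambda>i j'. (if j' = j then of_nat i else 1) * y j' ^ i) =
     y j * (\<Sum>p\<in>?P. of_int (sign p) * (of_nat (inv p j) * y j ^ (inv p j - 1) * ?r p))"
    unfolding detN_col_expand[OF j] sum_distrib_left
  proof (rule sum.cong[OF refl])
    fix p assume p: "p \<in> ?P"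
    have "inv p j \<in> {1..N}" using p j permutes_in_image[of "inv p" "{1..N}" j] permutes_inv[of p "{1..N}"] by auto
    then have "y j * y j ^ (inv p j - 1) = y j ^ inv p j" by (metis atLeastAtMost_iff power_eq_if not_one_le_zero)
    moreover have "(\<Prod>i\<in>{1..N}-{inv p j}. (if p i = j then of_nat i else 1) * y (p i) ^ i) = ?r p"
      by (intro prod.cong refl) (use pj[OF p] in auto)
    ultimately show "of_int (sign p) * ((if j = j then of_nat (inv p j) else 1) * y j ^ inv p j *
         (\<Prod>i\<in>{1..N}-{inv p j}. (if p i = j then of_nat i else 1) * y (p i) ^ i)) =
       y j * (of_int (sign p) * (of_nat (inv p j) * y j ^ (inv p j - 1) * ?r p))"
      by (simp add: mult_ac)
  qed
  also have "\<dots> = y j * (C * ((\<Prod>b\<in>{1..N}-{j}. y j - y b) * (1 + (\<Sum>b\<in>{1..N}-{j}. y j / (y j - y b)))))"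
    using DERIV_unique[OF d1 d2] by simp
  also have "\<dots> = (1 + (\<Sum>b\<in>{1..N}-{j}. y j / (y j - y b))) * G (y j)"
    using G2[of "y j"] y by (simp add: mult_ac)
  also have "G (y j) = detN N (\<lambda>i j. y j ^ i)" by (simp add: G_def)
  finally show ?thesis .
qed

lemma expc_nzpt: "expc t \<in> nzpt" by (simp add: expc_def nzpt_def)

lemma eventually_expc_inj: "eventually (\<lambda>t. inj_on (expc t) {1..N}) (at 0)"
proof -
  have "gcurve N (\<lambda>t i. expc t (id i))" by (rule gcurve_expc_permute[OF permutes_id])
  from gcurve_inj[OF this] show ?thesis by simp
qed

lemma detN_eq_vandermonde_norm_schur:
  assumes l: "l \<in> sig N" and u: "u \<in> nzpt"
  shows "(1 / schurP N (particle N l) ones) * detN N (\<lambda>i j. u i powi particle N l j) = vandermonde N u * norm_schur N l u"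
proof -
  have "detN N (\<lambda>i j. u i powi particle N l j) = vandermonde N u * schurP N (particle N l) u"
    by (rule detN_eq_vandermonde_schurP) (use u in \<open>auto simp: nzpt_def intro!: particle_strict_dec[OF l]\<close>)
  then show ?thesis by (simp add: norm_schur_def)
qed

lemma norm_schur_ones: "l \<in> sig N \<Longrightarrow> norm_schur N l ones = 1"
  by (simp add: norm_schur_def schurP_ones_nz)

text \<open>The operator is evaluated on the alternant along the exponential curve in two ways:
  column by column, with limit \<open>R\<close> by the hypothesis \<open>W\<close>, and by the
  Leibniz rule, where all (m+1)-sets contribute the same \<open>symq_lim\<close>.\<close>

lemma norm_schur_identity:
  assumes l: "l \<in> sig N" and \<phi>: "\<phi> holomorphic_on ball 1 s" "s > 0"
    and W: "((\<lambda>t. (\<Sum>j\<in>{1..N}. ffall (particle N l j) k * ((1 / schurP N (particle N l) ones) *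
       detN N (\<lambda>i j'. (if j' = j then \<phi> (expc t i) else 1) * expc t i powi particle N l j'))) / vandermonde N (expc t)) \<longlongrightarrow> R) (at 0)"
  shows "R = (\<Sum>m\<le>k. of_nat (k choose m) * fact m * (of_nat (N choose Suc m) * symq_lim \<phi> k m (norm_schur N l)))"
proof -
  let ?f = "norm_schur N l"
  let ?cst = "1 / schurP N (particle N l) ones"
  have sum: "((\<lambda>t. \<Sum>I\<in>{I. I \<subseteq> {1..N} \<and> card I = Suc m}. symq \<phi> k (k - m) ?f I (expc t)) \<longlongrightarrow>
     of_nat (N choose Suc m) * symq_lim \<phi> k m ?f) (at 0)" if m: "m \<le> k" for m
  proof -
    have "((\<lambda>t. \<Sum>I\<in>{I. I \<subseteq> {1..N} \<and> card I = Suc m}. symq \<phi> k (k - m) ?f I (expc t)) \<longlongrightarrow>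
      (\<Sum>I\<in>{I. I \<subseteq> {1..N} \<and> card I = Suc m}. symq_lim \<phi> k m ?f)) (at 0)"
      by (intro tendsto_sum symq_tendsto_symq_lim(2)[OF laurent_norm_schur symN_norm_schur[OF l] \<phi> m]) auto
    then show ?thesis using n_subsets[of "{1..N}" "Suc m"] by simp
  qed
  have lim: "((\<lambda>t. \<Sum>m\<le>k. of_nat (k choose m) * fact m *
      (\<Sum>I\<in>{I. I \<subseteq> {1..N} \<and> card I = Suc m}. symq \<phi> k (k - m) ?f I (expc t))) \<longlongrightarrow>
     (\<Sum>m\<le>k. of_nat (k choose m) * fact m * (of_nat (N choose Suc m) * symq_lim \<phi> k m ?f))) (at 0)"
    by (intro tendsto_intros sum) auto
  have "((\<lambda>t. \<Sum>m\<le>k. of_nat (k choose m) * fact m *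
      (\<Sum>I\<in>{I. I \<subseteq> {1..N} \<and> card I = Suc m}. symq \<phi> k (k - m) ?f I (expc t))) \<longlongrightarrow> R) (at 0)"
  proof (rule Lim_transform_eventually[OF W])
    show "eventually (\<lambda>t. (\<Sum>j\<in>{1..N}. ffall (particle N l j) k * (?cst *
       detN N (\<lambda>i j'. (if j' = j then \<phi> (expc t i) else 1) * expc t i powi particle N l j'))) / vandermonde N (expc t) =
       (\<Sum>m\<le>k. of_nat (k choose m) * fact m *
      (\<Sum>I\<in>{I. I \<subseteq> {1..N} \<and> card I = Suc m}. symq \<phi> k (k - m) ?f I (expc t)))) (at 0)"
      using eventually_expc_inj[of N]
    proof eventually_elim
      case (elim t)
      let ?u = "expc t"
      \<comment> \<open>The two functions agree on \<open>nzpt\<close> only, hence in a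
        neighbourhood of the i-th coordinate when the others are frozen, which is enough for their
        derivatives.\<close>
      have pd_eq: "pd k i (\<lambda>v. ?cst * detN N (\<lambda>i j. v i powi particle N l j)) ?u = pd k i (\<lambda>v. vandermonde N v * ?f v) ?u" for i
      proof -
        have "eventually (\<lambda>z. z \<in> - {0}) (nhds (?u i))"
          using expc_nzpt[of t] by (intro eventually_nhds_in_open) (auto simp: nzpt_def open_Compl)
        then have "eventually (\<lambda>z. ?cst * detN N (\<lambda>i' j. (?u(i := z)) i' powi particle N l j) = vandermonde N (?u(i := z)) * ?f (?u(i := z))) (nhds (?u i))"
        proof eventually_elim
          case (elim z)
          then have "?u(i := z) \<in> nzpt" using expc_nzpt[of t] by (intro nzpt_upd) auto
          then show ?case by (rule detN_eq_vandermonde_norm_schur[OF l])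
        qed
        then show ?thesis unfolding pd_def by (intro higher_deriv_cong_ev) auto
      qed
      have "(\<Sum>j\<in>{1..N}. ffall (particle N l j) k * (?cst *
         detN N (\<lambda>i j'. (if j' = j then \<phi> (?u i) else 1) * ?u i powi particle N l j'))) =
         (\<Sum>i\<in>{1..N}. \<phi> (?u i) * ?u i ^ k * pd k i (\<lambda>v. vandermonde N v * ?f v) ?u)"
        using sum_pd_detN[OF expc_nzpt, of \<phi> t k ?cst N "particle N l"] unfolding pd_eq by simp
      also have "\<dots> = vandermonde N ?u * (\<Sum>m\<le>k. of_nat (k choose m) * fact m *
         (\<Sum>I\<in>{I. I \<subseteq> {1..N} \<and> card I = Suc m}. symq \<phi> k (k - m) ?f I ?u))"
        by (rule leibniz_symq[OF expc_nzpt elim laurent_norm_schur])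
      finally show ?case using vandermonde_nz_iff[of N ?u] elim by simp
    qed
  qed
  then show ?thesis using lim by (rule tendsto_unique[OF at_neq_bot])
qed

lemma norm_schur_expc_tendsto: "l \<in> sig N \<Longrightarrow> ((\<lambda>t. norm_schur N l (expc t)) \<longlongrightarrow> 1) (at 0)"
proof -
  assume l: "l \<in> sig N"
  have "((\<lambda>t. norm_schur N l (expc t)) \<longlongrightarrow> norm_schur N l ones) (at 0)"
  proof (rule laurent_tendsto[OF laurent_norm_schur ones_nzpt])
    show "((\<lambda>t. expc t i) \<longlongrightarrow> ones i) (at 0)" for i
      unfolding expc_def ones_def by (rule tendsto_eq_intros refl | simp)+
  qed
  then show ?thesis using norm_schur_ones[OF l] by simp
qed

text \<open>Weight 1 leaves the determinant unchanged, so the eigenvalue appears for every small t,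
  multiplied by the normalised Schur function, which tends to 1.\<close>

lemma ffall_sum_identity:
  assumes l: "l \<in> sig N"
  shows "(\<Sum>j\<in>{1..N}. ffall (particle N l j) k) =
    (\<Sum>m\<le>k. of_nat (k choose m) * fact m * (of_nat (N choose Suc m) * symq_lim (\<lambda>_. 1) k m (norm_schur N l)))"
proof (rule norm_schur_identity[OF l, of _ 1])
  have "((\<lambda>t. (\<Sum>j\<in>{1..N}. ffall (particle N l j) k) * norm_schur N l (expc t)) \<longlongrightarrow> (\<Sum>j\<in>{1..N}. ffall (particle N l j) k) * 1) (at 0)"
    by (intro tendsto_intros norm_schur_expc_tendsto l)
  then have lim: "((\<lambda>t. (\<Sum>j\<in>{1..N}. ffall (particle N l j) k) * norm_schur N l (expc t)) \<longlongrightarrow> (\<Sum>j\<in>{1..N}. ffall (particle N l j) k)) (at 0)"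
    by simp
  show "((\<lambda>t. (\<Sum>j\<in>{1..N}. ffall (particle N l j) k * ((1 / schurP N (particle N l) ones) *
       detN N (\<lambda>i j'. (if j' = j then (1::complex) else 1) * expc t i powi particle N l j'))) / vandermonde N (expc t)) \<longlongrightarrow> (\<Sum>j\<in>{1..N}. ffall (particle N l j) k)) (at 0)"
  proof (rule Lim_transform_eventually[OF lim])
    show "eventually (\<lambda>t. (\<Sum>j\<in>{1..N}. ffall (particle N l j) k) * norm_schur N l (expc t) = (\<Sum>j\<in>{1..N}. ffall (particle N l j) k * ((1 / schurP N (particle N l) ones) *
       detN N (\<lambda>i j'. (if j' = j then (1::complex) else 1) * expc t i powi particle N l j'))) / vandermonde N (expc t)) (at 0)"
      using eventually_expc_inj[of N]
    proof eventually_elim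
      case (elim t)
      have "(\<Sum>j\<in>{1..N}. ffall (particle N l j) k * ((1 / schurP N (particle N l) ones) *
         detN N (\<lambda>i j'. (if j' = j then (1::complex) else 1) * expc t i powi particle N l j'))) =
         (\<Sum>j\<in>{1..N}. ffall (particle N l j) k * (vandermonde N (expc t) * norm_schur N l (expc t)))"
        unfolding detN_eq_vandermonde_norm_schur[OF l expc_nzpt, of t, symmetric] by (simp only: if_cancel mult_1_left)
      also have "\<dots> = (\<Sum>j\<in>{1..N}. ffall (particle N l j) k) * (vandermonde N (expc t) * norm_schur N l (expc t))"
        by (simp only: sum_distrib_right)
      finally show ?case using vandermonde_nz_iff[of N "expc t"] elim by simp
    qed
  qed
qed auto

lemma exp_diff_quotient_tendsto:
  assumes "(a::complex) \<noteq> b"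
  shows "((\<lambda>t. t * (exp (a * t) / (exp (a * t) - exp (b * t)))) \<longlongrightarrow> 1 / (a - b)) (at 0)"
proof -
  have 1: "((\<lambda>t. (exp (a * t) - 1) / t - (exp (b * t) - 1) / t) \<longlongrightarrow> a - b) (at 0)"
    by (intro tendsto_diff exp_quotient_tendsto)
  have 2: "((\<lambda>t. exp (a * t)) \<longlongrightarrow> 1) (at 0)" by (rule tendsto_eq_intros refl | simp)+
  have "((\<lambda>t. exp (a * t) / ((exp (a * t) - 1) / t - (exp (b * t) - 1) / t)) \<longlongrightarrow> 1 / (a - b)) (at 0)"
    by (rule tendsto_divide[OF 2 1]) (use assms in simp)
  then show ?thesis
  proof (rule Lim_transform_eventually)
    show "eventually (\<lambda>t. exp (a * t) / ((exp (a * t) - 1) / t - (exp (b * t) - 1) / t) =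
      t * (exp (a * t) / (exp (a * t) - exp (b * t)))) (at 0)"
      by (auto simp: eventually_at_filter diff_divide_distrib[symmetric])
  qed
qed

lemma Ln_holomorphic_ball: "Ln holomorphic_on ball 1 1"
proof (rule holomorphic_on_Ln)
  have "z \<notin> \<real>\<^sub>\<le>\<^sub>0" if "z \<in> ball 1 1" for z :: complex
  proof -
    have "\<bar>Re (1 - z)\<bar> < 1" using abs_Re_le_cmod[of "1 - z"] that by (simp add: dist_norm)
    then show ?thesis by (auto simp: complex_nonpos_Reals_iff)
  qed
  then show "ball 1 1 \<inter> \<real>\<^sub>\<le>\<^sub>0 = ({} :: complex set)" by (simp only: disjoint_iff) simp
qed

text \<open>Along u_i = exp(i t) the entry u_i^(x_j) is y_j^i with y_j = exp(x_j t), and Ln u_i = i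
  t. The weighted column is thus t times the column of \<open>detN_log_column\<close>, and t
  y_j/(y_j - y_b) tends to 1/(x_j - x_b).\<close>

lemma ffall_log_identity:
  assumes l: "l \<in> sig N"
  shows "(\<Sum>j\<in>{1..N}. ffall (particle N l j) k * (\<Sum>b\<in>{1..N}-{j}. 1 / (of_int (particle N l j) - of_int (particle N l b)))) =
    (\<Sum>m\<le>k. of_nat (k choose m) * fact m * (of_nat (N choose Suc m) * symq_lim Ln k m (norm_schur N l)))"
    (is "?R = _")
proof (rule norm_schur_identity[OF l, of _ 1])
  let ?x = "\<lambda>j. of_int (particle N l j) :: complex"
  define y where "y t j = exp (?x j * t)" for t j
  have inj_x: "?x j \<noteq> ?x b" if "j \<in> {1..N}" "b \<in> {1..N}-{j}" for j b
    using particle_strict_dec[OF l, of j b] particle_strict_dec[OF l, of b j] that by (cases j b rule: linorder_cases) auto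
  have ev_inj: "eventually (\<lambda>t. inj_on (y t) {1..N}) (at 0)"
  proof -
    have "eventually (\<lambda>t. \<forall>p\<in>(SIGMA i:{1..N}. {1..N}-{i}). y t (fst p) \<noteq> y t (snd p)) (at 0)"
    proof (intro eventually_ball_finite ballI)
      fix p assume p: "p \<in> (SIGMA i:{1..N}. {1..N}-{i})"
      have "((\<lambda>t. (y t (fst p) - 1) / t - (y t (snd p) - 1) / t) \<longlongrightarrow> ?x (fst p) - ?x (snd p)) (at 0)"
        unfolding y_def by (intro tendsto_diff exp_quotient_tendsto)
      moreover have "?x (fst p) - ?x (snd p) \<noteq> 0" using inj_x[of "fst p" "snd p"] p by auto
      ultimately have "eventually (\<lambda>t. (y t (fst p) - 1) / t - (y t (snd p) - 1) / t \<noteq> 0) (at 0)"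
        by (rule tendsto_imp_eventually_ne)
      then show "eventually (\<lambda>t. y t (fst p) \<noteq> y t (snd p)) (at 0)" by eventually_elim auto
    qed auto
    then show ?thesis by eventually_elim (force simp: inj_on_def)
  qed
  \<comment> \<open>For small t the exponents i t stay in the principal strip, so that no multiple
    of 2 pi enters.\<close>
  have ev_Ln: "eventually (\<lambda>t. \<forall>i\<in>{1..N}. Ln (expc t i) = of_nat i * t) (at 0)"
  proof (intro eventually_ball_finite ballI)
    fix i
    have "((\<lambda>t. of_nat i * t) \<longlongrightarrow> of_nat i * 0) (at (0::complex))" by (intro tendsto_intros)
    then have "eventually (\<lambda>t. dist (of_nat i * t) 0 < pi) (at (0::complex))"
      using tendstoD[of "\<lambda>t::complex. of_nat i * t" "of_nat i * 0" "at 0" pi] pi_gt_zero by simp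
    then show "eventually (\<lambda>t. Ln (expc t i) = of_nat i * t) (at 0)"
    proof eventually_elim
      case (elim t)
      then have "\<bar>Im (of_nat i * t)\<bar> < pi" using abs_Im_le_cmod[of "of_nat i * t"] by simp
      then show ?case unfolding expc_def by (intro Ln_exp) auto
    qed
  qed auto
  have "((\<lambda>t. (\<Sum>j\<in>{1..N}. ffall (particle N l j) k * (t + (\<Sum>b\<in>{1..N}-{j}. t * (exp (?x j * t) / (exp (?x j * t) - exp (?x b * t))))))
      * norm_schur N l (expc t)) \<longlongrightarrow> (\<Sum>j\<in>{1..N}. ffall (particle N l j) k * (0 + (\<Sum>b\<in>{1..N}-{j}. 1 / (?x j - ?x b)))) * 1) (at 0)"
    by (intro tendsto_intros norm_schur_expc_tendsto l exp_diff_quotient_tendsto inj_x)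
  then have lim: "((\<lambda>t. (\<Sum>j\<in>{1..N}. ffall (particle N l j) k * (t + (\<Sum>b\<in>{1..N}-{j}. t * (exp (?x j * t) / (exp (?x j * t) - exp (?x b * t))))))
      * norm_schur N l (expc t)) \<longlongrightarrow> ?R) (at 0)" by simp
  show "((\<lambda>t. (\<Sum>j\<in>{1..N}. ffall (particle N l j) k * ((1 / schurP N (particle N l) ones) *
       detN N (\<lambda>i j'. (if j' = j then Ln (expc t i) else 1) * expc t i powi particle N l j'))) / vandermonde N (expc t)) \<longlongrightarrow> ?R) (at 0)"
  proof (rule Lim_transform_eventually[OF lim])
    show "eventually (\<lambda>t. (\<Sum>j\<in>{1..N}. ffall (particle N l j) k * (t + (\<Sum>b\<in>{1..N}-{j}. t * (exp (?x j * t) / (exp (?x j * t) - exp (?x b * t))))))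
      * norm_schur N l (expc t) = (\<Sum>j\<in>{1..N}. ffall (particle N l j) k * ((1 / schurP N (particle N l) ones) *
       detN N (\<lambda>i j'. (if j' = j then Ln (expc t i) else 1) * expc t i powi particle N l j'))) / vandermonde N (expc t)) (at 0)"
      using eventually_expc_inj[of N] ev_inj ev_Ln
    proof eventually_elim
      case (elim t)
      have pw: "expc t i powi particle N l j = y t j ^ i" for i j
      proof -
        have "exp (of_nat i * t) powi n = exp (of_int n * (of_nat i * t))" for n
          using exp_power_int[of "of_nat i * t" n] by simp
        then show ?thesis using exp_of_nat_mult[of i "?x j * t"] by (simp add: expc_def y_def mult_ac)
      qed
      have "detN N (\<lambda>i j'. (if j' = j then Ln (expc t i) else 1) * expc t i powi particle N l j') =
         (t + (\<Sum>b\<in>{1..N}-{j}. t * (y t j / (y t j - y t b)))) * detN N (\<lambda>i j. expc t i powi particle N l j)" if j: "j \<in> {1..N}" for j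
      proof -
        have "detN N (\<lambda>i j'. (if j' = j then Ln (expc t i) else 1) * expc t i powi particle N l j') =
          detN N (\<lambda>i j'. (if j' = j then t else 1) * ((if j' = j then of_nat i else 1) * y t j' ^ i))"
          by (rule detN_cong) (use elim(3) in \<open>auto simp: pw\<close>)
        also have "\<dots> = (\<Prod>j'\<in>{1..N}. if j' = j then t else 1) * detN N (\<lambda>i j'. (if j' = j then of_nat i else 1) * y t j' ^ i)"
          by (rule detN_scale_cols)
        also have "(\<Prod>j'\<in>{1..N}. if j' = j then t else 1) = t" using j by simp
        also have "detN N (\<lambda>i j'. (if j' = j then of_nat i else 1) * y t j' ^ i) =
           (1 + (\<Sum>b\<in>{1..N}-{j}. y t j / (y t j - y t b))) * detN N (\<lambda>i j. y t j ^ i)"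
          by (rule detN_log_column[OF j _ elim(2)]) (simp add: y_def)
        finally show ?thesis by (simp add: pw sum_distrib_left algebra_simps)
      qed
      then have "(\<Sum>j\<in>{1..N}. ffall (particle N l j) k * ((1 / schurP N (particle N l) ones) *
       detN N (\<lambda>i j'. (if j' = j then Ln (expc t i) else 1) * expc t i powi particle N l j'))) =
       (\<Sum>j\<in>{1..N}. ffall (particle N l j) k * (t + (\<Sum>b\<in>{1..N}-{j}. t * (y t j / (y t j - y t b)))) *
         ((1 / schurP N (particle N l) ones) * detN N (\<lambda>i j. expc t i powi particle N l j)))"
        by (intro sum.cong refl) (simp only: mult_ac)
      also have "\<dots> = (\<Sum>j\<in>{1..N}. ffall (particle N l j) k * (t + (\<Sum>b\<in>{1..N}-{j}. t * (y t j / (y t j - y t b))))) *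
         (vandermonde N (expc t) * norm_schur N l (expc t))"
        unfolding detN_eq_vandermonde_norm_schur[OF l expc_nzpt] by (simp only: sum_distrib_right)
      finally show ?case using vandermonde_nz_iff[of N "expc t"] elim(1) by (simp add: y_def)
    qed
  qed
  show "Ln holomorphic_on ball 1 1" by (rule Ln_holomorphic_ball)
qed auto

section \<open>Asymptotics of the expectations\<close>

lemma uniform_limit_bounded_mult:
  fixes c :: "'b \<Rightarrow> complex"
  assumes f: "uniform_limit X f l F" and c: "bounded (c ` X)"
  shows "uniform_limit X (\<lambda>n x. c x * f n x) (\<lambda>x. c x * l x) F"
proof (rule uniform_limitI)
  fix e :: real assume e: "e > 0"
  obtain B where B: "B > 0" "\<And>x. x \<in> X \<Longrightarrow> cmod (c x) \<le> B"
    using c unfolding bounded_pos by blast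
  have "eventually (\<lambda>n. \<forall>x\<in>X. dist (f n x) (l x) < e / B) F"
    using uniform_limitD[OF f, of "e / B"] e B by simp
  then show "eventually (\<lambda>n. \<forall>x\<in>X. dist (c x * f n x) (c x * l x) < e) F"
  proof eventually_elim
    case (elim n)
    show ?case
    proof
      fix x assume x: "x \<in> X"
      have "dist (c x * f n x) (c x * l x) = cmod (c x) * dist (f n x) (l x)"
        by (simp add: dist_norm norm_mult[symmetric] right_diff_distrib)
      also have "\<dots> \<le> B * dist (f n x) (l x)" using B(2)[OF x] by (intro mult_right_mono) auto
      also have "\<dots> < B * (e / B)" using elim x B(1) by (intro mult_strict_left_mono) auto
      finally show "dist (c x * f n x) (c x * l x) < e" using B by simp
    qed
  qed
qed

section \<open>Uniform limits of separately holomorphic functions, and contour integrals\<close>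

lemma holomorphic_on_uniform_limit:
  assumes f: "eventually (\<lambda>n. f n holomorphic_on A) F" and ul: "uniform_limit A f g F"
    and A: "open A" and F: "F \<noteq> bot"
  shows "g holomorphic_on A"
proof -
  have "g field_differentiable at z" if z: "z \<in> A" for z
  proof -
    obtain r where r: "r > 0" "cball z r \<subseteq> A" using A z open_contains_cball by blast
    have "eventually (\<lambda>n. continuous_on (cball z r) (f n) \<and> f n holomorphic_on ball z r) F"
      using f by eventually_elim
        (meson r(2) holomorphic_on_subset ball_subset_cball subset_trans holomorphic_on_imp_continuous_on)
    moreover have "uniform_limit (cball z r) f g F" using ul r(2) by (rule uniform_limit_on_subset)
    ultimately have "g holomorphic_on ball z r" using holomorphic_uniform_limit F by blast
    then show ?thesis using r(1) by (intro holomorphic_on_imp_differentiable_at) auto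
  qed
  then show ?thesis by (auto simp: holomorphic_on_def field_differentiable_at_within)
qed

lemma nbhd_r_upd:
  assumes "u \<in> nbhd_r r d" "i \<in> {1..r}" "cmod (z - 1) < e" "d \<le> e"
  shows "u(i := z) \<in> nbhd_r r e"
  using assms by (fastforce simp: nbhd_r_def)

text \<open>Holomorphy in one letter with the others frozen: the notion that fits \<open>pd\<close>,
  which differentiates in a single letter.\<close>

definition sephol :: "nat \<Rightarrow> real \<Rightarrow> nat \<Rightarrow> ((nat \<Rightarrow> complex) \<Rightarrow> complex) \<Rightarrow> bool" where
  "sephol r d i f \<longleftrightarrow> (\<forall>u\<in>nbhd_r r d. (\<lambda>z. f (u(i := z))) holomorphic_on ball 1 d)"

lemma nbhd_r_mono: "e \<le> d \<Longrightarrow> nbhd_r r e \<subseteq> nbhd_r r d"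
  by (force simp: nbhd_r_def)

lemma sephol_uniform_limit:
  assumes f: "eventually (\<lambda>n. sephol r d i (f n)) F" and i: "i \<in> {1..r}"
    and ul: "uniform_limit (nbhd_r r d) f g F" and F: "F \<noteq> bot"
  shows "sephol r d i g"
  unfolding sephol_def
proof
  fix u assume u: "u \<in> nbhd_r r d"
  show "(\<lambda>z. g (u(i := z))) holomorphic_on ball 1 d"
  proof (rule holomorphic_on_uniform_limit[where F = F and f = "\<lambda>n z. f n (u(i := z))"])
    show "eventually (\<lambda>n. (\<lambda>z. f n (u(i := z))) holomorphic_on ball 1 d) F"
      using f by eventually_elim (use u in \<open>auto simp: sephol_def\<close>)
    show "uniform_limit (ball 1 d) (\<lambda>n z. f n (u(i := z))) (\<lambda>z. g (u(i := z))) F"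
      using ul by (rule uniform_limit_compose') (use u i in \<open>auto intro!: nbhd_r_upd simp: dist_norm norm_minus_commute\<close>)
  qed (use F in auto)
qed

text \<open>Cauchy's inequality. If |u_i - 1| < d/2, the closed disc of radius d/4 about u_i stays
  in the ball of radius d, and uniform closeness there controls the derivatives at u_i.\<close>

lemma pd_uniform_limit:
  assumes f: "eventually (\<lambda>n. sephol r d i (f n)) F" and i: "i \<in> {1..r}"
    and ul: "uniform_limit (nbhd_r r d) f g F" and F: "F \<noteq> bot" and d: "d > 0"
  shows "uniform_limit (nbhd_r r (d/2)) (\<lambda>n. pd p i (f n)) (pd p i g) F"
proof (rule uniform_limitI)
  fix e :: real assume e: "e > 0"
  have g: "sephol r d i g" by (rule sephol_uniform_limit[OF f i ul F])
  \<comment> \<open>Chosen so that Cauchy's bound p! eta/(d/4)^p equals e/2.\<close>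
  define \<eta> where "\<eta> = e / 2 * (d/4) ^ p / fact p"
  have \<eta>: "\<eta> > 0" using e d by (simp add: \<eta>_def)
  have "eventually (\<lambda>n. \<forall>u\<in>nbhd_r r d. dist (f n u) (g u) < \<eta>) F" by (rule uniform_limitD[OF ul \<eta>])
  then show "eventually (\<lambda>n. \<forall>u\<in>nbhd_r r (d/2). dist (pd p i (f n) u) (pd p i g u) < e) F"
    using f
  proof eventually_elim
    case (elim n)
    show ?case
    proof
      fix u assume u: "u \<in> nbhd_r r (d/2)"
      have u': "u \<in> nbhd_r r d" using u nbhd_r_mono[of "d/2" d r] d by auto
      have ui: "cmod (u i - 1) < d/2" using u i by (auto simp: nbhd_r_def)
      have hf: "(\<lambda>z. f n (u(i := z))) holomorphic_on ball 1 d" and hg: "(\<lambda>z. g (u(i := z))) holomorphic_on ball 1 d"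
        using elim(2) g u' by (auto simp: sephol_def)
      have sub: "cball (u i) (d/4) \<subseteq> ball 1 d"
      proof
        fix x assume "x \<in> cball (u i) (d/4)"
        then have "dist 1 x \<le> dist 1 (u i) + d/4" using dist_triangle[of 1 x "u i"] by simp
        then show "x \<in> ball 1 d" using ui d by (simp add: dist_norm norm_minus_commute)
      qed
      have h: "(\<lambda>z. f n (u(i := z)) - g (u(i := z))) holomorphic_on ball 1 d"
        by (intro holomorphic_on_diff hf hg)
      have "cmod ((deriv ^^ p) (\<lambda>z. f n (u(i := z)) - g (u(i := z))) (u i)) \<le> fact p * \<eta> / (d/4) ^ p"
      proof (rule Cauchy_inequality)
        show "(\<lambda>z. f n (u(i := z)) - g (u(i := z))) holomorphic_on ball (u i) (d/4)"
          using h sub by (meson holomorphic_on_subset ball_subset_cball subset_trans)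
        show "continuous_on (cball (u i) (d/4)) (\<lambda>z. f n (u(i := z)) - g (u(i := z)))"
          using h sub by (meson holomorphic_on_subset holomorphic_on_imp_continuous_on)
        show "0 < d/4" using d by simp
        fix x assume "cmod (u i - x) = d/4"
        then have "x \<in> ball 1 d" using sub by (auto simp: dist_norm)
        then have "u(i := x) \<in> nbhd_r r d" using nbhd_r_upd[OF u' i, of x d] by (simp add: dist_norm norm_minus_commute)
        then show "cmod (f n (u(i := x)) - g (u(i := x))) \<le> \<eta>" using elim(1) by (force simp: dist_norm)
      qed
      also have "\<dots> = e / 2" using d by (simp add: \<eta>_def)
      also have "\<dots> < e" using e by simp
      finally have "cmod ((deriv ^^ p) (\<lambda>z. f n (u(i := z)) - g (u(i := z))) (u i)) < e" .
      moreover have "u i \<in> ball 1 d" using ui d by (simp add: dist_norm norm_minus_commute)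
      ultimately show "dist (pd p i (f n) u) (pd p i g u) < e"
        using higher_deriv_diff[OF hf hg, of "u i" p] by (simp add: pd_def dist_norm)
    qed
  qed
qed

lemma laurent_sephol:
  assumes "laurent f" "d \<le> 1"
  shows "sephol r d i f"
  unfolding sephol_def
proof
  fix u assume u: "u \<in> nbhd_r r d"
  show "(\<lambda>z. f (u(i := z))) holomorphic_on ball 1 d"
  proof (rule laurent_holomorphic[OF assms(1)])
    show "(\<lambda>z. (u(i := z)) j) holomorphic_on ball 1 d" for j
      by (cases "j = i") (auto intro!: holomorphic_intros)
    fix z :: complex assume "z \<in> ball 1 d"
    then have "z \<noteq> 0" using assms(2) by auto
    then show "u(i := z) \<in> nzpt" using nbhd_r_nzpt[OF u assms(2)] by simp
  qed
qed

text \<open>The branch of the logarithm in the hypothesis of the theorem is merely continuous. It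
  differs from a holomorphic logarithm by a continuous function with values in 2 pi i Z, hence by a
  constant on a convex set.\<close>

lemma continuous_log_holomorphic:
  fixes g h :: "complex \<Rightarrow> complex"
  assumes A: "convex A" "open A" and g: "continuous_on A g" and h: "h holomorphic_on A"
    and eq: "\<And>z. z \<in> A \<Longrightarrow> exp (g z) = h z"
  shows "g holomorphic_on A"
proof (cases "A = {}")
  case False
  then obtain z0 where z0: "z0 \<in> A" by blast
  have "h z \<noteq> 0" if "z \<in> A" for z using eq[OF that] by (metis exp_not_eq_zero)
  then obtain k where k: "k holomorphic_on A" "\<And>z. z \<in> A \<Longrightarrow> exp (k z) = h z"
    using holomorphic_logarithm_exists[OF A h _ z0] by blast
  have cont: "continuous_on A (\<lambda>z. g z - k z)"
    by (intro continuous_on_diff g holomorphic_on_imp_continuous_on k)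
  have "(\<lambda>z. g z - k z) constant_on A"
  proof (rule continuous_discrete_range_constant[OF convex_connected[OF A(1)] cont])
    fix x assume x: "x \<in> A"
    have "2 * pi \<le> cmod ((g y - k y) - (g x - k x))" if y: "y \<in> A" "g y - k y \<noteq> g x - k x" for y
    proof -
      have e1: "exp (g z - k z) = 1" if "z \<in> A" for z using eq[OF that] k(2)[OF that] exp_not_eq_zero[of "g z"] by (simp add: exp_diff)
      have "exp ((g y - k y) - (g x - k x)) = 1" using e1[OF x] e1[OF y(1)] by (simp only: exp_diff) simp
      then obtain n where n: "(g y - k y) - (g x - k x) = of_int (2 * n) * pi * \<i>"
        unfolding exp_eq_1 by (auto simp: complex_eq_iff)
      then have "n \<noteq> 0" using y(2) by auto
      then have "1 \<le> \<bar>real_of_int n\<bar>" by linarith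
      then show ?thesis unfolding n by (simp add: norm_mult)
    qed
    then show "\<exists>e>0. \<forall>y. y \<in> A \<and> g y - k y \<noteq> g x - k x \<longrightarrow> e \<le> cmod ((g y - k y) - (g x - k x))"
      by (intro exI[of _ "2 * pi"]) auto
  qed
  then obtain c where c: "\<And>z. z \<in> A \<Longrightarrow> g z - k z = c" by (auto simp: constant_on_def)
  have "(\<lambda>z. k z + c) holomorphic_on A" using k by (intro holomorphic_intros)
  then show ?thesis by (rule holomorphic_transform) (use c in \<open>auto simp: algebra_simps\<close>)
qed (auto simp: holomorphic_on_def)

lemma sephol_log:
  assumes L: "continuous_on (nbhd_r r d) L" and S: "sephol r d i S" and i: "i \<in> {1..r}"
    and eq: "\<And>u. u \<in> nbhd_r r d \<Longrightarrow> exp (L u) = S u"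
  shows "sephol r d i L"
  unfolding sephol_def
proof
  fix u assume u: "u \<in> nbhd_r r d"
  have in_nb: "u(i := z) \<in> nbhd_r r d" if "z \<in> ball 1 d" for z
    using that by (intro nbhd_r_upd[OF u i]) (auto simp: dist_norm norm_minus_commute)
  show "(\<lambda>z. L (u(i := z))) holomorphic_on ball 1 d"
  proof (rule continuous_log_holomorphic[where h = "\<lambda>z. S (u(i := z))"])
    have "continuous_on (ball 1 d) (\<lambda>z. u(i := z))"
    proof (rule continuous_on_coordinatewise_then_product)
      show "continuous_on (ball 1 d) (\<lambda>z. (u(i := z)) j)" for j by (cases "j = i") (auto intro: continuous_intros)
    qed
    then show "continuous_on (ball 1 d) (\<lambda>z. L (u(i := z)))"
      by (rule continuous_on_compose2[OF L]) (use in_nb in auto)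
    show "(\<lambda>z. S (u(i := z))) holomorphic_on ball 1 d" using S u by (auto simp: sephol_def)
    show "exp (L (u(i := z))) = S (u(i := z))" if "z \<in> ball 1 d" for z using eq[OF in_nb[OF that]] .
  qed auto
qed

text \<open>Turns the limit at a removable singularity into an integral over a circle that avoids
  it, where the later interchanges of limits are harmless.\<close>

lemma cauchy_removable_at_0:
  fixes f :: "complex \<Rightarrow> complex"
  assumes f: "f holomorphic_on ball 0 R - {0}" and lim: "(f \<longlongrightarrow> c) (at 0)" and \<delta>: "0 < \<delta>" "\<delta> < R"
  shows "((\<lambda>t. f t / t) has_contour_integral 2 * of_real pi * \<i> * c) (circlepath 0 \<delta>)"
proof -
  define g where "g t = (if t = 0 then c else f t)" for t
  have "g holomorphic_on ball 0 R"
  proof (rule no_isolated_singularity'[of "{0}"])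
    show "(g \<longlongrightarrow> g z) (at z within ball 0 R)" if "z \<in> {0}" for z
    proof -
      have "(g \<longlongrightarrow> c) (at 0)"
        by (rule Lim_transform_eventually[OF lim]) (auto simp: g_def eventually_at_filter)
      then have "(g \<longlongrightarrow> c) (at 0 within ball 0 R)" by (rule tendsto_within_subset) auto
      then show ?thesis using that by (simp add: g_def)
    qed
    show "g holomorphic_on ball 0 R - {0}" by (rule holomorphic_transform[OF f]) (auto simp: g_def)
  qed auto
  then have "g holomorphic_on cball 0 \<delta>" by (rule holomorphic_on_subset) (use \<delta> in auto)
  then have "((\<lambda>t. g t / (t - 0)) has_contour_integral 2 * of_real pi * \<i> * g 0) (circlepath 0 \<delta>)"
    by (rule Cauchy_integral_circlepath_simple) (use \<delta> in auto)
  then have "((\<lambda>t. g t / (t - 0)) has_contour_integral 2 * of_real pi * \<i> * c) (circlepath 0 \<delta>)"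
    by (simp add: g_def)
  then show ?thesis
    by (rule has_contour_integral_eq) (use \<delta> in \<open>auto simp: g_def\<close>)
qed

lemma pd_cmult_add:
  assumes f: "laurent f" and g: "laurent g" and u: "u \<in> nzpt"
  shows "pd p i (\<lambda>u. c * f u + g u) u = c * pd p i f u + pd p i g u"
proof -
  have hol: "(\<lambda>z. h (u(i := z))) holomorphic_on - {0}" if "laurent h" for h
  proof (rule laurent_holomorphic[OF that])
    show "(\<lambda>z. (u(i := z)) j) holomorphic_on - {0}" for j
      by (cases "j = i") (auto intro!: holomorphic_intros)
  qed (use u in auto)
  have ui: "u i \<in> - {0}" using nzpt_nz[OF u] by simp
  have op: "open (- {0::complex})" by (simp add: open_Compl)
  show ?thesis unfolding pd_def
    using higher_deriv_add[OF holomorphic_on_mult[OF holomorphic_on_const hol[OF f]] hol[OF g] op ui, of p c]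
      higher_deriv_cmult[OF hol[OF f] ui op, of p c] by simp
qed

lemma pd_sum_laurent:
  assumes f: "\<And>l. laurent (f l)" and u: "u \<in> nzpt"
  shows "pd p i (\<lambda>u. \<Sum>l\<in>F. c l * f l u) u = (\<Sum>l\<in>F. c l * pd p i (f l) u)"
proof (induction F rule: infinite_finite_induct)
  case (insert x F)
  have "laurent (\<lambda>u. \<Sum>l\<in>F. c l * f l u)" by (intro laurent_sum laurent_mult laurent_const f)
  from pd_cmult_add[OF f this u, of p i "c x" x] show ?case using insert by simp
qed (auto simp: pd_def)

lemma symq_sum_laurent:
  assumes f: "\<And>l. laurent (f l)" and u: "u \<in> nzpt"
  shows "symq \<phi> k p (\<lambda>u. \<Sum>l\<in>F. c l * f l u) I u = (\<Sum>l\<in>F. c l * symq \<phi> k p (f l) I u)"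
proof -
  have "symq \<phi> k p (\<lambda>u. \<Sum>l\<in>F. c l * f l u) I u =
     (\<Sum>i\<in>I. \<Sum>l\<in>F. c l * (\<phi> (u i) * u i ^ k * pd p i (f l) u / (\<Prod>j\<in>I-{i}. u i - u j)))"
    unfolding symq_def pd_sum_laurent[OF f u]
    by (intro sum.cong refl) (simp add: sum_distrib_left sum_divide_distrib mult_ac)
  also have "\<dots> = (\<Sum>l\<in>F. c l * symq \<phi> k p (f l) I u)"
    unfolding symq_def sum_distrib_left by (rule sum.swap)
  finally show ?thesis .
qed

lemma uniform_limit_finite_sum:
  fixes f :: "'i \<Rightarrow> 'n \<Rightarrow> 'x \<Rightarrow> complex"
  assumes "\<And>i. i \<in> A \<Longrightarrow> uniform_limit X (f i) (l i) F"
  shows "uniform_limit X (\<lambda>n x. \<Sum>i\<in>A. f i n x) (\<lambda>x. \<Sum>i\<in>A. l i x) F"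
  using assms
  by (induction A rule: infinite_finite_induct) (auto intro!: uniform_limit_add uniform_limit_const)

lemma linc_nbhd:
  assumes "cmod t < R" "real r * R \<le> e" "e > 0"
  shows "linc r t \<in> nbhd_r r e"
proof -
  have "cmod (of_nat i * t) < e" if "i \<in> {1..r}" for i
  proof -
    have "cmod (of_nat i * t) = real i * cmod t" by (simp add: norm_mult)
    also have "\<dots> < real i * R" using that assms(1) by (intro mult_strict_left_mono) auto
    also have "\<dots> \<le> real r * R" using that assms(1) norm_ge_zero[of t]
      by (intro mult_right_mono) (auto intro: order_trans[OF norm_ge_zero[of t]])
    finally show ?thesis using assms(2) by simp
  qed
  then show ?thesis by (auto simp: nbhd_r_def linc_def)
qed

lemma linc_diff_nz: "i \<in> {1..r} \<Longrightarrow> j \<in> {1..r}-{i} \<Longrightarrow> t \<noteq> 0 \<Longrightarrow> linc r t i - linc r t j \<noteq> 0"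
  by (auto simp: linc_def)

lemma linc_holomorphic: "(\<lambda>t. linc r t i) holomorphic_on A"
  by (cases "i \<in> {1..r}") (auto simp: linc_def intro!: holomorphic_intros)

lemma linc_0: "linc r 0 = ones"
  by (auto simp: linc_def ones_def)

text \<open>The interchange of t -> 0 with the sum over signatures. For a finite partial sum the
  limit is a Cauchy integral over |t| = delta, where the coordinates on the line are distinct and
  the partial sums converge uniformly with their derivatives. Dividing the integrand by
  \<open>S\<close> changes nothing at t = 0 since \<open>S ones = 1\<close>, and turns it into a
  combination of quotients of derivatives of \<open>S\<close> by \<open>S\<close>, whose asymptotics
  are accessible.\<close>

lemma symq_lim_has_sum:
  fixes \<rho> :: "(nat \<Rightarrow> int) pmf"
  assumes m: "Suc m \<le> N" "m \<le> k" and \<phi>: "\<phi> holomorphic_on ball 1 s" "s > 0"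
    and d: "0 < d" "d \<le> 1"
    and ul: "uniform_limit (nbhd_r (Suc m) d) (\<lambda>F u. \<Sum>l\<in>F. sgf_term N \<rho> l u) S (finite_subsets_at_top (sig N))"
    and nz: "\<And>u. u \<in> nbhd_r (Suc m) d \<Longrightarrow> S u \<noteq> 0" and S1: "S ones = 1"
    and R: "0 < \<delta>" "\<delta> < R" "real (Suc m) * R \<le> d/2" "real (Suc m) * R \<le> s"
  shows "((\<lambda>l. of_real (pmf \<rho> l) * symq_lim \<phi> k m (norm_schur N l)) has_sum
     (contour_integral (circlepath 0 \<delta>) (\<lambda>t. symq \<phi> k (k - m) S {1..Suc m} (linc (Suc m) t) / S (linc (Suc m) t) / t)
       / (2 * of_real pi * \<i>))) (sig N) \<and>
   (\<lambda>t. symq \<phi> k (k - m) S {1..Suc m} (linc (Suc m) t) / S (linc (Suc m) t) / t) contour_integrable_on circlepath 0 \<delta>"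
proof -
  define r where "r = Suc m"
  define c where "c l = complex_of_real (pmf \<rho> l)" for l
  \<comment> \<open>Written with \<open>norm_schur\<close> the partial sums are Laurent polynomials;
    near 1 they agree with those of \<open>sgf_term\<close> for finite subsets of
    \<open>sig N\<close>.\<close>
  define P where "P F u = (\<Sum>l\<in>F. c l * norm_schur N l u)" for F u
  let ?FF = "finite_subsets_at_top (sig N)"
  have lpP: "laurent (P F)" for F unfolding P_def by (intro laurent_sum laurent_mult laurent_const laurent_norm_schur)
  have ulP: "uniform_limit (nbhd_r r d) P S ?FF"
  proof (rule uniform_limit_cong[THEN iffD1, OF _ _ ul[folded r_def]])
    have "eventually (\<lambda>F. finite F \<and> F \<subseteq> sig N) ?FF" by (rule eventually_finite_subsets_at_top_weakI) auto
    then show "eventually (\<lambda>F. \<forall>u\<in>nbhd_r r d. (\<Sum>l\<in>F. sgf_term N \<rho> l u) = P F u) ?FF"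
      by eventually_elim (auto simp: P_def c_def intro!: sum.cong sgf_term_eq nbhd_r_nzpt[OF _ d(2)])
  qed auto
  have linc_nb: "linc r t \<in> nbhd_r r (d/2)" if "t \<in> ball 0 R" for t
    using that R d by (intro linc_nbhd[of _ R]) (auto simp: r_def)
  have linc_nb': "linc r t \<in> nbhd_r r d" if "t \<in> ball 0 R" for t
    using linc_nb[OF that] nbhd_r_mono[of "d/2" d r] d by auto
  have linc_nz: "linc r t \<in> nzpt" if "t \<in> ball 0 R" for t
    using linc_nb'[OF that] d(2) by (rule nbhd_r_nzpt)
  have linc_s: "linc r t i \<in> ball 1 s" if "t \<in> ball 0 R" for t i
  proof (cases "i \<in> {1..r}")
    case True
    have "linc r t \<in> nbhd_r r s" using that R \<phi>(2) by (intro linc_nbhd[of _ R]) (auto simp: r_def)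
    then show ?thesis using True by (auto simp: nbhd_r_def dist_norm norm_minus_commute)
  qed (use \<phi>(2) in \<open>auto simp: linc_def\<close>)
  have holS: "(\<lambda>t. S (linc r t)) holomorphic_on ball 0 R"
  proof (rule holomorphic_on_uniform_limit[where F = ?FF and f = "\<lambda>F t. P F (linc r t)"])
    show "eventually (\<lambda>F. (\<lambda>t. P F (linc r t)) holomorphic_on ball 0 R) ?FF"
      by (intro always_eventually allI laurent_holomorphic[OF lpP] linc_holomorphic linc_nz)
    show "uniform_limit (ball 0 R) (\<lambda>F t. P F (linc r t)) (\<lambda>t. S (linc r t)) ?FF"
      using ulP by (rule uniform_limit_compose') (use linc_nb' in auto)
  qed auto
  have Slim: "((\<lambda>t. S (linc r t)) \<longlongrightarrow> 1) (at 0)"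
  proof -
    have "isCont (\<lambda>t. S (linc r t)) 0"
      using holomorphic_on_imp_continuous_on[OF holS] R by (intro continuous_on_interior) auto
    then show ?thesis by (simp add: isCont_def linc_0 S1)
  qed
  define C where "C i t = \<phi> (linc r t i) * linc r t i ^ k / (\<Prod>j\<in>{1..r}-{i}. linc r t i - linc r t j)" for i t
  have holC: "C i holomorphic_on ball 0 R - {0}" if i: "i \<in> {1..r}" for i
  proof -
    have "(\<lambda>t. \<phi> (linc r t i)) holomorphic_on ball 0 R - {0}"
      using holomorphic_on_compose_gen[OF linc_holomorphic \<phi>(1), of r i "ball 0 R - {0}"] linc_s
      by (auto simp: o_def image_subset_iff)
    then show ?thesis unfolding C_def
      by (intro holomorphic_intros linc_holomorphic) (use linc_diff_nz[OF i] in \<open>auto simp: prod_zero_iff\<close>)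
  qed
  have symq_C: "symq \<phi> k p f {1..r} (linc r t) = (\<Sum>i\<in>{1..r}. C i t * pd p i f (linc r t))" for p f t
    by (simp add: symq_def C_def)
  let ?h = "\<lambda>F t. symq \<phi> k (k - m) (P F) {1..r} (linc r t) / S (linc r t)"
  have int: "((\<lambda>t. ?h F t / t) has_contour_integral 2 * of_real pi * \<i> * (\<Sum>l\<in>F. c l * symq_lim \<phi> k m (norm_schur N l))) (circlepath 0 \<delta>)"
    if F: "F \<subseteq> sig N" for F
  proof (rule cauchy_removable_at_0[OF _ _ R(1,2)])
    show "?h F holomorphic_on ball 0 R - {0}"
      unfolding symq_C
    proof (intro holomorphic_on_divide holomorphic_on_sum holomorphic_on_mult holC)
      show "(\<lambda>t. S (linc r t)) holomorphic_on ball 0 R - {0}" using holS by (rule holomorphic_on_subset) auto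
      show "S (linc r t) \<noteq> 0" if "t \<in> ball 0 R - {0}" for t using that linc_nb' nz r_def by auto
      show "(\<lambda>t. pd (k - m) i (P F) (linc r t)) holomorphic_on ball 0 R - {0}" for i
      proof -
        obtain g where g: "laurent g" "\<forall>u\<in>nzpt. pd (k - m) i (P F) u = g u" using laurent_pd[OF lpP] by blast
        have "(\<lambda>t. g (linc r t)) holomorphic_on ball 0 R - {0}"
          by (rule laurent_holomorphic[OF g(1) linc_holomorphic]) (use linc_nz in auto)
        then show ?thesis by (rule holomorphic_transform) (use g(2) linc_nz in auto)
      qed
    qed auto
    have "((\<lambda>t. (\<Sum>l\<in>F. c l * symq \<phi> k (k - m) (norm_schur N l) {1..r} (linc r t)) / S (linc r t)) \<longlongrightarrow>
       (\<Sum>l\<in>F. c l * symq_lim \<phi> k m (norm_schur N l)) / 1) (at 0)"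
    proof (intro tendsto_divide tendsto_sum tendsto_mult tendsto_const Slim)
      fix l assume "l \<in> F"
      then have l: "l \<in> sig N" using F by auto
      show "((\<lambda>t. symq \<phi> k (k - m) (norm_schur N l) {1..r} (linc r t)) \<longlongrightarrow> symq_lim \<phi> k m (norm_schur N l)) (at 0)"
        unfolding r_def by (rule symq_tendsto_symq_lim(1)[OF laurent_norm_schur symN_norm_schur[OF l] \<phi> m(2) m(1)])
    qed auto
    moreover have "eventually (\<lambda>t. (\<Sum>l\<in>F. c l * symq \<phi> k (k - m) (norm_schur N l) {1..r} (linc r t)) / S (linc r t) = ?h F t) (at 0)"
    proof -
      have "eventually (\<lambda>t. t \<in> ball 0 R) (at (0::complex))" using R by (intro eventually_at_in_open') auto
      then show ?thesis
        unfolding P_def by eventually_elim (simp add: symq_sum_laurent[OF laurent_norm_schur linc_nz])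
    qed
    ultimately show "(?h F \<longlongrightarrow> (\<Sum>l\<in>F. c l * symq_lim \<phi> k m (norm_schur N l))) (at 0)"
      by (simp add: Lim_transform_eventually)
  qed
  have sph: "t \<in> ball 0 R \<and> t \<noteq> 0" if "t \<in> sphere 0 \<delta>" for t :: complex using that R by auto
  \<comment> \<open>The denominators in \<open>C i\<close> vanish at t = 0, but on the circle
    \<open>C i\<close> is continuous and thus bounded, so that it preserves uniform
    convergence.\<close>
  have ulh: "uniform_limit (sphere 0 \<delta>) (\<lambda>F t. ?h F t / t) (\<lambda>t. symq \<phi> k (k - m) S {1..r} (linc r t) / S (linc r t) / t) ?FF"
  proof -
    have "uniform_limit (sphere 0 \<delta>) (\<lambda>F t. \<Sum>i\<in>{1..r}. (C i t / S (linc r t) / t) * pd (k - m) i (P F) (linc r t))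
       (\<lambda>t. \<Sum>i\<in>{1..r}. (C i t / S (linc r t) / t) * pd (k - m) i S (linc r t)) ?FF"
    proof (intro uniform_limit_finite_sum uniform_limit_bounded_mult)
      fix i assume i: "i \<in> {1..r}"
      have "uniform_limit (nbhd_r r (d/2)) (\<lambda>F. pd (k - m) i (P F)) (pd (k - m) i S) ?FF"
        by (rule pd_uniform_limit[OF _ i ulP]) (use d in \<open>auto intro!: always_eventually laurent_sephol[OF lpP]\<close>)
      then show "uniform_limit (sphere 0 \<delta>) (\<lambda>F t. pd (k - m) i (P F) (linc r t)) (\<lambda>t. pd (k - m) i S (linc r t)) ?FF"
        by (rule uniform_limit_compose') (use linc_nb sph in auto)
      have "continuous_on (sphere 0 \<delta>) (\<lambda>t. C i t / S (linc r t) / t)"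
      proof (intro continuous_on_divide continuous_on_id)
        show "continuous_on (sphere 0 \<delta>) (C i)"
          using holomorphic_on_imp_continuous_on[OF holC[OF i]] by (rule continuous_on_subset) (use sph in auto)
        show "continuous_on (sphere 0 \<delta>) (\<lambda>t. S (linc r t))"
          using holomorphic_on_imp_continuous_on[OF holS] by (rule continuous_on_subset) (use sph in auto)
      qed (use sph nz linc_nb' r_def in auto)
      then show "bounded ((\<lambda>t. C i t / S (linc r t) / t) ` sphere 0 \<delta>)"
        by (intro compact_imp_bounded compact_continuous_image) auto
    qed
    then show ?thesis unfolding symq_C sum_divide_distrib by simp
  qed
  have ev_int: "eventually (\<lambda>F. (\<lambda>t. ?h F t / t) contour_integrable_on circlepath 0 \<delta>) ?FF"
  proof -
    have "eventually (\<lambda>F. finite F \<and> F \<subseteq> sig N) ?FF" by (rule eventually_finite_subsets_at_top_weakI) auto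
    then show ?thesis
    proof eventually_elim
      case (elim F)
      show ?case by (rule has_contour_integral_integrable[OF int]) (use elim in simp)
    qed
  qed
  note lims = contour_integral_uniform_limit_circlepath[OF ev_int ulh finite_subsets_at_top_neq_bot R(1)]
  from lims(2) have "((\<lambda>F. 2 * of_real pi * \<i> * (\<Sum>l\<in>F. c l * symq_lim \<phi> k m (norm_schur N l))) \<longlongrightarrow>
     contour_integral (circlepath 0 \<delta>) (\<lambda>t. symq \<phi> k (k - m) S {1..r} (linc r t) / S (linc r t) / t)) ?FF"
  proof (rule Lim_transform_eventually)
    have "eventually (\<lambda>F. finite F \<and> F \<subseteq> sig N) ?FF" by (rule eventually_finite_subsets_at_top_weakI) auto
    then show "eventually (\<lambda>F. contour_integral (circlepath 0 \<delta>) (\<lambda>t. ?h F t / t) =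
       2 * of_real pi * \<i> * (\<Sum>l\<in>F. c l * symq_lim \<phi> k m (norm_schur N l))) ?FF"
    proof eventually_elim
      case (elim F)
      show ?case by (rule contour_integral_unique[OF int]) (use elim in simp)
    qed
  qed
  then have "((\<lambda>F. 2 * of_real pi * \<i> * (\<Sum>l\<in>F. c l * symq_lim \<phi> k m (norm_schur N l)) / (2 * of_real pi * \<i>)) \<longlongrightarrow>
     contour_integral (circlepath 0 \<delta>) (\<lambda>t. symq \<phi> k (k - m) S {1..r} (linc r t) / S (linc r t) / t) / (2 * of_real pi * \<i>)) ?FF"
    by (intro tendsto_divide tendsto_const) auto
  then show ?thesis using lims(1) unfolding has_sum_def c_def r_def by simp
qed

section \<open>Divided differences and their confluent limit\<close>

lemma divided_difference_const:
  fixes v :: "nat \<Rightarrow> complex"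
  assumes "finite I" "card I \<ge> 2" "inj_on v I"
  shows "(\<Sum>i\<in>I. 1 / (\<Prod>j\<in>I-{i}. v i - v j)) = 0"
  using assms
proof (induction "card I" arbitrary: I rule: less_induct)
  case less
  obtain a b where ab: "a \<in> I" "b \<in> I" "a \<noteq> b"
    using less.prems(2) card_le_Suc0_iff_eq[OF less.prems(1)] by (metis not_less_eq_eq numeral_2_eq_2)
  have vab: "v b - v a \<noteq> 0" using inj_onD[OF less.prems(3), of b a] ab by auto
  have nz: "v i - v j \<noteq> 0" if "i \<in> I" "j \<in> I" "i \<noteq> j" for i j
    using inj_onD[OF less.prems(3), of i j] that by auto
  have removed: "(\<Sum>i\<in>I. (v i - v c) / (\<Prod>j\<in>I-{i}. v i - v j)) = (\<Sum>i\<in>I-{c}. 1 / (\<Prod>j\<in>I-{c}-{i}. v i - v j))"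
    if c: "c \<in> I" for c
  proof -
    have "(\<Sum>i\<in>I. (v i - v c) / (\<Prod>j\<in>I-{i}. v i - v j)) = (\<Sum>i\<in>I-{c}. (v i - v c) / (\<Prod>j\<in>I-{i}. v i - v j))"
      using less.prems(1) c by (subst sum.remove[of _ c]) auto
    also have "\<dots> = (\<Sum>i\<in>I-{c}. 1 / (\<Prod>j\<in>I-{c}-{i}. v i - v j))"
    proof (rule sum.cong[OF refl])
      fix i assume i: "i \<in> I - {c}"
      have "(\<Prod>j\<in>I-{i}. v i - v j) = (v i - v c) * (\<Prod>j\<in>I-{i}-{c}. v i - v j)"
        using i c less.prems(1) by (intro prod.remove) auto
      moreover have "I - {i} - {c} = I - {c} - {i}" by auto
      ultimately show "(v i - v c) / (\<Prod>j\<in>I-{i}. v i - v j) = 1 / (\<Prod>j\<in>I-{c}-{i}. v i - v j)"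
        using nz[of i c] i c by simp
    qed
    finally show ?thesis .
  qed
  \<comment> \<open>From v_b - v_a = (v_i - v_a) - (v_i - v_b) come two sums of the same kind with
    one node fewer. They vanish by induction, or cancel as 1 - 1 if there were only two
    nodes.\<close>
  have "(v b - v a) * (\<Sum>i\<in>I. 1 / (\<Prod>j\<in>I-{i}. v i - v j)) =
     (\<Sum>i\<in>I. (v i - v a) / (\<Prod>j\<in>I-{i}. v i - v j)) - (\<Sum>i\<in>I. (v i - v b) / (\<Prod>j\<in>I-{i}. v i - v j))"
    unfolding sum_distrib_left sum_subtractf[symmetric] diff_divide_distrib[symmetric] by simp
  also have "\<dots> = (\<Sum>i\<in>I-{a}. 1 / (\<Prod>j\<in>I-{a}-{i}. v i - v j)) - (\<Sum>i\<in>I-{b}. 1 / (\<Prod>j\<in>I-{b}-{i}. v i - v j))"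
    using removed ab by simp
  also have "\<dots> = 0"
  proof (cases "card I = 2")
    case True
    then have "I - {a} = {b}" "I - {b} = {a}"
      using ab less.prems(1) by (auto simp: card_2_iff)
    then show ?thesis by simp
  next
    case False
    have "(\<Sum>i\<in>I-{c}. 1 / (\<Prod>j\<in>I-{c}-{i}. v i - v j)) = 0" if "c \<in> I" for c
    proof (rule less.hyps)
      show "card (I - {c}) < card I" using that less.prems(1) by (intro psubset_card_mono) auto
      show "2 \<le> card (I - {c})" using that less.prems False by (simp add: card_Diff_singleton)
      show "inj_on v (I - {c})" using less.prems(3) by (rule inj_on_subset) auto
    qed (use less.prems in auto)
    then show ?thesis using ab by simp
  qed
  finally show ?case using vab by simp
qed

text \<open>Writing v_i^(n+1) = v_i^n (v_i - v_c) + v_c v_i^n lowers the degree, and in the first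
  sum also the number of nodes.\<close>

lemma divided_difference_power:
  fixes v :: "nat \<Rightarrow> complex"
  assumes "finite I" "n < card I" "inj_on v I"
  shows "(\<Sum>i\<in>I. v i ^ n / (\<Prod>j\<in>I-{i}. v i - v j)) = (if Suc n = card I then 1 else 0)"
  using assms
proof (induction n arbitrary: I)
  case 0
  show ?case
  proof (cases "card I = 1")
    case True
    then obtain a where "I = {a}" by (auto simp: card_1_singleton_iff)
    then show ?thesis by simp
  next
    case False
    then show ?thesis using divided_difference_const[of I v] 0 by simp
  qed
next
  case (Suc n)
  obtain c where c: "c \<in> I" using Suc.prems by (metis card.empty ex_in_conv not_less_zero)
  have nz: "v i - v j \<noteq> 0" if "i \<in> I" "j \<in> I" "i \<noteq> j" for i j
    using inj_onD[OF Suc.prems(3), of i j] that by auto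
  have "(\<Sum>i\<in>I. v i ^ Suc n / (\<Prod>j\<in>I-{i}. v i - v j)) =
    (\<Sum>i\<in>I. v i ^ n * (v i - v c) / (\<Prod>j\<in>I-{i}. v i - v j)) + v c * (\<Sum>i\<in>I. v i ^ n / (\<Prod>j\<in>I-{i}. v i - v j))"
    unfolding sum_distrib_left sum.distrib[symmetric] times_divide_eq_right add_divide_distrib[symmetric]
    by (intro sum.cong refl) (simp add: algebra_simps)
  also have "(\<Sum>i\<in>I. v i ^ n / (\<Prod>j\<in>I-{i}. v i - v j)) = 0"
    using Suc.IH[of I] Suc.prems by simp
  also have "(\<Sum>i\<in>I. v i ^ n * (v i - v c) / (\<Prod>j\<in>I-{i}. v i - v j)) =
      (\<Sum>i\<in>I-{c}. v i ^ n * (v i - v c) / (\<Prod>j\<in>I-{i}. v i - v j))"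
    using Suc.prems(1) c by (subst sum.remove[of _ c]) auto
  also have "\<dots> = (\<Sum>i\<in>I-{c}. v i ^ n / (\<Prod>j\<in>I-{c}-{i}. v i - v j))"
  proof (rule sum.cong[OF refl])
    fix i assume i: "i \<in> I - {c}"
    have "(\<Prod>j\<in>I-{i}. v i - v j) = (v i - v c) * (\<Prod>j\<in>I-{i}-{c}. v i - v j)"
      using i c Suc.prems(1) by (intro prod.remove) auto
    moreover have "I - {i} - {c} = I - {c} - {i}" by auto
    ultimately show "v i ^ n * (v i - v c) / (\<Prod>j\<in>I-{i}. v i - v j) = v i ^ n / (\<Prod>j\<in>I-{c}-{i}. v i - v j)"
      using nz[of i c] i c by simp
  qed
  also have "\<dots> = (if Suc n = card (I - {c}) then 1 else 0)"
    using Suc.prems c by (intro Suc.IH inj_on_subset[OF Suc.prems(3)]) (auto simp: card_Diff_singleton)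
  finally show ?case using Suc.prems c by (auto simp: card_Diff_singleton)
qed

text \<open>The monomials (z - 1)^n with n < m are annihilated, n = m contributes its Taylor
  coefficient, and the remainder is o(t^m) against denominators of order t^m.\<close>

lemma divided_difference_tendsto:
  assumes h: "h holomorphic_on ball 1 s" "s > 0"
  shows "((\<lambda>t. \<Sum>i\<in>{1..Suc m}. h (linc (Suc m) t i) / (\<Prod>j\<in>{1..Suc m}-{i}. linc (Suc m) t i - linc (Suc m) t j))
     \<longlongrightarrow> (deriv ^^ m) h 1 / fact m) (at 0)"
proof -
  let ?c = "linc (Suc m)"
  define T where "T z = (\<Sum>n\<le>m. (deriv ^^ n) h 1 * (z - 1) ^ n / fact n)" for z
  have gc: "gcurve (Suc m) ?c" by (rule gcurve_linc)
  have c1: "((\<lambda>t. ?c t i) \<longlongrightarrow> 1) (at 0)" for i using gc by (auto simp: gcurve_def)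
  have ca: "((\<lambda>t. (?c t i - 1) / t) \<longlongrightarrow> of_nat i) (at 0)" if "i \<in> {1..Suc m}" for i
    by (rule Lim_transform_eventually[OF tendsto_const])
       (use that in \<open>auto simp: eventually_at_filter linc_def\<close>)
  have prod_eq: "(\<Prod>j\<in>{1..Suc m}-{i}. ?c t i - ?c t j) = t ^ m * (\<Prod>j\<in>{1..Suc m}-{i}. of_nat i - of_nat j)"
    if i: "i \<in> {1..Suc m}" for i t
  proof -
    have "(\<Prod>j\<in>{1..Suc m}-{i}. ?c t i - ?c t j) = (\<Prod>j\<in>{1..Suc m}-{i}. t * (of_nat i - of_nat j))"
      using i by (intro prod.cong) (auto simp: linc_def algebra_simps)
    also have "\<dots> = t ^ card ({1..Suc m}-{i}) * (\<Prod>j\<in>{1..Suc m}-{i}. of_nat i - of_nat j)"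
      by (simp add: prod.distrib)
    also have "card ({1..Suc m}-{i}) = m" using i by simp
    finally show ?thesis .
  qed
  have "((\<lambda>t. (\<Sum>i\<in>{1..Suc m}. (h (?c t i) - T (?c t i)) / t ^ m / (\<Prod>j\<in>{1..Suc m}-{i}. of_nat i - of_nat j)) +
      (deriv ^^ m) h 1 / fact m) \<longlongrightarrow>
     (\<Sum>i\<in>{1..Suc m}. 0 / (\<Prod>j\<in>{1..Suc m}-{i}. of_nat i - of_nat j)) + (deriv ^^ m) h 1 / fact m) (at 0)"
  proof (intro tendsto_add tendsto_sum tendsto_divide tendsto_const)
    fix i assume i: "i \<in> {1..Suc m}"
    show "((\<lambda>t. (h (?c t i) - T (?c t i)) / t ^ m) \<longlongrightarrow> 0) (at 0)"
      unfolding T_def by (rule taylor_remainder_tendsto[OF h _ c1 ca[OF i]]) simp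
    show "(\<Prod>j\<in>{1..Suc m}-{i}. of_nat i - of_nat j :: complex) \<noteq> 0" by auto
  qed auto
  then have lim: "((\<lambda>t. (\<Sum>i\<in>{1..Suc m}. (h (?c t i) - T (?c t i)) / t ^ m / (\<Prod>j\<in>{1..Suc m}-{i}. of_nat i - of_nat j)) +
      (deriv ^^ m) h 1 / fact m) \<longlongrightarrow> (deriv ^^ m) h 1 / fact m) (at 0)" by simp
  show ?thesis
  proof (rule Lim_transform_eventually[OF lim])
    show "eventually (\<lambda>t. (\<Sum>i\<in>{1..Suc m}. (h (?c t i) - T (?c t i)) / t ^ m / (\<Prod>j\<in>{1..Suc m}-{i}. of_nat i - of_nat j)) +
      (deriv ^^ m) h 1 / fact m = (\<Sum>i\<in>{1..Suc m}. h (?c t i) / (\<Prod>j\<in>{1..Suc m}-{i}. ?c t i - ?c t j))) (at 0)"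
      using gcurve_inj[OF gc]
    proof eventually_elim
      case (elim t)
      have "(\<Sum>i\<in>{1..Suc m}. T (?c t i) / (\<Prod>j\<in>{1..Suc m}-{i}. ?c t i - ?c t j)) =
         (\<Sum>i\<in>{1..Suc m}. \<Sum>n\<le>m. (deriv ^^ n) h 1 / fact n * ((?c t i - 1) ^ n / (\<Prod>j\<in>{1..Suc m}-{i}. (?c t i - 1) - (?c t j - 1))))"
        by (simp add: T_def sum_divide_distrib)
      also have "\<dots> = (\<Sum>n\<le>m. (deriv ^^ n) h 1 / fact n * (\<Sum>i\<in>{1..Suc m}. (?c t i - 1) ^ n / (\<Prod>j\<in>{1..Suc m}-{i}. (?c t i - 1) - (?c t j - 1))))"
        by (subst sum.swap) (simp only: sum_distrib_left)
      also have "\<dots> = (\<Sum>n\<le>m. (deriv ^^ n) h 1 / fact n * (if n = m then 1 else 0))"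
      proof (intro sum.cong refl arg_cong2[of _ _ _ _ "(*)"])
        fix n assume n: "n \<in> {..m}"
        have "inj_on (\<lambda>i. ?c t i - 1) {1..Suc m}" using elim by (simp add: inj_on_def)
        then show "(\<Sum>i\<in>{1..Suc m}. (?c t i - 1) ^ n / (\<Prod>j\<in>{1..Suc m}-{i}. (?c t i - 1) - (?c t j - 1))) = (if n = m then 1 else 0)"
          using divided_difference_power[of "{1..Suc m}" n "\<lambda>i. ?c t i - 1"] n by simp
      qed
      also have "\<dots> = (deriv ^^ m) h 1 / fact m"
        by (subst sum.mono_neutral_right[of _ "{m}"]) auto
      finally have T: "(deriv ^^ m) h 1 / fact m = (\<Sum>i\<in>{1..Suc m}. T (?c t i) / (\<Prod>j\<in>{1..Suc m}-{i}. ?c t i - ?c t j))" by simp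
      show ?case unfolding T sum.distrib[symmetric]
        by (intro sum.cong refl) (simp only: prod_eq diff_divide_distrib divide_divide_eq_left diff_add_cancel)
    qed
  qed
qed

lemma binomial_asymp: "(\<lambda>N. of_nat (N choose j) / of_nat N ^ j :: complex) \<longlonglongrightarrow> 1 / fact j"
proof -
  have "(\<lambda>N. (\<Prod>i=0..<j. 1 - of_nat i * (1 / of_nat N)) / fact j :: complex) \<longlonglongrightarrow> (\<Prod>i=0..<j. 1 - of_nat i * 0) / fact j"
    by (intro tendsto_intros lim_1_over_n) auto
  then have lim: "(\<lambda>N. (\<Prod>i=0..<j. 1 - of_nat i * (1 / of_nat N)) / fact j :: complex) \<longlonglongrightarrow> 1 / fact j" by simp
  show ?thesis
  proof (rule Lim_transform_eventually[OF lim])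
    show "eventually (\<lambda>N. (\<Prod>i=0..<j. 1 - of_nat i * (1 / of_nat N)) / fact j = (of_nat (N choose j) / of_nat N ^ j :: complex)) sequentially"
      using eventually_gt_at_top[of 0]
    proof eventually_elim
      case (elim N)
      have "(of_nat (N choose j) :: complex) = (\<Prod>i=0..<j. of_nat N - of_nat i) / fact j"
        by (simp add: binomial_gbinomial gbinomial_prod_rev)
      also have "(\<Prod>i=0..<j. of_nat N - of_nat i :: complex) = (\<Prod>i=0..<j. of_nat N * (1 - of_nat i * (1 / of_nat N)))"
        using elim by (intro prod.cong refl) (simp add: field_simps)
      also have "\<dots> = of_nat N ^ j * (\<Prod>i=0..<j. 1 - of_nat i * (1 / of_nat N))" by (simp add: prod.distrib)
      finally show ?case using elim by simp
    qed
  qed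
qed

section \<open>Asymptotics of the generating function and of the operator expectations\<close>

locale sgf_asymp =
  fixes \<rho> :: "nat \<Rightarrow> (nat \<Rightarrow> int) pmf" and \<Psi> :: "complex \<Rightarrow> complex"
  assumes supp: "\<And>N. set_pmf (\<rho> N) \<subseteq> sig N"
    and analytic: "\<Psi> analytic_on {1}"
    and limit: "\<And>r. \<exists>d>0. \<exists>L :: nat \<Rightarrow> (nat \<Rightarrow> complex) \<Rightarrow> complex.
         (\<forall>N\<ge>r. continuous_on (nbhd_r r d) (L N) \<and> L N ones = 0 \<and>
            (\<forall>u\<in>nbhd_r r d. exp (L N u) = sgf N (\<rho> N) u)) \<and>
         uniform_limit (nbhd_r r d) (\<lambda>N u. L N u / of_nat N)
            (\<lambda>u. \<Sum>i\<in>{1..r}. \<Psi> (u i)) sequentially"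
begin

text \<open>One radius for everything that follows. Being an exponential, \<open>sgf\<close> does
  not vanish, which yields its uniform convergence; its holomorphy in each letter then makes the
  branch \<open>L\<close> holomorphic in each letter.\<close>

lemma asymp_setup:
  obtains d L where "0 < d" "d < 1" "\<Psi> holomorphic_on ball 1 (2 * d)"
    "\<And>N i. r \<le> N \<Longrightarrow> i \<in> {1..r} \<Longrightarrow> sephol r d i (L N)"
    "\<And>N i. r \<le> N \<Longrightarrow> i \<in> {1..r} \<Longrightarrow> sephol r d i (sgf N (\<rho> N))"
    "\<And>N u. r \<le> N \<Longrightarrow> u \<in> nbhd_r r d \<Longrightarrow> exp (L N u) = sgf N (\<rho> N) u"
    "\<And>N. r \<le> N \<Longrightarrow> sgf N (\<rho> N) ones = 1"
    "uniform_limit (nbhd_r r d) (\<lambda>N u. L N u / of_nat N) (\<lambda>u. \<Sum>i\<in>{1..r}. \<Psi> (u i)) sequentially"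
    "\<And>N. r \<le> N \<Longrightarrow> uniform_limit (nbhd_r r d) (\<lambda>F u. \<Sum>l\<in>F. sgf_term N (\<rho> N) l u) (sgf N (\<rho> N)) (finite_subsets_at_top (sig N))"
proof -
  obtain d0 L where d0: "d0 > 0" and L: "\<And>N. N \<ge> r \<Longrightarrow> continuous_on (nbhd_r r d0) (L N)"
     "\<And>N. N \<ge> r \<Longrightarrow> L N ones = 0" "\<And>N u. N \<ge> r \<Longrightarrow> u \<in> nbhd_r r d0 \<Longrightarrow> exp (L N u) = sgf N (\<rho> N) u"
     and ul: "uniform_limit (nbhd_r r d0) (\<lambda>N u. L N u / of_nat N) (\<lambda>u. \<Sum>i\<in>{1..r}. \<Psi> (u i)) sequentially"
    using limit[of r] by blast
  obtain e where e: "e > 0" "\<Psi> holomorphic_on ball 1 e" using analytic by (auto simp: analytic_on_def)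
  \<comment> \<open>Below \<open>d0\<close> to leave room for the corners, below 1 to keep
    coordinates away from 0, and at most half of a radius on which \<open>\<Psi>\<close> is
    holomorphic.\<close>
  define d where "d = min (d0 / 2) (min (1/2) (e / 2))"
  have d: "0 < d" "d < d0" "d < 1" "2 * d \<le> e" using d0 e by (auto simp: d_def)
  have sub: "nbhd_r r d \<subseteq> nbhd_r r d0" using d by (intro nbhd_r_mono) auto
  have ulS: "uniform_limit (nbhd_r r d) (\<lambda>F u. \<Sum>l\<in>F. sgf_term N (\<rho> N) l u) (sgf N (\<rho> N)) (finite_subsets_at_top (sig N))"
    if N: "r \<le> N" for N
  proof (rule sgf_uniform_limit[OF N d0])
    show "sgf N (\<rho> N) u \<noteq> 0" if "u \<in> nbhd_r r d0" for u using L(3)[OF N that] by (metis exp_not_eq_zero)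
  qed (use d in auto)
  have sepS: "sephol r d i (sgf N (\<rho> N))" if N: "r \<le> N" and i: "i \<in> {1..r}" for N i
  proof (rule sephol_uniform_limit[OF _ i _ finite_subsets_at_top_neq_bot])
    show "uniform_limit (nbhd_r r d) (\<lambda>F u. \<Sum>l\<in>F. of_real (pmf (\<rho> N) l) * norm_schur N l u) (sgf N (\<rho> N)) (finite_subsets_at_top (sig N))"
    proof (rule uniform_limit_cong[THEN iffD1, OF _ _ ulS[OF N]])
      have "eventually (\<lambda>F. finite F \<and> F \<subseteq> sig N) (finite_subsets_at_top (sig N))"
        by (rule eventually_finite_subsets_at_top_weakI) auto
      then show "eventually (\<lambda>F. \<forall>u\<in>nbhd_r r d. (\<Sum>l\<in>F. sgf_term N (\<rho> N) l u) =
           (\<Sum>l\<in>F. of_real (pmf (\<rho> N) l) * norm_schur N l u)) (finite_subsets_at_top (sig N))"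
        by eventually_elim (use d in \<open>auto intro!: sum.cong sgf_term_eq nbhd_r_nzpt[where d = d and r = r]\<close>)
    qed auto
    show "eventually (\<lambda>F. sephol r d i (\<lambda>u. \<Sum>l\<in>F. of_real (pmf (\<rho> N) l) * norm_schur N l u)) (finite_subsets_at_top (sig N))"
      using d by (intro always_eventually allI laurent_sephol laurent_sum laurent_mult laurent_const laurent_norm_schur) auto
  qed
  have ones: "ones \<in> nbhd_r r d0" using d0 by (simp add: nbhd_r_def ones_def)
  show thesis
  proof (rule that[of d L])
    show "\<Psi> holomorphic_on ball 1 (2 * d)" using e(2) by (rule holomorphic_on_subset) (use d in auto)
    show "sephol r d i (L N)" if "r \<le> N" "i \<in> {1..r}" for N i
      by (rule sephol_log[OF _ sepS[OF that] that(2)]) (use L that sub in \<open>auto intro: continuous_on_subset\<close>)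
    show "sgf N (\<rho> N) ones = 1" if "r \<le> N" for N using L(3)[OF that ones] L(2)[OF that] by simp
    show "uniform_limit (nbhd_r r d) (\<lambda>N u. L N u / of_nat N) (\<lambda>u. \<Sum>i\<in>{1..r}. \<Psi> (u i)) sequentially"
      using ul sub by (rule uniform_limit_on_subset)
  qed (use d sepS ulS L sub in auto)
qed

text \<open>With f_p the quotient of the p-th derivative of S by N^p S, differentiation gives
  f_(p+1) = (1/N) df_p + f_p d(L/N). The first summand tends to 0, the second to the next power of
  the derivative of \<open>\<Psi>\<close>. Each step differentiates a uniform limit once more and
  halves the radius.\<close>

lemma pd_sgf_asymp:
  assumes d: "0 < d" "d < 1" and \<Psi>: "\<Psi> holomorphic_on ball 1 (2 * d)"
    and L: "\<And>N. r \<le> N \<Longrightarrow> sephol r d i (L N)" and S: "\<And>N. r \<le> N \<Longrightarrow> sephol r d i (sgf N (\<rho> N))"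
    and eq: "\<And>N u. r \<le> N \<Longrightarrow> u \<in> nbhd_r r d \<Longrightarrow> exp (L N u) = sgf N (\<rho> N) u"
    and ul: "uniform_limit (nbhd_r r d) (\<lambda>N u. L N u / of_nat N) (\<lambda>u. \<Sum>i\<in>{1..r}. \<Psi> (u i)) sequentially"
    and i: "i \<in> {1..r}"
  shows "\<exists>e>0. e \<le> d \<and> uniform_limit (nbhd_r r e)
     (\<lambda>N u. pd p i (sgf N (\<rho> N)) u / (of_nat N ^ p * sgf N (\<rho> N) u)) (\<lambda>u. deriv \<Psi> (u i) ^ p) sequentially"
proof (induction p)
  case 0
  have "uniform_limit (nbhd_r r d) (\<lambda>N u. pd 0 i (sgf N (\<rho> N)) u / (of_nat N ^ 0 * sgf N (\<rho> N) u)) (\<lambda>u. deriv \<Psi> (u i) ^ 0) sequentially"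
  proof (rule uniform_limit_cong[THEN iffD1, OF _ _ uniform_limit_const[where c = "\<lambda>u. 1"]])
    show "eventually (\<lambda>N. \<forall>u\<in>nbhd_r r d. 1 = pd 0 i (sgf N (\<rho> N)) u / (of_nat N ^ 0 * sgf N (\<rho> N) u)) sequentially"
      using eventually_ge_at_top[of r]
    proof eventually_elim
      case (elim N)
      then have "sgf N (\<rho> N) u \<noteq> 0" if "u \<in> nbhd_r r d" for u using eq[OF elim that] by (metis exp_not_eq_zero)
      then show ?case by (simp add: pd_def)
    qed
  qed auto
  then show ?case using d by (intro exI[of _ d]) auto
next
  case (Suc p)
  then obtain e where e: "e > 0" "e \<le> d" and IH: "uniform_limit (nbhd_r r e)
     (\<lambda>N u. pd p i (sgf N (\<rho> N)) u / (of_nat N ^ p * sgf N (\<rho> N) u)) (\<lambda>u. deriv \<Psi> (u i) ^ p) sequentially" by blast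
  define f where "f N u = pd p i (sgf N (\<rho> N)) u / (of_nat N ^ p * sgf N (\<rho> N) u)" for N u
  define G where "G N u = L N u / of_nat N" for N u
  have nz: "sgf N (\<rho> N) u \<noteq> 0" if "r \<le> N" "u \<in> nbhd_r r d" for N u using eq[OF that] by (metis exp_not_eq_zero)
  have upd: "u(i := z) \<in> nbhd_r r d" if "u \<in> nbhd_r r e" "z \<in> ball 1 d" for u z
    using that e i by (intro nbhd_r_upd[of u r e]) (auto simp: dist_norm norm_minus_commute)
  have sub: "nbhd_r r e \<subseteq> nbhd_r r d" using e by (intro nbhd_r_mono) auto
  have sub2: "nbhd_r r (e/2) \<subseteq> nbhd_r r e" "nbhd_r r (e/2) \<subseteq> nbhd_r r (d/2)" using e by (intro nbhd_r_mono; simp)+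
  have f_upd: "f N (u(i := z)) = (deriv ^^ p) (\<lambda>z. sgf N (\<rho> N) (u(i := z))) z / (of_nat N ^ p * sgf N (\<rho> N) (u(i := z)))" for N u z
    by (simp add: f_def pd_def)
  have hs: "(\<lambda>z. sgf N (\<rho> N) (u(i := z))) holomorphic_on ball 1 d" if "r \<le> N" "u \<in> nbhd_r r e" for N u
    using S[OF that(1)] that(2) sub unfolding sephol_def by blast
  have sepf: "eventually (\<lambda>N. sephol r e i (f N)) sequentially"
    using eventually_ge_at_top[of r] eventually_gt_at_top[of 0]
  proof eventually_elim
    case (elim N)
    show ?case unfolding sephol_def f_upd
    proof
      fix u assume u: "u \<in> nbhd_r r e"
      have "(\<lambda>z. (deriv ^^ p) (\<lambda>z. sgf N (\<rho> N) (u(i := z))) z / (of_nat N ^ p * sgf N (\<rho> N) (u(i := z)))) holomorphic_on ball 1 d"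
      proof (intro holomorphic_on_divide holomorphic_on_mult holomorphic_on_const holomorphic_higher_deriv hs elim u)
        show "of_nat N ^ p * sgf N (\<rho> N) (u(i := z)) \<noteq> 0" if "z \<in> ball 1 d" for z
          using nz[OF elim(1) upd[OF u that]] elim by simp
      qed auto
      then show "(\<lambda>z. (deriv ^^ p) (\<lambda>z. sgf N (\<rho> N) (u(i := z))) z / (of_nat N ^ p * sgf N (\<rho> N) (u(i := z)))) holomorphic_on ball 1 e"
        by (rule holomorphic_on_subset) (use e in auto)
    qed
  qed
  have rec: "pd (Suc p) i (sgf N (\<rho> N)) u / (of_nat N ^ Suc p * sgf N (\<rho> N) u) =
      1 / of_nat N * pd 1 i (f N) u + f N u * pd 1 i (G N) u"
    if N: "r \<le> N" "0 < N" and u: "u \<in> nbhd_r r e" for N u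
  proof -
    let ?s = "\<lambda>z. sgf N (\<rho> N) (u(i := z))"
    let ?l = "\<lambda>z. L N (u(i := z))"
    have ui: "u i \<in> ball 1 d" using u i e by (force simp: nbhd_r_def dist_norm norm_minus_commute)
    have s_nz: "?s (u i) \<noteq> 0" using nz[OF N(1), of u] u sub by auto
    have ds: "((deriv ^^ q) ?s has_field_derivative (deriv ^^ Suc q) ?s (u i)) (at (u i))" for q
      using has_field_derivative_higher_deriv[OF hs[OF N(1) u] _ ui, of q] by simp
    have hl: "?l holomorphic_on ball 1 d" using L[OF N(1)] u sub unfolding sephol_def by blast
    have dl: "(?l has_field_derivative deriv ?l (u i)) (at (u i))"
      using holomorphic_derivI[OF hl _ ui] by simp
    have "((\<lambda>z. exp (?l z)) has_field_derivative exp (?l (u i)) * deriv ?l (u i)) (at (u i))"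
      using dl by (auto intro!: derivative_eq_intros)
    then have "(?s has_field_derivative exp (?l (u i)) * deriv ?l (u i)) (at (u i))"
      by (rule has_field_derivative_transform_within_open[where S = "ball 1 d"]) (use ui eq[OF N(1)] upd[OF u] in auto)
    moreover have "exp (?l (u i)) = ?s (u i)" using eq[OF N(1), of u] u sub by auto
    ultimately have s1: "deriv ?s (u i) = ?s (u i) * deriv ?l (u i)" by (simp add: DERIV_imp_deriv)
    have e1: "pd 1 i (G N) u = deriv ?l (u i) / of_nat N"
      unfolding pd_def G_def using DERIV_cdivide[OF dl, of "of_nat N"] by (simp add: DERIV_imp_deriv)
    have e2: "pd 1 i (f N) u = ((deriv ^^ Suc p) ?s (u i) * (of_nat N ^ p * ?s (u i)) - (deriv ^^ p) ?s (u i) * (of_nat N ^ p * deriv ?s (u i)))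
        / ((of_nat N ^ p * ?s (u i)) * (of_nat N ^ p * ?s (u i)))"
    proof -
      have "((\<lambda>z. of_nat N ^ p * ?s z) has_field_derivative of_nat N ^ p * deriv ?s (u i)) (at (u i))"
        using DERIV_cmult[OF ds[of 0], of "of_nat N ^ p"] by simp
      from DERIV_divide[OF ds[of p] this] s_nz N(2)
      show ?thesis unfolding pd_def f_upd by (simp add: DERIV_imp_deriv)
    qed
    have e3: "f N u = (deriv ^^ p) ?s (u i) / (of_nat N ^ p * ?s (u i))"
      and e4: "pd (Suc p) i (sgf N (\<rho> N)) u / (of_nat N ^ Suc p * sgf N (\<rho> N) u) =
         (deriv ^^ Suc p) ?s (u i) / (of_nat N * of_nat N ^ p * ?s (u i))"
      by (simp_all add: f_def pd_def)
    have alg: "X / (n * q * s) = 1 / n * ((X * (q * s) - P * (q * (s * l))) / ((q * s) * (q * s))) + P / (q * s) * (l / n)"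
      if "n \<noteq> 0" "q \<noteq> 0" "s \<noteq> 0" for X P s l n q :: complex
      using that by (simp add: field_simps)
    show ?thesis unfolding e1 e2 e3 e4 s1 by (rule alg) (use s_nz N(2) in auto)
  qed
  have l1: "uniform_limit (nbhd_r r (e/2)) (\<lambda>N. pd 1 i (f N)) (pd 1 i (\<lambda>u. deriv \<Psi> (u i) ^ p)) sequentially"
    by (rule pd_uniform_limit[OF sepf i]) (use IH e in \<open>auto simp: f_def[abs_def]\<close>)
  have "eventually (\<lambda>N. sephol r d i (G N)) sequentially"
    using eventually_ge_at_top[of r]
    by eventually_elim (use L in \<open>auto simp: sephol_def G_def intro!: holomorphic_intros\<close>)
  then have "uniform_limit (nbhd_r r (d/2)) (\<lambda>N. pd 1 i (G N)) (pd 1 i (\<lambda>u. \<Sum>i\<in>{1..r}. \<Psi> (u i))) sequentially"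
    by (rule pd_uniform_limit[OF _ i]) (use ul d in \<open>auto simp: G_def[abs_def]\<close>)
  then have "uniform_limit (nbhd_r r (e/2)) (\<lambda>N. pd 1 i (G N)) (pd 1 i (\<lambda>u. \<Sum>i\<in>{1..r}. \<Psi> (u i))) sequentially"
    using sub2(2) by (rule uniform_limit_on_subset)
  then have l2: "uniform_limit (nbhd_r r (e/2)) (\<lambda>N. pd 1 i (G N)) (\<lambda>u. deriv \<Psi> (u i)) sequentially"
  proof (rule uniform_limit_cong[THEN iffD1, rotated 2])
    fix u assume u: "u \<in> nbhd_r r (e/2)"
    have ui: "u i \<in> ball 1 (2 * d)" using u i e by (force simp: nbhd_r_def dist_norm norm_minus_commute)
    have "(\<lambda>z. \<Sum>j\<in>{1..r}. \<Psi> ((u(i := z)) j)) = (\<lambda>z. \<Psi> z + (\<Sum>j\<in>{1..r}-{i}. \<Psi> (u j)))"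
    proof
      fix z
      have "(\<Sum>j\<in>{1..r}. \<Psi> ((u(i := z)) j)) = \<Psi> z + (\<Sum>j\<in>{1..r}-{i}. \<Psi> ((u(i := z)) j))"
        using i by (subst sum.remove[of _ i]) auto
      also have "(\<Sum>j\<in>{1..r}-{i}. \<Psi> ((u(i := z)) j)) = (\<Sum>j\<in>{1..r}-{i}. \<Psi> (u j))" by (intro sum.cong) auto
      finally show "(\<Sum>j\<in>{1..r}. \<Psi> ((u(i := z)) j)) = \<Psi> z + (\<Sum>j\<in>{1..r}-{i}. \<Psi> (u j))" .
    qed
    moreover have "((\<lambda>z. \<Psi> z + (\<Sum>j\<in>{1..r}-{i}. \<Psi> (u j))) has_field_derivative deriv \<Psi> (u i) + 0) (at (u i))"
      by (intro DERIV_add DERIV_const holomorphic_derivI[OF \<Psi> _ ui]) auto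
    ultimately show "pd 1 i (\<lambda>u. \<Sum>i\<in>{1..r}. \<Psi> (u i)) u = deriv \<Psi> (u i)"
      by (simp add: pd_def DERIV_imp_deriv)
  qed auto
  have bdd: "bounded ((\<lambda>u. h (u i)) ` nbhd_r r (e/2))" if h: "h holomorphic_on ball 1 (2 * d)" for h
  proof (rule bounded_subset)
    have "continuous_on (cball 1 (e/2)) h"
      by (rule holomorphic_on_imp_continuous_on, rule holomorphic_on_subset[OF h]) (use e in auto)
    then show "bounded (h ` cball 1 (e/2))" by (intro compact_imp_bounded compact_continuous_image) auto
    show "(\<lambda>u. h (u i)) ` nbhd_r r (e/2) \<subseteq> h ` cball 1 (e/2)"
      using i by (force simp: nbhd_r_def dist_norm norm_minus_commute)
  qed
  have h\<Psi>: "(\<lambda>z. deriv \<Psi> z ^ p) holomorphic_on ball 1 (2 * d)" "deriv \<Psi> holomorphic_on ball 1 (2 * d)"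
    by (intro holomorphic_intros \<Psi> | simp)+
  have "uniform_limit (nbhd_r r (e/2)) (\<lambda>N u. 1 / of_nat N * pd 1 i (f N) u + f N u * pd 1 i (G N) u)
      (\<lambda>u. 0 * pd 1 i (\<lambda>u. deriv \<Psi> (u i) ^ p) u + deriv \<Psi> (u i) ^ p * deriv \<Psi> (u i)) sequentially"
  proof (intro uniform_limit_add uniform_lim_mult l1 l2)
    show "uniform_limit (nbhd_r r (e/2)) (\<lambda>N u. 1 / of_nat N :: complex) (\<lambda>u. 0) sequentially"
    proof (rule uniform_limitI)
      fix \<epsilon> :: real assume "\<epsilon> > 0"
      then have "eventually (\<lambda>N. dist (1 / of_nat N :: complex) 0 < \<epsilon>) sequentially"
        using tendstoD[OF lim_1_over_n, of \<epsilon>] by simp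
      then show "eventually (\<lambda>N. \<forall>u\<in>nbhd_r r (e/2). dist (1 / of_nat N :: complex) 0 < \<epsilon>) sequentially"
        by eventually_elim auto
    qed
    show "uniform_limit (nbhd_r r (e/2)) f (\<lambda>u. deriv \<Psi> (u i) ^ p) sequentially"
      using IH sub2(1) unfolding f_def[abs_def] by (rule uniform_limit_on_subset)
    show "bounded ((\<lambda>u. deriv \<Psi> (u i) ^ p) ` nbhd_r r (e/2))" using bdd[OF h\<Psi>(1)] by simp
    show "bounded ((\<lambda>u. deriv \<Psi> (u i)) ` nbhd_r r (e/2))" using bdd[OF h\<Psi>(2)] by simp
    have "pd 1 i (\<lambda>u. deriv \<Psi> (u i) ^ p) = (\<lambda>u. deriv (\<lambda>z. deriv \<Psi> z ^ p) (u i))"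
      by (simp add: pd_def fun_eq_iff)
    then show "bounded (pd 1 i (\<lambda>u. deriv \<Psi> (u i) ^ p) ` nbhd_r r (e/2))"
      using bdd[of "deriv (\<lambda>z. deriv \<Psi> z ^ p)"] h\<Psi>(1) by (simp add: holomorphic_deriv)
    show "bounded ((\<lambda>u. 0) ` nbhd_r r (e/2))" by (auto simp: image_constant_conv)
  qed
  then have "uniform_limit (nbhd_r r (e/2)) (\<lambda>N u. pd (Suc p) i (sgf N (\<rho> N)) u / (of_nat N ^ Suc p * sgf N (\<rho> N) u))
      (\<lambda>u. deriv \<Psi> (u i) ^ Suc p) sequentially"
  proof (rule uniform_limit_cong[THEN iffD1, rotated 2])
    show "eventually (\<lambda>N. \<forall>u\<in>nbhd_r r (e/2). 1 / of_nat N * pd 1 i (f N) u + f N u * pd 1 i (G N) u =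
        pd (Suc p) i (sgf N (\<rho> N)) u / (of_nat N ^ Suc p * sgf N (\<rho> N) u)) sequentially"
      using eventually_ge_at_top[of r] eventually_gt_at_top[of 0]
      by eventually_elim (use rec sub2 in auto)
  qed auto
  then show ?case using e by (intro exI[of _ "e/2"]) auto
qed


text \<open>The limit of the normalised expectation for the weight \<open>\<phi>\<close>. The
  coefficient is (k choose m) m! from the Leibniz rule, times 1/(m+1)! from the number of
  (m+1)-sets, times 1/m! from the confluent divided difference.\<close>

definition mom :: "(complex \<Rightarrow> complex) \<Rightarrow> nat \<Rightarrow> complex" where
  "mom \<phi> k = (\<Sum>m\<le>k. of_nat (k choose m) / fact (Suc m) *
     (deriv ^^ m) (\<lambda>u. \<phi> u * u ^ k * deriv \<Psi> u ^ (k - m)) 1)"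

text \<open>On the circle the integrand, scaled by N^(k-m), converges uniformly to 1/t times a
  divided difference of h(u) = phi(u) u^k Psi'(u)^(k-m). The divided difference extends to t = 0
  with value the m-th derivative of h over m!, and Cauchy's formula extracts it.\<close>

lemma symq_lim_asymp:
  assumes \<phi>: "\<phi> holomorphic_on ball 1 s" "s > 0" and m: "m \<le> k"
  shows "\<exists>a. (\<forall>N\<ge>Suc m. ((\<lambda>l. of_real (pmf (\<rho> N) l) * symq_lim \<phi> k m (norm_schur N l)) has_sum a N) (sig N)) \<and>
     (\<lambda>N. a N / of_nat N ^ (k - m)) \<longlonglongrightarrow> (deriv ^^ m) (\<lambda>u. \<phi> u * u ^ k * deriv \<Psi> u ^ (k - m)) 1 / fact m"
proof -
  define r where "r = Suc m"
  define p where "p = k - m"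
  let ?S = "\<lambda>N. sgf N (\<rho> N)"
  show ?thesis
  proof (rule asymp_setup[where r = r])
  fix d L assume d: "0 < d" "d < 1" and \<Psi>: "\<Psi> holomorphic_on ball 1 (2 * d)"
    and L: "\<And>N i. r \<le> N \<Longrightarrow> i \<in> {1..r} \<Longrightarrow> sephol r d i (L N)"
    and S: "\<And>N i. r \<le> N \<Longrightarrow> i \<in> {1..r} \<Longrightarrow> sephol r d i (?S N)"
    and eq: "\<And>N u. r \<le> N \<Longrightarrow> u \<in> nbhd_r r d \<Longrightarrow> exp (L N u) = ?S N u"
    and S1: "\<And>N. r \<le> N \<Longrightarrow> ?S N ones = 1"
    and ul: "uniform_limit (nbhd_r r d) (\<lambda>N u. L N u / of_nat N) (\<lambda>u. \<Sum>i\<in>{1..r}. \<Psi> (u i)) sequentially"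
    and ulS: "\<And>N. r \<le> N \<Longrightarrow> uniform_limit (nbhd_r r d) (\<lambda>F u. \<Sum>l\<in>F. sgf_term N (\<rho> N) l u) (?S N) (finite_subsets_at_top (sig N))"
  have nz: "?S N u \<noteq> 0" if "r \<le> N" "u \<in> nbhd_r r d" for N u using eq[OF that] by (metis exp_not_eq_zero)
  have "\<forall>i\<in>{1..r}. \<exists>e>0. e \<le> d \<and> uniform_limit (nbhd_r r e)
     (\<lambda>N u. pd p i (?S N) u / (of_nat N ^ p * ?S N u)) (\<lambda>u. deriv \<Psi> (u i) ^ p) sequentially"
    using pd_sgf_asymp[OF d \<Psi> L S eq ul] by blast
  then obtain e where e: "\<forall>i\<in>{1..r}. e i > 0 \<and> e i \<le> d \<and> uniform_limit (nbhd_r r (e i))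
     (\<lambda>N u. pd p i (?S N) u / (of_nat N ^ p * ?S N u)) (\<lambda>u. deriv \<Psi> (u i) ^ p) sequentially"
    by (rule bchoice[THEN exE])
  define E where "E = Min (e ` {1..r})"
  have ne: "finite (e ` {1..r})" "e ` {1..r} \<noteq> {}" by (auto simp: r_def)
  have E: "E > 0" using e ne by (simp add: E_def)
  have Ele: "E \<le> e i" if "i \<in> {1..r}" for i using that ne by (auto simp: E_def)
  have Ed: "E \<le> d"
  proof -
    have "1 \<in> {1..r}" by (simp add: r_def)
    then show ?thesis using Ele[of 1] e by fastforce
  qed
  have ulE: "uniform_limit (nbhd_r r E) (\<lambda>N u. pd p i (?S N) u / (of_nat N ^ p * ?S N u)) (\<lambda>u. deriv \<Psi> (u i) ^ p) sequentially"
    if "i \<in> {1..r}" for i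
    using e that nbhd_r_mono[OF Ele[OF that], of r] uniform_limit_on_subset by blast
  \<comment> \<open>Among the first r letters the line moves by at most r |t|, so this radius keeps
    it in all the neighbourhoods that occur.\<close>
  define R where "R = min (E / 2) s / real r"
  define \<delta> where "\<delta> = R / 2"
  have r0: "real r > 0" by (simp add: r_def)
  have rR: "real r * R = min (E / 2) s" using r0 by (simp add: R_def)
  have R0: "R > 0" using E \<phi>(2) r0 by (simp add: R_def)
  have R: "0 < \<delta>" "\<delta> < R" "real r * R \<le> d / 2" "real r * R \<le> s" "real r * R \<le> E"
    using E Ed R0 by (auto simp: \<delta>_def rR)
  define J where "J N t = symq \<phi> k p (?S N) {1..r} (linc r t) / ?S N (linc r t) / t" for N t
  define a where "a N = contour_integral (circlepath 0 \<delta>) (J N) / (2 * of_real pi * \<i>)" for N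
  have main: "((\<lambda>l. of_real (pmf (\<rho> N) l) * symq_lim \<phi> k m (norm_schur N l)) has_sum a N) (sig N) \<and> J N contour_integrable_on circlepath 0 \<delta>"
    if N: "r \<le> N" for N
    unfolding a_def J_def[abs_def] r_def p_def
    by (rule symq_lim_has_sum[OF _ m \<phi> d(1) _ ulS[OF N, unfolded r_def] _ _ R(1-4)[unfolded r_def]])
       (use N d nz[OF N] S1[OF N] in \<open>auto simp: r_def\<close>)
  have linc_nb: "linc r t \<in> nbhd_r r E" if "t \<in> ball 0 R" for t
    using that R E by (intro linc_nbhd[of _ R]) auto
  have linc_ball: "linc r t i \<in> ball 1 s \<inter> ball 1 (2 * d)" if "t \<in> ball 0 R" for t i
  proof (cases "i \<in> {1..r}")
    case True
    have "linc r t \<in> nbhd_r r s" using that R \<phi>(2) by (intro linc_nbhd[of _ R]) auto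
    moreover have "linc r t \<in> nbhd_r r (2 * d)" using linc_nb[OF that] nbhd_r_mono[of E "2*d" r] Ed d by auto
    ultimately show ?thesis using True by (auto simp: nbhd_r_def dist_norm norm_minus_commute)
  qed (use \<phi>(2) d in \<open>auto simp: linc_def\<close>)
  define h where "h u = \<phi> u * u ^ k * deriv \<Psi> u ^ p" for u
  define s' where "s' = min s (2 * d)"
  have s': "s' > 0" using \<phi>(2) d by (simp add: s'_def)
  have ball_s': "ball (1::complex) s' = ball 1 s \<inter> ball 1 (2 * d)" by (auto simp: s'_def)
  have holh: "h holomorphic_on ball 1 s'" unfolding h_def ball_s'
  proof (intro holomorphic_on_mult holomorphic_on_power holomorphic_on_ident)
    show "\<phi> holomorphic_on ball 1 s \<inter> ball 1 (2 * d)" using \<phi>(1) by (rule holomorphic_on_subset) auto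
    have "deriv \<Psi> holomorphic_on ball 1 (2 * d)" by (rule holomorphic_deriv[OF \<Psi>]) auto
    then show "deriv \<Psi> holomorphic_on ball 1 s \<inter> ball 1 (2 * d)" by (rule holomorphic_on_subset) auto
  qed
  define y where "y t = (\<Sum>i\<in>{1..r}. h (linc r t i) / (\<Prod>j\<in>{1..r}-{i}. linc r t i - linc r t j))" for t
  have sph: "t \<in> ball 0 R \<and> t \<noteq> 0" if "t \<in> sphere 0 \<delta>" for t :: complex using that R by auto
  have comp: "(\<lambda>t. f (linc r t i)) holomorphic_on ball 0 R" if "f holomorphic_on ball 1 s'" for f i
    using holomorphic_on_compose_gen[OF linc_holomorphic that, of r i "ball 0 R"] linc_ball
    by (auto simp: o_def image_subset_iff ball_s')
  have "((\<lambda>t. y t / t) has_contour_integral 2 * of_real pi * \<i> * ((deriv ^^ m) h 1 / fact m)) (circlepath 0 \<delta>)"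
  proof (rule cauchy_removable_at_0[OF _ _ R(1,2)])
    show "y holomorphic_on ball 0 R - {0}" unfolding y_def
    proof (intro holomorphic_on_sum holomorphic_on_divide holomorphic_on_prod holomorphic_on_diff linc_holomorphic)
      show "(\<lambda>t. h (linc r t i)) holomorphic_on ball 0 R - {0}" for i
        using comp[OF holh] by (rule holomorphic_on_subset) auto
      fix i t assume "i \<in> {1..r}" "t \<in> ball 0 R - {0::complex}"
      then show "(\<Prod>j\<in>{1..r}-{i}. linc r t i - linc r t j) \<noteq> 0" using linc_diff_nz[of i r _ t] by simp
    qed
    show "(y \<longlongrightarrow> (deriv ^^ m) h 1 / fact m) (at 0)"
      unfolding y_def r_def by (rule divided_difference_tendsto[OF holh s'])
  qed
  then have yint: "contour_integral (circlepath 0 \<delta>) (\<lambda>t. y t / t) = 2 * of_real pi * \<i> * ((deriv ^^ m) h 1 / fact m)"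
    by (rule contour_integral_unique)
  have ulJ: "uniform_limit (sphere 0 \<delta>) (\<lambda>N t. J N t / of_nat N ^ p) (\<lambda>t. y t / t) sequentially"
  proof -
    define C where "C i t = \<phi> (linc r t i) * linc r t i ^ k / (\<Prod>j\<in>{1..r}-{i}. linc r t i - linc r t j) / t" for i t
    have "uniform_limit (sphere 0 \<delta>) (\<lambda>N t. \<Sum>i\<in>{1..r}. C i t * (pd p i (?S N) (linc r t) / (of_nat N ^ p * ?S N (linc r t))))
       (\<lambda>t. \<Sum>i\<in>{1..r}. C i t * deriv \<Psi> (linc r t i) ^ p) sequentially"
    proof (intro uniform_limit_finite_sum uniform_limit_bounded_mult)
      fix i assume i: "i \<in> {1..r}"
      show "uniform_limit (sphere 0 \<delta>) (\<lambda>N t. pd p i (?S N) (linc r t) / (of_nat N ^ p * ?S N (linc r t)))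
         (\<lambda>t. deriv \<Psi> (linc r t i) ^ p) sequentially"
        using ulE[OF i] by (rule uniform_limit_compose') (use linc_nb sph in auto)
      have "\<phi> holomorphic_on ball 1 s'" using \<phi>(1) by (rule holomorphic_on_subset) (auto simp: s'_def)
      then have "(\<lambda>t. \<phi> (linc r t i)) holomorphic_on ball 0 R" by (rule comp)
      then have c1: "continuous_on (sphere 0 \<delta>) (\<lambda>t. \<phi> (linc r t i))"
        using holomorphic_on_imp_continuous_on continuous_on_subset sph by (metis subsetI)
      have c2: "continuous_on (sphere 0 \<delta>) (\<lambda>t. linc r t j)" for j
        using linc_holomorphic holomorphic_on_imp_continuous_on by blast
      have "continuous_on (sphere 0 \<delta>) (C i)" unfolding C_def
        by (intro continuous_intros c1 c2) (use linc_diff_nz[OF i] sph in \<open>auto simp: prod_zero_iff\<close>)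
      then show "bounded (C i ` sphere 0 \<delta>)" by (intro compact_imp_bounded compact_continuous_image) auto
    qed
    moreover have "(\<Sum>i\<in>{1..r}. C i t * (pd p i (?S N) (linc r t) / (of_nat N ^ p * ?S N (linc r t)))) = J N t / of_nat N ^ p" for N t
      unfolding J_def symq_def C_def sum_divide_distrib by (intro sum.cong refl) (simp add: field_simps)
    moreover have "(\<Sum>i\<in>{1..r}. C i t * deriv \<Psi> (linc r t i) ^ p) = y t / t" for t
      unfolding y_def h_def C_def sum_divide_distrib by (intro sum.cong refl) (simp add: field_simps)
    ultimately show ?thesis by simp
  qed
  have "(\<lambda>N. contour_integral (circlepath 0 \<delta>) (\<lambda>t. J N t / of_nat N ^ p)) \<longlonglongrightarrow> contour_integral (circlepath 0 \<delta>) (\<lambda>t. y t / t)"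
  proof (rule contour_integral_uniform_limit_circlepath(2)[OF _ ulJ _ R(1)])
    show "eventually (\<lambda>N. (\<lambda>t. J N t / of_nat N ^ p) contour_integrable_on circlepath 0 \<delta>) sequentially"
      using eventually_ge_at_top[of r] by eventually_elim (use main contour_integrable_div in blast)
  qed auto
  then have "(\<lambda>N. contour_integral (circlepath 0 \<delta>) (J N) / of_nat N ^ p) \<longlonglongrightarrow> contour_integral (circlepath 0 \<delta>) (\<lambda>t. y t / t)"
  proof (rule Lim_transform_eventually)
    show "eventually (\<lambda>N. contour_integral (circlepath 0 \<delta>) (\<lambda>t. J N t / of_nat N ^ p) =
       contour_integral (circlepath 0 \<delta>) (J N) / of_nat N ^ p) sequentially"
      using eventually_ge_at_top[of r] by eventually_elim (use main contour_integral_div in blast)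
  qed
  then have "(\<lambda>N. contour_integral (circlepath 0 \<delta>) (J N) / of_nat N ^ p / (2 * of_real pi * \<i>)) \<longlonglongrightarrow>
      2 * of_real pi * \<i> * ((deriv ^^ m) h 1 / fact m) / (2 * of_real pi * \<i>)"
    unfolding yint by (intro tendsto_divide tendsto_const) auto
  then have "(\<lambda>N. a N / of_nat N ^ p) \<longlonglongrightarrow> (deriv ^^ m) h 1 / fact m"
    unfolding a_def by (simp add: mult_ac)
  then show ?thesis using main unfolding h_def p_def r_def by blast
  qed
qed

lemma has_sum_finite_sum:
  fixes f :: "'i \<Rightarrow> 'a \<Rightarrow> complex"
  assumes "\<And>m. m \<in> M \<Longrightarrow> (f m has_sum a m) A"
  shows "((\<lambda>x. \<Sum>m\<in>M. f m x) has_sum (\<Sum>m\<in>M. a m)) A"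
  using assms by (induction M rule: infinite_finite_induct) (auto intro!: has_sum_add)

lemma mom_asymp:
  assumes \<phi>: "\<phi> holomorphic_on ball 1 s" "s > 0"
  shows "\<exists>a. (\<forall>N\<ge>Suc k. ((\<lambda>l. of_real (pmf (\<rho> N) l) *
        (\<Sum>m\<le>k. of_nat (k choose m) * fact m * (of_nat (N choose Suc m) * symq_lim \<phi> k m (norm_schur N l)))) has_sum a N) (sig N)) \<and>
     (\<lambda>N. a N / of_nat N ^ Suc k) \<longlonglongrightarrow> mom \<phi> k"
proof -
  let ?D = "\<lambda>m. (deriv ^^ m) (\<lambda>u. \<phi> u * u ^ k * deriv \<Psi> u ^ (k - m)) 1"
  have "\<forall>m\<in>{..k}. \<exists>a. (\<forall>N\<ge>Suc m. ((\<lambda>l. of_real (pmf (\<rho> N) l) * symq_lim \<phi> k m (norm_schur N l)) has_sum a N) (sig N)) \<and>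
     (\<lambda>N. a N / of_nat N ^ (k - m)) \<longlonglongrightarrow> ?D m / fact m"
    using symq_lim_asymp[OF \<phi>] by auto
  then obtain b where b: "\<forall>m\<in>{..k}. (\<forall>N\<ge>Suc m. ((\<lambda>l. of_real (pmf (\<rho> N) l) * symq_lim \<phi> k m (norm_schur N l)) has_sum b m N) (sig N)) \<and>
     (\<lambda>N. b m N / of_nat N ^ (k - m)) \<longlonglongrightarrow> ?D m / fact m"
    by (rule bchoice[THEN exE])
  define a where "a N = (\<Sum>m\<le>k. (of_nat (k choose m) * fact m * of_nat (N choose Suc m)) * b m N)" for N
  have "((\<lambda>l. of_real (pmf (\<rho> N) l) *
        (\<Sum>m\<le>k. of_nat (k choose m) * fact m * (of_nat (N choose Suc m) * symq_lim \<phi> k m (norm_schur N l)))) has_sum a N) (sig N)"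
    if N: "N \<ge> Suc k" for N
  proof -
    have "((\<lambda>l. \<Sum>m\<le>k. (of_nat (k choose m) * fact m * of_nat (N choose Suc m)) * (of_real (pmf (\<rho> N) l) * symq_lim \<phi> k m (norm_schur N l)))
       has_sum a N) (sig N)"
      unfolding a_def by (intro has_sum_finite_sum has_sum_cmult_right) (use b N in auto)
    then show ?thesis by (simp add: sum_distrib_left mult_ac)
  qed
  moreover have "(\<lambda>N. a N / of_nat N ^ Suc k) \<longlonglongrightarrow> mom \<phi> k"
  proof -
    have "(\<lambda>N. \<Sum>m\<le>k. of_nat (k choose m) * fact m * (of_nat (N choose Suc m) / of_nat N ^ Suc m) * (b m N / of_nat N ^ (k - m))) \<longlonglongrightarrow>
       (\<Sum>m\<le>k. of_nat (k choose m) * fact m * (1 / fact (Suc m)) * (?D m / fact m))"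
      by (intro tendsto_sum tendsto_mult tendsto_const binomial_asymp) (use b in auto)
    moreover have "(\<Sum>m\<le>k. of_nat (k choose m) * fact m * (of_nat (N choose Suc m) / of_nat N ^ Suc m) * (b m N / of_nat N ^ (k - m))) =
       a N / of_nat N ^ Suc k" for N
      unfolding a_def sum_divide_distrib
    proof (rule sum.cong[OF refl])
      fix m assume "m \<in> {..k}"
      then have "Suc k = Suc m + (k - m)" by simp
      then have "(of_nat N :: complex) ^ Suc k = of_nat N ^ Suc m * of_nat N ^ (k - m)" by (metis power_add)
      then show "of_nat (k choose m) * fact m * (of_nat (N choose Suc m) / of_nat N ^ Suc m) * (b m N / of_nat N ^ (k - m)) =
         of_nat (k choose m) * fact m * of_nat (N choose Suc m) * b m N / of_nat N ^ Suc k"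
        by (simp only: times_divide_eq_right times_divide_eq_left divide_divide_eq_left mult_ac)
    qed
    moreover have "(\<Sum>m\<le>k. of_nat (k choose m) * fact m * (1 / fact (Suc m)) * (?D m / fact m)) = mom \<phi> k"
      unfolding mom_def by (intro sum.cong refl) simp
    ultimately show ?thesis by simp
  qed
  ultimately show ?thesis by blast
qed

end

section \<open>From falling factorials to powers\<close>

lemma ffall_Suc_mult: "of_int x * ffall x a = ffall x (Suc a) + of_nat a * ffall x a"
  by (simp add: ffall_def algebra_simps)

lemma power_eq_sum_ffall: "\<exists>c :: nat \<Rightarrow> complex. c k = 1 \<and> (\<forall>x. of_int x ^ k = (\<Sum>a\<le>k. c a * ffall x a))"
proof (induction k)
  case 0
  show ?case by (intro exI[of _ "\<lambda>_. 1"]) (simp add: ffall_def)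
next
  case (Suc k)
  then obtain c where c: "c k = 1" "\<And>x. of_int x ^ k = (\<Sum>a\<le>k. c a * ffall x a)" by blast
  \<comment> \<open>The recursion of the Stirling numbers of the second kind, coming from
    \<open>ffall_Suc_mult\<close>.\<close>
  define c' where "c' a = (if a = 0 then 0 else c (a - 1)) + (if a \<le> k then of_nat a * c a else 0)" for a
  have "of_int x ^ Suc k = (\<Sum>a\<le>Suc k. c' a * ffall x a)" for x
  proof -
    have "of_int x ^ Suc k = (\<Sum>a\<le>k. c a * (of_int x * ffall x a))"
      by (simp add: c(2) sum_distrib_left mult_ac)
    also have "\<dots> = (\<Sum>a\<le>k. c a * ffall x (Suc a)) + (\<Sum>a\<le>k. of_nat a * c a * ffall x a)"
      unfolding ffall_Suc_mult sum.distrib[symmetric] by (intro sum.cong refl) (simp add: algebra_simps)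
    also have "(\<Sum>a\<le>k. c a * ffall x (Suc a)) = (\<Sum>a\<le>Suc k. (if a = 0 then 0 else c (a - 1)) * ffall x a)"
      by (subst sum.atMost_Suc_shift) simp
    also have "(\<Sum>a\<le>k. of_nat a * c a * ffall x a) = (\<Sum>a\<le>Suc k. (if a \<le> k then of_nat a * c a else 0) * ffall x a)"
      by (simp add: sum.atMost_Suc)
    finally show ?thesis by (simp add: c'_def sum.distrib[symmetric] distrib_right del: sum.atMost_Suc)
  qed
  moreover have "c' (Suc k) = 1" using c(1) by (simp add: c'_def)
  ultimately show ?case by blast
qed

context sgf_asymp
begin

text \<open>A power is a monic combination of falling factorials, and the expectation with index a
  has order at most N^(a+1): after division by N^(k+1) only a = k survives. The weight
  \<open>W\<close> covers the plain and the logarithmic case at once.\<close>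

lemma power_moment_asymp:
  fixes W :: "nat \<Rightarrow> (nat \<Rightarrow> int) \<Rightarrow> nat \<Rightarrow> complex"
  assumes "\<And>a. \<exists>A. (\<forall>N\<ge>Suc a. ((\<lambda>l. of_real (pmf (\<rho> N) l) * (\<Sum>j\<in>{1..N}. ffall (particle N l j) a * W N l j)) has_sum A N) (sig N)) \<and>
     (\<lambda>N. A N / of_nat N ^ Suc a) \<longlonglongrightarrow> M a"
  shows "\<exists>B. (\<forall>N\<ge>Suc k. ((\<lambda>l. of_real (pmf (\<rho> N) l) * (\<Sum>j\<in>{1..N}. of_int (particle N l j) ^ k * W N l j)) has_sum B N) (sig N)) \<and>
     (\<lambda>N. B N / of_nat N ^ Suc k) \<longlonglongrightarrow> M k"
proof -
  have "\<forall>a. \<exists>A. (\<forall>N\<ge>Suc a. ((\<lambda>l. of_real (pmf (\<rho> N) l) * (\<Sum>j\<in>{1..N}. ffall (particle N l j) a * W N l j)) has_sum A N) (sig N)) \<and>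
     (\<lambda>N. A N / of_nat N ^ Suc a) \<longlonglongrightarrow> M a"
    using assms by (rule allI)
  then obtain A where "\<forall>a. (\<forall>N\<ge>Suc a. ((\<lambda>l. of_real (pmf (\<rho> N) l) * (\<Sum>j\<in>{1..N}. ffall (particle N l j) a * W N l j)) has_sum A a N) (sig N)) \<and>
     (\<lambda>N. A a N / of_nat N ^ Suc a) \<longlonglongrightarrow> M a"
    by (rule choice[THEN exE])
  then have A: "\<And>a N. N \<ge> Suc a \<Longrightarrow> ((\<lambda>l. of_real (pmf (\<rho> N) l) * (\<Sum>j\<in>{1..N}. ffall (particle N l j) a * W N l j)) has_sum A a N) (sig N)"
    "\<And>a. (\<lambda>N. A a N / of_nat N ^ Suc a) \<longlonglongrightarrow> M a"
    by blast+
  obtain c :: "nat \<Rightarrow> complex" where c: "c k = 1" "\<And>x. of_int x ^ k = (\<Sum>a\<le>k. c a * ffall x a)"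
    using power_eq_sum_ffall by blast
  define B where "B N = (\<Sum>a\<le>k. c a * A a N)" for N
  have "((\<lambda>l. of_real (pmf (\<rho> N) l) * (\<Sum>j\<in>{1..N}. of_int (particle N l j) ^ k * W N l j)) has_sum B N) (sig N)"
    if N: "N \<ge> Suc k" for N
  proof -
    have "((\<lambda>l. \<Sum>a\<le>k. c a * (of_real (pmf (\<rho> N) l) * (\<Sum>j\<in>{1..N}. ffall (particle N l j) a * W N l j))) has_sum B N) (sig N)"
      unfolding B_def by (intro has_sum_finite_sum has_sum_cmult_right A) (use N in auto)
    moreover have "(\<Sum>a\<le>k. c a * (of_real (pmf (\<rho> N) l) * (\<Sum>j\<in>{1..N}. ffall (particle N l j) a * W N l j))) =
       of_real (pmf (\<rho> N) l) * (\<Sum>j\<in>{1..N}. of_int (particle N l j) ^ k * W N l j)" for l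
      unfolding c(2) sum_distrib_left sum_distrib_right
      by (subst sum.swap) (intro sum.cong refl, simp only: mult_ac)
    ultimately show ?thesis by simp
  qed
  moreover have "(\<lambda>N. B N / of_nat N ^ Suc k) \<longlonglongrightarrow> M k"
  proof -
    have "(\<lambda>N. c a * (A a N / of_nat N ^ Suc a) * (1 / of_nat N) ^ (k - a)) \<longlonglongrightarrow> c a * M a * 0 ^ (k - a)" for a
      by (intro tendsto_intros A lim_1_over_n)
    then have "(\<lambda>N. \<Sum>a\<le>k. c a * (A a N / of_nat N ^ Suc a) * (1 / of_nat N) ^ (k - a)) \<longlonglongrightarrow> (\<Sum>a\<le>k. c a * M a * 0 ^ (k - a))"
      by (intro tendsto_sum)
    moreover have "(\<Sum>a\<le>k. c a * M a * 0 ^ (k - a)) = M k"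
      by (subst sum.mono_neutral_right[of _ "{k}"]) (auto simp: c)
    moreover have "(\<Sum>a\<le>k. c a * (A a N / of_nat N ^ Suc a) * (1 / of_nat N) ^ (k - a)) = B N / of_nat N ^ Suc k" for N
      unfolding B_def sum_divide_distrib
    proof (rule sum.cong[OF refl])
      fix a assume "a \<in> {..k}"
      then have "Suc k = Suc a + (k - a)" by simp
      then have "(of_nat N :: complex) ^ Suc k = of_nat N ^ Suc a * of_nat N ^ (k - a)" by (metis power_add)
      then show "c a * (A a N / of_nat N ^ Suc a) * (1 / of_nat N) ^ (k - a) = c a * A a N / of_nat N ^ Suc k"
        by (simp only: times_divide_eq_right times_divide_eq_left divide_divide_eq_left power_one_over mult_ac mult_1 power_divide power_one)
    qed
    ultimately show ?thesis by simp
  qed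
  ultimately show ?thesis by blast
qed

lemma moment_has_sum:
  "\<exists>B. (\<forall>N\<ge>Suc k. ((\<lambda>l. of_real (pmf (\<rho> N) l) * (\<Sum>j\<in>{1..N}. of_int (particle N l j) ^ k)) has_sum B N) (sig N)) \<and>
     (\<lambda>N. B N / of_nat N ^ Suc k) \<longlonglongrightarrow> mom (\<lambda>_. 1) k"
proof -
  have "\<exists>A. (\<forall>N\<ge>Suc a. ((\<lambda>l. of_real (pmf (\<rho> N) l) * (\<Sum>j\<in>{1..N}. ffall (particle N l j) a * 1)) has_sum A N) (sig N)) \<and>
     (\<lambda>N. A N / of_nat N ^ Suc a) \<longlonglongrightarrow> mom (\<lambda>_. 1) a" for a
  proof -
    obtain A where A: "\<forall>N\<ge>Suc a. ((\<lambda>l. of_real (pmf (\<rho> N) l) *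
        (\<Sum>m\<le>a. of_nat (a choose m) * fact m * (of_nat (N choose Suc m) * symq_lim (\<lambda>_. 1) a m (norm_schur N l)))) has_sum A N) (sig N)"
      "(\<lambda>N. A N / of_nat N ^ Suc a) \<longlonglongrightarrow> mom (\<lambda>_. 1) a"
      using mom_asymp[of "\<lambda>_. 1" 1 a] by auto
    have "((\<lambda>l. of_real (pmf (\<rho> N) l) * (\<Sum>j\<in>{1..N}. ffall (particle N l j) a * 1)) has_sum A N) (sig N)" if "N \<ge> Suc a" for N
      by (rule has_sum_cong[THEN iffD1, OF _ A(1)[rule_format, OF that]]) (simp only: ffall_sum_identity mult_1_right)
    then show ?thesis using A(2) by blast
  qed
  from power_moment_asymp[OF this, of k] show ?thesis by simp
qed

lemma log_moment_has_sum:
  "\<exists>B. (\<forall>N\<ge>Suc k. ((\<lambda>l. of_real (pmf (\<rho> N) l) * (\<Sum>j\<in>{1..N}. of_int (particle N l j) ^ k *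
        (\<Sum>b\<in>{1..N}-{j}. 1 / (of_int (particle N l j) - of_int (particle N l b))))) has_sum B N) (sig N)) \<and>
     (\<lambda>N. B N / of_nat N ^ Suc k) \<longlonglongrightarrow> mom Ln k"
proof -
  have "\<exists>A. (\<forall>N\<ge>Suc a. ((\<lambda>l. of_real (pmf (\<rho> N) l) * (\<Sum>j\<in>{1..N}. ffall (particle N l j) a *
        (\<Sum>b\<in>{1..N}-{j}. 1 / (of_int (particle N l j) - of_int (particle N l b))))) has_sum A N) (sig N)) \<and>
     (\<lambda>N. A N / of_nat N ^ Suc a) \<longlonglongrightarrow> mom Ln a" for a
  proof -
    obtain A where A: "\<forall>N\<ge>Suc a. ((\<lambda>l. of_real (pmf (\<rho> N) l) *
        (\<Sum>m\<le>a. of_nat (a choose m) * fact m * (of_nat (N choose Suc m) * symq_lim Ln a m (norm_schur N l)))) has_sum A N) (sig N)"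
      "(\<lambda>N. A N / of_nat N ^ Suc a) \<longlonglongrightarrow> mom Ln a"
      using mom_asymp[OF Ln_holomorphic_ball, of a] by auto
    have "((\<lambda>l. of_real (pmf (\<rho> N) l) * (\<Sum>j\<in>{1..N}. ffall (particle N l j) a *
        (\<Sum>b\<in>{1..N}-{j}. 1 / (of_int (particle N l j) - of_int (particle N l b))))) has_sum A N) (sig N)" if "N \<ge> Suc a" for N
      by (rule has_sum_cong[THEN iffD1, OF _ A(1)[rule_format, OF that]]) (simp only: ffall_log_identity)
    then show ?thesis using A(2) by blast
  qed
  from power_moment_asymp[OF this, of k] show ?thesis .
qed

end

section \<open>The limiting moments\<close>

text \<open>The coefficient is the residue of x'/x^d, an exact derivative for d > 1. In the proof
  the two pieces cancel because the derivative of kappa^(d-1) is (d-1) kappa' kappa^(d-2).\<close>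

lemma fps_lagrange_coeff:
  fixes \<kappa> x :: "complex fps"
  assumes \<kappa>0: "\<kappa> $ 0 = 1" and x: "x = fps_X * inverse \<kappa>" and d: "d \<ge> 1"
  shows "(fps_deriv x * \<kappa> ^ d) $ (d - 1) = (if d = 1 then 1 else 0)"
proof -
  have \<kappa>x: "x * \<kappa> = fps_X" using \<kappa>0 by (simp add: x mult.assoc inverse_mult_eq_1)
  then have "fps_deriv (x * \<kappa>) = 1" by simp
  then have dx: "fps_deriv x * \<kappa> = 1 - x * fps_deriv \<kappa>" by (simp add: algebra_simps)
  show ?thesis
  proof (cases "d = 1")
    case True
    then show ?thesis using dx by (simp add: x)
  next
    case False
    define e where "e = d - 2"
    have de: "d = Suc (Suc e)" using False d by (simp add: e_def)
    have "fps_deriv x * \<kappa> ^ d = \<kappa> ^ Suc e - (x * \<kappa>) * (fps_deriv \<kappa> * \<kappa> ^ e)"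
    proof -
      have "fps_deriv x * \<kappa> ^ d = (fps_deriv x * \<kappa>) * \<kappa> ^ Suc e" by (simp add: de mult_ac)
      also have "\<dots> = \<kappa> ^ Suc e - (x * \<kappa>) * (fps_deriv \<kappa> * \<kappa> ^ e)" unfolding dx by (simp add: algebra_simps)
      finally show ?thesis .
    qed
    also have "\<dots> = \<kappa> ^ Suc e - fps_X * (fps_deriv \<kappa> * \<kappa> ^ e)" by (simp only: \<kappa>x)
    finally have eq: "fps_deriv x * \<kappa> ^ d = \<kappa> ^ Suc e - fps_X * (fps_deriv \<kappa> * \<kappa> ^ e)" .
    have "fps_deriv (\<kappa> ^ Suc e) = fps_const (of_nat (Suc e)) * (fps_deriv \<kappa> * \<kappa> ^ e)"
      by (subst fps_deriv_power') (simp add: fps_of_nat[symmetric] mult_ac)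
    then have "of_nat (Suc e) * (\<kappa> ^ Suc e) $ (Suc e) = of_nat (Suc e) * (fps_deriv \<kappa> * \<kappa> ^ e) $ e"
      by (metis fps_deriv_nth fps_mult_left_const_nth Suc_eq_plus1)
    then have "(\<kappa> ^ Suc e) $ (Suc e) = (fps_deriv \<kappa> * \<kappa> ^ e) $ e"
      using of_nat_neq_0[of e, where 'a = complex] by (metis mult_left_cancel)
    then show ?thesis unfolding eq using False by (simp add: de)
  qed
qed

text \<open>With Q the composition on the left, H is Q composed with x, and Q' is expanded in powers
  of x. Since x^i kappa^(k+1) = X^i kappa^(k+1-i), \<open>fps_lagrange_coeff\<close> selects i =
  k.\<close>

lemma fps_lagrange_inversion:
  fixes \<kappa> x H :: "complex fps"
  assumes \<kappa>0: "\<kappa> $ 0 = 1" and x: "x = fps_X * inverse \<kappa>"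
  shows "of_nat (Suc k) * (H oo fps_inv x) $ Suc k = (fps_deriv H * \<kappa> ^ Suc k) $ k"
proof -
  define Q where "Q = H oo fps_inv x"
  have x0: "x $ 0 = 0" by (simp add: x)
  have x1: "x $ 1 \<noteq> 0" using \<kappa>0 by (simp add: x)
  have inv0: "fps_inv x $ 0 = 0" by (simp add: fps_inv_def)
  have "Q oo x = H oo (fps_inv x oo x)" unfolding Q_def by (rule fps_compose_assoc[symmetric, OF x0 inv0])
  then have H: "H = Q oo x" using fps_inv[OF x0 x1] by simp
  define A where "A = fps_deriv Q"
  define Z where "Z = fps_deriv x * \<kappa> ^ Suc k"
  have \<kappa>x: "x * \<kappa> = fps_X" using \<kappa>0 by (simp add: x mult.assoc inverse_mult_eq_1)
  have "(fps_deriv H * \<kappa> ^ Suc k) $ k = ((A oo x) * Z) $ k"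
    unfolding H fps_compose_deriv[OF x0] A_def Z_def by (simp add: mult.assoc)
  also have "\<dots> = (\<Sum>j=0..k. (\<Sum>i=0..k. A $ i * (x ^ i) $ j) * Z $ (k - j))"
    unfolding fps_mult_nth
  proof (intro sum.cong refl arg_cong2[of _ _ _ _ "(*)"])
    fix j assume j: "j \<in> {0..k}"
    show "(A oo x) $ j = (\<Sum>i=0..k. A $ i * (x ^ i) $ j)"
      unfolding fps_compose_nth
      by (rule sum.mono_neutral_left) (use j startsby_zero_power_prefix[OF x0] in auto)
  qed
  also have "\<dots> = (\<Sum>i=0..k. A $ i * (x ^ i * Z) $ k)"
    unfolding fps_mult_nth sum_distrib_left sum_distrib_right
    by (subst sum.swap) (simp add: mult.assoc)
  also have "\<dots> = (\<Sum>i=0..k. A $ i * (if i = k then 1 else 0))"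
  proof (intro sum.cong refl arg_cong2[of _ _ _ _ "(*)"])
    fix i assume i: "i \<in> {0..k}"
    have "x ^ i * Z = (x * \<kappa>) ^ i * (fps_deriv x * \<kappa> ^ (Suc k - i))"
    proof -
      have "\<kappa> ^ Suc k = \<kappa> ^ i * \<kappa> ^ (Suc k - i)" using i by (simp add: power_add[symmetric] del: power_Suc)
      then show ?thesis unfolding Z_def by (simp only: power_mult_distrib mult_ac)
    qed
    then have "(x ^ i * Z) $ k = (fps_X ^ i * (fps_deriv x * \<kappa> ^ (Suc k - i))) $ k" by (simp only: \<kappa>x)
    also have "\<dots> = (fps_deriv x * \<kappa> ^ (Suc k - i)) $ (Suc k - i - 1)" using i by (simp add: fps_X_power_mult_nth)
    also have "\<dots> = (if Suc k - i = 1 then 1 else 0)"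
      by (rule fps_lagrange_coeff[OF \<kappa>0 x]) (use i in auto)
    also have "\<dots> = (if i = k then 1 else 0)" using i by auto
    finally show "(x ^ i * Z) $ k = (if i = k then 1 else 0)" .
  qed
  also have "\<dots> = A $ k" by (subst sum.mono_neutral_right[of _ "{k}"]) auto
  finally show ?thesis by (simp add: A_def Q_def)
qed

lemma higher_deriv_at_1_fps:
  fixes h :: "complex \<Rightarrow> complex"
  assumes "(\<lambda>x. h (1 + x)) has_fps_expansion F"
  shows "(deriv ^^ m) h 1 = fact m * F $ m"
  using fps_nth_fps_expansion[OF assms, of m] higher_deriv_shift_0[of m h 1] by (simp add: o_def)

context sgf_asymp
begin

definition psi_fps :: "complex fps" where "psi_fps = fps_expansion (deriv \<Psi>) 1"

text \<open>In the variable X = u - 1, powers of this series assemble the sum over m in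
  \<open>mom\<close>; see \<open>mom_eq_fps\<close>.\<close>

definition kap :: "complex fps" where "kap = (1 + fps_X) * (1 + fps_X * psi_fps)"

definition yinv :: "complex fps" where "yinv = fps_inv (fps_X * inverse kap)"

definition lnfps :: "complex fps" where "lnfps = fps_expansion Ln 1"

lemma psi_fps: "(\<lambda>x. deriv \<Psi> (1 + x)) has_fps_expansion psi_fps"
  unfolding psi_fps_def by (rule analytic_at_imp_has_fps_expansion) (rule analytic_deriv[OF analytic])

text \<open>The m-th derivative is m! times a coefficient, and (k+1) (k choose m)/(m+1) = (k+1
  choose m+1) = (k+1 choose l) with l = k - m. The sum over l is the binomial expansion of (1 + X
  Psi')^(k+1), and 1/(1+X) corrects (1+X)^(k+1) in the power of \<open>kap\<close> to
  (1+X)^k.\<close>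

lemma mom_eq_fps:
  assumes B: "(\<lambda>x. \<phi> (1 + x)) has_fps_expansion B"
  shows "of_nat (Suc k) * mom \<phi> k = (B * inverse (1 + fps_X) * kap ^ Suc k) $ k"
proof -
  have D: "(deriv ^^ m) (\<lambda>u. \<phi> u * u ^ k * deriv \<Psi> u ^ p) 1 = fact m * (B * (1 + fps_X) ^ k * psi_fps ^ p) $ m" for m p
    by (rule higher_deriv_at_1_fps) (intro fps_expansion_intros B psi_fps)
  have "B * inverse (1 + fps_X) * kap ^ Suc k = B * (inverse (1 + fps_X) * (1 + fps_X)) * (1 + fps_X) ^ k * (1 + fps_X * psi_fps) ^ Suc k"
    unfolding kap_def power_mult_distrib by (simp add: mult_ac)
  also have "inverse (1 + fps_X) * (1 + fps_X :: complex fps) = 1" by (rule inverse_mult_eq_1) simp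
  also have "(1 + fps_X * psi_fps) ^ Suc k = (\<Sum>l\<le>Suc k. of_nat (Suc k choose l) * (fps_X * psi_fps) ^ l)"
    using binomial_ring[of "fps_X * psi_fps" 1 "Suc k"] by (simp add: add.commute)
  finally have "B * inverse (1 + fps_X) * kap ^ Suc k =
     (\<Sum>l\<le>Suc k. fps_const (of_nat (Suc k choose l)) * (fps_X ^ l * (B * (1 + fps_X) ^ k * psi_fps ^ l)))"
    by (simp add: sum_distrib_left power_mult_distrib mult_ac fps_of_nat del: sum.atMost_Suc)
  then have "(B * inverse (1 + fps_X) * kap ^ Suc k) $ k =
     (\<Sum>l\<le>Suc k. of_nat (Suc k choose l) * (if k < l then 0 else (B * (1 + fps_X) ^ k * psi_fps ^ l) $ (k - l)))"
    by (simp add: fps_sum_nth fps_X_power_mult_nth del: sum.atMost_Suc)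
  also have "\<dots> = (\<Sum>l\<le>k. of_nat (Suc k choose l) * (B * (1 + fps_X) ^ k * psi_fps ^ l) $ (k - l))"
    by simp
  also have "\<dots> = (\<Sum>m\<le>k. of_nat (Suc k choose (k - m)) * (B * (1 + fps_X) ^ k * psi_fps ^ (k - m)) $ m)"
    by (rule sum.reindex_bij_witness[where i = "\<lambda>m. k - m" and j = "\<lambda>l. k - l"]) auto
  also have "\<dots> = (\<Sum>m\<le>k. of_nat (Suc k) * (of_nat (k choose m) / fact (Suc m) *
      (deriv ^^ m) (\<lambda>u. \<phi> u * u ^ k * deriv \<Psi> u ^ (k - m)) 1))"
  proof (rule sum.cong[OF refl])
    fix m assume m: "m \<in> {..k}"
    have "Suc k choose (k - m) = Suc k choose Suc m" using binomial_symmetric[of "Suc m" "Suc k"] m by simp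
    moreover have "(of_nat (Suc m) * of_nat (Suc k choose Suc m) :: complex) = of_nat (Suc k) * of_nat (k choose m)"
      using Suc_times_binomial[of m k] by (metis of_nat_mult mult.commute)
    ultimately have "(of_nat (Suc k choose (k - m)) :: complex) = of_nat (Suc k) * of_nat (k choose m) / of_nat (Suc m)"
      by (simp add: field_simps del: of_nat_Suc)
    then show "of_nat (Suc k choose (k - m)) * (B * (1 + fps_X) ^ k * psi_fps ^ (k - m)) $ m =
      of_nat (Suc k) * (of_nat (k choose m) / fact (Suc m) * (deriv ^^ m) (\<lambda>u. \<phi> u * u ^ k * deriv \<Psi> u ^ (k - m)) 1)"
      unfolding D by (simp add: field_simps del: of_nat_Suc)
  qed
  also have "\<dots> = of_nat (Suc k) * mom \<phi> k" by (simp only: mom_def sum_distrib_left)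
  finally show ?thesis by simp
qed

text \<open>By Lagrange inversion the limits for every weight are coefficients of a composition with
  one fixed series \<open>yinv\<close>. Identities among the primitives \<open>H\<close> therefore
  become identities among moments.\<close>

lemma mom_eq_compose:
  assumes B: "(\<lambda>x. \<phi> (1 + x)) has_fps_expansion B" and H: "fps_deriv H = B * inverse (1 + fps_X)"
  shows "mom \<phi> k = (H oo yinv) $ Suc k"
proof -
  have "of_nat (Suc k) * (H oo yinv) $ Suc k = (fps_deriv H * kap ^ Suc k) $ k"
    unfolding yinv_def by (rule fps_lagrange_inversion) (simp_all add: kap_def)
  also have "\<dots> = of_nat (Suc k) * mom \<phi> k" unfolding H mom_eq_fps[OF B] ..
  finally show ?thesis by (simp del: of_nat_Suc)
qed

lemma lnfps: "(\<lambda>x. Ln (1 + x)) has_fps_expansion lnfps"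
  unfolding lnfps_def by (rule analytic_at_imp_has_fps_expansion) (auto intro!: analytic_intros)

lemma lnfps_deriv: "fps_deriv lnfps = inverse (1 + fps_X)"
proof (rule fps_expansion_unique_complex)
  show "deriv (\<lambda>x. Ln (1 + x)) has_fps_expansion fps_deriv lnfps" by (rule has_fps_expansion_deriv[OF lnfps])
  have "(\<lambda>x::complex. inverse (1 + x)) has_fps_expansion inverse (1 + fps_X)" by (intro fps_expansion_intros) simp
  moreover have "eventually (\<lambda>x. inverse (1 + x) = deriv (\<lambda>x. Ln (1 + x)) x) (nhds (0::complex))"
  proof -
    have "eventually (\<lambda>x. x \<in> ball 0 1) (nhds (0::complex))" by (intro eventually_nhds_in_open) auto
    then show ?thesis
    proof eventually_elim
      case (elim x)
      have "\<bar>Re x\<bar> < 1" using abs_Re_le_cmod[of x] elim by simp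
      then have "1 + x \<notin> \<real>\<^sub>\<le>\<^sub>0" by (auto simp: complex_nonpos_Reals_iff)
      then have "((\<lambda>x. Ln (1 + x)) has_field_derivative inverse (1 + x)) (at x)"
        by (auto intro!: derivative_eq_intros simp: field_simps)
      then show ?case by (simp add: DERIV_imp_deriv)
    qed
  qed
  ultimately show "deriv (\<lambda>x. Ln (1 + x)) has_fps_expansion inverse (1 + fps_X)"
    by (subst has_fps_expansion_cong[OF _ refl]) (auto simp: eq_commute)
qed

lemma lnfps_0: "lnfps $ 0 = 0"
  by (simp add: lnfps_def fps_expansion_def)

lemma yinv_0: "yinv $ 0 = 0"
  by (simp add: yinv_def fps_inv_def)

text \<open>The generating series of the limits m_k of the power means, m_k standing at X^(k+1);
  formally it is log(1 + yinv).\<close>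

definition mfps :: "complex fps" where "mfps = lnfps oo yinv"

lemma mfps_nth: "mfps $ 0 = 0" "mfps $ Suc k = mom (\<lambda>_. 1) k"
proof -
  show "mfps $ 0 = 0" by (simp add: mfps_def lnfps_0)
  show "mfps $ Suc k = mom (\<lambda>_. 1) k"
    unfolding mfps_def by (rule mom_eq_compose[symmetric, of _ 1]) (simp_all add: lnfps_deriv)
qed

text \<open>For the weight \<open>Ln\<close> the primitive is half the square of the primitive for
  weight 1, so the generating series is half the square of \<open>mfps\<close>, and the right side
  is its convolution.\<close>

lemma mom_Ln_eq: "2 * mom Ln k = (\<Sum>a<k. mom (\<lambda>_. 1) a * mom (\<lambda>_. 1) (k - 1 - a))"
proof -
  have "mom Ln k = (fps_const (1/2) * lnfps ^ 2 oo yinv) $ Suc k"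
  proof (rule mom_eq_compose[OF lnfps])
    have "fps_deriv (lnfps ^ 2) = 2 * (lnfps * fps_deriv lnfps)" by (simp add: power2_eq_square)
    then have "fps_deriv (fps_const (1/2) * lnfps ^ 2) = fps_const (1/2) * (2 * (lnfps * fps_deriv lnfps))" by simp
    also have "\<dots> = (fps_const (1/2) * 2) * (lnfps * fps_deriv lnfps)" by (simp only: mult.assoc)
    also have "fps_const (1/2) * 2 = (1 :: complex fps)"
      by (simp add: fps_eq_iff numeral_fps_const)
    finally show "fps_deriv (fps_const (1/2) * lnfps ^ 2) = lnfps * inverse (1 + fps_X)" by (simp add: lnfps_deriv)
  qed
  also have "fps_const (1/2) * lnfps ^ 2 oo yinv = fps_const (1/2) * (mfps * mfps)"
    by (simp add: fps_compose_mult_distrib[OF yinv_0] mfps_def power2_eq_square)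
  finally have "mom Ln k = 1/2 * (mfps * mfps) $ Suc k" by (simp only: fps_mult_left_const_nth)
  then have "2 * mom Ln k = (mfps * mfps) $ Suc k" by (simp only: mult.assoc[symmetric]) simp
  also have "\<dots> = (\<Sum>i=0..Suc k. mfps $ i * mfps $ (Suc k - i))" by (rule fps_mult_nth)
  also have "\<dots> = (\<Sum>i\<in>{1..k}. mfps $ i * mfps $ (Suc k - i))"
  proof (rule sum.mono_neutral_right)
    show "\<forall>i\<in>{0..Suc k} - {1..k}. mfps $ i * mfps $ (Suc k - i) = 0"
    proof
      fix i assume "i \<in> {0..Suc k} - {1..k}"
      then have "i = 0 \<or> i = Suc k" by auto
      then show "mfps $ i * mfps $ (Suc k - i) = 0" by (auto simp: mfps_nth(1))
    qed
  qed auto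
  also have "\<dots> = (\<Sum>a<k. mom (\<lambda>_. 1) a * mom (\<lambda>_. 1) (k - 1 - a))"
  proof (rule sum.reindex_bij_witness[where i = Suc and j = "\<lambda>i. i - 1"])
    fix i assume "i \<in> {1..k}"
    then have "i = Suc (i - 1)" "Suc k - i = Suc (k - 1 - (i - 1))" by auto
    then show "mom (\<lambda>_. 1) (i - 1) * mom (\<lambda>_. 1) (k - 1 - (i - 1)) = mfps $ i * mfps $ (Suc k - i)"
      by (metis mfps_nth(2))
  qed auto
  finally show ?thesis .
qed

text \<open>Near 1 the power u^(k-q) splits as u^(-q) u^k, which identifies the claimed moments as
  \<open>mom\<close> for the weight u^(-q).\<close>

lemma mu_q_eq_mom: "mu_q q \<Psi> k = mom (\<lambda>u. u powr (- of_real q)) k"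
proof -
  have "(deriv ^^ m) (\<lambda>u. u powr (of_nat k - of_real q) * deriv \<Psi> u ^ (k - m)) 1 =
     (deriv ^^ m) (\<lambda>u. u powr (- of_real q) * u ^ k * deriv \<Psi> u ^ (k - m)) 1" for m
  proof (rule higher_deriv_cong_ev[OF _ refl])
    have "eventually (\<lambda>u. u \<in> - {0}) (nhds (1::complex))" by (intro eventually_nhds_in_open) (auto simp: open_Compl)
    then show "eventually (\<lambda>u. u powr (of_nat k - of_real q) * deriv \<Psi> u ^ (k - m) =
        u powr (- of_real q) * u ^ k * deriv \<Psi> u ^ (k - m)) (nhds 1)"
    proof eventually_elim
      case (elim u)
      have "u powr (of_nat k - of_real q) = u powr (- of_real q) * u powr (of_nat k)"
        by (simp add: powr_add[symmetric] add.commute)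
      then show ?case using elim by (simp add: powr_nat)
    qed
  qed
  then show ?thesis unfolding mu_q_def mom_def
    by (simp add: atMost_atLeast0 del: fact_Suc)
qed

text \<open>For B = (1+X)^c with c = -q the primitive H of B/(1+X) satisfies 1 + cH = B. Composed
  with \<open>yinv\<close> this becomes the differential equation Q' = (1 + cQ) mfps', whose
  coefficients are the recursion. Nothing is divided by q, so q = 0 is included.\<close>

lemma mu_q_rec:
  "of_nat (Suc k) * mu_q q \<Psi> k = of_nat (Suc k) * mom (\<lambda>_. 1) k -
     of_real q * (\<Sum>a<k. mu_q q \<Psi> a * (of_nat (k - a) * mom (\<lambda>_. 1) (k - 1 - a)))"
proof -
  define c :: complex where "c = - of_real q"
  define B where "B = fps_binomial c"
  define H where "H = fps_integral0 (B * inverse (1 + fps_X))"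
  have H': "fps_deriv H = B * inverse (1 + fps_X)" unfolding H_def by (rule fps_deriv_fps_integral)
  have H0: "H $ 0 = 0" by (simp add: H_def)
  define Q where "Q = H oo yinv"
  have Q: "Q $ Suc a = mu_q q \<Psi> a" for a
    unfolding Q_def mu_q_eq_mom
    by (rule mom_eq_compose[symmetric, OF _ H']) (use has_fps_expansion_binomial_complex[of c] in \<open>simp add: B_def c_def\<close>)
  have Q0: "Q $ 0 = 0" by (simp add: Q_def H0)
  have "fps_deriv B = fps_const c * fps_deriv H"
    unfolding H' B_def fps_binomial_deriv by (simp add: fps_divide_unit mult.assoc)
  then have "fps_deriv B = fps_deriv (fps_const c * H)" by simp
  then have B: "B = 1 + fps_const c * H"
    unfolding fps_deriv_eq_iff by (simp add: H0 B_def)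
  have "fps_deriv Q = (fps_deriv H oo yinv) * fps_deriv yinv"
    unfolding Q_def by (rule fps_compose_deriv[OF yinv_0])
  also have "fps_deriv H = (1 + fps_const c * H) * fps_deriv lnfps" unfolding H' lnfps_deriv B[symmetric] ..
  also have "((1 + fps_const c * H) * fps_deriv lnfps oo yinv) * fps_deriv yinv =
     (1 + fps_const c * Q) * ((fps_deriv lnfps oo yinv) * fps_deriv yinv)"
    by (simp add: fps_compose_mult_distrib[OF yinv_0] fps_compose_add_distrib Q_def mult.assoc)
  also have "(fps_deriv lnfps oo yinv) * fps_deriv yinv = fps_deriv mfps"
    unfolding mfps_def by (rule fps_compose_deriv[OF yinv_0, symmetric])
  finally have "fps_deriv Q = fps_deriv mfps + fps_const c * (Q * fps_deriv mfps)" by (simp add: algebra_simps)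
  then have "fps_deriv Q $ k = fps_deriv mfps $ k + c * (Q * fps_deriv mfps) $ k" by simp
  then have "of_nat (Suc k) * mu_q q \<Psi> k = of_nat (Suc k) * mom (\<lambda>_. 1) k + c * (Q * fps_deriv mfps) $ k"
    by (simp add: Q mfps_nth)
  also have "(Q * fps_deriv mfps) $ k = (\<Sum>i=0..k. Q $ i * fps_deriv mfps $ (k - i))" by (rule fps_mult_nth)
  also have "\<dots> = (\<Sum>i\<in>{1..k}. Q $ i * fps_deriv mfps $ (k - i))"
    by (rule sum.mono_neutral_right) (auto simp: Q0 not_le)
  also have "\<dots> = (\<Sum>a<k. mu_q q \<Psi> a * (of_nat (k - a) * mom (\<lambda>_. 1) (k - 1 - a)))"
  proof (rule sum.reindex_bij_witness[where i = Suc and j = "\<lambda>i. i - 1"])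
    fix i assume "i \<in> {1..k}"
    then have i: "i = Suc (i - 1)" "Suc (k - i) = k - (i - 1)" "k - 1 - (i - 1) = k - i" by auto
    have "fps_deriv mfps $ (k - i) = of_nat (Suc (k - i)) * mom (\<lambda>_. 1) (k - i)" by (simp add: mfps_nth)
    moreover have "Q $ i = mu_q q \<Psi> (i - 1)" using Q[of "i - 1"] i(1) by simp
    ultimately show "mu_q q \<Psi> (i - 1) * (of_nat (k - (i - 1)) * mom (\<lambda>_. 1) (k - 1 - (i - 1))) = Q $ i * fps_deriv mfps $ (k - i)"
      using i by (simp only:)
  qed auto
  finally show ?thesis by (simp add: c_def)
qed

end

section \<open>Power sums and the deformed moments\<close>

text \<open>Bridge from unconditional sums over signatures to Bochner expectations. Real summability
  is absolute, which gives integrability; terms outside the support vanish.\<close>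

lemma pmf_expectation_has_sum:
  fixes f :: "'a \<Rightarrow> real"
  assumes hs: "((\<lambda>l. complex_of_real (pmf p l) * complex_of_real (f l)) has_sum c) A" and A: "set_pmf p \<subseteq> A"
  shows "integrable (measure_pmf p) f" "complex_of_real (measure_pmf.expectation p f) = c"
proof -
  have "((\<lambda>l. complex_of_real (pmf p l * f l)) has_sum c) UNIV"
    using hs by (rule has_sum_cong_neutral[THEN iffD1, rotated 3]) (use A in \<open>auto simp: pmf_eq_0_set_pmf\<close>)
  then have cs: "((\<lambda>l. complex_of_real (pmf p l * f l)) has_sum c) UNIV" .
  have rs: "((\<lambda>l. pmf p l * f l) has_sum Re c) UNIV" using has_sum_Re[OF cs] by simp
  have "((\<lambda>l. Im (complex_of_real (pmf p l * f l))) has_sum Im c) UNIV" using has_sum_Im[OF cs] .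
  then have "((\<lambda>l::'a. 0::real) has_sum Im c) UNIV" by (simp only: Im_complex_of_real)
  from infsumI[OF this] have im: "Im c = 0" by simp
  have "(\<lambda>l. pmf p l * f l) summable_on UNIV" using rs by (rule has_sum_imp_summable)
  then have abs: "(\<lambda>l. norm (pmf p l * f l)) summable_on UNIV" by (rule summable_on_iff_abs_summable_on_real[THEN iffD1])
  then have "integrable (count_space UNIV) (\<lambda>l. pmf p l * f l)"
    using abs_summable_equivalent[of "\<lambda>l. pmf p l * f l" UNIV] by (simp add: Infinite_Set_Sum.abs_summable_on_def)
  then show "integrable (measure_pmf p) f"
    unfolding measure_pmf_eq_density by (subst integrable_density) auto
  have "measure_pmf.expectation p f = (\<integral>l. pmf p l * f l \<partial>count_space UNIV)"
    unfolding measure_pmf_eq_density by (subst integral_density) auto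
  also have "\<dots> = infsetsum (\<lambda>l. pmf p l * f l) UNIV" by (simp add: infsetsum_def)
  also have "\<dots> = infsum (\<lambda>l. pmf p l * f l) UNIV"
    using abs_summable_equivalent[of "\<lambda>l. pmf p l * f l" UNIV] abs by (intro infsetsum_infsum) simp
  also have "\<dots> = Re c" using rs by (rule infsumI)
  finally show "complex_of_real (measure_pmf.expectation p f) = c" using im by (simp add: complex_eq_iff)
qed

text \<open>Symmetrised in j and b, the summand (x_j^k - x_b^k)/(x_j - x_b) is a sum of products of
  powers. Over all pairs it gives products of power sums; the diagonal pairs are absent and account
  for the correction with factor k.\<close>

lemma sum_inverse_difference:
  fixes x :: "nat \<Rightarrow> real"
  assumes "finite A" "inj_on x A"
  shows "2 * (\<Sum>j\<in>A. x j ^ k * (\<Sum>b\<in>A-{j}. 1 / (x j - x b))) =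
    (\<Sum>a<k. (\<Sum>j\<in>A. x j ^ a) * (\<Sum>j\<in>A. x j ^ (k - 1 - a))) - real k * (\<Sum>j\<in>A. x j ^ (k - 1))"
proof -
  let ?S = "\<Sum>j\<in>A. \<Sum>b\<in>A-{j}. x j ^ k / (x j - x b)"
  have swap: "(\<Sum>j\<in>A. \<Sum>b\<in>A-{j}. g j b) = (\<Sum>j\<in>A. \<Sum>b\<in>A-{j}. g b j)" for g :: "nat \<Rightarrow> nat \<Rightarrow> real"
  proof -
    have "(\<Sum>j\<in>A. \<Sum>b\<in>A-{j}. g j b) = (\<Sum>j\<in>A. \<Sum>b\<in>A. if b \<noteq> j then g j b else 0)"
      using assms(1) by (intro sum.cong refl sum.mono_neutral_cong_left) auto
    also have "\<dots> = (\<Sum>b\<in>A. \<Sum>j\<in>A. if b \<noteq> j then g j b else 0)" by (rule sum.swap)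
    also have "\<dots> = (\<Sum>b\<in>A. \<Sum>j\<in>A-{b}. g j b)"
      using assms(1) by (intro sum.cong refl sum.mono_neutral_cong_right) auto
    finally show ?thesis .
  qed
  have "2 * ?S = ?S + (\<Sum>j\<in>A. \<Sum>b\<in>A-{j}. x b ^ k / (x b - x j))" using swap[of "\<lambda>j b. x j ^ k / (x j - x b)"] by simp
  also have "\<dots> = (\<Sum>j\<in>A. \<Sum>b\<in>A-{j}. \<Sum>a<k. x j ^ a * x b ^ (k - 1 - a))"
    unfolding sum.distrib[symmetric]
  proof (intro sum.cong refl)
    fix j b assume jb: "j \<in> A" "b \<in> A - {j}"
    then have ne: "x j - x b \<noteq> 0" using inj_onD[OF assms(2), of j b] by auto
    have "x b ^ k / (x b - x j) = - (x b ^ k / (x j - x b))" by (metis minus_diff_eq minus_divide_right)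
    then have "x j ^ k / (x j - x b) + x b ^ k / (x b - x j) = (x j ^ k - x b ^ k) / (x j - x b)"
      by (simp add: diff_divide_distrib)
    also have "x j ^ k - x b ^ k = (x j - x b) * (\<Sum>i<k. x b ^ (k - Suc i) * x j ^ i)" by (rule power_diff_sumr2)
    also have "\<dots> / (x j - x b) = (\<Sum>a<k. x j ^ a * x b ^ (k - 1 - a))" using ne by (simp add: mult.commute)
    finally show "x j ^ k / (x j - x b) + x b ^ k / (x b - x j) = (\<Sum>a<k. x j ^ a * x b ^ (k - 1 - a))" .
  qed
  also have "\<dots> = (\<Sum>j\<in>A. (\<Sum>b\<in>A. \<Sum>a<k. x j ^ a * x b ^ (k - 1 - a)) - (\<Sum>a<k. x j ^ a * x j ^ (k - 1 - a)))"
    using assms(1) by (intro sum.cong refl) (simp add: sum_diff1)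
  also have "\<dots> = (\<Sum>j\<in>A. (\<Sum>b\<in>A. \<Sum>a<k. x j ^ a * x b ^ (k - 1 - a)) - real k * x j ^ (k - 1))"
  proof (intro sum.cong refl arg_cong2[of _ _ _ _ "(-)"])
    fix j
    have "(\<Sum>a<k. x j ^ a * x j ^ (k - 1 - a)) = (\<Sum>a<k. x j ^ (k - 1))"
      by (intro sum.cong refl) (simp add: power_add[symmetric])
    then show "(\<Sum>a<k. x j ^ a * x j ^ (k - 1 - a)) = real k * x j ^ (k - 1)" by simp
  qed
  also have "\<dots> = (\<Sum>j\<in>A. \<Sum>b\<in>A. \<Sum>a<k. x j ^ a * x b ^ (k - 1 - a)) - real k * (\<Sum>j\<in>A. x j ^ (k - 1))"
    by (simp add: sum_subtractf sum_distrib_left)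
  also have "(\<Sum>j\<in>A. \<Sum>b\<in>A. \<Sum>a<k. x j ^ a * x b ^ (k - 1 - a)) =
     (\<Sum>a<k. (\<Sum>j\<in>A. x j ^ a) * (\<Sum>j\<in>A. x j ^ (k - 1 - a)))"
    unfolding sum_product
    by (subst (2) sum.swap, subst sum.swap) (rule refl)
  finally show ?thesis by (simp add: sum_distrib_left)
qed

context sgf_asymp
begin

definition power_mean :: "nat \<Rightarrow> nat \<Rightarrow> (nat \<Rightarrow> int) \<Rightarrow> real" where
  "power_mean a N l = (\<Sum>j\<in>{1..N}. (real_of_int (particle N l j) / real N) ^ a) / real N"

definition mom_re :: "nat \<Rightarrow> real" where "mom_re a = Re (mom (\<lambda>_. 1) a)"

abbreviation EE :: "nat \<Rightarrow> ((nat \<Rightarrow> int) \<Rightarrow> real) \<Rightarrow> real" where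
  "EE N f \<equiv> measure_pmf.expectation (\<rho> N) f"

lemma power_mean_eq: "power_mean a N l = (\<Sum>j\<in>{1..N}. real_of_int (particle N l j) ^ a) / real N ^ Suc a"
  by (simp add: power_mean_def power_divide sum_divide_distrib[symmetric] divide_divide_eq_left mult.commute)

lemma power_mean_expectation:
  shows power_mean_integrable: "N \<ge> Suc a \<Longrightarrow> integrable (\<rho> N) (power_mean a N)"
    and power_mean_mean: "(\<lambda>N. EE N (power_mean a N)) \<longlonglongrightarrow> mom_re a" and mom_real: "mom (\<lambda>_. 1) a = of_real (mom_re a)"
proof -
  obtain B where B: "\<And>N. N \<ge> Suc a \<Longrightarrow> ((\<lambda>l. of_real (pmf (\<rho> N) l) * (\<Sum>j\<in>{1..N}. of_int (particle N l j) ^ a)) has_sum B N) (sig N)"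
    and lim: "(\<lambda>N. B N / of_nat N ^ Suc a) \<longlonglongrightarrow> mom (\<lambda>_. 1) a"
    using moment_has_sum[of a] by blast
  let ?f = "\<lambda>N l. \<Sum>j\<in>{1..N}. real_of_int (particle N l j) ^ a"
  have hs: "((\<lambda>l. of_real (pmf (\<rho> N) l) * complex_of_real (?f N l)) has_sum B N) (sig N)" if "N \<ge> Suc a" for N
    using B[OF that] by simp
  have int: "integrable (\<rho> N) (?f N)" and ex: "complex_of_real (EE N (?f N)) = B N" if "N \<ge> Suc a" for N
    using pmf_expectation_has_sum[OF hs[OF that] supp] by auto
  have EP: "complex_of_real (EE N (power_mean a N)) = B N / of_nat N ^ Suc a" if "N \<ge> Suc a" for N
    unfolding power_mean_eq using ex[OF that] by simp
  show "N \<ge> Suc a \<Longrightarrow> integrable (\<rho> N) (power_mean a N)"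
    unfolding power_mean_eq[abs_def] using int by (intro integrable_divide) auto
  have L: "(\<lambda>N. complex_of_real (EE N (power_mean a N))) \<longlonglongrightarrow> mom (\<lambda>_. 1) a"
    by (rule Lim_transform_eventually[OF lim])
       (use eventually_ge_at_top[of "Suc a"] in eventually_elim, use EP in simp)
  from tendsto_Re[OF L] show "(\<lambda>N. EE N (power_mean a N)) \<longlonglongrightarrow> mom_re a" by (simp add: mom_re_def)
  \<comment> \<open>Expectations of real quantities are real, hence so is their limit; reality of
    \<open>mom\<close> comes without any inspection of \<open>\<Psi>\<close>.\<close>
  from tendsto_Im[OF L] have "(\<lambda>N. 0::real) \<longlonglongrightarrow> Im (mom (\<lambda>_. 1) a)" by simp
  then have "Im (mom (\<lambda>_. 1) a) = 0" using LIMSEQ_unique tendsto_const by blast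
  then show "mom (\<lambda>_. 1) a = of_real (mom_re a)" by (simp add: mom_re_def complex_eq_iff)
qed

lemma particle_inj: "l \<in> sig N \<Longrightarrow> inj_on (\<lambda>j. real_of_int (particle N l j)) {1..N}"
proof (rule inj_onI)
  fix i j assume l: "l \<in> sig N" and ij: "i \<in> {1..N}" "j \<in> {1..N}" "real_of_int (particle N l i) = real_of_int (particle N l j)"
  then show "i = j" using particle_strict_dec[OF l, of i j] particle_strict_dec[OF l, of j i] by (cases i j rule: linorder_cases) auto
qed

text \<open>Cauchy-Schwarz for the uniform measure on the particles.\<close>

lemma power_mean_square_le:
  assumes "N > 0"
  shows "(power_mean a N l)\<^sup>2 \<le> power_mean (2 * a) N l"
proof -
  let ?y = "\<lambda>j. (real_of_int (particle N l j) / real N) ^ a"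
  have "(\<Sum>j\<in>{1..N}. ?y j)\<^sup>2 \<le> (\<Sum>j\<in>{1..N}. (?y j)\<^sup>2) * real N"
    using sum_squared_le_sum_of_squares[of ?y "{1..N}"] by simp
  then have "(\<Sum>j\<in>{1..N}. ?y j)\<^sup>2 / (real N)\<^sup>2 \<le> (\<Sum>j\<in>{1..N}. (?y j)\<^sup>2) * real N / (real N)\<^sup>2"
    by (intro divide_right_mono) auto
  then show ?thesis using assms
    by (simp add: power_mean_def power_divide power_mult[symmetric] mult.commute power2_eq_square[of "real N"])
qed

text \<open>Products are dominated by even power means: 2 |P_a P_b| <= P_a^2 + P_b^2 <= P_(2a) +
  P_(2b).\<close>

lemma power_mean_mult_integrable:
  assumes N: "N \<ge> Suc (2 * a)" "N \<ge> Suc (2 * b)"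
  shows "integrable (\<rho> N) (\<lambda>l. power_mean a N l * power_mean b N l)"
proof (rule Bochner_Integration.integrable_bound)
  show "integrable (\<rho> N) (\<lambda>l. power_mean (2 * a) N l + power_mean (2 * b) N l)"
    by (intro Bochner_Integration.integrable_add power_mean_integrable N)
  have "\<bar>power_mean a N l * power_mean b N l\<bar> \<le> \<bar>power_mean (2 * a) N l + power_mean (2 * b) N l\<bar>" for l
  proof -
    have "N > 0" using N by simp
    then have "(power_mean a N l)\<^sup>2 \<le> power_mean (2 * a) N l" "(power_mean b N l)\<^sup>2 \<le> power_mean (2 * b) N l" by (rule power_mean_square_le)+
    moreover have "2 * \<bar>power_mean a N l * power_mean b N l\<bar> \<le> (power_mean a N l)\<^sup>2 + (power_mean b N l)\<^sup>2"
      using sum_squares_bound[of "\<bar>power_mean a N l\<bar>" "\<bar>power_mean b N l\<bar>"] by (simp add: abs_mult)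
    moreover have "0 \<le> (power_mean a N l)\<^sup>2" "0 \<le> (power_mean b N l)\<^sup>2" by auto
    ultimately show ?thesis by linarith
  qed
  then show "AE l in \<rho> N. norm (power_mean a N l * power_mean b N l) \<le> norm (power_mean (2 * a) N l + power_mean (2 * b) N l)" by auto
qed auto

lemma power_mean_quadratic_mean:
  "(\<lambda>N. \<Sum>a<k. EE N (\<lambda>l. power_mean a N l * power_mean (k - 1 - a) N l)) \<longlonglongrightarrow> (\<Sum>a<k. mom_re a * mom_re (k - 1 - a))"
proof (cases "k = 0")
  case False
  obtain B where B: "\<And>N. N \<ge> Suc k \<Longrightarrow> ((\<lambda>l. of_real (pmf (\<rho> N) l) * (\<Sum>j\<in>{1..N}. of_int (particle N l j) ^ k *
        (\<Sum>b\<in>{1..N}-{j}. 1 / (of_int (particle N l j) - of_int (particle N l b))))) has_sum B N) (sig N)"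
    and lim: "(\<lambda>N. B N / of_nat N ^ Suc k) \<longlonglongrightarrow> mom Ln k"
    using log_moment_has_sum[of k] by blast
  define R where "R N l = (\<Sum>j\<in>{1..N}. real_of_int (particle N l j) ^ k *
        (\<Sum>b\<in>{1..N}-{j}. 1 / (real_of_int (particle N l j) - real_of_int (particle N l b))))" for N l
  have hs: "((\<lambda>l. of_real (pmf (\<rho> N) l) * complex_of_real (R N l)) has_sum B N) (sig N)" if "N \<ge> Suc k" for N
    using B[OF that] by (simp add: R_def)
  have ex: "complex_of_real (EE N (R N)) = B N" if "N \<ge> Suc k" for N
    using pmf_expectation_has_sum[OF hs[OF that] supp] by auto
  \<comment> \<open>The lower order term is explicit: k/N times one power mean, whose expectation
    converges.\<close>
  have Req: "2 * R N l / real N ^ Suc k = (\<Sum>a<k. power_mean a N l * power_mean (k - 1 - a) N l) - real k / real N * power_mean (k - 1) N l"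
    if N: "N > 0" and l: "l \<in> sig N" for N l
  proof -
    let ?p = "\<lambda>a. \<Sum>j\<in>{1..N}. real_of_int (particle N l j) ^ a"
    have "2 * R N l = (\<Sum>a<k. ?p a * ?p (k - 1 - a)) - real k * ?p (k - 1)"
      unfolding R_def by (rule sum_inverse_difference[OF _ particle_inj[OF l]]) simp
    then have "2 * R N l / real N ^ Suc k = (\<Sum>a<k. ?p a * ?p (k - 1 - a) / real N ^ Suc k) - real k * ?p (k - 1) / real N ^ Suc k"
      by (simp only: diff_divide_distrib sum_divide_distrib)
    moreover have "?p a * ?p (k - 1 - a) / real N ^ Suc k = power_mean a N l * power_mean (k - 1 - a) N l" if "a < k" for a
    proof -
      have "Suc k = Suc a + Suc (k - 1 - a)" using that by simp
      then have "real N ^ Suc k = real N ^ Suc a * real N ^ Suc (k - 1 - a)" by (metis power_add)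
      then show ?thesis unfolding power_mean_eq by (simp only: times_divide_times_eq)
    qed
    moreover have "real k * ?p (k - 1) / real N ^ Suc k = real k / real N * power_mean (k - 1) N l"
    proof -
      have "real N ^ Suc k = real N * real N ^ Suc (k - 1)" using False by simp
      then show ?thesis unfolding power_mean_eq by (simp only: times_divide_times_eq)
    qed
    ultimately show ?thesis by simp
  qed
  have eqN: "(\<Sum>a<k. EE N (\<lambda>l. power_mean a N l * power_mean (k - 1 - a) N l)) =
     2 * Re (B N / of_nat N ^ Suc k) + real k * EE N (power_mean (k - 1) N) * (1 / real N)" if N: "N \<ge> Suc (2 * k)" for N
  proof -
    have int: "integrable (\<rho> N) (\<lambda>l. power_mean a N l * power_mean (k - 1 - a) N l)" if "a \<in> {..<k}" for a
      using N that by (intro power_mean_mult_integrable) auto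
    have int2: "integrable (\<rho> N) (power_mean (k - 1) N)" using N by (intro power_mean_integrable) auto
    have "Re (B N / of_nat N ^ Suc k) = EE N (R N) / real N ^ Suc k"
    proof -
      have "B N / of_nat N ^ Suc k = of_real (EE N (R N) / real N ^ Suc k)" using ex[of N] N by simp
      then show ?thesis by (metis Re_complex_of_real)
    qed
    then have "2 * Re (B N / of_nat N ^ Suc k) = EE N (\<lambda>l. 2 * R N l / real N ^ Suc k)" by simp
    also have "\<dots> = EE N (\<lambda>l. (\<Sum>a<k. power_mean a N l * power_mean (k - 1 - a) N l) - real k / real N * power_mean (k - 1) N l)"
    proof (rule integral_cong_AE)
      show "AE l in \<rho> N. 2 * R N l / real N ^ Suc k = (\<Sum>a<k. power_mean a N l * power_mean (k - 1 - a) N l) - real k / real N * power_mean (k - 1) N l"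
        using Req supp[of N] N by (auto simp: AE_measure_pmf_iff)
    qed auto
    also have "\<dots> = EE N (\<lambda>l. \<Sum>a<k. power_mean a N l * power_mean (k - 1 - a) N l) - EE N (\<lambda>l. real k / real N * power_mean (k - 1) N l)"
      by (intro Bochner_Integration.integral_diff Bochner_Integration.integrable_sum int integrable_mult_right int2)
    also have "EE N (\<lambda>l. \<Sum>a<k. power_mean a N l * power_mean (k - 1 - a) N l) = (\<Sum>a<k. EE N (\<lambda>l. power_mean a N l * power_mean (k - 1 - a) N l))"
      by (intro Bochner_Integration.integral_sum int)
    finally show ?thesis by simp
  qed
  have "(\<lambda>N. 2 * Re (B N / of_nat N ^ Suc k) + real k * EE N (power_mean (k - 1) N) * (1 / real N)) \<longlonglongrightarrow>
     2 * Re (mom Ln k) + real k * mom_re (k - 1) * 0"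
    by (intro tendsto_intros lim power_mean_mean lim_1_over_n)
  moreover have "2 * Re (mom Ln k) = (\<Sum>a<k. mom_re a * mom_re (k - 1 - a))"
  proof -
    have "complex_of_real (\<Sum>a<k. mom_re a * mom_re (k - 1 - a)) = 2 * mom Ln k" unfolding mom_Ln_eq mom_real by simp
    then show ?thesis by (metis Re_complex_of_real Re_divide_numeral mult_2 plus_complex.sel(1))
  qed
  ultimately have L: "(\<lambda>N. 2 * Re (B N / of_nat N ^ Suc k) + real k * EE N (power_mean (k - 1) N) * (1 / real N)) \<longlonglongrightarrow>
     (\<Sum>a<k. mom_re a * mom_re (k - 1 - a))" by simp
  show ?thesis
    by (rule Lim_transform_eventually[OF L])
       (use eventually_ge_at_top[of "Suc (2 * k)"] in eventually_elim, use eqN in simp)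
qed simp

end

section \<open>Partial fractions as formal power series\<close>

lemma fps_nth_inverse_linear: "inverse (1 - fps_const (c::real) * fps_X) $ n = c ^ n"
proof -
  have "inverse (1 - fps_const c * fps_X) = Abs_fps (\<lambda>n. c ^ n)"
  proof (rule fps_inverse_unique)
    show "(1 - fps_const c * fps_X) * Abs_fps (\<lambda>n. c ^ n) = 1"
    proof (rule fps_ext)
      fix n show "((1 - fps_const c * fps_X) * Abs_fps (\<lambda>n. c ^ n)) $ n = 1 $ n"
        by (cases n) (auto simp: left_diff_distrib mult.assoc)
    qed
  qed
  then show ?thesis by simp
qed

text \<open>Partial fractions; with \<open>X = 1/z\<close> the series \<open>X / (1 - c X)\<close> stands for \<open>1 / (z - c)\<close>.\<close>

definition pole :: "real \<Rightarrow> real fps" where "pole c = fps_X * inverse (1 - fps_const c * fps_X)"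

lemma pole_nth: "pole c $ 0 = 0" "pole c $ Suc n = c ^ n"
  by (simp_all add: pole_def fps_nth_inverse_linear)

lemma pole_unit: "(1 - fps_const c * fps_X) * inverse (1 - fps_const c * fps_X) = (1::real fps)"
  by (rule inverse_mult_eq_1') simp

lemma linear_ratio_pole: "(1 - fps_const c * fps_X) * inverse (1 - fps_const y * fps_X) = 1 + fps_const (y - c) * pole y"
proof -
  have "1 - fps_const c * fps_X = (1 - fps_const y * fps_X) + fps_const (y - c) * fps_X"
    by (simp add: algebra_simps flip: fps_const_sub)
  then have "(1 - fps_const c * fps_X) * inverse (1 - fps_const y * fps_X) =
     ((1 - fps_const y * fps_X) + fps_const (y - c) * fps_X) * inverse (1 - fps_const y * fps_X)" by (rule arg_cong)
  then show ?thesis by (simp only: pole_unit distrib_right pole_def mult.assoc)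
qed

text \<open>The resolvent identity for two simple poles, in the reciprocal variable.\<close>

lemma pole_mult:
  assumes "y \<noteq> z"
  shows "pole y * pole z = fps_const (1 / (y - z)) * (pole y - pole z)"
proof -
  let ?iy = "inverse (1 - fps_const y * fps_X)" and ?iz = "inverse (1 - fps_const z * fps_X)"
  have "pole y - pole z = fps_X * (?iy * ((1 - fps_const z * fps_X) * ?iz) - ?iz * ((1 - fps_const y * fps_X) * ?iy))"
    unfolding pole_unit by (simp add: pole_def algebra_simps)
  also have "\<dots> = fps_X * ?iy * ?iz * ((1 - fps_const z * fps_X) - (1 - fps_const y * fps_X))" by (simp only: algebra_simps)
  also have "(1 - fps_const z * fps_X) - (1 - fps_const y * fps_X) = fps_const (y - z) * fps_X"
    by (simp add: algebra_simps flip: fps_const_sub)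
  finally have "pole y - pole z = fps_const (y - z) * (pole y * pole z)" by (simp add: pole_def mult_ac)
  then have "fps_const (1 / (y - z)) * (pole y - pole z) = (fps_const (1 / (y - z)) * fps_const (y - z)) * (pole y * pole z)"
    by (simp only: mult.assoc)
  also have "fps_const (1 / (y - z)) * fps_const (y - z) = 1" using assms by simp
  finally show ?thesis by simp
qed

lemma fps_const_sum: "fps_const (\<Sum>i\<in>A. f i) = (\<Sum>i\<in>A. fps_const (f i :: real))"
  by (induction A rule: infinite_finite_induct) (auto simp flip: fps_const_add)

text \<open>A factor (z - c_a)/(z - y_a) is adjoined. Splitting products of two poles multiplies the
  old residue A_i by (y_i - c_a)/(y_i - y_a); the new residue is found by evaluating the induction
  hypothesis at z = y_a.\<close>

lemma partial_fractions_real: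
  fixes y c :: "nat \<Rightarrow> real"
  assumes "finite I" "inj_on y I" "z \<notin> y ` I"
  shows "(\<Prod>j\<in>I. (z - c j) / (z - y j)) = 1 + (\<Sum>i\<in>I. (\<Prod>j\<in>I. y i - c j) / (\<Prod>j\<in>I-{i}. y i - y j) / (z - y i))"
  using assms
proof (induction I arbitrary: z rule: finite_induct)
  case (insert a I)
  define A where "A i = (\<Prod>j\<in>I. y i - c j) / (\<Prod>j\<in>I-{i}. y i - y j)" for i
  have inj: "inj_on y I" and ya: "y a \<notin> y ` I" using insert.prems insert.hyps by auto
  have za: "z - y a \<noteq> 0" and zi: "\<And>i. i \<in> I \<Longrightarrow> z - y i \<noteq> 0"
    using insert.prems by auto
  have yi: "y i - y a \<noteq> 0" if "i \<in> I" for i using ya imageI[OF that, of y] by auto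
  have IHz: "(\<Prod>j\<in>I. (z - c j) / (z - y j)) = 1 + (\<Sum>i\<in>I. A i / (z - y i))"
    unfolding A_def using insert.prems by (intro insert.IH inj) auto
  have IHa: "(\<Prod>j\<in>I. (y a - c j) / (y a - y j)) = 1 + (\<Sum>i\<in>I. A i / (y a - y i))"
    unfolding A_def by (intro insert.IH inj ya)
  have coeff: "(\<Prod>j\<in>insert a I. y i - c j) / (\<Prod>j\<in>insert a I - {i}. y i - y j) = A i * ((y i - c a) / (y i - y a))"
    if i: "i \<in> I" for i
  proof -
    have "insert a I - {i} = insert a (I - {i})" using i insert.hyps by auto
    then show ?thesis using insert.hyps by (simp add: A_def mult.commute)
  qed
  have coeff_a: "(\<Prod>j\<in>insert a I. y a - c j) / (\<Prod>j\<in>insert a I - {a}. y a - y j) = (y a - c a) * (1 + (\<Sum>i\<in>I. A i / (y a - y i)))"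
  proof -
    have "insert a I - {a} = I" using insert.hyps by auto
    then show ?thesis unfolding IHa[symmetric] using insert.hyps by (simp add: prod_dividef)
  qed
  have trm: "A i * ((y i - c a) / (y i - y a)) / (z - y i) = A i / (z - y i) * ((z - c a) / (z - y a))
      - (y a - c a) * (A i / (y a - y i)) / (z - y a)" if i: "i \<in> I" for i
    using za zi[OF i] yi[OF i] that by (simp add: divide_simps) (simp add: algebra_simps)?
  have "(\<Sum>i\<in>insert a I. (\<Prod>j\<in>insert a I. y i - c j) / (\<Prod>j\<in>insert a I - {i}. y i - y j) / (z - y i)) =
    (y a - c a) * (1 + (\<Sum>i\<in>I. A i / (y a - y i))) / (z - y a) + (\<Sum>i\<in>I. A i * ((y i - c a) / (y i - y a)) / (z - y i))"
    unfolding sum.insert[OF insert.hyps] coeff_a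
    by (intro arg_cong2[of _ _ _ _ "(+)"] refl sum.cong arg_cong2[of _ _ _ _ "(/)"] coeff)
  also have "(\<Sum>i\<in>I. A i * ((y i - c a) / (y i - y a)) / (z - y i)) =
     (\<Sum>i\<in>I. A i / (z - y i)) * ((z - c a) / (z - y a)) - (y a - c a) * (\<Sum>i\<in>I. A i / (y a - y i)) / (z - y a)"
    using trm by (simp add: sum_subtractf sum_distrib_left sum_distrib_right sum_divide_distrib)
  finally have "1 + (\<Sum>i\<in>insert a I. (\<Prod>j\<in>insert a I. y i - c j) / (\<Prod>j\<in>insert a I - {i}. y i - y j) / (z - y i)) =
     (z - c a) / (z - y a) * (1 + (\<Sum>i\<in>I. A i / (z - y i)))"
    using za by (simp add: divide_simps) (simp add: algebra_simps)?
  then show ?case using insert.hyps IHz by simp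
qed simp

text \<open>The same induction in X = 1/z. A formal series cannot be evaluated at the node y_a, so
  the new residue is taken from the version over the reals.\<close>

lemma partial_fractions_fps:
  fixes y c :: "nat \<Rightarrow> real"
  assumes "finite I" "inj_on y I"
  shows "(\<Prod>j\<in>I. (1 - fps_const (c j) * fps_X) * inverse (1 - fps_const (y j) * fps_X)) =
     1 + (\<Sum>i\<in>I. fps_const ((\<Prod>j\<in>I. y i - c j) / (\<Prod>j\<in>I-{i}. y i - y j)) * pole (y i))"
  using assms
proof (induction I rule: finite_induct)
  case (insert a I)
  define A where "A i = (\<Prod>j\<in>I. y i - c j) / (\<Prod>j\<in>I-{i}. y i - y j)" for i
  have inj: "inj_on y I" and ya: "y a \<notin> y ` I" using insert.prems insert.hyps by auto
  have yi: "y i \<noteq> y a" if "i \<in> I" for i using ya imageI[OF that, of y] by auto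
  have IHa: "(\<Prod>j\<in>I. (y a - c j) / (y a - y j)) = 1 + (\<Sum>i\<in>I. A i / (y a - y i))"
    unfolding A_def by (intro partial_fractions_real insert.hyps inj ya)
  have coeff: "(\<Prod>j\<in>insert a I. y i - c j) / (\<Prod>j\<in>insert a I - {i}. y i - y j) = A i * ((y i - c a) / (y i - y a))"
    if i: "i \<in> I" for i
  proof -
    have "insert a I - {i} = insert a (I - {i})" using i insert.hyps by auto
    then show ?thesis using insert.hyps by (simp add: A_def mult.commute)
  qed
  have coeff_a: "(\<Prod>j\<in>insert a I. y a - c j) / (\<Prod>j\<in>insert a I - {a}. y a - y j) = (y a - c a) * (1 + (\<Sum>i\<in>I. A i / (y a - y i)))"
  proof -
    have "insert a I - {a} = I" using insert.hyps by auto
    then show ?thesis unfolding IHa[symmetric] using insert.hyps by (simp add: prod_dividef)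
  qed
  have "(\<Prod>j\<in>insert a I. (1 - fps_const (c j) * fps_X) * inverse (1 - fps_const (y j) * fps_X)) =
     (1 + fps_const (y a - c a) * pole (y a)) * (1 + (\<Sum>i\<in>I. fps_const (A i) * pole (y i)))"
    using insert by (simp add: linear_ratio_pole A_def inj)
  also have "\<dots> = 1 + fps_const ((y a - c a) * (1 + (\<Sum>i\<in>I. A i / (y a - y i)))) * pole (y a) +
     (\<Sum>i\<in>I. fps_const (A i * ((y i - c a) / (y i - y a))) * pole (y i))"
  proof -
    have "fps_const (y a - c a) * pole (y a) * (fps_const (A i) * pole (y i)) =
       fps_const ((y a - c a) * A i / (y a - y i)) * pole (y a) + fps_const (A i * ((y i - c a) / (y i - y a)) - A i) * pole (y i)"
      if i: "i \<in> I" for i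
    proof -
      have "fps_const (y a - c a) * pole (y a) * (fps_const (A i) * pole (y i)) = fps_const ((y a - c a) * A i) * (pole (y a) * pole (y i))"
        by (simp add: mult_ac flip: fps_const_mult)
      also have "\<dots> = fps_const ((y a - c a) * A i * (1 / (y a - y i))) * (pole (y a) - pole (y i))"
        using pole_mult[of "y a" "y i"] yi[OF i] by (simp add: mult.assoc flip: fps_const_mult)
      also have "\<dots> = fps_const ((y a - c a) * A i / (y a - y i)) * pole (y a) - fps_const ((y a - c a) * A i / (y a - y i)) * pole (y i)"
        by (simp add: right_diff_distrib)
      finally have e1: "fps_const (y a - c a) * pole (y a) * (fps_const (A i) * pole (y i)) =
        fps_const ((y a - c a) * A i / (y a - y i)) * pole (y a) - fps_const ((y a - c a) * A i / (y a - y i)) * pole (y i)" .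
      have v: "(y a - c a) * A i / (y a - y i) = - (A i * ((y i - c a) / (y i - y a)) - A i)"
        using yi[OF i] by (simp add: divide_simps) (simp add: algebra_simps)?
      have "fps_const ((y a - c a) * A i / (y a - y i)) * pole (y i) = - (fps_const (A i * ((y i - c a) / (y i - y a)) - A i) * pole (y i))"
        unfolding v fps_const_neg[symmetric] by (rule minus_mult_left[symmetric])
      then show ?thesis unfolding e1 by (simp only: diff_minus_eq_add)
    qed
    then have "fps_const (y a - c a) * pole (y a) * (\<Sum>i\<in>I. fps_const (A i) * pole (y i)) =
       fps_const (\<Sum>i\<in>I. (y a - c a) * A i / (y a - y i)) * pole (y a) + (\<Sum>i\<in>I. fps_const (A i * ((y i - c a) / (y i - y a)) - A i) * pole (y i))"
      by (simp add: sum_distrib_left sum.distrib sum_distrib_right fps_const_sum del: fps_const_sub)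
    then show ?thesis
      by (simp add: distrib_left distrib_right sum.distrib sum_subtractf sum_distrib_left left_diff_distrib
          flip: fps_const_add fps_const_sub fps_const_mult)
  qed
  also have "\<dots> = 1 + (\<Sum>i\<in>insert a I. fps_const ((\<Prod>j\<in>insert a I. y i - c j) / (\<Prod>j\<in>insert a I - {i}. y i - y j)) * pole (y i))"
    unfolding sum.insert[OF insert.hyps] coeff_a add.assoc
    by (intro arg_cong2[of _ _ _ _ "(+)"] refl sum.cong arg_cong2[of _ _ _ _ "(*)"] arg_cong[of _ _ fps_const] coeff[symmetric])
  finally show ?case .
qed simp

lemma log_deriv_ratio_fps:
  fixes y c :: "nat \<Rightarrow> real"
  assumes "finite I"
  defines "E \<equiv> \<lambda>I. \<Prod>j\<in>I. (1 - fps_const (c j) * fps_X) * inverse (1 - fps_const (y j) * fps_X)"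
  shows "fps_deriv (E I) = E I * (\<Sum>j\<in>I. fps_const (y j) * inverse (1 - fps_const (y j) * fps_X) - fps_const (c j) * inverse (1 - fps_const (c j) * fps_X))"
  using assms(1)
proof (induction I rule: finite_induct)
  case (insert a I)
  let ?u = "1 - fps_const (c a) * fps_X" and ?w = "1 - fps_const (y a) * fps_X"
  have dinv: "fps_deriv (inverse ?w) = fps_const (y a) * inverse ?w * inverse ?w"
    by (subst fps_inverse_deriv) (simp_all add: power2_eq_square mult.assoc)
  have g: "fps_deriv (?u * inverse ?w) = (?u * inverse ?w) * (fps_const (y a) * inverse ?w - fps_const (c a) * inverse ?u)"
  proof -
    have "fps_deriv (?u * inverse ?w) = ?u * (fps_const (y a) * inverse ?w * inverse ?w) - fps_const (c a) * inverse ?w"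
      by (simp add: dinv flip: fps_const_neg)
    also have "fps_const (c a) * inverse ?w = fps_const (c a) * inverse ?w * (?u * inverse ?u)" by (simp add: pole_unit)
    finally show ?thesis by (simp only: algebra_simps)
  qed
  have Ei: "E (insert a I) = (?u * inverse ?w) * E I" using insert.hyps by (simp add: E_def)
  have alg: "G * (e * S) + G * t * e = G * e * (t + S)" for G e S t :: "real fps" by (simp add: algebra_simps)
  show ?case unfolding Ei sum.insert[OF insert.hyps] fps_deriv_mult[of "?u * inverse ?w" "E I"] insert.IH g
    by (rule alg)
qed (simp add: E_def)

context sgf_asymp
begin

text \<open>With y_j = x_j/N and s = q/N this is 1/q times the sum over j of (y_j + s)^(b+1) -
  y_j^(b+1), expanded so that q = 0 makes sense.\<close>

definition diff_mom :: "real \<Rightarrow> nat \<Rightarrow> nat \<Rightarrow> (nat \<Rightarrow> int) \<Rightarrow> real" where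
  "diff_mom q b N l = (\<Sum>a\<le>b. real (Suc b choose a) * (q / real N) ^ (b - a) * power_mean a N l)"

lemma pp_weight_eq:
  assumes N: "N > 0"
  shows "pp_weight N q l i = (\<Prod>j\<in>{1..N}-{i}. (real_of_int (particle N l i) / real N - (real_of_int (particle N l j) / real N + q / real N)) /
     (real_of_int (particle N l i) / real N - real_of_int (particle N l j) / real N))"
  unfolding pp_weight_def
proof (rule prod.cong[OF refl])
  fix j
  have e: "real_of_int (particle N l i) - real_of_int (particle N l j) = real_of_int ((l i - int i) - (l j - int j))" by (simp add: particle_def)
  have n: "real_of_int (particle N l i) / real N - (real_of_int (particle N l j) / real N + q / real N) =
      (real_of_int (particle N l i) - real_of_int (particle N l j) - q) / real N"
    and d: "real_of_int (particle N l i) / real N - real_of_int (particle N l j) / real N =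
      (real_of_int (particle N l i) - real_of_int (particle N l j)) / real N"
    by (simp_all add: diff_divide_distrib)
  show "(real_of_int ((l i - int i) - (l j - int j)) - q) / real_of_int ((l i - int i) - (l j - int j)) =
    (real_of_int (particle N l i) / real N - (real_of_int (particle N l j) / real N + q / real N)) /
     (real_of_int (particle N l i) / real N - real_of_int (particle N l j) / real N)"
    using N unfolding n d e by simp
qed

text \<open>E is the product of all (1 - c_j X)/(1 - y_j X) with c_j = y_j + q/N. Its residue at y_i
  is -q/N times the weight, so its coefficient at X^(k+1) is -q times the deformed moment. The
  recursion follows from E' = E D after cancelling -q, which is why q = 0 is treated apart.\<close>

lemma pp_moment_rec:
  assumes N: "N > 0" and l: "l \<in> sig N"
  shows "real (Suc k) * pp_moment N q l k = diff_mom q k N l - q * (\<Sum>a<k. pp_moment N q l a * diff_mom q (k - 1 - a) N l)"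
proof (cases "q = 0")
  case True
  have "pp_weight N 0 l i = 1" if "i \<in> {1..N}" for i
  proof -
    have "real_of_int ((l i - int i) - (l j - int j)) \<noteq> 0" if "j \<in> {1..N}-{i}" for j
      using inj_onD[OF particle_inj[OF l], of i j] that \<open>i \<in> {1..N}\<close> by (auto simp: particle_def)
    then show ?thesis unfolding pp_weight_def by (intro prod.neutral) auto
  qed
  then have "pp_moment N 0 l k = power_mean k N l" by (simp add: pp_moment_def power_mean_def particle_def)
  moreover have "diff_mom 0 k N l = real (Suc k) * power_mean k N l"
    unfolding diff_mom_def by (subst sum.mono_neutral_right[of _ "{k}"]) auto
  ultimately show ?thesis using True by simp
next
  case False
  define y where "y j = real_of_int (particle N l j) / real N" for j
  define s where "s = q / real N"
  define c where "c j = y j + s" for j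
  define E where "E = (\<Prod>j\<in>{1..N}. (1 - fps_const (c j) * fps_X) * inverse (1 - fps_const (y j) * fps_X))"
  have injy: "inj_on y {1..N}"
  proof (rule inj_onI)
    fix i j assume "i \<in> {1..N}" "j \<in> {1..N}" "y i = y j"
    then show "i = j" using inj_onD[OF particle_inj[OF l], of i j] N by (simp add: y_def)
  qed
  have E1: "E = 1 + (\<Sum>i\<in>{1..N}. fps_const ((\<Prod>j\<in>{1..N}. y i - c j) / (\<Prod>j\<in>{1..N}-{i}. y i - y j)) * pole (y i))"
    unfolding E_def by (rule partial_fractions_fps[OF _ injy]) simp
  have coeff: "(\<Prod>j\<in>{1..N}. y i - c j) / (\<Prod>j\<in>{1..N}-{i}. y i - y j) = - s * pp_weight N q l i" if i: "i \<in> {1..N}" for i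
  proof -
    have "(\<Prod>j\<in>{1..N}. y i - c j) = (y i - c i) * (\<Prod>j\<in>{1..N}-{i}. y i - c j)" using i by (intro prod.remove) auto
    moreover have "pp_weight N q l i = (\<Prod>j\<in>{1..N}-{i}. y i - c j) / (\<Prod>j\<in>{1..N}-{i}. y i - y j)"
      unfolding pp_weight_eq[OF N] prod_dividef[symmetric] by (simp add: y_def c_def s_def)
    ultimately show ?thesis by (simp add: c_def)
  qed
  have E_Suc: "E $ Suc k = - q * pp_moment N q l k" for k
  proof -
    have "E $ Suc k = (\<Sum>i\<in>{1..N}. (\<Prod>j\<in>{1..N}. y i - c j) / (\<Prod>j\<in>{1..N}-{i}. y i - y j) * y i ^ k)"
      unfolding E1 by (simp add: fps_sum_nth pole_nth)
    also have "\<dots> = (\<Sum>i\<in>{1..N}. - s * pp_weight N q l i * y i ^ k)"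
      by (intro sum.cong refl arg_cong2[of _ _ _ _ "(*)"] coeff)
    also have "\<dots> = - q * pp_moment N q l k"
      by (simp add: pp_moment_def s_def y_def particle_def sum_distrib_left mult_ac sum_negf[symmetric])
    finally show ?thesis .
  qed
  have E_0: "E $ 0 = 1" unfolding E1 by (simp add: fps_sum_nth pole_nth)
  let ?D = "\<Sum>j\<in>{1..N}. fps_const (y j) * inverse (1 - fps_const (y j) * fps_X) - fps_const (c j) * inverse (1 - fps_const (c j) * fps_X)"
  have D: "?D $ n = - q * diff_mom q n N l" for n
  proof -
    have "?D $ n = - (\<Sum>j\<in>{1..N}. c j ^ Suc n - y j ^ Suc n)"
      by (simp add: fps_sum_nth fps_nth_inverse_linear sum_negf[symmetric])
    also have "(\<Sum>j\<in>{1..N}. c j ^ Suc n - y j ^ Suc n) = (\<Sum>j\<in>{1..N}. \<Sum>a\<le>n. real (Suc n choose a) * y j ^ a * s ^ (Suc n - a))"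
    proof (rule sum.cong[OF refl])
      fix j
      have "c j ^ Suc n = (\<Sum>a\<le>Suc n. real (Suc n choose a) * y j ^ a * s ^ (Suc n - a))"
        unfolding c_def by (rule binomial_ring)
      then show "c j ^ Suc n - y j ^ Suc n = (\<Sum>a\<le>n. real (Suc n choose a) * y j ^ a * s ^ (Suc n - a))"
        by (simp add: sum.atMost_Suc)
    qed
    also have "\<dots> = (\<Sum>a\<le>n. \<Sum>j\<in>{1..N}. real (Suc n choose a) * y j ^ a * s ^ (Suc n - a))" by (rule sum.swap)
    also have "\<dots> = (\<Sum>a\<le>n. q * (real (Suc n choose a) * s ^ (n - a) * power_mean a N l))"
    proof (rule sum.cong[OF refl])
      fix a assume "a \<in> {..n}"
      then have sa: "s ^ (Suc n - a) = s ^ (n - a) * s" by (simp add: Suc_diff_le)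
      have "(\<Sum>j\<in>{1..N}. real (Suc n choose a) * y j ^ a * s ^ (Suc n - a)) = real (Suc n choose a) * s ^ (n - a) * (s * (\<Sum>j\<in>{1..N}. y j ^ a))"
        unfolding sa by (simp add: sum_distrib_left mult_ac)
      also have "s * (\<Sum>j\<in>{1..N}. y j ^ a) = q * power_mean a N l" by (simp add: s_def power_mean_def y_def)
      finally show "(\<Sum>j\<in>{1..N}. real (Suc n choose a) * y j ^ a * s ^ (Suc n - a)) = q * (real (Suc n choose a) * s ^ (n - a) * power_mean a N l)"
        by simp
    qed
    also have "\<dots> = q * diff_mom q n N l" by (simp add: diff_mom_def s_def sum_distrib_left)
    finally show ?thesis by simp
  qed
  have "fps_deriv E = E * ?D" unfolding E_def by (rule log_deriv_ratio_fps) simp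
  then have "fps_deriv E $ k = (E * ?D) $ k" by (rule arg_cong)
  then have "real (Suc k) * E $ Suc k = (\<Sum>i=0..k. E $ i * ?D $ (k - i))"
    unfolding fps_mult_nth fps_deriv_nth by (simp only: Suc_eq_plus1)
  also have "\<dots> = E $ 0 * ?D $ k + (\<Sum>a<k. E $ Suc a * ?D $ (k - Suc a))"
  proof -
    have "(\<Sum>i=0..k. f i) = f 0 + (\<Sum>a<k. f (Suc a))" for f :: "nat \<Rightarrow> real"
      by (simp only: atLeast0AtMost lessThan_Suc_atMost[symmetric] sum.lessThan_Suc_shift)
    from this[of "\<lambda>i. E $ i * ?D $ (k - i)"] show ?thesis by (simp only: diff_zero)
  qed
  finally have "real (Suc k) * (- q * pp_moment N q l k) = - q * diff_mom q k N l + (\<Sum>a<k. - q * pp_moment N q l a * (- q * diff_mom q (k - Suc a) N l))"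
    by (simp only: E_Suc E_0 D)
  moreover have "(\<Sum>a<k. - q * pp_moment N q l a * (- q * diff_mom q (k - Suc a) N l)) =
     q * (q * (\<Sum>a<k. pp_moment N q l a * diff_mom q (k - 1 - a) N l))"
    by (simp add: sum_distrib_left mult_ac)
  ultimately have "(- q) * (real (Suc k) * pp_moment N q l k) = (- q) * (diff_mom q k N l - q * (\<Sum>a<k. pp_moment N q l a * diff_mom q (k - 1 - a) N l))"
    by (simp only: right_diff_distrib mult.left_commute[of "real (Suc k)"])
  then show ?thesis using False by (metis mult_left_cancel neg_equal_0_iff_equal)
qed


section \<open>Concentration\<close>

definition conv_prob :: "(nat \<Rightarrow> (nat \<Rightarrow> int) \<Rightarrow> real) \<Rightarrow> real \<Rightarrow> bool" where
  "conv_prob X c \<longleftrightarrow> (\<forall>e>0. (\<lambda>N. measure_pmf.prob (\<rho> N) {l. \<bar>X N l - c\<bar> > e}) \<longlonglongrightarrow> 0)"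

lemma prob_null_mono:
  assumes "(\<lambda>N. measure_pmf.prob (\<rho> N) (A N)) \<longlonglongrightarrow> 0" "eventually (\<lambda>N. B N \<inter> set_pmf (\<rho> N) \<subseteq> A N) sequentially"
  shows "(\<lambda>N. measure_pmf.prob (\<rho> N) (B N)) \<longlonglongrightarrow> 0"
proof (rule tendsto_sandwich[OF _ _ tendsto_const assms(1)])
  show "eventually (\<lambda>N. measure_pmf.prob (\<rho> N) (B N) \<le> measure_pmf.prob (\<rho> N) (A N)) sequentially"
    using assms(2)
  proof eventually_elim
    case (elim N)
    have "measure_pmf.prob (\<rho> N) (B N) = measure_pmf.prob (\<rho> N) (B N \<inter> set_pmf (\<rho> N))" by (simp add: measure_Int_set_pmf)
    also have "\<dots> \<le> measure_pmf.prob (\<rho> N) (A N)" using elim by (intro measure_pmf.finite_measure_mono) auto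
    finally show ?case .
  qed
qed auto

lemma prob_null_Un:
  assumes "(\<lambda>N. measure_pmf.prob (\<rho> N) (A N)) \<longlonglongrightarrow> 0" "(\<lambda>N. measure_pmf.prob (\<rho> N) (B N)) \<longlonglongrightarrow> 0"
  shows "(\<lambda>N. measure_pmf.prob (\<rho> N) (A N \<union> B N)) \<longlonglongrightarrow> 0"
proof (rule tendsto_sandwich[OF _ _ tendsto_const])
  show "(\<lambda>N. measure_pmf.prob (\<rho> N) (A N) + measure_pmf.prob (\<rho> N) (B N)) \<longlonglongrightarrow> 0"
    using tendsto_add[OF assms] by simp
  show "eventually (\<lambda>N. measure_pmf.prob (\<rho> N) (A N \<union> B N) \<le> measure_pmf.prob (\<rho> N) (A N) + measure_pmf.prob (\<rho> N) (B N)) sequentially"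
    by (intro always_eventually allI measure_Un_le) auto
qed auto

lemma conv_prob_const: "c \<longlonglongrightarrow> d \<Longrightarrow> conv_prob (\<lambda>N l. c N) d"
  unfolding conv_prob_def
proof (intro allI impI)
  fix e :: real assume c: "c \<longlonglongrightarrow> d" and e: "e > 0"
  have "eventually (\<lambda>N. \<bar>c N - d\<bar> < e) sequentially" using tendstoD[OF c e] by (simp add: dist_real_def)
  then have "eventually (\<lambda>N. measure_pmf.prob (\<rho> N) {l. e < \<bar>c N - d\<bar>} = 0) sequentially"
    by eventually_elim auto
  then show "(\<lambda>N. measure_pmf.prob (\<rho> N) {l. e < \<bar>c N - d\<bar>}) \<longlonglongrightarrow> 0" by (rule tendsto_eventually)
qed

lemma conv_prob_mult:
  assumes "conv_prob X c" "conv_prob Y d"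
  shows "conv_prob (\<lambda>N l. X N l * Y N l) (c * d)"
  unfolding conv_prob_def
proof (intro allI impI)
  fix e :: real assume e: "e > 0"
  \<comment> \<open>From |xy - cd| <= |x - c| |y - d| + |c| |y - d| + |d| |x - c| <= delta (1 + |c|
    + |d|); the cap 1 takes care of the product of the two errors.\<close>
  define \<delta> where "\<delta> = min 1 (e / (1 + \<bar>c\<bar> + \<bar>d\<bar>))"
  have pos: "1 + \<bar>c\<bar> + \<bar>d\<bar> > 0" by simp
  have \<delta>: "\<delta> > 0" "\<delta> \<le> 1" using e pos by (simp_all add: \<delta>_def)
  have \<delta>e: "\<delta> * (1 + \<bar>c\<bar> + \<bar>d\<bar>) \<le> e"
  proof -
    have "\<delta> \<le> e / (1 + \<bar>c\<bar> + \<bar>d\<bar>)" by (simp add: \<delta>_def)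
    then show ?thesis using pos by (simp add: pos_le_divide_eq)
  qed
  have "(\<lambda>N. measure_pmf.prob (\<rho> N) ({l. \<bar>X N l - c\<bar> > \<delta>} \<union> {l. \<bar>Y N l - d\<bar> > \<delta>})) \<longlonglongrightarrow> 0"
    using assms \<delta> by (intro prob_null_Un) (auto simp: conv_prob_def)
  then show "(\<lambda>N. measure_pmf.prob (\<rho> N) {l. e < \<bar>X N l * Y N l - c * d\<bar>}) \<longlonglongrightarrow> 0"
  proof (rule prob_null_mono)
    have *: "\<bar>x * y - c * d\<bar> \<le> e" if x: "\<bar>x - c\<bar> \<le> \<delta>" and y: "\<bar>y - d\<bar> \<le> \<delta>" for x y
    proof -
      have "x * y - c * d = (x - c) * (y - d) + c * (y - d) + d * (x - c)" by (simp add: algebra_simps)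
      then have "\<bar>x * y - c * d\<bar> \<le> \<bar>(x - c) * (y - d)\<bar> + \<bar>c * (y - d)\<bar> + \<bar>d * (x - c)\<bar>" by linarith
      also have "\<dots> = \<bar>x - c\<bar> * \<bar>y - d\<bar> + \<bar>c\<bar> * \<bar>y - d\<bar> + \<bar>d\<bar> * \<bar>x - c\<bar>" by (simp add: abs_mult)
      also have "\<dots> \<le> \<delta> * 1 + \<bar>c\<bar> * \<delta> + \<bar>d\<bar> * \<delta>"
        using x y \<delta> by (intro add_mono mult_mono) auto
      also have "\<dots> = \<delta> * (1 + \<bar>c\<bar> + \<bar>d\<bar>)" by (simp add: algebra_simps)
      finally show ?thesis using \<delta>e by linarith
    qed
    have "{l. e < \<bar>X N l * Y N l - c * d\<bar>} \<subseteq> {l. \<delta> < \<bar>X N l - c\<bar>} \<union> {l. \<delta> < \<bar>Y N l - d\<bar>}" for N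
    proof
      fix l assume "l \<in> {l. e < \<bar>X N l * Y N l - c * d\<bar>}"
      with * show "l \<in> {l. \<delta> < \<bar>X N l - c\<bar>} \<union> {l. \<delta> < \<bar>Y N l - d\<bar>}"
        unfolding mem_Collect_eq Un_iff by (metis not_le)
    qed
    then show "eventually (\<lambda>N. {l. e < \<bar>X N l * Y N l - c * d\<bar>} \<inter> set_pmf (\<rho> N) \<subseteq>
        {l. \<delta> < \<bar>X N l - c\<bar>} \<union> {l. \<delta> < \<bar>Y N l - d\<bar>}) sequentially" by (intro always_eventually) blast
  qed
qed

lemma conv_prob_add:
  assumes "conv_prob X c" "conv_prob Y d"
  shows "conv_prob (\<lambda>N l. X N l + Y N l) (c + d)"
  unfolding conv_prob_def
proof (intro allI impI)
  fix e :: real assume e: "e > 0"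
  have "(\<lambda>N. measure_pmf.prob (\<rho> N) ({l. \<bar>X N l - c\<bar> > e/2} \<union> {l. \<bar>Y N l - d\<bar> > e/2})) \<longlonglongrightarrow> 0"
    using assms half_gt_zero[OF e] unfolding conv_prob_def by (intro prob_null_Un) blast+
  then show "(\<lambda>N. measure_pmf.prob (\<rho> N) {l. e < \<bar>X N l + Y N l - (c + d)\<bar>}) \<longlonglongrightarrow> 0"
  proof (rule prob_null_mono)
    show "eventually (\<lambda>N. {l. e < \<bar>X N l + Y N l - (c + d)\<bar>} \<inter> set_pmf (\<rho> N) \<subseteq>
        {l. \<bar>X N l - c\<bar> > e/2} \<union> {l. \<bar>Y N l - d\<bar> > e/2}) sequentially"
    proof (intro always_eventually allI subsetI)
      fix N l assume "l \<in> {l. e < \<bar>X N l + Y N l - (c + d)\<bar>} \<inter> set_pmf (\<rho> N)"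
      then have "e < \<bar>X N l + Y N l - (c + d)\<bar>" by simp
      then have "e < \<bar>X N l - c\<bar> + \<bar>Y N l - d\<bar>" by linarith
      then have "\<bar>X N l - c\<bar> > e/2 \<or> \<bar>Y N l - d\<bar> > e/2" by linarith
      then show "l \<in> {l. \<bar>X N l - c\<bar> > e/2} \<union> {l. \<bar>Y N l - d\<bar> > e/2}" by simp
    qed
  qed
qed

lemma conv_prob_cong:
  assumes "conv_prob X c" "\<And>N l. N > 0 \<Longrightarrow> l \<in> sig N \<Longrightarrow> X N l = Y N l"
  shows "conv_prob Y c"
  unfolding conv_prob_def
proof (intro allI impI)
  fix e :: real assume e: "e > 0"
  have "(\<lambda>N. measure_pmf.prob (\<rho> N) {l. \<bar>X N l - c\<bar> > e}) \<longlonglongrightarrow> 0" using assms(1) e by (auto simp: conv_prob_def)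
  then show "(\<lambda>N. measure_pmf.prob (\<rho> N) {l. e < \<bar>Y N l - c\<bar>}) \<longlonglongrightarrow> 0"
  proof (rule prob_null_mono)
    show "eventually (\<lambda>N. {l. e < \<bar>Y N l - c\<bar>} \<inter> set_pmf (\<rho> N) \<subseteq> {l. e < \<bar>X N l - c\<bar>}) sequentially"
      using eventually_gt_at_top[of 0]
    proof eventually_elim
      case (elim N)
      then show ?case using assms(2)[OF elim] supp[of N] by auto
    qed
  qed
qed

lemma conv_prob_sum:
  assumes "\<And>i. i \<in> A \<Longrightarrow> conv_prob (X i) (c i)"
  shows "conv_prob (\<lambda>N l. \<Sum>i\<in>A. X i N l) (\<Sum>i\<in>A. c i)"
  using assms
proof (induction A rule: infinite_finite_induct)
  case (insert x F)
  then have "conv_prob (\<lambda>N l. X x N l + (\<Sum>i\<in>F. X i N l)) (c x + (\<Sum>i\<in>F. c i))" by (intro conv_prob_add) auto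
  then show ?case using insert.hyps by simp
qed (auto intro!: conv_prob_const)

text \<open>The inequality |XY| <= X^2/(2 eta) + eta Y^2/2 takes the place of Cauchy-Schwarz; with
  eta = e/K and E X^2 < e eta each of the two terms accounts for at most e/2.\<close>

lemma expectation_product_null:
  assumes int: "\<And>N. N \<ge> n0 \<Longrightarrow> integrable (\<rho> N) (\<lambda>l. (X N l)\<^sup>2)" "\<And>N. N \<ge> n0 \<Longrightarrow> integrable (\<rho> N) (\<lambda>l. (Y N l)\<^sup>2)"
    "\<And>N. N \<ge> n0 \<Longrightarrow> integrable (\<rho> N) (\<lambda>l. X N l * Y N l)"
    and X: "(\<lambda>N. EE N (\<lambda>l. (X N l)\<^sup>2)) \<longlonglongrightarrow> 0" and K: "\<And>N. N \<ge> n0 \<Longrightarrow> EE N (\<lambda>l. (Y N l)\<^sup>2) \<le> K" "K > 0"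
  shows "(\<lambda>N. EE N (\<lambda>l. X N l * Y N l)) \<longlonglongrightarrow> 0"
proof (rule tendstoI)
  fix e :: real assume e: "e > 0"
  define \<eta> where "\<eta> = e / K"
  have \<eta>: "\<eta> > 0" using e K by (simp add: \<eta>_def)
  have "eventually (\<lambda>N. dist (EE N (\<lambda>l. (X N l)\<^sup>2)) 0 < e * \<eta>) sequentially" by (rule tendstoD[OF X]) (use e \<eta> in simp)
  then show "eventually (\<lambda>N. dist (EE N (\<lambda>l. X N l * Y N l)) 0 < e) sequentially"
    using eventually_ge_at_top[of n0]
  proof eventually_elim
    case (elim N)
    have bound: "\<bar>X N l * Y N l\<bar> \<le> (X N l)\<^sup>2 / (2 * \<eta>) + \<eta> / 2 * (Y N l)\<^sup>2" for l
    proof -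
      have "0 \<le> (\<bar>X N l\<bar> - \<eta> * \<bar>Y N l\<bar>)\<^sup>2 / (2 * \<eta>)" using \<eta> by simp
      also have "\<dots> = (X N l)\<^sup>2 / (2 * \<eta>) + \<eta> / 2 * (Y N l)\<^sup>2 - \<bar>X N l * Y N l\<bar>"
        using \<eta> by (simp add: power2_diff power_mult_distrib abs_mult field_simps power2_eq_square)
      finally show ?thesis by simp
    qed
    have "\<bar>EE N (\<lambda>l. X N l * Y N l)\<bar> \<le> EE N (\<lambda>l. \<bar>X N l * Y N l\<bar>)" by (rule integral_abs_bound)
    also have "\<dots> \<le> EE N (\<lambda>l. (X N l)\<^sup>2 / (2 * \<eta>) + \<eta> / 2 * (Y N l)\<^sup>2)"
      using int elim(2) bound by (intro integral_mono) auto
    also have "\<dots> = EE N (\<lambda>l. (X N l)\<^sup>2) / (2 * \<eta>) + \<eta> / 2 * EE N (\<lambda>l. (Y N l)\<^sup>2)"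
      using int elim(2) by (subst Bochner_Integration.integral_add) auto
    also have "\<dots> < e * \<eta> / (2 * \<eta>) + \<eta> / 2 * K"
    proof (rule add_less_le_mono)
      show "EE N (\<lambda>l. (X N l)\<^sup>2) / (2 * \<eta>) < e * \<eta> / (2 * \<eta>)"
        using elim(1) \<eta> by (intro divide_strict_right_mono) auto
      show "\<eta> / 2 * EE N (\<lambda>l. (Y N l)\<^sup>2) \<le> \<eta> / 2 * K" using K(1)[OF elim(2)] \<eta> by (intro mult_left_mono) auto
    qed
    also have "\<dots> = e" using \<eta> K by (simp add: \<eta>_def)
    finally show ?case by (simp add: dist_real_def)
  qed
qed

text \<open>The square of P_b is at most P_(2b), whose expectation converges.\<close>

lemma power_mean_second_moment_bound: "\<exists>K>0. \<exists>n0. \<forall>N\<ge>n0. EE N (\<lambda>l. (power_mean b N l)\<^sup>2) \<le> K"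
proof -
  have "eventually (\<lambda>N. EE N (power_mean (2 * b) N) < \<bar>mom_re (2 * b)\<bar> + 1) sequentially"
    by (rule order_tendstoD(2)[OF power_mean_mean]) linarith
  then obtain n1 where n1: "\<And>N. N \<ge> n1 \<Longrightarrow> EE N (power_mean (2 * b) N) < \<bar>mom_re (2 * b)\<bar> + 1"
    by (auto simp: eventually_sequentially)
  have "EE N (\<lambda>l. (power_mean b N l)\<^sup>2) \<le> \<bar>mom_re (2 * b)\<bar> + 1" if N: "N \<ge> max n1 (Suc (2 * b))" for N
  proof -
    have "EE N (\<lambda>l. (power_mean b N l)\<^sup>2) \<le> EE N (power_mean (2 * b) N)"
      using N power_mean_mult_integrable[of b N b] power_mean_integrable[of "2 * b" N] power_mean_square_le[of N b]
      by (intro integral_mono) (auto simp: power2_eq_square)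
    then show ?thesis using n1[of N] N by simp
  qed
  then show ?thesis
    by (intro exI[of _ "\<bar>mom_re (2 * b)\<bar> + 1"] conjI exI[of _ "max n1 (Suc (2 * b))"] allI impI) auto
qed

lemma power_mean_variance: "(\<lambda>N. EE N (\<lambda>l. (power_mean c N l - mom_re c)\<^sup>2)) \<longlonglongrightarrow> 0"
proof (induction c rule: less_induct)
  case (less c)
  \<comment> \<open>By the induction hypothesis \<open>power_mean a\<close> may be replaced by its
    limit with an error that is small in L2, while the second moment of the other factor stays
    bounded, however large \<open>b\<close> is.\<close>
  have cross: "(\<lambda>N. EE N (\<lambda>l. power_mean a N l * power_mean b N l)) \<longlonglongrightarrow> mom_re a * mom_re b" if a: "a < c" for a b
  proof -
    obtain K n0 where K: "K > 0" "\<And>N. N \<ge> n0 \<Longrightarrow> EE N (\<lambda>l. (power_mean b N l)\<^sup>2) \<le> K"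
      using power_mean_second_moment_bound[of b] by blast
    define n1 where "n1 = max n0 (max (Suc (2 * a)) (Suc (2 * b)))"
    have i1: "integrable (\<rho> N) (\<lambda>l. power_mean x N l * power_mean y N l)" if "N \<ge> n1" "x \<in> {a,b}" "y \<in> {a,b}" for N x y
      using that by (intro power_mean_mult_integrable) (auto simp: n1_def)
    have i2: "integrable (\<rho> N) (power_mean x N)" if "N \<ge> n1" "x \<in> {a,b}" for N x
      using that by (intro power_mean_integrable) (auto simp: n1_def)
    have lim: "(\<lambda>N. EE N (\<lambda>l. (power_mean a N l - mom_re a) * power_mean b N l)) \<longlonglongrightarrow> 0"
    proof (rule expectation_product_null[where K = K and ?n0.0 = n1])
      show "integrable (\<rho> N) (\<lambda>l. (power_mean a N l - mom_re a)\<^sup>2)" if "n1 \<le> N" for N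
        using i1[OF that, of a a] i2[OF that, of a]
        by (auto simp: power2_eq_square algebra_simps)
      show "integrable (\<rho> N) (\<lambda>l. (power_mean b N l)\<^sup>2)" if "n1 \<le> N" for N
        using i1[OF that, of b b] by (simp add: power2_eq_square)
      show "integrable (\<rho> N) (\<lambda>l. (power_mean a N l - mom_re a) * power_mean b N l)" if "n1 \<le> N" for N
        using i1[OF that, of a b] i2[OF that, of b] by (auto simp: left_diff_distrib)
    qed (use less.IH[OF a] K in \<open>auto simp: n1_def\<close>)
    have "(\<lambda>N. EE N (\<lambda>l. (power_mean a N l - mom_re a) * power_mean b N l) + mom_re a * EE N (power_mean b N)) \<longlonglongrightarrow> 0 + mom_re a * mom_re b"
      by (intro tendsto_intros lim power_mean_mean)
    then have "(\<lambda>N. EE N (\<lambda>l. (power_mean a N l - mom_re a) * power_mean b N l) + mom_re a * EE N (power_mean b N)) \<longlonglongrightarrow> mom_re a * mom_re b" by simp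
    then show ?thesis
    proof (rule Lim_transform_eventually)
      show "eventually (\<lambda>N. EE N (\<lambda>l. (power_mean a N l - mom_re a) * power_mean b N l) + mom_re a * EE N (power_mean b N) = EE N (\<lambda>l. power_mean a N l * power_mean b N l)) sequentially"
        using eventually_ge_at_top[of n1]
      proof eventually_elim
        case (elim N)
        have "EE N (\<lambda>l. (power_mean a N l - mom_re a) * power_mean b N l) = EE N (\<lambda>l. power_mean a N l * power_mean b N l) - EE N (\<lambda>l. mom_re a * power_mean b N l)"
          unfolding left_diff_distrib by (intro Bochner_Integration.integral_diff integrable_mult_right i1 i2 elim) auto
        then show ?case by simp
      qed
    qed
  qed
  \<comment> \<open>Of the indices a and 2c - a one is below c unless both equal c.\<close>
  have cross': "(\<lambda>N. EE N (\<lambda>l. power_mean a N l * power_mean (2 * c - a) N l)) \<longlonglongrightarrow> mom_re a * mom_re (2 * c - a)"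
    if "a \<in> {..<Suc (2 * c)} - {c}" for a
  proof (cases "a < c")
    case False
    then have "2 * c - a < c" using that by auto
    from cross[OF this, of a] show ?thesis by (simp add: mult.commute)
  qed (rule cross)
  \<comment> \<open>The instance 2c + 1 of the quadratic limit is the one whose exponents add up to
    2c.\<close>
  have quad: "(\<lambda>N. \<Sum>a<Suc (2 * c). EE N (\<lambda>l. power_mean a N l * power_mean (2 * c - a) N l)) \<longlonglongrightarrow> (\<Sum>a<Suc (2 * c). mom_re a * mom_re (2 * c - a))"
    using power_mean_quadratic_mean[of "Suc (2 * c)"] by simp
  have split: "(\<Sum>a<Suc (2 * c). f a) - (\<Sum>a\<in>{..<Suc (2 * c)} - {c}. f a) = f c" for f :: "nat \<Rightarrow> real"
    by (subst sum.remove[of _ c]) auto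
  have "(\<lambda>N. (\<Sum>a<Suc (2 * c). EE N (\<lambda>l. power_mean a N l * power_mean (2 * c - a) N l)) -
      (\<Sum>a\<in>{..<Suc (2 * c)} - {c}. EE N (\<lambda>l. power_mean a N l * power_mean (2 * c - a) N l))) \<longlonglongrightarrow>
     (\<Sum>a<Suc (2 * c). mom_re a * mom_re (2 * c - a)) - (\<Sum>a\<in>{..<Suc (2 * c)} - {c}. mom_re a * mom_re (2 * c - a))"
    by (intro tendsto_diff quad tendsto_sum cross')
  then have sq: "(\<lambda>N. EE N (\<lambda>l. power_mean c N l * power_mean c N l)) \<longlonglongrightarrow> mom_re c * mom_re c" unfolding split by (simp add: mult_2)
  have "(\<lambda>N. EE N (\<lambda>l. power_mean c N l * power_mean c N l) - 2 * mom_re c * EE N (power_mean c N) + mom_re c * mom_re c) \<longlonglongrightarrow> mom_re c * mom_re c - 2 * mom_re c * mom_re c + mom_re c * mom_re c"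
    by (intro tendsto_intros sq power_mean_mean)
  then have L: "(\<lambda>N. EE N (\<lambda>l. power_mean c N l * power_mean c N l) - 2 * mom_re c * EE N (power_mean c N) + mom_re c * mom_re c) \<longlonglongrightarrow> 0" by simp
  show ?case
  proof (rule Lim_transform_eventually[OF L])
    show "eventually (\<lambda>N. EE N (\<lambda>l. power_mean c N l * power_mean c N l) - 2 * mom_re c * EE N (power_mean c N) + mom_re c * mom_re c = EE N (\<lambda>l. (power_mean c N l - mom_re c)\<^sup>2)) sequentially"
      using eventually_ge_at_top[of "Suc (2 * c)"]
    proof eventually_elim
      case (elim N)
      have i: "integrable (\<rho> N) (\<lambda>l. power_mean c N l * power_mean c N l)" "integrable (\<rho> N) (power_mean c N)"
        using elim by (auto intro!: power_mean_mult_integrable power_mean_integrable)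
      have e: "(power_mean c N l - mom_re c)\<^sup>2 = (power_mean c N l * power_mean c N l - 2 * mom_re c * power_mean c N l) + mom_re c * mom_re c" for l
        by (simp add: power2_eq_square algebra_simps)
      have "EE N (\<lambda>l. (power_mean c N l - mom_re c)\<^sup>2) = EE N (\<lambda>l. power_mean c N l * power_mean c N l - 2 * mom_re c * power_mean c N l) + EE N (\<lambda>l. mom_re c * mom_re c)"
        unfolding e using i by (intro Bochner_Integration.integral_add) auto
      also have "EE N (\<lambda>l. power_mean c N l * power_mean c N l - 2 * mom_re c * power_mean c N l) = EE N (\<lambda>l. power_mean c N l * power_mean c N l) - EE N (\<lambda>l. 2 * mom_re c * power_mean c N l)"
        using i by (intro Bochner_Integration.integral_diff) auto
      finally show ?case by simp
    qed
  qed
qed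

lemma conv_prob_power_mean: "conv_prob (power_mean c) (mom_re c)"
  unfolding conv_prob_def
proof (intro allI impI)
  fix e :: real assume e: "e > 0"
  show "(\<lambda>N. measure_pmf.prob (\<rho> N) {l. e < \<bar>power_mean c N l - mom_re c\<bar>}) \<longlonglongrightarrow> 0"
  proof (rule tendsto_sandwich[OF _ _ tendsto_const])
    show "(\<lambda>N. EE N (\<lambda>l. (power_mean c N l - mom_re c)\<^sup>2) / e\<^sup>2) \<longlonglongrightarrow> 0"
      using tendsto_divide[OF power_mean_variance[of c] tendsto_const[of "e\<^sup>2"]] e by simp
    show "eventually (\<lambda>N. measure_pmf.prob (\<rho> N) {l. e < \<bar>power_mean c N l - mom_re c\<bar>} \<le> EE N (\<lambda>l. (power_mean c N l - mom_re c)\<^sup>2) / e\<^sup>2) sequentially"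
      using eventually_ge_at_top[of "Suc (2 * c)"]
    proof eventually_elim
      case (elim N)
      have i: "integrable (\<rho> N) (\<lambda>l. power_mean c N l * power_mean c N l)" "integrable (\<rho> N) (power_mean c N)"
        using elim by (auto intro!: power_mean_mult_integrable power_mean_integrable)
      have int: "integrable (\<rho> N) (\<lambda>l. (power_mean c N l - mom_re c)\<^sup>2)"
        using i by (auto simp: power2_eq_square algebra_simps)
      have "measure_pmf.prob (\<rho> N) {l. e < \<bar>power_mean c N l - mom_re c\<bar>} \<le> measure_pmf.prob (\<rho> N) {l \<in> space (\<rho> N). e\<^sup>2 \<le> (power_mean c N l - mom_re c)\<^sup>2}"
      proof (rule measure_pmf.finite_measure_mono)
        show "{l. e < \<bar>power_mean c N l - mom_re c\<bar>} \<subseteq> {l \<in> space (\<rho> N). e\<^sup>2 \<le> (power_mean c N l - mom_re c)\<^sup>2}"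
        proof
          fix l assume "l \<in> {l. e < \<bar>power_mean c N l - mom_re c\<bar>}"
          then have "e\<^sup>2 \<le> \<bar>power_mean c N l - mom_re c\<bar>\<^sup>2" using e by (intro power_mono) auto
          then show "l \<in> {l \<in> space (\<rho> N). e\<^sup>2 \<le> (power_mean c N l - mom_re c)\<^sup>2}" by simp
        qed
      qed simp
      also have "\<dots> \<le> EE N (\<lambda>l. (power_mean c N l - mom_re c)\<^sup>2) / e\<^sup>2"
        using e by (intro integral_Markov_inequality_measure[OF int, of "{}"]) auto
      finally show ?case .
    qed
  qed auto
qed

text \<open>Since q/N tends to 0, only a = b survives, with coefficient (b+1 choose b).\<close>

lemma conv_prob_diff_mom: "conv_prob (diff_mom q b) (real (Suc b) * mom_re b)"
proof -
  have "conv_prob (\<lambda>N l. real (Suc b choose a) * (q / real N) ^ (b - a) * power_mean a N l) (real (Suc b choose a) * 0 ^ (b - a) * mom_re a)" for a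
  proof (intro conv_prob_mult conv_prob_power_mean conv_prob_const)
    have "(\<lambda>N. q * (1 / real N)) \<longlonglongrightarrow> q * 0" by (intro tendsto_intros lim_1_over_n)
    then show "(\<lambda>N. (q / real N) ^ (b - a)) \<longlonglongrightarrow> 0 ^ (b - a)" by (intro tendsto_power) simp
  qed auto
  then have "conv_prob (\<lambda>N l. \<Sum>a\<le>b. real (Suc b choose a) * (q / real N) ^ (b - a) * power_mean a N l) (\<Sum>a\<le>b. real (Suc b choose a) * 0 ^ (b - a) * mom_re a)"
    by (intro conv_prob_sum)
  moreover have "(\<Sum>a\<le>b. real (Suc b choose a) * 0 ^ (b - a) * mom_re a) = real (Suc b) * mom_re b"
    by (subst sum.mono_neutral_right[of _ "{b}"]) auto
  ultimately show ?thesis unfolding diff_mom_def[abs_def] by simp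
qed

lemma mu_q_real: "mu_q q \<Psi> k = of_real (Re (mu_q q \<Psi> k))"
proof (induction k rule: less_induct)
  case (less k)
  have "of_nat (Suc k) * mu_q q \<Psi> k = of_real (real (Suc k) * mom_re k - q * (\<Sum>a<k. Re (mu_q q \<Psi> a) * (real (k - a) * mom_re (k - 1 - a))))"
    unfolding mu_q_rec mom_real using less.IH by (simp del: of_nat_Suc)
  then have "mu_q q \<Psi> k = of_real ((real (Suc k) * mom_re k - q * (\<Sum>a<k. Re (mu_q q \<Psi> a) * (real (k - a) * mom_re (k - 1 - a)))) / real (Suc k))"
    by (simp add: field_simps del: of_nat_Suc)
  then show ?case by (metis Re_complex_of_real)
qed

lemma conv_prob_pp_moment: "conv_prob (\<lambda>N l. pp_moment N q l k) (Re (mu_q q \<Psi> k))"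
proof (induction k rule: less_induct)
  case (less k)
  \<comment> \<open>For a < k the factor k - a is rewritten as \<open>Suc (k - 1 - a)\<close>, the
    form in which \<open>conv_prob_diff_mom\<close> delivers it.\<close>
  have rec: "real (Suc k) * Re (mu_q q \<Psi> k) = real (Suc k) * mom_re k + (- q) * (\<Sum>a<k. Re (mu_q q \<Psi> a) * (real (Suc (k - 1 - a)) * mom_re (k - 1 - a)))"
  proof -
    have "complex_of_real (real (Suc k) * Re (mu_q q \<Psi> k)) = of_nat (Suc k) * mu_q q \<Psi> k"
      using mu_q_real[of q k] by (simp del: of_nat_Suc)
    also have "\<dots> = complex_of_real (real (Suc k) * mom_re k - q * (\<Sum>a<k. Re (mu_q q \<Psi> a) * (real (k - a) * mom_re (k - 1 - a))))"
      unfolding mu_q_rec mom_real using mu_q_real[of q] by (simp del: of_nat_Suc)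
    finally have "real (Suc k) * Re (mu_q q \<Psi> k) = real (Suc k) * mom_re k - q * (\<Sum>a<k. Re (mu_q q \<Psi> a) * (real (k - a) * mom_re (k - 1 - a)))"
      by (simp only: of_real_eq_iff)
    moreover have "(\<Sum>a<k. Re (mu_q q \<Psi> a) * (real (k - a) * mom_re (k - 1 - a))) = (\<Sum>a<k. Re (mu_q q \<Psi> a) * (real (Suc (k - 1 - a)) * mom_re (k - 1 - a)))"
      by (intro sum.cong refl) (auto simp: Suc_diff_Suc)
    ultimately show ?thesis by simp
  qed
  have "conv_prob (\<lambda>N l. (1 / real (Suc k)) * (diff_mom q k N l + (- q) * (\<Sum>a<k. pp_moment N q l a * diff_mom q (k - 1 - a) N l)))
     ((1 / real (Suc k)) * (real (Suc k) * mom_re k + (- q) * (\<Sum>a<k. Re (mu_q q \<Psi> a) * (real (Suc (k - 1 - a)) * mom_re (k - 1 - a)))))"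
    by (intro conv_prob_mult conv_prob_add conv_prob_const tendsto_const conv_prob_diff_mom conv_prob_sum less.IH) auto
  then have "conv_prob (\<lambda>N l. (1 / real (Suc k)) * (diff_mom q k N l + (- q) * (\<Sum>a<k. pp_moment N q l a * diff_mom q (k - 1 - a) N l))) (Re (mu_q q \<Psi> k))"
    unfolding rec[symmetric] by simp
  then show ?case
  proof (rule conv_prob_cong)
    fix N l assume "0 < N" "l \<in> sig N"
    from pp_moment_rec[OF this, of k q]
    have e: "diff_mom q k N l + (- q) * (\<Sum>a<k. pp_moment N q l a * diff_mom q (k - 1 - a) N l) = real (Suc k) * pp_moment N q l k" by simp
    show "(1 / real (Suc k)) * (diff_mom q k N l + (- q) * (\<Sum>a<k. pp_moment N q l a * diff_mom q (k - 1 - a) N l)) = pp_moment N q l k"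
      unfolding e by simp
  qed
qed

end

section \<open>The limiting measure\<close>

text \<open>For |x| <= R clipping does nothing. Otherwise |x| >= R >= 1 and |x|^k <= |x|^(2k)
  x^2/R^2. The even exponent makes the bound a moment without absolute values.\<close>

lemma clip_power_error:
  fixes R x :: real
  assumes "R \<ge> 1"
  shows "\<bar>x ^ k - (max (- R) (min R x)) ^ k\<bar> \<le> 2 / R\<^sup>2 * x ^ (2 * (k + 1))"
proof (cases "\<bar>x\<bar> \<le> R")
  case True
  then have "max (- R) (min R x) = x" by auto
  moreover have "0 \<le> 2 / R\<^sup>2 * x ^ (2 * (k + 1))" by (simp only: power_mult) simp
  ultimately show ?thesis by simp
next
  case False
  have x: "1 \<le> \<bar>x\<bar>" "R \<le> \<bar>x\<bar>" using False assms by auto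
  have "\<bar>max (- R) (min R x)\<bar> \<le> \<bar>x\<bar>" using x assms by auto
  then have c: "\<bar>(max (- R) (min R x)) ^ k\<bar> \<le> \<bar>x\<bar> ^ k" unfolding power_abs by (intro power_mono) auto
  have "\<bar>x ^ k - (max (- R) (min R x)) ^ k\<bar> \<le> \<bar>x ^ k\<bar> + \<bar>(max (- R) (min R x)) ^ k\<bar>" by linarith
  also have "\<dots> \<le> 2 * \<bar>x\<bar> ^ k" using c by (simp add: power_abs)
  also have "\<dots> \<le> 2 * (\<bar>x\<bar> ^ (2 * k) * (\<bar>x\<bar>\<^sup>2 / R\<^sup>2))"
  proof -
    have "1 \<le> \<bar>x\<bar>\<^sup>2 / R\<^sup>2" using power_mono[OF x(2), of 2] assms by (simp add: pos_le_divide_eq)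
    moreover have "\<bar>x\<bar> ^ k \<le> \<bar>x\<bar> ^ (2 * k)" using x by (intro power_increasing) auto
    ultimately have "\<bar>x\<bar> ^ k * 1 \<le> \<bar>x\<bar> ^ (2 * k) * (\<bar>x\<bar>\<^sup>2 / R\<^sup>2)" by (intro mult_mono) auto
    then show ?thesis by simp
  qed
  also have "\<dots> = 2 / R\<^sup>2 * \<bar>x\<bar> ^ (2 * (k + 1))" by (simp add: power_add power2_eq_square)
  also have "\<bar>x\<bar> ^ (2 * (k + 1)) = x ^ (2 * (k + 1))" by (rule power_even_abs) simp
  finally show ?thesis .
qed

lemma moment_convergence_imp_tight:
  assumes D: "\<And>n. real_distribution (D n)"
    and int: "\<And>n. integrable (D n) (\<lambda>t. t\<^sup>2)"
    and B: "\<And>n. (\<integral>t. t\<^sup>2 \<partial>D n) \<le> B"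
  shows "tight D"
  unfolding tight_def
proof (intro conjI allI impI D)
  fix e :: real assume e: "e > 0"
  \<comment> \<open>The factor 2 yields B < R e for positive B, hence the strict inequality B/R^2 <
    e.\<close>
  define R where "R = max 1 (2 * B / e)"
  have R: "R \<ge> 1" "2 * B \<le> R * e" using e by (auto simp: R_def field_simps max_def)
  have "1 - e < measure (D n) {- R<..R}" for n
  proof -
    interpret real_distribution "D n" by (rule D)
    have "prob {t \<in> space (D n). R\<^sup>2 \<le> t\<^sup>2} \<le> (\<integral>t. t\<^sup>2 \<partial>D n) / R\<^sup>2"
      using R by (intro integral_Markov_inequality_measure[OF int, of "{}"]) auto
    also have "\<dots> \<le> B / R\<^sup>2" using B by (intro divide_right_mono) auto
    also have "\<dots> < e"
    proof -
      have "B < R\<^sup>2 * e"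
      proof (cases "B \<le> 0")
        case True
        have "0 < R\<^sup>2 * e" using R e by simp
        then show ?thesis using True by linarith
      next
        case False
        then have "B < R * e" using R by linarith
        also have "R * 1 * e \<le> R * R * e" using R e by (intro mult_right_mono mult_left_mono) auto
        then have "R * e \<le> R\<^sup>2 * e" by (simp add: power2_eq_square)
        finally show ?thesis .
      qed
      then show ?thesis using R by (simp add: divide_less_eq mult.commute)
    qed
    finally have "prob {t \<in> space (D n). R\<^sup>2 \<le> t\<^sup>2} < e" .
    moreover have "1 - prob {t \<in> space (D n). R\<^sup>2 \<le> t\<^sup>2} = prob (space (D n) - {t \<in> space (D n). R\<^sup>2 \<le> t\<^sup>2})"
      by (rule prob_compl[symmetric]) simp
    moreover have "prob (space (D n) - {t \<in> space (D n). R\<^sup>2 \<le> t\<^sup>2}) \<le> prob {- R<..R}"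
    proof (rule finite_measure_mono)
      show "space (D n) - {t \<in> space (D n). R\<^sup>2 \<le> t\<^sup>2} \<subseteq> {- R<..R}"
      proof
        fix t assume "t \<in> space (D n) - {t \<in> space (D n). R\<^sup>2 \<le> t\<^sup>2}"
        then have "\<bar>t\<bar>\<^sup>2 < R\<^sup>2" by simp
        then have "\<bar>t\<bar> < R" using R by (intro power2_less_imp_less[of "\<bar>t\<bar>"]) auto
        then show "t \<in> {- R<..R}" by auto
      qed
    qed simp
    ultimately show ?thesis by linarith
  qed
  moreover have "- R < R" using R by linarith
  ultimately show "\<exists>a b. a < b \<and> (\<forall>n. 1 - e < measure (D n) {a<..b})" by blast
qed

text \<open>Weak convergence along a subsequence does not reach powers, which are unbounded. Clipped
  powers are bounded and continuous, so their integrals converge; the clipping error is O(R^-2)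
  uniformly along the sequence by a bound on the moments of order 2(k+1), and likewise for the limit
  once its even moments are known to be finite.\<close>

lemma moment_limit_measure:
  assumes D: "\<And>n. real_distribution (D n)"
    and int: "\<And>n k. integrable (D n) (\<lambda>t. t ^ k)"
    and lim: "\<And>k. (\<lambda>n. \<integral>t. t ^ k \<partial>D n) \<longlonglongrightarrow> m k"
  shows "\<exists>M. real_distribution M \<and> (\<forall>k. integrable M (\<lambda>t. t ^ k) \<and> (\<integral>t. t ^ k \<partial>M) = m k)"
proof -
  have "\<exists>B. \<forall>n. (\<integral>t. t ^ k \<partial>D n) \<le> B" for k
  proof -
    have "Bseq (\<lambda>n. \<integral>t. t ^ k \<partial>D n)" using lim[of k] by (intro convergent_imp_Bseq convergentI)
    then obtain B where "\<And>n. norm (\<integral>t. t ^ k \<partial>D n) \<le> B" unfolding Bseq_def by blast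
    then show ?thesis by (metis abs_le_D1 real_norm_def)
  qed
  then obtain B where B: "\<And>k n. (\<integral>t. t ^ k \<partial>D n) \<le> B k" by metis
  have "tight D" by (rule moment_convergence_imp_tight[OF D int B])
  from tight_imp_convergent_subsubsequence[OF this strict_mono_id]
  obtain r M where r: "strict_mono (r :: nat \<Rightarrow> nat)" and M: "real_distribution M" and w: "weak_conv_m (D \<circ> id \<circ> r) M"
    by blast
  define E where "E n = D (r n)" for n
  have w: "weak_conv_m E M" using w by (simp add: E_def[abs_def] o_def)
  have ED: "\<And>n. real_distribution (E n)" and Eint: "\<And>n k. integrable (E n) (\<lambda>t. t ^ k)"
    and EB: "\<And>k n. (\<integral>t. t ^ k \<partial>E n) \<le> B k" using D int B by (auto simp: E_def)
  have Elim: "(\<lambda>n. \<integral>t. t ^ k \<partial>E n) \<longlonglongrightarrow> m k" for k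
    using LIMSEQ_subseq_LIMSEQ[OF lim r] by (simp add: E_def o_def)
  interpret M: real_distribution M by (rule M)
  interpret E: real_distribution "E n" for n by (rule ED)
  define c where "c R t = max (- R) (min R t)" for R t :: real
  have c_meas [measurable]: "c R \<in> borel_measurable borel" for R unfolding c_def by measurable
  have c_le: "\<bar>c R t ^ k\<bar> \<le> R ^ k" if "R \<ge> 0" for R t k
    unfolding power_abs using that by (intro power_mono) (auto simp: c_def)
  have c_int: "integrable M (\<lambda>t. c R t ^ k)" "integrable (E n) (\<lambda>t. c R t ^ k)" if "R \<ge> 0" for R k n
    using c_le[OF that] by (auto intro!: M.integrable_const_bound[where B = "R ^ k"] E.integrable_const_bound[where B = "R ^ k"])
  have c_conv: "(\<lambda>n. \<integral>t. c R t ^ k \<partial>E n) \<longlonglongrightarrow> (\<integral>t. c R t ^ k \<partial>M)" if "R \<ge> 0" for R k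
  proof (rule weak_conv_imp_integral_bdd_continuous_conv[OF ED M w])
    show "isCont (\<lambda>t. c R t ^ k) x" for x unfolding c_def by (intro continuous_intros)
    show "norm (c R x ^ k) \<le> R ^ k" for x using c_le[OF that] by simp
  qed
  \<comment> \<open>Clipped even powers increase to the full power, and their integrals stay below
    the moment bound of the sequence: monotone convergence.\<close>
  have even_int: "integrable M (\<lambda>t. t ^ (2 * k))" for k
  proof -
    have mono: "mono (\<lambda>n. c (real n) t ^ (2 * k))" for t
    proof (rule monoI)
      fix a b :: nat assume "a \<le> b"
      then have "\<bar>c (real a) t\<bar> \<le> \<bar>c (real b) t\<bar>" by (auto simp: c_def)
      then have "\<bar>c (real a) t\<bar> ^ (2 * k) \<le> \<bar>c (real b) t\<bar> ^ (2 * k)" by (intro power_mono) auto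
      then show "c (real a) t ^ (2 * k) \<le> c (real b) t ^ (2 * k)" by (simp add: power_even_abs)
    qed
    have "(\<integral>t. c (real a) t ^ (2 * k) \<partial>M) \<le> B (2 * k)" for a :: nat
    proof (rule LIMSEQ_le_const2[OF c_conv])
      have "(\<integral>t. c (real a) t ^ (2 * k) \<partial>E n) \<le> B (2 * k)" for n
      proof -
        have "(\<integral>t. c (real a) t ^ (2 * k) \<partial>E n) \<le> (\<integral>t. t ^ (2 * k) \<partial>E n)"
        proof (rule integral_mono)
          fix t
          have "\<bar>c (real a) t\<bar> \<le> \<bar>t\<bar>" by (auto simp: c_def)
          then have "\<bar>c (real a) t\<bar> ^ (2 * k) \<le> \<bar>t\<bar> ^ (2 * k)" by (intro power_mono) auto
          then show "c (real a) t ^ (2 * k) \<le> t ^ (2 * k)" by (simp add: power_even_abs)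
        qed (auto intro!: c_int Eint)
        then show ?thesis using EB[of n "2 * k"] by linarith
      qed
      then show "\<exists>N. \<forall>n\<ge>N. (\<integral>t. c (real a) t ^ (2 * k) \<partial>E n) \<le> B (2 * k)" by blast
    qed simp
    moreover have "incseq (\<lambda>a. \<integral>t. c (real a) t ^ (2 * k) \<partial>M)"
      by (intro incseq_SucI integral_mono c_int monoD[OF mono]) auto
    ultimately obtain L where L: "(\<lambda>a. \<integral>t. c (real a) t ^ (2 * k) \<partial>M) \<longlonglongrightarrow> L"
      by (elim incseq_convergent) auto
    show ?thesis
    proof (rule integrable_monotone_convergence[OF _ _ _ L])
      show "AE t in M. (\<lambda>i. c (real i) t ^ (2 * k)) \<longlonglongrightarrow> t ^ (2 * k)"
      proof (rule AE_I2)
        fix t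
        obtain n0 :: nat where n0: "\<bar>t\<bar> \<le> real n0" using real_arch_simple by blast
        have "eventually (\<lambda>i. c (real i) t ^ (2 * k) = t ^ (2 * k)) sequentially"
          using eventually_ge_at_top[of n0]
        proof eventually_elim
          case (elim i)
          then have "\<bar>t\<bar> \<le> real i" using n0 by linarith
          then have "c (real i) t = t" by (auto simp: c_def)
          then show ?case by simp
        qed
        then show "(\<lambda>i. c (real i) t ^ (2 * k)) \<longlonglongrightarrow> t ^ (2 * k)" by (rule tendsto_eventually)
      qed
    qed (auto intro!: c_int mono)
  qed
  have Mint: "integrable M (\<lambda>t. t ^ k)" for k
  proof (rule Bochner_Integration.integrable_bound[of M "\<lambda>t. 1 + t ^ (2 * k)"])
    have "\<bar>t ^ k\<bar> \<le> 1 + t ^ (2 * k)" for t :: real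
    proof -
      have "0 \<le> (\<bar>t ^ k\<bar> - 1)\<^sup>2" "0 \<le> \<bar>t ^ k\<bar>\<^sup>2" by simp_all
      then have "\<bar>t ^ k\<bar> \<le> 1 + \<bar>t ^ k\<bar>\<^sup>2" unfolding power2_diff power_one mult_1_right by linarith
      then show ?thesis by (simp add: power_mult[symmetric] mult.commute)
    qed
    then show "AE t in M. norm (t ^ k) \<le> norm (1 + t ^ (2 * k))"
      by (intro AE_I2) (metis abs_ge_self order_trans real_norm_def)
  qed (auto intro!: even_int)
  have "(\<integral>t. t ^ k \<partial>M) = m k" for k
  proof -
    let ?K = "B (2 * (k + 1)) + (\<integral>t. t ^ (2 * (k + 1)) \<partial>M)"
    have clip: "\<bar>(\<integral>t. t ^ k \<partial>N) - (\<integral>t. c R t ^ k \<partial>N)\<bar> \<le> 2 / R\<^sup>2 * (\<integral>t. t ^ (2 * (k + 1)) \<partial>N)"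
      if "R \<ge> 1" and i: "integrable N (\<lambda>t. t ^ k)" "integrable N (\<lambda>t. c R t ^ k)" "integrable N (\<lambda>t. t ^ (2 * (k + 1)))" for R and N :: "real measure"
    proof -
      have "\<bar>(\<integral>t. t ^ k \<partial>N) - (\<integral>t. c R t ^ k \<partial>N)\<bar> = \<bar>\<integral>t. t ^ k - c R t ^ k \<partial>N\<bar>"
        using i by (simp add: Bochner_Integration.integral_diff)
      also have "\<dots> \<le> (\<integral>t. \<bar>t ^ k - c R t ^ k\<bar> \<partial>N)" by (rule integral_abs_bound)
      also have "\<dots> \<le> (\<integral>t. 2 / R\<^sup>2 * t ^ (2 * (k + 1)) \<partial>N)"
        using i clip_power_error[OF that(1), of _ k]
        by (intro integral_mono integrable_abs Bochner_Integration.integrable_diff integrable_mult_right) (auto simp: c_def)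
      finally show ?thesis by simp
    qed
    \<comment> \<open>Both numbers are compared with the clipped integral under \<open>M\<close>;
      letting R grow forces equality.\<close>
    have bound: "\<bar>(\<integral>t. t ^ k \<partial>M) - m k\<bar> \<le> 2 / R\<^sup>2 * ?K" if R: "R \<ge> 1" for R
    proof -
      have R0: "0 \<le> R" using R by simp
      have 1: "\<bar>(\<integral>t. t ^ k \<partial>M) - (\<integral>t. c R t ^ k \<partial>M)\<bar> \<le> 2 / R\<^sup>2 * (\<integral>t. t ^ (2 * (k + 1)) \<partial>M)"
        by (intro clip R Mint c_int R0)
      have 2: "\<bar>m k - (\<integral>t. c R t ^ k \<partial>M)\<bar> \<le> 2 / R\<^sup>2 * B (2 * (k + 1))"
      proof (rule LIMSEQ_le_const2[of "\<lambda>n. \<bar>(\<integral>t. t ^ k \<partial>E n) - (\<integral>t. c R t ^ k \<partial>E n)\<bar>"])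
        show "(\<lambda>n. \<bar>(\<integral>t. t ^ k \<partial>E n) - (\<integral>t. c R t ^ k \<partial>E n)\<bar>) \<longlonglongrightarrow> \<bar>m k - (\<integral>t. c R t ^ k \<partial>M)\<bar>"
          by (intro tendsto_intros Elim c_conv R0)
        have "\<bar>(\<integral>t. t ^ k \<partial>E n) - (\<integral>t. c R t ^ k \<partial>E n)\<bar> \<le> 2 / R\<^sup>2 * B (2 * (k + 1))" for n
        proof -
          have "\<bar>(\<integral>t. t ^ k \<partial>E n) - (\<integral>t. c R t ^ k \<partial>E n)\<bar> \<le> 2 / R\<^sup>2 * (\<integral>t. t ^ (2 * (k + 1)) \<partial>E n)"
            by (intro clip R Eint c_int R0)
          also have "\<dots> \<le> 2 / R\<^sup>2 * B (2 * (k + 1))" by (intro mult_left_mono EB) simp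
          finally show ?thesis .
        qed
        then show "\<exists>N. \<forall>n\<ge>N. \<bar>(\<integral>t. t ^ k \<partial>E n) - (\<integral>t. c R t ^ k \<partial>E n)\<bar> \<le> 2 / R\<^sup>2 * B (2 * (k + 1))" by blast
      qed
      show ?thesis unfolding distrib_left[of "2 / R\<^sup>2"] using 1 2 by linarith
    qed
    have "(\<lambda>n. 2 * (inverse (real (Suc n)))\<^sup>2 * ?K) \<longlonglongrightarrow> 2 * 0\<^sup>2 * ?K"
      by (intro tendsto_intros LIMSEQ_inverse_real_of_nat)
    then have "(\<lambda>n. 2 / (real (Suc n))\<^sup>2 * ?K) \<longlonglongrightarrow> 0" by (simp add: power_inverse divide_inverse)
    then have "\<bar>(\<integral>t. t ^ k \<partial>M) - m k\<bar> \<le> 0"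
      by (rule LIMSEQ_le_const) (use bound in auto)
    then show ?thesis by simp
  qed
  with Mint M show ?thesis by blast
qed

text \<open>Mass is placed on the index set and pushed forward by \<open>x\<close>, so coinciding
  positions need no separate treatment.\<close>

lemma finite_weights_distribution:
  fixes w x :: "'a \<Rightarrow> real"
  assumes A: "finite A" "\<And>i. i \<in> A \<Longrightarrow> 0 \<le> w i" "sum w A = 1"
  shows "\<exists>D. real_distribution D \<and> (\<forall>k. integrable D (\<lambda>t. t ^ k) \<and> (\<integral>t. t ^ k \<partial>D) = (\<Sum>i\<in>A. w i * x i ^ k))"
proof -
  define f where "f i = (if i \<in> A then w i else 0)" for i
  have f0: "0 \<le> f i" for i using A by (auto simp: f_def)
  have "(\<integral>\<^sup>+i. ennreal (f i) \<partial>count_space UNIV) = (\<Sum>i\<in>A. ennreal (f i))"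
    using A by (intro nn_integral_count_space') (auto simp: f_def)
  also have "\<dots> = ennreal (sum f A)" using f0 by (intro sum_ennreal) auto
  also have "sum f A = 1" using A by (simp add: f_def)
  finally have pmf: "pmf (embed_pmf f) i = f i" for i using f0 by (intro pmf_embed_pmf) auto
  let ?p = "embed_pmf f"
  have supp: "set_pmf ?p \<subseteq> A" unfolding set_pmf_eq pmf by (auto simp: f_def)
  then have fin: "finite (set_pmf ?p)" using A finite_subset by blast
  have m: "x \<in> measurable (measure_pmf ?p) borel" by simp
  have "integrable (distr (measure_pmf ?p) borel x) (\<lambda>t. t ^ k)" for k
    using m integrable_measure_pmf_finite[OF fin] by (subst integrable_distr_eq) auto
  moreover have "(\<integral>t. t ^ k \<partial>distr (measure_pmf ?p) borel x) = (\<Sum>i\<in>A. w i * x i ^ k)" for k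
  proof -
    have "(\<integral>t. t ^ k \<partial>distr (measure_pmf ?p) borel x) = (\<integral>i. x i ^ k \<partial>measure_pmf ?p)"
      using m by (subst integral_distr) auto
    also have "\<dots> = (\<Sum>i\<in>A. x i ^ k * pmf ?p i)" using A supp by (intro integral_measure_pmf_real) auto
    also have "\<dots> = (\<Sum>i\<in>A. w i * x i ^ k)" unfolding pmf by (intro sum.cong) (auto simp: f_def)
    finally show ?thesis .
  qed
  moreover have "real_distribution (distr (measure_pmf ?p) borel x)"
    using m by (intro prob_space.real_distribution_distr prob_space_measure_pmf) auto
  ultimately show ?thesis by blast
qed

text \<open>Differences of particle positions are nonzero integers, of modulus at least 1 >= |q|, so
  subtracting q cannot reverse their sign.\<close>

lemma pp_weight_nonneg:
  assumes "-1 \<le> q" "q \<le> 1" "l \<in> sig N" "i \<in> {1..N}"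
  shows "0 \<le> pp_weight N q l i"
  unfolding pp_weight_def
proof (rule prod_nonneg)
  fix j assume j: "j \<in> {1..N} - {i}"
  define d where "d = (l i - int i) - (l j - int j)"
  have "i < j \<or> j < i" using j by auto
  then have "d \<noteq> 0"
  proof
    assume "i < j"
    then have "l j \<le> l i" using assms j by (auto simp: sig_def)
    then show ?thesis using \<open>i < j\<close> by (simp add: d_def)
  next
    assume "j < i"
    then have "l i \<le> l j" using assms j by (auto simp: sig_def)
    then show ?thesis using \<open>j < i\<close> by (simp add: d_def)
  qed
  then consider "1 \<le> real_of_int d" | "real_of_int d \<le> - 1" by linarith
  then show "0 \<le> (real_of_int ((l i - int i) - (l j - int j)) - q) / real_of_int ((l i - int i) - (l j - int j))"
    unfolding d_def[symmetric]
  proof cases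
    case 1
    then show "0 \<le> (real_of_int d - q) / real_of_int d" using assms by (intro divide_nonneg_pos) auto
  next
    case 2
    then show "0 \<le> (real_of_int d - q) / real_of_int d" using assms by (intro divide_nonpos_neg) auto
  qed
qed

context sgf_asymp
begin

text \<open>Total mass one of the deformed measure is the recursion at k = 0, where no earlier
  moment enters.\<close>

lemma pp_moment_0:
  assumes "0 < N" "l \<in> sig N"
  shows "pp_moment N q l 0 = 1"
  using pp_moment_rec[OF assms, of 0 q] assms by (simp add: diff_mom_def power_mean_def)

lemma pp_measure_exists:
  assumes q: "-1 \<le> q" "q \<le> 1" and l: "0 < N" "l \<in> sig N"
  shows "\<exists>D. real_distribution D \<and> (\<forall>k. integrable D (\<lambda>t. t ^ k) \<and> (\<integral>t. t ^ k \<partial>D) = pp_moment N q l k)"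
proof -
  have "\<exists>D. real_distribution D \<and> (\<forall>k. integrable D (\<lambda>t. t ^ k) \<and>
      (\<integral>t. t ^ k \<partial>D) = (\<Sum>i\<in>{1..N}. (1 / real N * pp_weight N q l i) * (real_of_int (l i + int N - int i) / real N) ^ k))"
  proof (rule finite_weights_distribution)
    show "(\<Sum>i\<in>{1..N}. 1 / real N * pp_weight N q l i) = 1"
      using pp_moment_0[OF l, of q] by (simp add: pp_moment_def sum_distrib_left sum_divide_distrib)
  qed (auto intro!: divide_nonneg_nonneg pp_weight_nonneg q l)
  then show ?thesis by (simp add: pp_moment_def sum_distrib_left mult.assoc)
qed

text \<open>Convergence in probability suffices to select deterministic signatures: for large N the
  bad events for k <= n together have probability below 1, so some signature in the support avoids
  them all.\<close>

lemma pp_moment_approximation: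
  "\<exists>N l. 0 < N \<and> l \<in> sig N \<and> (\<forall>k\<le>n. \<bar>pp_moment N q l k - Re (mu_q q \<Psi> k)\<bar> \<le> inverse (real (Suc n)))"
proof -
  define B where "B N k = {l. \<bar>pp_moment N q l k - Re (mu_q q \<Psi> k)\<bar> > inverse (real (Suc n))}" for N k
  have B: "(\<lambda>N. measure_pmf.prob (\<rho> N) (B N k)) \<longlonglongrightarrow> 0" for k
    using conv_prob_pp_moment[of q k] unfolding conv_prob_def B_def by simp
  have "(\<lambda>N. measure_pmf.prob (\<rho> N) (\<Union>k\<le>j. B N k)) \<longlonglongrightarrow> 0" for j
  proof (induction j)
    case (Suc j)
    then show ?case unfolding atMost_Suc UN_insert by (intro prob_null_Un B)
  qed (simp add: B)
  from order_tendstoD(2)[OF this, of 1 n]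
  have "eventually (\<lambda>N. measure_pmf.prob (\<rho> N) (\<Union>k\<le>n. B N k) < 1 \<and> 0 < N) sequentially"
    using eventually_gt_at_top[of "0::nat"] by (simp add: eventually_conj)
  then obtain N where N: "measure_pmf.prob (\<rho> N) (\<Union>k\<le>n. B N k) < 1" "0 < N"
    by (auto simp: eventually_sequentially)
  have "\<exists>l\<in>set_pmf (\<rho> N). l \<notin> (\<Union>k\<le>n. B N k)"
  proof (rule ccontr)
    assume "\<not> ?thesis"
    then have "measure_pmf.prob (\<rho> N) (set_pmf (\<rho> N)) \<le> measure_pmf.prob (\<rho> N) (\<Union>k\<le>n. B N k)"
      by (intro measure_pmf.finite_measure_mono) auto
    moreover have "measure_pmf.prob (\<rho> N) (set_pmf (\<rho> N)) = 1"
      using measure_Int_set_pmf[of "\<rho> N" UNIV] by simp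
    ultimately show False using N by simp
  qed
  then obtain l where "l \<in> set_pmf (\<rho> N)" "l \<notin> (\<Union>k\<le>n. B N k)" by blast
  then have "l \<in> sig N" "\<forall>k\<le>n. \<bar>pp_moment N q l k - Re (mu_q q \<Psi> k)\<bar> \<le> inverse (real (Suc n))"
    using supp[of N] by (auto simp: B_def not_less)
  then show ?thesis using N by blast
qed

lemma mu_q_measure_exists:
  assumes q: "-1 \<le> q" "q \<le> 1"
  shows "\<exists>M. real_distribution M \<and> (\<forall>k. integrable M (\<lambda>t. t ^ k) \<and> (\<integral>t. t ^ k \<partial>M) = Re (mu_q q \<Psi> k))"
proof -
  have "\<exists>D. real_distribution D \<and> (\<forall>k. integrable D (\<lambda>t. t ^ k)) \<and>
     (\<forall>k\<le>n. \<bar>(\<integral>t. t ^ k \<partial>D) - Re (mu_q q \<Psi> k)\<bar> \<le> inverse (real (Suc n)))" for n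
  proof -
    obtain N l where N: "0 < N" "l \<in> sig N" and
      a: "\<forall>k\<le>n. \<bar>pp_moment N q l k - Re (mu_q q \<Psi> k)\<bar> \<le> inverse (real (Suc n))"
      using pp_moment_approximation by blast
    obtain D where "real_distribution D" "\<forall>k. integrable D (\<lambda>t. t ^ k) \<and> (\<integral>t. t ^ k \<partial>D) = pp_moment N q l k"
      using pp_measure_exists[OF q N] by blast
    with a show ?thesis by (intro exI[of _ D]) auto
  qed
  then obtain D where D: "\<And>n. real_distribution (D n)" "\<And>n k. integrable (D n) (\<lambda>t. t ^ k)"
    "\<And>n k. k \<le> n \<Longrightarrow> \<bar>(\<integral>t. t ^ k \<partial>D n) - Re (mu_q q \<Psi> k)\<bar> \<le> inverse (real (Suc n))"
    by metis
  show ?thesis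
  proof (rule moment_limit_measure[OF D(1,2)])
    fix k
    have "(\<lambda>n. (\<integral>t. t ^ k \<partial>D n) - Re (mu_q q \<Psi> k)) \<longlonglongrightarrow> 0"
    proof (rule Lim_null_comparison[OF _ LIMSEQ_inverse_real_of_nat])
      show "eventually (\<lambda>n. norm ((\<integral>t. t ^ k \<partial>D n) - Re (mu_q q \<Psi> k)) \<le> inverse (real (Suc n))) sequentially"
        using eventually_ge_at_top[of k] by eventually_elim (use D(3) in auto)
    qed
    then show "(\<lambda>n. \<integral>t. t ^ k \<partial>D n) \<longlonglongrightarrow> Re (mu_q q \<Psi> k)" by (simp add: LIM_zero_iff)
  qed
qed

end

theorem theorem12:
  fixes q :: real
    and \<rho> :: "nat \<Rightarrow> (nat \<Rightarrow> int) pmf"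
    and \<Psi> :: "complex \<Rightarrow> complex"
  assumes q: "-1 \<le> q" "q \<le> 1"
    and supp: "\<And>N. set_pmf (\<rho> N) \<subseteq> sig N"
    and sgf_conv: "\<And>N. \<exists>d>0. uniform_limit (nbhd1 N d)
         (\<lambda>F u. \<Sum>l\<in>F. sgf_term N (\<rho> N) l u) (sgf N (\<rho> N)) (finite_subsets_at_top (sig N))"
    and analytic: "\<Psi> analytic_on {1}"
    and limit: "\<And>r. \<exists>d>0. \<exists>L :: nat \<Rightarrow> (nat \<Rightarrow> complex) \<Rightarrow> complex.
         (\<forall>N\<ge>r. continuous_on (nbhd_r r d) (L N) \<and> L N ones = 0 \<and>
            (\<forall>u\<in>nbhd_r r d. exp (L N u) = sgf N (\<rho> N) u)) \<and>
         uniform_limit (nbhd_r r d) (\<lambda>N u. L N u / of_nat N)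
            (\<lambda>u. \<Sum>i\<in>{1..r}. \<Psi> (u i)) sequentially"
  shows "\<exists>\<mu> :: real measure. sets \<mu> = sets borel \<and>
     (\<forall>k. integrable \<mu> (\<lambda>t. t ^ k) \<and> complex_of_real (\<integral>t. t ^ k \<partial>\<mu>) = mu_q q \<Psi> k) \<and>
     (\<forall>k. \<forall>e>0. (\<lambda>N. measure_pmf.prob (\<rho> N)
         {l. cmod (complex_of_real (pp_moment N q l k) - mu_q q \<Psi> k) > e}) \<longlonglongrightarrow> 0)"
proof -
  interpret sgf_asymp \<rho> \<Psi> by (rule sgf_asymp.intro[OF supp analytic limit])
  obtain M where M: "real_distribution M" "\<And>k. integrable M (\<lambda>t. t ^ k)" "\<And>k. (\<integral>t. t ^ k \<partial>M) = Re (mu_q q \<Psi> k)"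
    using mu_q_measure_exists[OF q] by blast
  \<comment> \<open>The limiting moments are real, so the complex distance in the claim is the real
    one used for \<open>conv_prob\<close>.\<close>
  have dist: "cmod (complex_of_real a - mu_q q \<Psi> k) = \<bar>a - Re (mu_q q \<Psi> k)\<bar>" for a k
    by (subst mu_q_real) (simp only: of_real_diff[symmetric] norm_of_real)
  have "sets M = sets borel" using M(1) by (simp add: real_distribution_def real_distribution_axioms_def)
  moreover have "complex_of_real (\<integral>t. t ^ k \<partial>M) = mu_q q \<Psi> k" for k
    using mu_q_real[of q k] by (simp only: M(3))
  moreover have "(\<lambda>N. measure_pmf.prob (\<rho> N)
      {l. cmod (complex_of_real (pp_moment N q l k) - mu_q q \<Psi> k) > e}) \<longlonglongrightarrow> 0" if "e > 0" for k e
    using conv_prob_pp_moment[of q k] that unfolding conv_prob_def dist by blast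
  ultimately show ?thesis using M(2) by (intro exI[of _ M]) blast
qed

end
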